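(* Let $f:\mathcal X\to S$ be a holomorphic family of compact hyperbolic Riemann surfaces over a complex manifold $S$ with $\dim S=1$ and local holomorphic coordinate $s$, together with a differentiable family of closed geodesics $\gamma_s\subset\mathcal X_s$ of length $\ell(\gamma_s)$. Let $A_s$ be the harmonic Beltrami differential on $\mathcal X_s$ associated to $\partial/\partial s$, and let $\|A_s\|_0$ be the maximum of its pointwise norm over the fiber $\mathcal X_s$. Then $$ \frac{\partial^2\ell(\gamma_s)}{\partial s\,\partial\overline s}\le\ell(\gamma_s)\,\|A_s\|_0^2,\qquad \frac{\partial^2\log\ell(\gamma_s)}{\partial s\,\partial\overline s}\le\frac34\,\|A_s\|_0^2 . $$
   Context: Setting. A holomorphic family of compact hyperbolic Riemann surfaces is a proper, smooth, holomorphic map $f:\mathcal X\to S$ onto a connected complex manifold $S$ whose fibers $\mathcal X_s=f^{-1}(s)$ are compact Riemann surfaces of genus at least $2$. Each fiber carries its hyperbolic metric $g(z,s)|dz|^2$ normalized by $g=\partial^2\log g/\partial z\,\partial\overline z$ (Gaussian curvature $-2$). Harmonic Beltrami differentials. $\rho:T_sS\to H^1(\mathcal X_s,\mathcal T_{\mathcal X_s})$ is the Kodaira–Spencer map, $\rho(\partial/\partial s)$ being the class of $\partial_{\overline z}b\,\partial_z\,\overline{dz}$ for any differentiable lift $\partial/\partial s+b\,\partial_z$. $A_s=A^z_{s\overline z}\partial_z\overline{dz}$ is its harmonic representative with respect to the hyperbolic metric; its pointwise norm is $|A^z_{s\overline z}|$. Geodesics. A differentiable family of closed geodesics is a family of closed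 geodesics $\gamma_s$ of $\mathcal X_s$ depending differentiably on $s$. Lengths are computed with $\|\dot u\|^2=g\,\dot u^z\,\overline{\dot u^z}$. *)

theory Defs
  imports "HOL-Complex_Analysis.Complex_Analysis" "HOL-Homology.Homology"
begin

section \<open>Calculus in coordinates\<close>

text \<open>All sets \<open>U\<close> below are open in the applications, so that derivatives at points of \<open>U\<close>
  do not depend on the values of a function outside of \<open>U\<close>.\<close>

fun Ck_on :: "nat \<Rightarrow> 'a::euclidean_space set \<Rightarrow> ('a \<Rightarrow> 'b::real_normed_vector) \<Rightarrow> bool" where
  "Ck_on 0 U f \<longleftrightarrow> continuous_on U f"
| "Ck_on (Suc k) U f \<longleftrightarrow> (\<forall>x\<in>U. f differentiable (at x)) \<and>
     (\<forall>v. Ck_on k U (\<lambda>x. frechet_derivative f (at x) v))"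

definition smooth_on :: "'a::euclidean_space set \<Rightarrow> ('a \<Rightarrow> 'b::real_normed_vector) \<Rightarrow> bool" where
  "smooth_on U f \<longleftrightarrow> (\<forall>k. Ck_on k U f)"

text \<open>Wirtinger derivatives \<open>\<partial>/\<partial>z\<close> and \<open>\<partial>/\<partial>z\<close>-bar.\<close>

definition dz :: "(complex \<Rightarrow> complex) \<Rightarrow> complex \<Rightarrow> complex" where
  "dz h z = (frechet_derivative h (at z) 1 - \<i> * frechet_derivative h (at z) \<i>) / 2"

definition dzbar :: "(complex \<Rightarrow> complex) \<Rightarrow> complex \<Rightarrow> complex" where
  "dzbar h z = (frechet_derivative h (at z) 1 + \<i> * frechet_derivative h (at z) \<i>) / 2"

text \<open>Holomorphic functions of two complex variables.\<close>

definition holomorphic2_on :: "(complex \<times> complex \<Rightarrow> complex) \<Rightarrow> (complex \<times> complex) set \<Rightarrow> bool" where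
  "holomorphic2_on F U \<longleftrightarrow> (\<forall>x\<in>U. \<exists>D. (F has_derivative D) (at x) \<and>
     (\<forall>a b k. D (k * a, k * b) = k * D (a, b)))"


section \<open>Complex manifolds of dimension one and two\<close>

text \<open>A chart is a pair of its domain and a coordinate map; the values of the coordinate map
  outside of the domain are irrelevant.\<close>

type_synonym ('a, 'e) chart = "'a set \<times> ('a \<Rightarrow> 'e)"

definition is_chart :: "'a topology \<Rightarrow> ('a, 'e::euclidean_space) chart \<Rightarrow> bool" where
  "is_chart T c \<longleftrightarrow> openin T (fst c) \<and> open (snd c ` fst c) \<and>
     homeomorphic_map (subtopology T (fst c)) (top_of_set (snd c ` fst c)) (snd c)"

definition chart_inv :: "('a, 'e) chart \<Rightarrow> 'e \<Rightarrow> 'a" where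
  "chart_inv c = inv_into (fst c) (snd c)"

definition compatible ::
  "(('e \<Rightarrow> 'e) \<Rightarrow> 'e set \<Rightarrow> bool) \<Rightarrow> ('a, 'e) chart \<Rightarrow> ('a, 'e) chart \<Rightarrow> bool" where
  "compatible hol c d \<longleftrightarrow>
     hol (snd d \<circ> chart_inv c) (snd c ` (fst c \<inter> fst d)) \<and>
     hol (snd c \<circ> chart_inv d) (snd d ` (fst c \<inter> fst d))"

text \<open>\<open>hol\<close> is the notion of holomorphy for maps between open subsets of the model space.
  A complex structure is a maximal atlas.\<close>

definition complex_structure ::
  "(('e \<Rightarrow> 'e) \<Rightarrow> 'e set \<Rightarrow> bool) \<Rightarrow> 'a topology \<Rightarrow> ('a, 'e::euclidean_space) chart set \<Rightarrow> bool" where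
  "complex_structure hol T \<A> \<longleftrightarrow>
     Hausdorff_space T \<and> second_countable T \<and>
     (\<forall>c\<in>\<A>. is_chart T c) \<and> (\<Union>c\<in>\<A>. fst c) = topspace T \<and>
     (\<forall>c\<in>\<A>. \<forall>d\<in>\<A>. compatible hol c d) \<and>
     (\<forall>c. is_chart T c \<longrightarrow> (\<forall>d\<in>\<A>. compatible hol c d) \<longrightarrow> c \<in> \<A>)"

definition complex_curve :: "'a topology \<Rightarrow> ('a, complex) chart set \<Rightarrow> bool" where
  "complex_curve = complex_structure (\<lambda>F U. F holomorphic_on U)"

definition complex_surface :: "'a topology \<Rightarrow> ('a, complex \<times> complex) chart set \<Rightarrow> bool" where
  "complex_surface = complex_structure
     (\<lambda>F U. holomorphic2_on (fst \<circ> F) U \<and> holomorphic2_on (snd \<circ> F) U)"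


section \<open>Holomorphic families of compact hyperbolic Riemann surfaces\<close>

definition fibre :: "'x topology \<Rightarrow> ('x \<Rightarrow> 's) \<Rightarrow> 's \<Rightarrow> 'x topology" where
  "fibre X f s = subtopology X {p. f p = s}"

text \<open>The genus of a compact connected surface, by the rank of the first integral homology group.\<close>

definition has_genus :: "'x topology \<Rightarrow> nat \<Rightarrow> bool" where
  "has_genus R k \<longleftrightarrow> homology_group 1 R \<cong> free_Abelian_group {..<2 * k}"

definition holomorphic_submersion ::
  "'x topology \<Rightarrow> ('x, complex \<times> complex) chart set \<Rightarrow> 's topology \<Rightarrow> ('s, complex) chart set
    \<Rightarrow> ('x \<Rightarrow> 's) \<Rightarrow> bool" where
  "holomorphic_submersion X \<X> S \<S> f \<longleftrightarrow>
     continuous_map X S f \<and>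
     (\<forall>d\<in>\<X>. \<forall>c\<in>\<S>.
        holomorphic2_on (snd c \<circ> f \<circ> chart_inv d) (snd d ` (fst d \<inter> f -` fst c)) \<and>
        (\<forall>p \<in> fst d \<inter> f -` fst c.
           surj (frechet_derivative (snd c \<circ> f \<circ> chart_inv d) (at (snd d p)))))"

definition hyperbolic_family ::
  "'x topology \<Rightarrow> ('x, complex \<times> complex) chart set \<Rightarrow> 's topology \<Rightarrow> ('s, complex) chart set
    \<Rightarrow> ('x \<Rightarrow> 's) \<Rightarrow> bool" where
  "hyperbolic_family X \<X> S \<S> f \<longleftrightarrow>
     complex_surface X \<X> \<and> complex_curve S \<S> \<and> connected_space S \<and>
     holomorphic_submersion X \<X> S \<S> f \<and> proper_map X S f \<and>
     (\<forall>s\<in>topspace S. compact_space (fibre X f s) \<and> connected_space (fibre X f s) \<and>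
        (\<exists>k\<ge>2. has_genus (fibre X f s) k))"

text \<open>Local coordinates \<open>(z, s)\<close> on the total space whose second component is a given local
  coordinate \<open>c\<close> of the base.  For fixed \<open>s\<close>, their first components are the
  holomorphic coordinates of the fibre (the set \<open>fibre_atlas\<close> is independent of \<open>c\<close>, which is
  why \<open>c\<close> ranges over all coordinates around \<open>s\<close> there).\<close>

definition adapted ::
  "('x, complex \<times> complex) chart set \<Rightarrow> ('x \<Rightarrow> 's) \<Rightarrow> ('s, complex) chart
    \<Rightarrow> ('x, complex \<times> complex) chart set" where
  "adapted \<X> f c = {d \<in> \<X>. \<forall>p\<in>fst d. f p \<in> fst c \<and> snd (snd d p) = snd c (f p)}"

definition fibre_chart ::
  "('x \<Rightarrow> 's) \<Rightarrow> 's \<Rightarrow> ('x, complex \<times> complex) chart \<Rightarrow> ('x, complex) chart" where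
  "fibre_chart f s d = (fst d \<inter> f -` {s}, \<lambda>p. fst (snd d p))"

definition fibre_atlas ::
  "('x, complex \<times> complex) chart set \<Rightarrow> ('s, complex) chart set \<Rightarrow> ('x \<Rightarrow> 's) \<Rightarrow> 's
    \<Rightarrow> ('x, complex) chart set" where
  "fibre_atlas \<X> \<S> f s = (\<Union>c\<in>{c\<in>\<S>. s \<in> fst c}. fibre_chart f s ` adapted \<X> f c)"


section \<open>Tensors on a Riemann surface\<close>

text \<open>Let \<open>B\<close> be a holomorphic atlas of a Riemann surface.  A tensor is given by its
  components: a function of a chart \<open>e \<in> B\<close> and of a point of its domain, subject to the
  usual transformation rule.  \<open>jac e e' p\<close> is \<open>dz'/dz\<close> at \<open>p\<close>, for
  the coordinates \<open>z\<close> of \<open>e\<close> and \<open>z'\<close> of \<open>e'\<close>.\<close>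

definition jac :: "('x, complex) chart \<Rightarrow> ('x, complex) chart \<Rightarrow> 'x \<Rightarrow> complex" where
  "jac e e' p = deriv (snd e' \<circ> chart_inv e) (snd e p)"

definition in_coord :: "('x, 'e) chart \<Rightarrow> (('x, 'e) chart \<Rightarrow> 'x \<Rightarrow> 'b) \<Rightarrow> 'e \<Rightarrow> 'b" where
  "in_coord e T = T e \<circ> chart_inv e"

definition smooth_components ::
  "('x, 'e::euclidean_space) chart set \<Rightarrow> (('x, 'e) chart \<Rightarrow> 'x \<Rightarrow> 'b::real_normed_vector) \<Rightarrow> bool" where
  "smooth_components B T \<longleftrightarrow> (\<forall>e\<in>B. smooth_on (snd e ` fst e) (in_coord e T))"

text \<open>The metric \<open>g |dz|\<^sup>2\<close>.\<close>

definition conformal_metric ::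
  "('x, complex) chart set \<Rightarrow> (('x, complex) chart \<Rightarrow> 'x \<Rightarrow> real) \<Rightarrow> bool" where
  "conformal_metric B g \<longleftrightarrow> smooth_components B g \<and> (\<forall>e\<in>B. \<forall>p\<in>fst e. g e p > 0) \<and>
     (\<forall>e\<in>B. \<forall>e'\<in>B. \<forall>p\<in>fst e \<inter> fst e'. g e p = g e' p * (cmod (jac e e' p))\<^sup>2)"

definition log_metric ::
  "(('x, complex) chart \<Rightarrow> 'x \<Rightarrow> real) \<Rightarrow> ('x, complex) chart \<Rightarrow> complex \<Rightarrow> complex" where
  "log_metric g e z = complex_of_real (ln (in_coord e g z))"

definition hyperbolic_metric ::
  "('x, complex) chart set \<Rightarrow> (('x, complex) chart \<Rightarrow> 'x \<Rightarrow> real) \<Rightarrow> bool" where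
  "hyperbolic_metric B g \<longleftrightarrow> conformal_metric B g \<and>
     (\<forall>e\<in>B. \<forall>z \<in> snd e ` fst e.
        complex_of_real (in_coord e g z) = dz (dzbar (log_metric g e)) z)"

text \<open>Vector fields \<open>v \<partial>\<^sub>z\<close> of type \<open>(1,0)\<close>, and Beltrami differentials
  \<open>A \<partial>\<^sub>z dz\<close>-bar.\<close>

definition vector_field ::
  "('x, complex) chart set \<Rightarrow> (('x, complex) chart \<Rightarrow> 'x \<Rightarrow> complex) \<Rightarrow> bool" where
  "vector_field B v \<longleftrightarrow> smooth_components B v \<and>
     (\<forall>e\<in>B. \<forall>e'\<in>B. \<forall>p\<in>fst e \<inter> fst e'. v e' p = v e p * jac e e' p)"

definition beltrami ::
  "('x, complex) chart set \<Rightarrow> (('x, complex) chart \<Rightarrow> 'x \<Rightarrow> complex) \<Rightarrow> bool" where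
  "beltrami B A \<longleftrightarrow> smooth_components B A \<and>
     (\<forall>e\<in>B. \<forall>e'\<in>B. \<forall>p\<in>fst e \<inter> fst e'. A e' p = A e p * jac e e' p / cnj (jac e e' p))"

definition dbar ::
  "(('x, complex) chart \<Rightarrow> 'x \<Rightarrow> complex) \<Rightarrow> ('x, complex) chart \<Rightarrow> 'x \<Rightarrow> complex" where
  "dbar v e p = dzbar (in_coord e v) (snd e p)"

text \<open>The formal adjoint of \<open>dbar\<close> with respect to \<open>g\<close>, that is, minus the divergence
  \<open>g\<^sup>-\<^sup>1 \<nabla>\<^sub>z A\<close>, where \<open>\<nabla>\<^sub>z A = \<partial>\<^sub>z A + (\<partial>\<^sub>z log g) A\<close>.\<close>

definition dbar_adjoint ::
  "(('x, complex) chart \<Rightarrow> 'x \<Rightarrow> real) \<Rightarrow> (('x, complex) chart \<Rightarrow> 'x \<Rightarrow> complex)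
    \<Rightarrow> ('x, complex) chart \<Rightarrow> 'x \<Rightarrow> complex" where
  "dbar_adjoint g A e p =
     - (dz (in_coord e A) (snd e p) + dz (log_metric g e) (snd e p) * A e p)
       / complex_of_real (g e p)"

text \<open>Harmonicity is the vanishing of the complex Laplacian; on \<open>(0,1)\<close>-forms on a curve only the
  summand \<open>dbar \<circ> dbar_adjoint\<close> of the Laplacian is present.\<close>

definition harmonic_beltrami ::
  "('x, complex) chart set \<Rightarrow> (('x, complex) chart \<Rightarrow> 'x \<Rightarrow> real)
    \<Rightarrow> (('x, complex) chart \<Rightarrow> 'x \<Rightarrow> complex) \<Rightarrow> bool" where
  "harmonic_beltrami B g A \<longleftrightarrow> beltrami B A \<and>
     (\<forall>e\<in>B. \<forall>p\<in>fst e. dbar (dbar_adjoint g A) e p = 0)"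

definition beltrami_norm ::
  "('x, complex) chart set \<Rightarrow> (('x, complex) chart \<Rightarrow> 'x \<Rightarrow> complex) \<Rightarrow> real" where
  "beltrami_norm B A = Sup {cmod (A e p) | e p. e \<in> B \<and> p \<in> fst e}"


section \<open>The Kodaira--Spencer map\<close>

text \<open>A differentiable lift \<open>\<partial>/\<partial>s + b \<partial>\<^sub>z\<close> of \<open>\<partial>/\<partial>s\<close>, for the local
  coordinate \<open>s\<close> given by \<open>c\<close>, is a smooth vector field over the coordinate
  domain.  Under a change of coordinates \<open>(z, s)\<close> to \<open>(z'(z, s), s)\<close> one has
  \<open>b' = (\<partial>z'/\<partial>z) b + \<partial>z'/\<partial>s\<close>.\<close>

definition differentiable_lift ::
  "('x, complex \<times> complex) chart set \<Rightarrow> ('x \<Rightarrow> 's) \<Rightarrow> ('s, complex) chart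
    \<Rightarrow> (('x, complex \<times> complex) chart \<Rightarrow> 'x \<Rightarrow> complex) \<Rightarrow> bool" where
  "differentiable_lift \<X> f c b \<longleftrightarrow> smooth_components (adapted \<X> f c) b \<and>
     (\<forall>d\<in>adapted \<X> f c. \<forall>d'\<in>adapted \<X> f c. \<forall>p\<in>fst d \<inter> fst d'.
        let z' = (\<lambda>z s. fst (snd d' (chart_inv d (z, s)))); z0 = fst (snd d p); s0 = snd (snd d p)
        in b d' p = deriv (\<lambda>z. z' z s0) z0 * b d p + deriv (\<lambda>s. z' z0 s) s0)"

text \<open>The class of \<open>\<partial>/\<partial>s\<close> in the first Dolbeault cohomology of the fibre at \<open>s\<close>, as a set of
  representatives: the Beltrami differentials cohomologous to \<open>\<partial>\<^sub>z\<close>-bar \<open>b\<close> for a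
  differentiable lift.\<close>

definition kodaira_spencer ::
  "('x, complex \<times> complex) chart set \<Rightarrow> ('s, complex) chart set \<Rightarrow> ('x \<Rightarrow> 's)
    \<Rightarrow> ('s, complex) chart \<Rightarrow> 's \<Rightarrow> (('x, complex) chart \<Rightarrow> 'x \<Rightarrow> complex) set" where
  "kodaira_spencer \<X> \<S> f c s = {A. beltrami (fibre_atlas \<X> \<S> f s) A \<and>
     (\<exists>b v. differentiable_lift \<X> f c b \<and> vector_field (fibre_atlas \<X> \<S> f s) v \<and>
        (\<forall>d\<in>adapted \<X> f c. \<forall>p\<in>fst d. f p = s \<longrightarrow>
           A (fibre_chart f s d) p =
             dzbar (\<lambda>z. in_coord d b (z, snd c s)) (fst (snd d p)) +
             dbar v (fibre_chart f s d) p))}"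


section \<open>Geodesics\<close>

text \<open>Closed geodesics are parametrized proportionally to arc length over a period of length one;
  the Christoffel symbol of \<open>g |dz|\<^sup>2\<close> is \<open>\<partial>\<^sub>z log g\<close>.\<close>

definition velocity :: "('x, complex) chart \<Rightarrow> (real \<Rightarrow> 'x) \<Rightarrow> real \<Rightarrow> complex" where
  "velocity e u t = vector_derivative (snd e \<circ> u) (at t)"

definition closed_geodesic ::
  "'x topology \<Rightarrow> ('x, complex) chart set \<Rightarrow> (('x, complex) chart \<Rightarrow> 'x \<Rightarrow> real)
    \<Rightarrow> (real \<Rightarrow> 'x) \<Rightarrow> bool" where
  "closed_geodesic R B g u \<longleftrightarrow>
     continuous_map euclideanreal R u \<and> (\<forall>t. u (t + 1) = u t) \<and> (\<exists>t. u t \<noteq> u 0) \<and>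
     (\<forall>e\<in>B. smooth_on (u -` fst e) (snd e \<circ> u)) \<and>
     (\<forall>e\<in>B. \<forall>t. u t \<in> fst e \<longrightarrow>
        vector_derivative (velocity e u) (at t) +
          dz (log_metric g e) (snd e (u t)) * (velocity e u t)\<^sup>2 = 0)"

definition speed ::
  "('x, complex) chart set \<Rightarrow> (('x, complex) chart \<Rightarrow> 'x \<Rightarrow> real) \<Rightarrow> (real \<Rightarrow> 'x) \<Rightarrow> real \<Rightarrow> real" where
  "speed B g u t =
     (THE r. \<exists>e\<in>B. u t \<in> fst e \<and> r = sqrt (g e (u t) * (cmod (velocity e u t))\<^sup>2))"

definition curve_length ::
  "('x, complex) chart set \<Rightarrow> (('x, complex) chart \<Rightarrow> 'x \<Rightarrow> real) \<Rightarrow> (real \<Rightarrow> 'x) \<Rightarrow> real" where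
  "curve_length B g u = integral {0..1} (speed B g u)"

definition geodesic_family ::
  "'x topology \<Rightarrow> ('x, complex \<times> complex) chart set \<Rightarrow> 's topology \<Rightarrow> ('s, complex) chart set
    \<Rightarrow> ('x \<Rightarrow> 's) \<Rightarrow> ('s \<Rightarrow> ('x, complex) chart \<Rightarrow> 'x \<Rightarrow> real) \<Rightarrow> ('s \<Rightarrow> real \<Rightarrow> 'x) \<Rightarrow> bool" where
  "geodesic_family X \<X> S \<S> f g \<gamma> \<longleftrightarrow>
     (\<forall>s\<in>topspace S. closed_geodesic (fibre X f s) (fibre_atlas \<X> \<S> f s) (g s) (\<gamma> s)) \<and>
     continuous_map (prod_topology S euclideanreal) X (\<lambda>(s, t). \<gamma> s t) \<and>
     (\<forall>c\<in>\<S>. \<forall>d\<in>\<X>.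
        smooth_on {(w, t). w \<in> snd c ` fst c \<and> \<gamma> (chart_inv c w) t \<in> fst d}
          (\<lambda>(w, t). snd d (\<gamma> (chart_inv c w) t)))"

end

theory Submission
  imports Defs
begin

text \<open>
  Over a coordinate disc of the base, write \<open>g = exp ph\<close> for the fibrewise metrics in adapted coordinates
  \<open>(z, w)\<close>, and \<open>a\<close> for the lift of \<open>\<partial>/\<partial>w\<close> whose \<open>dzbar\<close> is the harmonic representative \<open>A\<close>.
  No regularity of \<open>g\<close> in \<open>w\<close> is assumed. It is derived from the equation \<open>lap ph = exp ph\<close> by the
  maximum principle on the compact fibres, applied to difference quotients in \<open>w\<close>: first
  \<open>\<partial>ph/\<partial>w = psi = - (a\<^sub>z + ph\<^sub>z a)\<close>, where harmonicity of \<open>A\<close> (equivalently \<open>A\<^sub>z + ph\<^sub>z A = 0\<close>)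
  enters, and then that \<open>psi\<close> is continuously differentiable. The function
  \<open>c = \<partial>psi/\<partial>w\<close>-bar \<open>- g |a|\<^sup>2\<close> is well defined on each fibre and solves \<open>lap c = g (c - |A|\<^sup>2)\<close>, so
  \<open>c \<le> max |A|\<^sup>2\<close>. Finally, for geodesics \<open>Z(w, t)\<close> of length \<open>\<ell>\<close>, with \<open>x = (Z\<^sub>w - a)/Z\<^sub>t\<close>, \<open>y = Z\<close>-wbar \<open>/Z\<^sub>t\<close>
  and \<open>\<alpha>\<close> the value of \<open>A\<close> on the tangent direction, the derivative \<open>\<lambda> = \<alpha> + x' + cnj y'\<close> of \<open>2 log \<ell>\<close> does not
  depend on \<open>t\<close>, and its derivative differs from \<open>c + \<ell>\<^sup>2 (|x|\<^sup>2 - |y|\<^sup>2)\<close> by the derivative of a periodic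
  function. Jacobi's equation for \<open>y\<close> turns this into \<open>\<partial>\<partial>\<close>-bar \<open>(2 log \<ell>) + |\<lambda>|\<^sup>2 / 2 \<le> 3/2 max |A|\<^sup>2\<close>,
  which gives both estimates.
\<close>

text \<open>The data on different fibres are unrelated a priori: the metrics and the lifts are given
  fibre by fibre, so even continuity in \<open>w\<close> has to be extracted from the elliptic
  equations. The candidate \<open>psi\<close> for the derivative of \<open>ph\<close> says that the
  lift preserves the hyperbolic area to first order; it solves the linearization
  \<open>lap psi = g psi\<close> of the metric equation, and it changes between charts as a
  derivative of \<open>ph\<close> in \<open>w\<close> would. Neither is a function on the fibre: the
  errors and difference quotients to be estimated agree across a chart change only up to terms that
  become negligible in the limit. The maximum principle is therefore stated for families of
  functions on finitely many discs that match up to an error, and a weight on each disc absorbs this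
  error. An interior gradient bound, proved with an explicit barrier, takes the place of elliptic
  regularity. In the final constant 3/2, which becomes 3/4 for log \<ell>, the summand 1 is the
  bound for \<open>c\<close>, and the summand 1/2 comes from \<alpha>, whose modulus is that of
  \<open>A\<close>.\<close>

abbreviation disc2 :: "('d * complex => real) => 'd * complex => complex set" where
 "disc2 r i == cball (snd i) (2 * r i)"

abbreviation shift :: "complex => complex * real => complex" where
 "shift v x == fst x + of_real (snd x) * v"

lemmas cmod_sq = complex_norm_square[symmetric]

section \<open>Differentiable functions of class C^k\<close>

subsection \<open>Smooth functions\<close>

lemma Ck_on_cong:
 assumes "open U" "!!x. x : U ==> f x = h x" "Ck_on k U f"
 shows "Ck_on k U h"
 using assms(2,3)
proof (induction k arbitrary: f h)
 case 0
 then have "continuous_on U f" by simp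
 then have "continuous_on U h" using 0(1) by (rule continuous_on_eq)
 then show ?case by simp
next
 case (Suc k)
 have d: "(h has_derivative frechet_derivative f (at x)) (at x)" if "x : U" for x
  using Suc.prems that assms(1)
  by (auto simp: frechet_derivative_works
    intro: has_derivative_transform_within_open[of f _ x UNIV U h])
 then have "frechet_derivative h (at x) = frechet_derivative f (at x)" if "x : U" for x
  using that frechet_derivative_at by metis
 then have "Ck_on k U (%x. frechet_derivative h (at x) v)" for v
  using Suc.prems by (auto intro: Suc.IH[of "%x. frechet_derivative f (at x) v"])
 then show ?case using d unfolding Ck_on.simps differentiable_def by blast
qed

lemma frechet_derivative_cong_open:
 assumes "open U" "x : U" "!!y. y : U ==> f y = h y"
 shows "frechet_derivative f (at x) = frechet_derivative h (at x)"
proof -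
 have "(f has_derivative D) (at x) \<longleftrightarrow> (h has_derivative D) (at x)" for D
  using assms by (auto intro: has_derivative_transform_within_open)
 then show ?thesis by (simp add: frechet_derivative_def)
qed

lemma Ck_on_subset: "Ck_on k U f ==> V <= U ==> Ck_on k V f"
 by (induction k arbitrary: f) (auto intro: continuous_on_subset)

lemma Ck_on_imp_continuous_on: "Ck_on k U f ==> continuous_on U f"
proof (cases k)
 case (Suc j)
 assume "Ck_on k U f"
 then show ?thesis
  unfolding Suc by (intro continuous_at_imp_continuous_on) (simp add: differentiable_imp_continuous_within)
qed simp

lemma Ck_on_SucD: "Ck_on (Suc k) U f ==> Ck_on k U f"
proof (induction k arbitrary: f)
 case 0
 then show ?case using Ck_on_imp_continuous_on[OF 0] by simp
qed auto

lemma Ck_on_const: "Ck_on k U (%x. c)"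
 by (induction k arbitrary: c) auto

text \<open>Derivatives are unique, so on an open set any explicitly given family of derivatives may
  stand for \<open>frechet_derivative\<close>. All later inductions on the order of
  differentiability go through this rule.\<close>

lemma Ck_on_SucI:
 assumes "open U" "!!x. x : U ==> (f has_derivative f' x) (at x)" "!!v. Ck_on k U (%x. f' x v)"
 shows "Ck_on (Suc k) U f"
proof -
 have eq: "frechet_derivative f (at x) = f' x" if "x : U" for x
  using assms(2)[OF that] frechet_derivative_at by metis
 have "Ck_on k U (%x. frechet_derivative f (at x) v)" for v
  by (rule Ck_on_cong[OF assms(1) _ assms(3)[of v]]) (simp add: eq)
 then show ?thesis using assms(2) unfolding Ck_on.simps differentiable_def by blast
qed

lemma Ck_on_has_derivative:
 "Ck_on (Suc k) U f ==> x : U ==> (f has_derivative frechet_derivative f (at x)) (at x)"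
 by (simp add: frechet_derivative_works)

lemma Ck_on_bounded_linear:
 assumes "open U" "bounded_linear L" "Ck_on k U f"
 shows "Ck_on k U (%x. L (f x))"
 using assms(3)
proof (induction k arbitrary: f)
 case 0
 then show ?case using assms by (auto intro: bounded_linear.continuous_on)
next
 case (Suc k)
 show ?case
  by (rule Ck_on_SucI[OF assms(1) bounded_linear.has_derivative[OF assms(2) Ck_on_has_derivative[OF Suc.prems]]])
   (use Suc in auto)
qed

lemma Ck_on_add:
 assumes "open U" "Ck_on k U f" "Ck_on k U h"
 shows "Ck_on k U (%x. f x + h x)"
 using assms(2,3)
proof (induction k arbitrary: f h)
 case (Suc k)
 show ?case
  by (rule Ck_on_SucI[OF assms(1) has_derivative_add[OF Ck_on_has_derivative[OF Suc.prems(1)] Ck_on_has_derivative[OF Suc.prems(2)]]])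
   (use Suc in auto)
qed (auto intro: continuous_intros)

lemma Ck_on_mult:
 fixes f h :: "'a::euclidean_space => 'b::real_normed_algebra"
 assumes "open U" "Ck_on k U f" "Ck_on k U h"
 shows "Ck_on k U (%x. f x * h x)"
 using assms(2,3)
proof (induction k arbitrary: f h)
 case (Suc k)
 have "Ck_on k U (%x. f x * frechet_derivative h (at x) v)" for v
  by (rule Suc.IH[OF Ck_on_SucD[OF Suc.prems(1)]]) (use Suc.prems in simp)
 moreover have "Ck_on k U (%x. frechet_derivative f (at x) v * h x)" for v
  by (rule Suc.IH[OF _ Ck_on_SucD[OF Suc.prems(2)]]) (use Suc.prems in simp)
 ultimately show ?case
  by (intro Ck_on_SucI[OF assms(1) has_derivative_mult[OF Ck_on_has_derivative[OF Suc.prems(1)] Ck_on_has_derivative[OF Suc.prems(2)]]]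
    Ck_on_add[OF assms(1)])
qed (auto intro: continuous_intros)

text \<open>The derivative is a product of \<open>inverse f\<close>, the derivative of
  \<open>f\<close> and \<open>inverse f\<close> again; all three are of class C^k by induction,
  which gains one order.\<close>

lemma Ck_on_inverse:
 fixes f :: "'a::euclidean_space => 'b::real_normed_field"
 assumes "open U" "!!x. x : U ==> f x ~= 0" "Ck_on k U f"
 shows "Ck_on k U (%x. inverse (f x))"
 using assms(3)
proof (induction k)
 case 0
 then show ?case using assms(2) by (auto intro: continuous_intros)
next
 case (Suc k)
 have i: "Ck_on k U (%x. inverse (f x))" using Suc Ck_on_SucD by blast
 show ?case
 proof (rule Ck_on_SucI[OF assms(1)])
  show "((%x. inverse (f x)) has_derivative (%v. (-1) * (inverse (f x) * frechet_derivative f (at x) v * inverse (f x)))) (at x)" if "x : U" for x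
   using Deriv.has_derivative_inverse[OF assms(2)[OF that] Ck_on_has_derivative[OF Suc.prems that]]
   by simp
  have "Ck_on k U (%x. frechet_derivative f (at x) v)" for v using Suc.prems by simp
  then show "Ck_on k U (%x. (-1) * (inverse (f x) * frechet_derivative f (at x) v * inverse (f x)))" for v
   by (intro Ck_on_mult[OF assms(1)] Ck_on_const i)
 qed
qed

lemma Ck_on_ln:
 fixes f :: "'a::euclidean_space => real"
 assumes "open U" "!!x. x : U ==> f x > 0" "Ck_on k U f"
 shows "Ck_on k U (%x. ln (f x))"
proof (cases k)
 case 0
 have "f x ~= 0" if "x : U" for x using assms(2)[OF that] by simp
 then show ?thesis using assms(3) 0 by (auto intro!: continuous_on_ln)
next
 case (Suc j)
 have f: "Ck_on (Suc j) U f" using assms Suc by simp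
 show ?thesis unfolding Suc
 proof (rule Ck_on_SucI[OF assms(1)])
  show "((%x. ln (f x)) has_derivative (%v. inverse (f x) * frechet_derivative f (at x) v)) (at x)" if "x : U" for x
   using has_derivative_ln[OF assms(2)[OF that] Ck_on_has_derivative[OF f that]]
   by (simp add: mult.commute)
  show "Ck_on j U (%x. inverse (f x) * frechet_derivative f (at x) v)" for v
  proof (rule Ck_on_mult[OF assms(1)])
   have "f x ~= 0" if "x : U" for x using assms(2)[OF that] by simp
   then show "Ck_on j U (%x. inverse (f x))" by (rule Ck_on_inverse[OF assms(1) _ Ck_on_SucD[OF f]])
   show "Ck_on j U (%x. frechet_derivative f (at x) v)" using f by simp
  qed
 qed
qed

text \<open>For an affine inner map the derivative of the composite is a derivative of
  \<open>f\<close> in the fixed direction \<open>L v\<close>, composed with the same map. The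
  induction thus closes without any product of derivatives.\<close>

lemma Ck_on_compose_affine:
 fixes L :: "'a::euclidean_space => 'b::euclidean_space"
 assumes "open U" "open V" "bounded_linear L" "Ck_on k U f" "!!x. x : V ==> c + L x : U"
 shows "Ck_on k V (%x. f (c + L x))"
 using assms(4)
proof (induction k arbitrary: f)
 case 0
 have "continuous_on V (%x. c + L x)"
  using assms(3) by (intro continuous_intros) (simp add: linear_continuous_on)
 then show ?case using 0 assms(5) by (auto intro!: continuous_on_compose2[of U f V])
next
 case (Suc k)
 show ?case
 proof (rule Ck_on_SucI[OF assms(2)])
  show "((%x. f (c + L x)) has_derivative (%v. frechet_derivative f (at (c + L x)) (L v))) (at x)" if "x : V" for x
  proof -
   have "((%x. c + L x) has_derivative L) (at x)"
    using assms(3) by (auto intro!: derivative_eq_intros bounded_linear_imp_has_derivative)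
   from diff_chain_at[OF this Ck_on_has_derivative[OF Suc.prems assms(5)[OF that]]]
   show ?thesis by (simp add: o_def)
  qed
  show "Ck_on k V (%x. frechet_derivative f (at (c + L x)) (L v))" for v
   using Suc.prems by (auto intro: Suc.IH[of "%x. frechet_derivative f (at x) (L v)"])
 qed
qed

lemma smooth_on_cong: "open U ==> (!!x. x : U ==> f x = h x) ==> smooth_on U f ==> smooth_on U h"
 unfolding smooth_on_def by (auto intro: Ck_on_cong)

lemma smo_subset: "smooth_on U f ==> V <= U ==> smooth_on V f"
 unfolding smooth_on_def by (auto intro: Ck_on_subset)

lemma smo_const: "smooth_on U (%x. c)"
 by (simp add: smooth_on_def Ck_on_const)

lemma smo_bounded_linear:
 "open U ==> bounded_linear L ==> smooth_on U f ==> smooth_on U (%x. L (f x))"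
 by (simp add: smooth_on_def Ck_on_bounded_linear)

lemma smo_of_real:
 "open U ==> smooth_on U f ==> smooth_on U (%x. complex_of_real (f x))"
 by (rule smo_bounded_linear[OF _ bounded_linear_of_real])

lemma smo_cnj: "open U ==> smooth_on U f ==> smooth_on U (%x. cnj (f x))"
 by (rule smo_bounded_linear[OF _ bounded_linear_cnj])

lemma smo_add:
 "open U ==> smooth_on U f ==> smooth_on U h ==> smooth_on U (%x. f x + h x)"
 by (simp add: smooth_on_def Ck_on_add)

lemma smo_mult:
 fixes f h :: "'a::euclidean_space => 'b::real_normed_algebra"
 shows "open U ==> smooth_on U f ==> smooth_on U h ==> smooth_on U (%x. f x * h x)"
 by (simp add: smooth_on_def Ck_on_mult)

lemma smo_minus:
 "open U ==> smooth_on U f ==> smooth_on U (%x. - f x)"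
 by (rule smo_bounded_linear[OF _ bounded_linear_minus[OF bounded_linear_ident]])

lemma smo_diff:
 "open U ==> smooth_on U f ==> smooth_on U h ==> smooth_on U (%x. f x - h x)"
 using smo_add[of U f "%x. - h x"] by (simp add: smo_minus)

lemma smo_inverse:
 fixes f :: "'a::euclidean_space => 'b::real_normed_field"
 shows "open U ==> (!!x. x : U ==> f x ~= 0) ==> smooth_on U f ==> smooth_on U (%x. inverse (f x))"
 by (simp add: smooth_on_def Ck_on_inverse)

lemma smo_ln:
 fixes f :: "'a::euclidean_space => real"
 shows "open U ==> (!!x. x : U ==> f x > 0) ==> smooth_on U f ==> smooth_on U (%x. ln (f x))"
 by (simp add: smooth_on_def Ck_on_ln)

lemma smo_frechet:
 "smooth_on U f ==> smooth_on U (%x. frechet_derivative f (at x) v)"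
 unfolding smooth_on_def
proof
 fix k assume "ALL k. Ck_on k U f"
 then have "Ck_on (Suc k) U f" by blast
 then show "Ck_on k U (%x. frechet_derivative f (at x) v)" by simp
qed

lemma smo_has_derivative:
 "smooth_on U f ==> x : U ==> (f has_derivative frechet_derivative f (at x)) (at x)"
 unfolding smooth_on_def by (rule Ck_on_has_derivative[of 0]) blast+

lemma smo_imp_continuous_on: "smooth_on U f ==> continuous_on U f"
 unfolding smooth_on_def by (metis Ck_on.simps(1))

lemma smo_compose_affine:
 fixes L :: "'a::euclidean_space => 'b::euclidean_space"
 assumes "open U" "open V" "bounded_linear L" "smooth_on U f" "!!x. x : V ==> c + L x : U"
 shows "smooth_on V (%x. f (c + L x))"
 unfolding smooth_on_def
proof
 fix k
 have "Ck_on k U f" using assms(4) by (simp add: smooth_on_def)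
 then show "Ck_on k V (%x. f (c + L x))"
  by (rule Ck_on_compose_affine[OF assms(1-3) _ assms(5)])
qed

text \<open>Both sides are the limit of the second difference quotient
 \<open>(f (x + h v + h w) - f (x + h v) - f (x + h w) + f x) / h\<^sup>2\<close>.\<close>

lemma second_difference_limit:
 fixes f :: "'a::real_normed_vector => 'b::real_normed_vector"
 assumes "open U" "x : U"
  and f: "!!y. y : U ==> (f has_derivative f' y) (at y)"
  and f': "((%y. f' y v) has_derivative f'') (at x)"
 shows "((%h::real. (1 / h\<^sup>2) *\<^sub>R (f (x + h *\<^sub>R v + h *\<^sub>R w) - f (x + h *\<^sub>R v) - f (x + h *\<^sub>R w) + f x))
  \<longlongrightarrow> f'' w) (at_right 0)"
proof (rule tendstoI)
 fix e :: real assume e: "e > 0"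
 interpret l: bounded_linear f'' using f' by (rule has_derivative_bounded_linear)
 \<comment> \<open>\<open>h * C\<close> bounds every increment that occurs; the summand 1 keeps
   \<open>C\<close> positive. The choice of \<open>e'\<close> makes the final error
   \<open>2 * e' * C = e / 2\<close>.\<close>
 define C where "C = 2 * (norm v + norm w) + 1"
 have C: "C > 0" by (simp add: C_def add_nonneg_pos)
 define e' where "e' = e / (4 * C)"
 have e': "e' > 0" using e C by (simp add: e'_def)
 obtain d where d: "d > 0" "!!y. norm (y - x) < d ==>
   norm (f' y v - f' x v - f'' (y - x)) <= e' * norm (y - x)"
  using f'[unfolded has_derivative_at_alt, THEN conjunct2, rule_format, OF e'] by auto
 obtain r where r: "r > 0" "ball x r <= U" using assms(1,2) openE by blast
 define h0 where "h0 = min d r / C"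
 have h0: "h0 > 0" using d r C by (simp add: h0_def)
 show "\<forall>\<^sub>F h in at_right 0. dist ((1 / h\<^sup>2) *\<^sub>R (f (x + h *\<^sub>R v + h *\<^sub>R w) - f (x + h *\<^sub>R v) - f (x + h *\<^sub>R w) + f x)) (f'' w) < e"
  unfolding eventually_at_right_field
 proof (intro exI conjI allI impI)
  show "0 < h0" by fact
  fix h :: real assume h: "0 < h" "h < h0"
  have small: "norm (s *\<^sub>R v + c *\<^sub>R w) <= h * C" "norm (s *\<^sub>R v + c *\<^sub>R w) < min d r"
   if "0 <= s" "s <= h" "0 <= c" "c <= h" for s c
  proof -
   have "norm (s *\<^sub>R v + c *\<^sub>R w) <= s * norm v + c * norm w"
    using that by (intro order.trans[OF norm_triangle_ineq]) auto
   also have "... <= h * norm v + h * norm w"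
    using that by (intro add_mono mult_right_mono) auto
   also have "... <= h * C" using h mult_nonneg_nonneg[of h "norm v"] mult_nonneg_nonneg[of h "norm w"]
    unfolding C_def by (simp add: distrib_left)
   finally show "norm (s *\<^sub>R v + c *\<^sub>R w) <= h * C" .
   also have "h * C < min d r" using h C by (simp add: h0_def pos_less_divide_eq)
   finally show "norm (s *\<^sub>R v + c *\<^sub>R w) < min d r" .
  qed
  define p where "p s = f (x + s *\<^sub>R v + h *\<^sub>R w) - f (x + s *\<^sub>R v)" for s
  define p' where "p' s = f' (x + s *\<^sub>R v + h *\<^sub>R w) v - f' (x + s *\<^sub>R v) v" for s
  have dp: "(p has_derivative (%t. t *\<^sub>R p' s)) (at s within {0..h})" if s: "s : {0..h}" for s
  proof -
   have in_U: "x + s *\<^sub>R v + c *\<^sub>R w : U" if "0 <= c" "c <= h" for c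
   proof -
    have "dist (x + (s *\<^sub>R v + c *\<^sub>R w)) x < r"
     using small(2)[of s c] that s by (simp add: dist_norm)
    then have "x + (s *\<^sub>R v + c *\<^sub>R w) : ball x r"
     by (simp only: mem_ball dist_commute)
    then show ?thesis using r(2) by (auto simp: add.assoc)
   qed
   have der: "((%s. f (x + s *\<^sub>R v + c *\<^sub>R w)) has_derivative (%t. t *\<^sub>R f' (x + s *\<^sub>R v + c *\<^sub>R w) v)) (at s)"
    if "0 <= c" "c <= h" for c
   proof -
    have a: "((%s. x + s *\<^sub>R v + c *\<^sub>R w) has_derivative (%t. t *\<^sub>R v)) (at s)"
     by (auto intro!: derivative_eq_intros)
    have "linear (f' (x + s *\<^sub>R v + c *\<^sub>R w))"
     by (rule has_derivative_linear[OF f[OF in_U[OF that]]])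
    then show ?thesis using diff_chain_at[OF a f[OF in_U[OF that]]]
     by (simp add: o_def linear_cmul)
   qed
   have "(p has_derivative (%t. t *\<^sub>R f' (x + s *\<^sub>R v + h *\<^sub>R w) v - t *\<^sub>R f' (x + s *\<^sub>R v + 0 *\<^sub>R w) v)) (at s)"
    unfolding p_def using has_derivative_diff[OF der[of h] der[of 0]] h by simp
   then show ?thesis by (simp add: p'_def scaleR_diff_right has_derivative_at_withinI)
  qed
  have bd: "norm (p' s - h *\<^sub>R f'' w) <= 2 * e' * (h * C)" if s: "s : {0..h}" for s
  proof -
   have a: "norm (f' (x + s *\<^sub>R v + c *\<^sub>R w) v - f' x v - f'' (s *\<^sub>R v + c *\<^sub>R w)) <= e' * (h * C)"
    if "0 <= c" "c <= h" for c
   proof -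
    have "norm (f' (x + s *\<^sub>R v + c *\<^sub>R w) v - f' x v - f'' (s *\<^sub>R v + c *\<^sub>R w)) <= e' * norm (s *\<^sub>R v + c *\<^sub>R w)"
     using d(2)[of "x + s *\<^sub>R v + c *\<^sub>R w"] small(2)[of s c] that s by (simp add: add.assoc)
    also have "... <= e' * (h * C)" using small(1)[of s c] that s e' by simp
    finally show ?thesis .
   qed
   have "p' s - h *\<^sub>R f'' w = (f' (x + s *\<^sub>R v + h *\<^sub>R w) v - f' x v - f'' (s *\<^sub>R v + h *\<^sub>R w))
    - (f' (x + s *\<^sub>R v + 0 *\<^sub>R w) v - f' x v - f'' (s *\<^sub>R v + 0 *\<^sub>R w))"
    by (simp add: p'_def l.add l.scaleR)
   also have "norm ... <= e' * (h * C) + e' * (h * C)"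
    by (intro order.trans[OF norm_triangle_ineq4] add_mono a) (use h in auto)
   finally show ?thesis by (simp add: mult_ac)
  qed
  \<comment> \<open>Mean value inequality on [0, h]: one factor \<open>h\<close> comes from the
    bound \<open>bd\<close> on the derivative, the other from the length of the interval. Together
    they match the division by the square of \<open>h\<close>.\<close>
  have "norm ((p h - h *\<^sub>R (h *\<^sub>R f'' w)) - (p 0 - 0 *\<^sub>R (h *\<^sub>R f'' w))) <= (2 * e' * (h * C)) * norm (h - 0)"
  proof (rule differentiable_bound[of "{0..h}" _ "%s t. t *\<^sub>R p' s - t *\<^sub>R (h *\<^sub>R f'' w)"])
   show "((%s. p s - s *\<^sub>R h *\<^sub>R f'' w) has_derivative (%t. t *\<^sub>R p' s - t *\<^sub>R h *\<^sub>R f'' w)) (at s within {0..h})" if "s : {0..h}" for s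
    using dp[OF that] by (auto intro!: derivative_eq_intros)
   show "onorm (%t. t *\<^sub>R p' s - t *\<^sub>R h *\<^sub>R f'' w) <= 2 * e' * (h * C)" if "s : {0..h}" for s
   proof (rule onorm_le)
    fix t
    have "norm (t *\<^sub>R (p' s - h *\<^sub>R f'' w)) <= (abs t) * (2 * e' * (h * C))"
     unfolding norm_scaleR by (intro mult_left_mono bd that) simp
    then show "norm (t *\<^sub>R p' s - t *\<^sub>R h *\<^sub>R f'' w) <= 2 * e' * (h * C) * norm t"
     by (simp only: scaleR_diff_right real_norm_def mult.commute)
   qed
  qed (use h in auto)
  then have b: "norm (p h - h\<^sup>2 *\<^sub>R f'' w - p 0) <= 2 * e' * C * h\<^sup>2"
   using h by (simp add: power2_eq_square mult_ac)
  have "dist ((1 / h\<^sup>2) *\<^sub>R (p h - p 0)) (f'' w) = (1 / h\<^sup>2) * norm (p h - h\<^sup>2 *\<^sub>R f'' w - p 0)"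
  proof -
   have "(1 / h\<^sup>2) *\<^sub>R (p h - p 0) - f'' w = (1 / h\<^sup>2) *\<^sub>R (p h - h\<^sup>2 *\<^sub>R f'' w - p 0)"
    using h by (simp add: scaleR_diff_right)
   then show ?thesis by (simp add: dist_norm)
  qed
  also have "... <= 2 * e' * C"
   using b h by (simp add: field_simps)
  also have "... < e" using C e by (simp add: e'_def)
  finally have "dist ((1 / h\<^sup>2) *\<^sub>R (p h - p 0)) (f'' w) < e" .
  moreover have "f (x + h *\<^sub>R v + h *\<^sub>R w) - f (x + h *\<^sub>R v) - f (x + h *\<^sub>R w) + f x = p h - p 0"
   by (simp add: p_def)
  ultimately show "dist ((1 / h\<^sup>2) *\<^sub>R (f (x + h *\<^sub>R v + h *\<^sub>R w) - f (x + h *\<^sub>R v) - f (x + h *\<^sub>R w) + f x)) (f'' w) < e"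
   by simp
 qed
qed

text \<open>The second difference is unchanged when \<open>v\<close> and \<open>w\<close> are
  exchanged, so the two limits coincide.\<close>

lemma frechet_derivative_commute:
 fixes f :: "'a::euclidean_space => 'b::real_normed_vector"
 assumes "open U" "x : U" "Ck_on 2 U f"
 shows "frechet_derivative (%y. frechet_derivative f (at y) v) (at x) w
   = frechet_derivative (%y. frechet_derivative f (at y) w) (at x) v"
proof -
 have f: "Ck_on (Suc (Suc 0)) U f" using assms(3) by (simp add: numeral_2_eq_2)
 have d2: "((%y. frechet_derivative f (at y) v) has_derivative
   frechet_derivative (%y. frechet_derivative f (at y) v) (at x)) (at x)" for v
  using f assms(2) by (simp add: frechet_derivative_works)
 note L = second_difference_limit[OF assms(1,2) Ck_on_has_derivative[OF f] d2]
 have "(%h::real. (1 / h\<^sup>2) *\<^sub>R (f (x + h *\<^sub>R v + h *\<^sub>R w) - f (x + h *\<^sub>R v) - f (x + h *\<^sub>R w) + f x))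
  = (%h::real. (1 / h\<^sup>2) *\<^sub>R (f (x + h *\<^sub>R w + h *\<^sub>R v) - f (x + h *\<^sub>R w) - f (x + h *\<^sub>R v) + f x))"
  by (simp add: add_ac diff_diff_eq)
 with L[of v w] L[of w v] show ?thesis
  by (intro tendsto_unique[OF trivial_limit_at_right_real]) simp_all
qed

section \<open>Wirtinger derivatives\<close>

subsection \<open>Wirtinger calculus\<close>

text \<open>Both Wirtinger derivatives in one statement that includes differentiability. Derivatives
  are computed by chaining rules for \<open>wirt\<close>, and \<open>dz\<close> and
  \<open>dzbar\<close> are read off at the end.\<close>

definition wirt :: "(complex => complex) => complex => complex => complex => bool" where
 "wirt f p q z \<longleftrightarrow> (f has_derivative (%h. p * h + q * cnj h)) (at z)"

lemma wirt_D:
 assumes "wirt f p q z" shows "dz f z = p" "dzbar f z = q"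
proof -
 have "frechet_derivative f (at z) = (%h. p * h + q * cnj h)"
  using assms frechet_derivative_at unfolding wirt_def by metis
 then show "dz f z = p" "dzbar f z = q"
  by (simp_all add: dz_def dzbar_def field_simps)
qed

lemma frechet_derivative_wirt:
 assumes "f differentiable (at z)"
 shows "frechet_derivative f (at z) h = dz f z * h + dzbar f z * cnj h"
proof -
 interpret linear "frechet_derivative f (at z)" using assms by (rule linear_frechet_derivative)
 have "frechet_derivative f (at z) h = frechet_derivative f (at z) (Re h *\<^sub>R 1 + Im h *\<^sub>R \<i>)"
  by (simp add: scaleR_conv_of_real mult.commute[of _ \<i>] complex_eq[symmetric])
 also have "... = of_real (Re h) * frechet_derivative f (at z) 1 + of_real (Im h) * frechet_derivative f (at z) \<i>"
  using scaleR[of "Re h" 1] scaleR[of "Im h" \<i>] by (simp add: add scaleR_conv_of_real)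
 also have "... = dz f z * h + dzbar f z * cnj h"
  by (subst (3 4) complex_eq) (simp add: dz_def dzbar_def field_simps)
 finally show ?thesis .
qed

lemma wirt_I: "f differentiable (at z) ==> wirt f (dz f z) (dzbar f z) z"
 using frechet_derivative_works[of f "at z"] frechet_derivative_wirt[of f z]
 unfolding wirt_def by (metis (no_types, lifting) ext)

lemma wirt_smooth: "smooth_on U f ==> z : U ==> wirt f (dz f z) (dzbar f z) z"
 by (intro wirt_I differentiableI) (rule smo_has_derivative)

lemma wirt_const: "wirt (%z. c) 0 0 z"
 by (simp add: wirt_def)

lemma wirt_add: "wirt f p q z ==> wirt h p' q' z ==> wirt (%z. f z + h z) (p + p') (q + q') z"
 unfolding wirt_def by (drule (1) has_derivative_add) (simp add: algebra_simps)

lemma wirt_diff: "wirt f p q z ==> wirt h p' q' z ==> wirt (%z. f z - h z) (p - p') (q - q') z"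
 unfolding wirt_def by (drule (1) has_derivative_diff) (simp add: algebra_simps)

lemma wirt_minus: "wirt f p q z ==> wirt (%z. - f z) (- p) (- q) z"
 unfolding wirt_def by (drule has_derivative_minus) (simp add: algebra_simps)

lemma wirt_mult:
 "wirt f p q z ==> wirt h p' q' z ==>
  wirt (%z. f z * h z) (f z * p' + p * h z) (f z * q' + q * h z) z"
 unfolding wirt_def by (drule (1) has_derivative_mult) (simp add: algebra_simps)

lemma wirt_cmult: "wirt f p q z ==> wirt (%z. c * f z) (c * p) (c * q) z"
 using wirt_mult[OF wirt_const[of c z]] by force

lemma wirt_cnj: "wirt f p q z ==> wirt (%z. cnj (f z)) (cnj q) (cnj p) z"
 unfolding wirt_def by (drule has_derivative_cnj) (simp add: algebra_simps)

lemma wirt_holomorphic: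
 assumes "(f has_field_derivative p) (at z)" shows "wirt f p 0 z"
 using assms by (simp add: wirt_def has_field_derivative_def)

lemma wirt_ident: "wirt (%z. z) 1 0 z"
 by (rule wirt_holomorphic) (rule DERIV_ident)

lemma wirt_post_compose:
 assumes "wirt f p q z" "(F has_field_derivative F') (at (f z))"
 shows "wirt (%z. F (f z)) (F' * p) (F' * q) z"
 using diff_chain_at[OF assms(1)[unfolded wirt_def] assms(2)[unfolded has_field_derivative_def]]
 by (simp add: wirt_def o_def algebra_simps)

lemma wirt_pre_compose:
 assumes "wirt f p q (t z)" "(t has_field_derivative t') (at z)"
 shows "wirt (%z. f (t z)) (p * t') (q * cnj t') z"
 using diff_chain_at[OF assms(2)[unfolded has_field_derivative_def] assms(1)[unfolded wirt_def]]
 by (simp add: wirt_def o_def algebra_simps)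

lemma wirt_reflect:
 assumes "wirt f p q (c + cnj (z - c))"
 shows "wirt (%z. f (c + cnj (z - c))) q p z"
proof -
 have "((%z. c + cnj (z - c)) has_derivative cnj) (at z)"
  by (auto intro!: derivative_eq_intros)
 from diff_chain_at[OF this assms[unfolded wirt_def]]
 show ?thesis by (simp add: wirt_def o_def algebra_simps)
qed

lemma wirt_exp: "wirt f p q z ==> wirt (%z. exp (f z)) (exp (f z) * p) (exp (f z) * q) z"
 by (rule wirt_post_compose) (auto intro: DERIV_exp)

lemma wirt_cong:
 assumes "open U" "z : U" "!!y. y : U ==> f y = h y" "wirt f p q z"
 shows "wirt h p q z"
 using assms unfolding wirt_def by (auto intro: has_derivative_transform_within_open)

lemma dz_cong: "open U ==> z : U ==> (!!y. y : U ==> f y = h y) ==> dz f z = dz h z"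
 unfolding dz_def using frechet_derivative_cong_open[of U z f h] by simp

lemma dzbar_cong: "open U ==> z : U ==> (!!y. y : U ==> f y = h y) ==> dzbar f z = dzbar h z"
 unfolding dzbar_def using frechet_derivative_cong_open[of U z f h] by simp

lemma smo_dz: "open U ==> smooth_on U f ==> smooth_on U (dz f)"
 unfolding dz_def[abs_def] divide_inverse
 by (intro smo_mult smo_diff smo_const smo_frechet)

lemma smo_dzbar: "open U ==> smooth_on U f ==> smooth_on U (dzbar f)"
 unfolding dzbar_def[abs_def] divide_inverse
 by (intro smo_mult smo_add smo_const smo_frechet)

text \<open>The mixed second derivatives cancel by symmetry, whichever of the two operators is
  applied first.\<close>

lemma dz_dzbar_eq:
 assumes "open U" "smooth_on U f" "z : U"
 defines "D == %v w. frechet_derivative (%y. frechet_derivative f (at y) v) (at z) w"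
 shows "dz (dzbar f) z = (D 1 1 + D \<i> \<i>) / 4" "dzbar (dz f) z = (D 1 1 + D \<i> \<i>) / 4"
proof -
 have c: "D 1 \<i> = D \<i> 1"
  unfolding D_def using assms by (intro frechet_derivative_commute[of U]) (auto simp: smooth_on_def)
 have d: "((%y. frechet_derivative f (at y) v) has_derivative D v) (at z)" for v
  unfolding D_def by (rule smo_has_derivative[OF smo_frechet[OF assms(2)] assms(3)])
 have "((%y. (frechet_derivative f (at y) 1 + \<i> * frechet_derivative f (at y) \<i>) / 2) has_derivative
  (%w. (D 1 w + \<i> * D \<i> w) / 2)) (at z)"
  by (rule bounded_linear.has_derivative[OF bounded_linear_divide[of 2]
    has_derivative_add[OF d[of 1] has_derivative_mult_right[OF d[of \<i>], of \<i>]]])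
 then have "frechet_derivative (dzbar f) (at z) = (%w. (D 1 w + \<i> * D \<i> w) / 2)"
  unfolding dzbar_def[abs_def] by (rule frechet_derivative_at[symmetric])
 then show "dz (dzbar f) z = (D 1 1 + D \<i> \<i>) / 4"
  by (simp add: dz_def c field_simps)
 have "((%y. (frechet_derivative f (at y) 1 - \<i> * frechet_derivative f (at y) \<i>) / 2) has_derivative
  (%w. (D 1 w - \<i> * D \<i> w) / 2)) (at z)"
  by (rule bounded_linear.has_derivative[OF bounded_linear_divide[of 2]
    has_derivative_diff[OF d[of 1] has_derivative_mult_right[OF d[of \<i>], of \<i>]]])
 then have "frechet_derivative (dz f) (at z) = (%w. (D 1 w - \<i> * D \<i> w) / 2)"
  unfolding dz_def[abs_def] by (rule frechet_derivative_at[symmetric])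
 then show "dzbar (dz f) z = (D 1 1 + D \<i> \<i>) / 4"
  by (simp add: dzbar_def c field_simps)
qed

lemma dzbar_dz_commute:
 "open U ==> smooth_on U f ==> z : U ==> dzbar (dz f) z = dz (dzbar f) z"
 by (simp add: dz_dzbar_eq)

text \<open>A quarter of the Euclidean Laplacian. In this normalization a metric of Gaussian
  curvature -2 satisfies \<open>lap (log g) = g\<close>.\<close>

abbreviation lap :: "(complex => complex) => complex => complex" where
 "lap f == dz (dzbar f)"

text \<open>Since \<open>lap\<close> is evaluated only on smooth functions, it suffices to know the first derivatives
 on an open set and to differentiate once more.\<close>

lemma lap_I:
 assumes "open U" "z : U" "!!y. y : U ==> wirt f (p y) (q y) y" "wirt q L L' z"
 shows "lap f z = L"
proof -
 have "dzbar f y = q y" if "y : U" for y using assms(3)[OF that] wirt_D by blast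
 then have "lap f z = dz q z" using assms by (intro dz_cong[of U]) auto
 then show ?thesis using assms(4) wirt_D by simp
qed

lemma lap_add:
 assumes "open U" "z : U" "smooth_on U f" "smooth_on U h"
 shows "lap (%z. f z + h z) z = lap f z + lap h z"
 by (rule lap_I[OF assms(1,2)], rule wirt_add[OF wirt_smooth[OF assms(3)] wirt_smooth[OF assms(4)]], assumption, assumption,
   rule wirt_add[OF wirt_smooth[OF smo_dzbar[OF assms(1,3)]] wirt_smooth[OF smo_dzbar[OF assms(1,4)]]]) fact+

lemma lap_diff:
 assumes "open U" "z : U" "smooth_on U f" "smooth_on U h"
 shows "lap (%z. f z - h z) z = lap f z - lap h z"
 by (rule lap_I[OF assms(1,2)], rule wirt_diff[OF wirt_smooth[OF assms(3)] wirt_smooth[OF assms(4)]], assumption, assumption,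
   rule wirt_diff[OF wirt_smooth[OF smo_dzbar[OF assms(1,3)]] wirt_smooth[OF smo_dzbar[OF assms(1,4)]]]) fact+

lemma lap_cmult:
 assumes "open U" "z : U" "smooth_on U f"
 shows "lap (%z. c * f z) z = c * lap f z"
 by (rule lap_I[OF assms(1,2)], rule wirt_cmult[OF wirt_smooth[OF assms(3)]], assumption,
   rule wirt_cmult[OF wirt_smooth[OF smo_dzbar[OF assms(1,3)]]]) fact

lemma lap_cnj:
 assumes "open U" "z : U" "smooth_on U f"
 shows "lap (%z. cnj (f z)) z = cnj (lap f z)"
proof -
 have "lap (%z. cnj (f z)) z = cnj (dzbar (dz f) z)"
  by (rule lap_I[OF assms(1,2)], rule wirt_cnj[OF wirt_smooth[OF assms(3)]], assumption,
    rule wirt_cnj[OF wirt_smooth[OF smo_dz[OF assms(1,3)]]]) fact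
 then show ?thesis using dzbar_dz_commute[OF assms(1,3,2)] by simp
qed

lemma lap_pre_compose:
 assumes "open U" "smooth_on U f" "open V" "z : V" "!!y. y : V ==> a + b * y : U"
 shows "lap (%z. f (a + b * z)) z = lap f (a + b * z) * (b * cnj b)"
proof -
 have d: "((%z. a + b * z) has_field_derivative b) (at y)" for y
  by (auto intro!: derivative_eq_intros)
 have 1: "wirt (%z. f (a + b * z)) (dz f (a + b * y) * b) (dzbar f (a + b * y) * cnj b) y" if "y : V" for y
  by (rule wirt_pre_compose[of f _ _ "%z. a + b * z", OF wirt_smooth[OF assms(2) assms(5)[OF that]] d])
 have 2: "wirt (%y. dzbar f (a + b * y)) (lap f (a + b * z) * b) (dzbar (dzbar f) (a + b * z) * cnj b) z"
  by (rule wirt_pre_compose[of "dzbar f" _ _ "%z. a + b * z", OF wirt_smooth[OF smo_dzbar[OF assms(1,2)] assms(5)[OF assms(4)]] d])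
 show ?thesis
  using lap_I[OF assms(3,4) 1 wirt_mult[OF 2 wirt_const[of "cnj b"]]] by simp
qed

lemma lap_reflect:
 assumes "open U" "smooth_on U f" "open V" "z : V" "!!y. y : V ==> c + cnj (y - c) : U"
 shows "lap (%z. f (c + cnj (z - c))) z = lap f (c + cnj (z - c))"
proof -
 have 1: "wirt (%z. f (c + cnj (z - c))) (dzbar f (c + cnj (y - c))) (dz f (c + cnj (y - c))) y" if "y : V" for y
  by (rule wirt_reflect[OF wirt_smooth[OF assms(2) assms(5)[OF that]]])
 have 2: "wirt (%y. dz f (c + cnj (y - c))) (dzbar (dz f) (c + cnj (z - c))) (dz (dz f) (c + cnj (z - c))) z"
  by (rule wirt_reflect[OF wirt_smooth[OF smo_dz[OF assms(1,2)] assms(5)[OF assms(4)]]])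
 show ?thesis
  using lap_I[OF assms(3,4) 1 2] dzbar_dz_commute[OF assms(1,2) assms(5)[OF assms(4)]] by simp
qed

subsection \<open>The maximum principle\<close>

text \<open>If \<open>h''\<close> were positive, \<open>h'\<close>, which vanishes at the maximum,
  would be positive just to the right of 0, and the mean value theorem would produce a value above
  the maximum.\<close>

lemma second_derivative_local_max:
 fixes h :: "real => real"
 assumes "d > 0" "!!t. (abs t) < d ==> (h has_real_derivative h' t) (at t)"
  and "(h' has_real_derivative h'') (at 0)" "!!t. (abs t) < d ==> h t <= h 0"
 shows "h'' <= 0"
proof (rule ccontr)
 assume "~ h'' <= 0"
 then obtain e where e: "e > 0" "!!x. 0 < x ==> x < e ==> h' 0 < h' (0 + x)"
  using DERIV_pos_inc_right[OF assms(3)] by auto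
 have 0: "h' 0 = 0"
  using DERIV_local_max[OF assms(2)[of 0] assms(1)] assms(1,4) by auto
 define x where "x = min d e / 2"
 have x: "0 < x" "x < d" "x < e" using assms(1) e by (auto simp: x_def)
 obtain y where "0 < y" "y < x" "h x - h 0 = (x - 0) * h' y"
  using MVT2[of 0 x h h'] x assms(2) by force
 moreover have "h' y > 0" using e(2)[of y] 0 \<open>0 < y\<close> \<open>y < x\<close> x by simp
 then have "(x - 0) * h' y > 0" using x(1) by simp
 ultimately have "h x > h 0" by linarith
 then show False using assms(4)[of x] x by simp
qed

text \<open>The second derivatives of the real part along the directions 1 and \<i> are at most
  zero, and \<open>dz_dzbar_eq\<close> writes \<open>lap\<close> as their sum divided by 4.\<close>

lemma lap_local_max:
 assumes "open U" "z : U" "smooth_on U f" "!!y. y : U ==> Re (f y) <= Re (f z)"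
 shows "Re (lap f z) <= 0"
proof -
 have "Re (frechet_derivative (%y. frechet_derivative f (at y) v) (at z) v) <= 0" if v: "norm v = 1" for v
 proof -
  obtain d where d: "d > 0" "ball z d <= U" using assms(1,2) openE by blast
  have in_U: "z + of_real t * v : U" if "(abs t) < d" for t
   using d(2) that v by (auto simp: subset_iff dist_norm norm_mult)
  have der: "((%t. Re (k (z + of_real t * v))) has_real_derivative Re (frechet_derivative k (at (z + of_real t * v)) v)) (at t)"
   if "smooth_on U k" "(abs t) < d" for k t
  proof -
   have a: "((%t. z + of_real t * v) has_derivative (%s. of_real s * v)) (at t)"
    by (auto intro!: derivative_eq_intros)
   note k = smo_has_derivative[OF that(1) in_U[OF that(2)]]
   interpret linear "frechet_derivative k (at (z + of_real t * v))"
    using k by (rule has_derivative_linear)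
   have "((%t. Re (k (z + of_real t * v))) has_derivative
    (%s. Re (frechet_derivative k (at (z + of_real t * v)) (of_real s * v)))) (at t)"
    using has_derivative_Re[OF diff_chain_at[OF a k]] by (simp add: o_def)
   moreover have "frechet_derivative k (at (z + of_real t * v)) (of_real s * v) =
     s *\<^sub>R frechet_derivative k (at (z + of_real t * v)) v" for s
    using scaleR[of s v] by (simp add: scaleR_conv_of_real)
   ultimately show ?thesis
    by (simp add: has_field_derivative_def mult_commute_abs)
  qed
  show ?thesis
   using second_derivative_local_max[OF d(1) der[OF assms(3)], of "Re (frechet_derivative (%y. frechet_derivative f (at y) v) (at z) v)"]
    der[OF smo_frechet[OF assms(3), of v], of 0] d(1) assms(4) in_U by simp
 qed
 from this[of 1] this[of \<i>] show ?thesis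
  by (simp add: dz_dzbar_eq(1)[OF assms(1,3,2)])
qed

section \<open>Maximum principle and gradient estimate\<close>

text \<open>The weight \<open>K |z - \<zeta>|\<^sup>2 / r\<^sup>2\<close> forces the maximum of the weighted functions over all
 discs to be attained in the interior of a disc.\<close>

lemma lap_norm_square: "lap (%y. c * ((y - a) * cnj (y - a))) z = c"
proof -
 have 0: "wirt (%y. y - a) 1 0 y" for y
  using wirt_diff[OF wirt_ident wirt_const[of a]] by simp
 have 1: "wirt (%y. c * ((y - a) * cnj (y - a))) (c * cnj (y - a)) (c * (y - a)) y" for y
  using wirt_cmult[OF wirt_mult[OF 0 wirt_cnj[OF 0]], of c y] by simp
 have 2: "wirt (%y. c * (y - a)) c 0 z"
  using wirt_cmult[OF 0, of c] by simp
 show ?thesis by (rule lap_I[OF open_UNIV UNIV_I 1 2])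
qed

lemma smo_ident: "smooth_on U (%x. x)"
proof -
 have "Ck_on k U (%x. x)" for k by (cases k) (auto simp: Ck_on_const)
 then show ?thesis by (simp add: smooth_on_def)
qed

text \<open>The weight equals \<open>4 K\<close> on the boundary of the doubled disc and is at most
  \<open>K\<close> on the inner disc. Passing from a boundary point to a matching inner point loses
  at most \<kappa> but gains \<open>3 K\<close>, so \<kappa> \<open>< 3 K\<close> keeps the maximum
  of the weighted functions off every boundary. At an interior maximum the Laplacian of the weight,
  \<open>K\<close> over the square of the radius, bounds that of \<open>u\<close>. Removing the
  weight costs \<open>4 K\<close>.\<close>

lemma finite_disc_max_principle:
 fixes u :: "'i => complex => complex"
 assumes "finite F" and r: "!!i. i : F ==> r i > 0"
  and sm: "!!i. i : F ==> EX V. open V & cball (\<zeta> i) (2 * r i) <= V & smooth_on V (u i)"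
  and bd: "!!i y. i : F ==> y : sphere (\<zeta> i) (2 * r i) ==>
   EX j:F. EX y':cball (\<zeta> j) (r j). Re (u i y) <= Re (u j y') + \<kappa>"
  and K: "\<kappa> < 3 * K" "K >= 0"
  and int: "!!i y. i : F ==> y : ball (\<zeta> i) (2 * r i) ==> Re (lap (u i) y) <= K / (r i)\<^sup>2 ==> Re (u i y) <= M"
  and i: "i : F" "y : cball (\<zeta> i) (2 * r i)"
 shows "Re (u i y) <= M + 4 * K"
proof -
 define v where "v j y = Re (u j y) - K / (r j)\<^sup>2 * (cmod (y - \<zeta> j))\<^sup>2" for j y
 have v_le: "Re (u j y) - 4 * K <= v j y" if "j : F" "y : cball (\<zeta> j) (2 * r j)" for j y
 proof -
  have "(cmod (y - \<zeta> j))\<^sup>2 <= (2 * r j)\<^sup>2"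
   using that by (intro power_mono) (auto simp: dist_norm norm_minus_commute)
  then have "K / (r j)\<^sup>2 * (cmod (y - \<zeta> j))\<^sup>2 <= K / (r j)\<^sup>2 * (2 * r j)\<^sup>2"
   using K by (intro mult_left_mono) auto
  also have "... = 4 * K" using r[OF that(1)] by (simp add: power_mult_distrib)
  finally show ?thesis by (simp add: v_def)
 qed
 have cont: "continuous_on (cball (\<zeta> j) (2 * r j)) (v j)" if jF: "j : F" for j
 proof -
  obtain V where "open V" "cball (\<zeta> j) (2 * r j) <= V" "smooth_on V (u j)" using sm[OF jF] by blast
  then have "continuous_on (cball (\<zeta> j) (2 * r j)) (u j)"
   by (meson continuous_on_subset smo_imp_continuous_on)
  then show ?thesis unfolding v_def by (intro continuous_intros)
 qed
 have "EX y:cball (\<zeta> j) (2 * r j). ALL y':cball (\<zeta> j) (2 * r j). v j y' <= v j y" if "j : F" for j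
  using continuous_attains_sup[OF compact_cball _ cont[OF that]] r[OF that] by simp
 then obtain m where m: "!!j. j : F ==> m j : cball (\<zeta> j) (2 * r j)"
   "!!j y'. j : F ==> y' : cball (\<zeta> j) (2 * r j) ==> v j y' <= v j (m j)"
  by metis
 have "Max ((%j. v j (m j)) ` F) : (%j. v j (m j)) ` F"
  using \<open>finite F\<close> i(1) by (intro Max_in) auto
 then obtain k where k: "k : F" "Max ((%j. v j (m j)) ` F) = v k (m k)" by blast
 have k2: "v j (m j) <= v k (m k)" if "j : F" for j
  unfolding k(2)[symmetric] using \<open>finite F\<close> that by (intro Max_ge) auto
 have max: "v j y' <= v k (m k)" if "j : F" "y' : cball (\<zeta> j) (2 * r j)" for j y'
  using m(2)[OF that] k2[OF that(1)] by simp
 have int_k: "m k : ball (\<zeta> k) (2 * r k)"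
 proof (rule ccontr)
  assume "m k \<notin> ball (\<zeta> k) (2 * r k)"
  then have s: "m k : sphere (\<zeta> k) (2 * r k)" using m(1)[OF k(1)] by auto
  then obtain j y' where j: "j : F" "y' : cball (\<zeta> j) (r j)" "Re (u k (m k)) <= Re (u j y') + \<kappa>"
   using bd[OF k(1)] by blast
  have "cmod (m k - \<zeta> k) = 2 * r k" using s by (simp add: dist_norm norm_minus_commute)
  then have 1: "v k (m k) = Re (u k (m k)) - 4 * K"
   using r[OF k(1)] by (simp add: v_def power_mult_distrib)
  have "(cmod (y' - \<zeta> j))\<^sup>2 <= (r j)\<^sup>2"
   using j by (intro power_mono) (auto simp: dist_norm norm_minus_commute)
  then have "K / (r j)\<^sup>2 * (cmod (y' - \<zeta> j))\<^sup>2 <= K / (r j)\<^sup>2 * (r j)\<^sup>2"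
   using K by (intro mult_left_mono) auto
  also have "... = K" using r[OF j(1)] by simp
  finally have "Re (u j y') - K <= v j y'" by (simp add: v_def)
  moreover have "v j y' <= v k (m k)"
   using j r[OF j(1)] by (intro max) auto
  ultimately show False using 1 j(3) K by simp
 qed
 obtain V where V: "open V" "cball (\<zeta> k) (2 * r k) <= V" "smooth_on V (u k)" using sm[OF k(1)] by blast
 define B where "B = ball (\<zeta> k) (2 * r k)"
 define q where "q y = of_real (K / (r k)\<^sup>2) * ((y - \<zeta> k) * cnj (y - \<zeta> k))" for y
 have smB: "open B" "smooth_on B (u k)"
  using smo_subset[OF V(3) subset_trans[OF ball_subset_cball V(2)]] by (simp_all add: B_def)
 have smq: "smooth_on B q"
  unfolding q_def by (intro smo_mult smo_const smo_diff smo_cnj smo_ident smB)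
 have Re_v: "Re (u k y - q y) = v k y" for y
 proof -
  have "q y = of_real (K / (r k)\<^sup>2 * (cmod (y - \<zeta> k))\<^sup>2)"
   unfolding q_def cmod_sq by simp
  then show ?thesis by (simp add: v_def del: of_real_mult of_real_divide of_real_power)
 qed
 have "Re (lap (%y. u k y - q y) (m k)) <= 0"
 proof (rule lap_local_max[of B])
  show "m k : B" using int_k by (simp add: B_def)
  show "smooth_on B (%y. u k y - q y)" by (intro smo_diff smB smq)
  show "Re (u k y - q y) <= Re (u k (m k) - q (m k))" if "y : B" for y
   unfolding Re_v using that k(1) by (intro max) (auto simp: B_def)
 qed (rule smB)
 moreover have "lap (%y. u k y - q y) (m k) = lap (u k) (m k) - of_real (K / (r k)\<^sup>2)"
 proof -
  have "lap q (m k) = of_real (K / (r k)\<^sup>2)"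
   unfolding q_def[abs_def] by (rule lap_norm_square)
  then show ?thesis using lap_diff[OF smB(1) _ smB(2) smq, of "m k"] int_k by (simp add: B_def)
 qed
 ultimately have "Re (u k (m k)) <= M"
  using int[OF k(1) int_k] by simp
 moreover have "v k (m k) <= Re (u k (m k))" using K by (simp add: v_def)
 moreover have "v i y <= v k (m k)" by (rule max[OF i])
 ultimately show ?thesis using v_le[OF i] by simp
qed

subsection \<open>An interior gradient estimate\<close>

text \<open>The barrier is compared with the odd part of \<open>f\<close> in the half square above \<open>z\<close>, on whose
 lower side the odd part vanishes.\<close>

lemma gradient_estimate_aux:
 assumes "open U" "smooth_on U f" and d: "d > 0"
  and sq: "!!y. \<bar>Re (y - z)\<bar> <= d ==> \<bar>Im (y - z)\<bar> <= d ==> y : U & cmod (f y) <= M & cmod (lap f y) <= N"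
  and "N > 0"
 shows "Re (frechet_derivative f (at z) \<i>) <= 2 * M / d + 4 * N * d"
proof -
 define R where "R y = z + cnj (y - z)" for y
 define X where "X y = (y - z)" for y
 define Y where "Y y = (X y - cnj (X y)) * (- \<i> / 2)" for y
 have Y: "Y y = of_real (Im (y - z))" for y
  by (simp add: Y_def X_def complex_eq_iff field_simps)
 define C1 C2 where "C1 = of_real (M / d\<^sup>2) / (2 :: complex)" and "C2 = (of_real (4 * N) :: complex)"
 \<comment> \<open>With \<open>x\<close> and \<open>y\<close> the real and imaginary parts of the
   argument minus \<open>z\<close>, the real part is the harmonic function
   \<open>M / d^2 * (x^2 - y^2 + 2 d y)\<close> plus \<open>4 N y (d - y)\<close>. The first summand
   handles the sides of the half square, the second has \<open>lap\<close> equal to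
   \<open>- 2 N\<close> and handles the interior.\<close>
 define \<Psi> where "\<Psi> y = C1 * (X y * X y + cnj (X y * X y)) + (C1 * (4 * of_real d) * Y y
   + C2 * (of_real d * Y y - Y y * Y y))" for y
 have M: "M >= 0" using sq[of z] d order.trans[OF norm_ge_zero[of "f z"]] by auto
 have Re_\<Psi>: "Re (\<Psi> y) = (M / d\<^sup>2) * ((Re (y - z))\<^sup>2 + Im (y - z) * (2 * d - Im (y - z))) + 4 * N * Im (y - z) * (d - Im (y - z))" for y
  unfolding \<Psi>_def Y C1_def C2_def X_def by (simp add: power2_eq_square field_simps)
 have wX: "wirt X 1 0 y" for y
  unfolding X_def[abs_def] using wirt_diff[OF wirt_ident wirt_const[of z]] by simp
 have wY: "wirt Y (- \<i> / 2) (\<i> / 2) y" for y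
  unfolding Y_def[abs_def]
  using wirt_mult[OF wirt_diff[OF wX wirt_cnj[OF wX]] wirt_const[of "- \<i> / 2"]] by simp
 have smX: "smooth_on V X" if "open V" for V
  unfolding X_def[abs_def] by (intro smo_diff smo_ident smo_const that)
 have smY: "smooth_on V Y" if "open V" for V
  unfolding Y_def[abs_def] by (intro smo_diff smo_cnj smo_mult smo_const smX that)
 have sm\<Psi>: "smooth_on V \<Psi>" if "open V" for V
  unfolding \<Psi>_def[abs_def]
  by (intro smo_add smo_diff smo_cnj smo_mult smo_const smX smY that)
 have lap\<Psi>: "lap \<Psi> y = - 2 * of_real N" for y
 proof -
  have 1: "wirt \<Psi> (C1 * (2 * X x) + (C1 * (4 * of_real d) * (- \<i> / 2) + C2 * (of_real d * (- \<i> / 2) - Y x * - \<i>)))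
    (C1 * (2 * cnj (X x)) + (C1 * (4 * of_real d) * (\<i> / 2) + C2 * (of_real d * (\<i> / 2) - Y x * \<i>))) x" for x
   using wirt_add[OF wirt_cmult[OF wirt_add[OF wirt_mult[OF wX wX] wirt_cnj[OF wirt_mult[OF wX wX]]], of C1]
     wirt_add[OF wirt_cmult[OF wY, of "C1 * (4 * of_real d)"]
      wirt_cmult[OF wirt_diff[OF wirt_cmult[OF wY, of "of_real d"] wirt_mult[OF wY wY]], of C2]], of x]
   by (simp add: \<Psi>_def[abs_def] algebra_simps)
  have 2: "wirt (%x. C1 * (2 * cnj (X x)) + (C1 * (4 * of_real d) * (\<i> / 2) + C2 * (of_real d * (\<i> / 2) - Y x * \<i>)))
   (C2 * (- (- \<i> / 2 * \<i>))) (C1 * 2 + C2 * (- (\<i> / 2 * \<i>))) y"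
   using wirt_add[OF wirt_cmult[OF wirt_cmult[OF wirt_cnj[OF wX], of 2], of C1]
     wirt_add[OF wirt_const[of "C1 * (4 * of_real d) * (\<i> / 2)"]
      wirt_cmult[OF wirt_diff[OF wirt_const[of "of_real d * (\<i> / 2)"] wirt_mult[OF wY wirt_const[of \<i>]]], of C2]], of y]
   by simp
  show ?thesis using lap_I[OF open_UNIV _ 1 2] by (simp add: C2_def)
 qed
 define H where "H y = f y - f (R y) - 2 * \<Psi> y" for y
 define S where "S = {y. \<bar>Re (y - z)\<bar> <= d & 0 <= Im (y - z) & Im (y - z) <= d}"
 define V where "V = {y. \<bar>Re (y - z)\<bar> < d & 0 < Im (y - z) & Im (y - z) < d}"
 have SU: "y : U" "R y : U" if "y : S" for y
  using that sq[of y] sq[of "R y"] by (auto simp: S_def R_def)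
 have "closed S" unfolding S_def
  by (intro closed_Collect_conj closed_Collect_le continuous_intros)
 moreover have "S <= cball z (2 * d)"
 proof
  fix y assume "y : S"
  then show "y : cball z (2 * d)"
   using cmod_le[of "y - z"] by (auto simp: S_def dist_norm norm_minus_commute)
 qed
 ultimately have "compact S"
  using compact_eq_bounded_closed bounded_cball bounded_subset by blast
 have contH: "continuous_on S (%y. Re (H y))"
 proof -
  have f: "continuous_on U f" by (rule smo_imp_continuous_on[OF assms(2)])
  have "continuous_on S (%y. f (R y))"
   by (rule continuous_on_compose2[OF f]) (use SU in "auto simp: R_def intro!: continuous_intros")
  moreover have "continuous_on S f" using f SU continuous_on_subset by blast
  moreover have "continuous_on S \<Psi>"
   using smo_imp_continuous_on[OF sm\<Psi>[OF open_UNIV]] continuous_on_subset by blast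
  ultimately show ?thesis unfolding H_def by (intro continuous_intros)
 qed
 have V: "open V" unfolding V_def
  by (intro open_Collect_conj open_Collect_less continuous_intros)
 have "z : S" using d by (simp add: S_def)
 then obtain m where m: "m : S" "!!y. y : S ==> Re (H y) <= Re (H m)"
  using continuous_attains_sup[OF \<open>compact S\<close> _ contH] by blast
 \<comment> \<open>At an interior maximum \<open>lap H\<close> would have real part at most zero;
   but the barrier contributes \<open>4 N\<close>, and the odd part of \<open>f\<close> contributes
   at least \<open>- 2 N\<close>.\<close>
 have "m \<notin> V"
 proof
  assume mV: "m : V"
  have VS: "V <= S" by (auto simp: V_def S_def)
  have smf: "smooth_on V f" using assms(2) by (rule smo_subset) (use VS SU in blast)
  have smR: "smooth_on V (%y. f (R y))"
  proof -
   have "smooth_on V (%y. f ((z - cnj z) + cnj y))"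
    by (rule smo_compose_affine[OF assms(1) V bounded_linear_cnj assms(2)])
     (use SU(2) VS in "auto simp: R_def algebra_simps")
   then show ?thesis by (simp add: R_def algebra_simps)
  qed
  have smH: "smooth_on V H"
   unfolding H_def[abs_def] by (intro smo_diff smo_mult smo_const V smf smR sm\<Psi>)
  have "Re (lap H m) <= 0"
   using lap_local_max[OF V mV smH] m(2) VS by blast
  moreover have "lap H m = lap f m - lap f (R m) - 2 * lap \<Psi> m"
  proof -
   have "lap H m = lap (%y. f y - f (R y)) m - lap (%y. 2 * \<Psi> y) m"
    unfolding H_def[abs_def]
    by (rule lap_diff[OF V mV]) (intro smo_diff smo_mult smo_const V smf smR sm\<Psi>)+
   also have "lap (%y. f y - f (R y)) m = lap f m - lap (%y. f (R y)) m"
    by (rule lap_diff[OF V mV smf smR])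
   also have "lap (%y. f (R y)) m = lap f (R m)"
    unfolding R_def by (rule lap_reflect[OF assms(1,2) V mV]) (use SU(2) VS in "auto simp: R_def")
   also have "lap (%y. 2 * \<Psi> y) m = 2 * lap \<Psi> m"
    by (rule lap_cmult[OF V mV sm\<Psi>[OF V]])
   finally show ?thesis .
  qed
  moreover have "cmod (lap f m) <= N" "cmod (lap f (R m)) <= N"
   using sq[of m] sq[of "R m"] mV by (auto simp: V_def R_def)
  ultimately show False
   using \<open>N > 0\<close> abs_Re_le_cmod[of "lap f m"] abs_Re_le_cmod[of "lap f (R m)"] by (simp add: lap\<Psi>)
 qed
 have Hm: "Re (H m) <= 0"
 proof -
  have fm: "Re (f m) - Re (f (R m)) <= 2 * M"
   using sq[of m] sq[of "R m"] m(1) abs_Re_le_cmod[of "f m"] abs_Re_le_cmod[of "f (R m)"]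
   by (auto simp: S_def R_def)
  have mS: "\<bar>Re (m - z)\<bar> <= d" "0 <= Im (m - z)" "Im (m - z) <= d" using m(1) by (auto simp: S_def)
  have 1: "0 <= 4 * N * Im (m - z) * (d - Im (m - z))"
   using mS \<open>N > 0\<close> by simp
  have 2: "0 <= Im (m - z) * (2 * d - Im (m - z))"
   using mS by simp
  \<comment> \<open>On the lateral and upper sides the first summand of the barrier is at least
    \<open>M\<close>, so twice the barrier covers the difference of two values of \<open>f\<close>.
    On the lower side the odd part vanishes.\<close>
  consider "\<bar>Re (m - z)\<bar> = d" | "Im (m - z) = 0" | "Im (m - z) = d"
   using \<open>m \<notin> V\<close> mS by (force simp: V_def)
  then show ?thesis
  proof cases
   case 1
   then have "(Re (m - z))\<^sup>2 = d\<^sup>2" using power2_abs by metis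
   then have "M <= M / d\<^sup>2 * ((Re (m - z))\<^sup>2 + Im (m - z) * (2 * d - Im (m - z)))"
    using d M 2 mult_nonneg_nonneg[of "M / d\<^sup>2" "Im (m - z) * (2 * d - Im (m - z))"]
    by (simp add: distrib_left)
   then show ?thesis using fm \<open>0 <= 4 * N * Im (m - z) * (d - Im (m - z))\<close> unfolding H_def by (simp add: Re_\<Psi>)
  next
   case 2
   then have "R m = m" by (simp add: R_def complex_eq_iff)
   moreover have "Re (\<Psi> m) >= 0" unfolding Re_\<Psi> using 2 M by simp
   ultimately show ?thesis by (simp add: H_def)
  next
   case 3
   have "M <= M / d\<^sup>2 * ((Re (m - z))\<^sup>2 + Im (m - z) * (2 * d - Im (m - z)))"
    unfolding 3 using d M mult_nonneg_nonneg[of "M / d\<^sup>2" "(Re (m - z))\<^sup>2"]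
    by (simp add: distrib_left power2_eq_square)
   then show ?thesis using fm \<open>0 <= 4 * N * Im (m - z) * (d - Im (m - z))\<close> unfolding H_def by (simp add: Re_\<Psi>)
  qed
 qed
 define h where "h t = Re (f (z + \<i> * of_real t))" for t
 have zU: "z : U" using SU \<open>z : S\<close> by blast
 define D where "D = Re (frechet_derivative f (at z) \<i>)"
 have dh: "(h has_real_derivative D) (at 0)"
 proof -
  have a: "((%t. z + \<i> * of_real t) has_derivative (%s. \<i> * of_real s)) (at 0)"
   by (auto intro!: derivative_eq_intros)
  have k: "(f has_derivative frechet_derivative f (at z)) (at (z + \<i> * of_real 0))"
   using smo_has_derivative[OF assms(2) zU] by simp
  interpret linear "frechet_derivative f (at z)"
   using smo_has_derivative[OF assms(2) zU] by (rule has_derivative_linear)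
  have "((%t. Re (f (z + \<i> * of_real t))) has_derivative
    (%s. Re (frechet_derivative f (at z) (\<i> * of_real s)))) (at 0)"
   using has_derivative_Re[OF diff_chain_at[OF a k]] by (simp add: o_def)
  moreover have "frechet_derivative f (at z) (\<i> * of_real s) = s *\<^sub>R frechet_derivative f (at z) \<i>" for s
   using scaleR[of s \<i>] by (simp add: scaleR_conv_of_real mult.commute)
  ultimately show ?thesis
   by (simp add: has_field_derivative_def h_def[abs_def] D_def mult_commute_abs)
 qed
 have "((%t. h t - h (- t)) has_real_derivative (D + D)) (at 0)"
 proof -
  have "((%t. h (- t)) has_real_derivative (D * - 1)) (at 0)"
   by (rule DERIV_chain2[where g = uminus]) (use dh in "auto intro!: derivative_eq_intros")
  from DERIV_diff[OF dh this] show ?thesis by simp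
 qed
 \<comment> \<open>The symmetric quotient tends to twice the vertical derivative, and the bound
   \<open>Re H <= 0\<close> on the segment above \<open>z\<close>, divided by \<open>t\<close>,
   passes to the limit.\<close>
 then have lim: "((%t. (h t - h (- t)) / t) \<longlongrightarrow> 2 * D) (at_right 0)"
  by (simp add: has_field_derivative_iff filterlim_at_split)
 have lim2: "((%t. 2 * (M / d\<^sup>2 * (2 * d - t) + 4 * N * (d - t))) \<longlongrightarrow> 2 * (M / d\<^sup>2 * (2 * d - 0) + 4 * N * (d - 0))) (at_right 0)"
  by (intro tendsto_intros)
 have "2 * D <= 2 * (M / d\<^sup>2 * (2 * d - 0) + 4 * N * (d - 0))"
 proof (rule tendsto_le[OF _ lim2 lim])
  show "\<forall>\<^sub>F t in at_right 0. (h t - h (- t)) / t <= 2 * (M / d\<^sup>2 * (2 * d - t) + 4 * N * (d - t))"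
   unfolding eventually_at_right_field
  proof (intro exI[of _ d] conjI allI impI d)
   fix t :: real assume t: "0 < t" "t < d"
   have "z + \<i> * of_real t : S" using t by (simp add: S_def)
   then have "Re (H (z + \<i> * of_real t)) <= 0" using m(2) Hm by force
   moreover have "R (z + \<i> * of_real t) = z + \<i> * of_real (- t)" by (simp add: R_def)
   ultimately have "h t - h (- t) <= 2 * (M / d\<^sup>2 * (t * (2 * d - t)) + 4 * N * t * (d - t))"
    by (simp add: H_def h_def Re_\<Psi>)
   then have "h t - h (- t) <= t * (2 * (M / d\<^sup>2 * (2 * d - t) + 4 * N * (d - t)))"
    by (simp add: algebra_simps diff_divide_distrib)
   then show "(h t - h (- t)) / t <= 2 * (M / d\<^sup>2 * (2 * d - t) + 4 * N * (d - t))"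
    using t by (simp add: pos_divide_le_eq mult.commute)
  qed
 qed simp
 then show ?thesis using d by (simp add: D_def power2_eq_square)
qed

text \<open>A rotation of the coordinate turns the direction \<open>v\<close> into \<i>, and
  multiplication by a unimodular factor makes the derivative in question real and nonnegative; then
  the one-sided estimate applies with \<open>d = r / 2\<close>. The square of half side
  \<open>r / 2\<close> lies in the disc of radius \<open>r\<close>.\<close>

lemma gradient_estimate:
 assumes "open U" "smooth_on U f" "r > 0" "cball z r <= U"
  and b: "!!y. y : cball z r ==> cmod (f y) <= M" "!!y. y : cball z r ==> cmod (lap f y) <= N" and "N > 0"
 shows "cmod (dz f z) <= 4 * M / r + 2 * N * r" "cmod (dzbar f z) <= 4 * M / r + 2 * N * r"
proof -
 define E where "E = 4 * M / r + 2 * N * r"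
 have E: "cmod (frechet_derivative f (at z) v) <= E" if v: "v = 1 | v = \<i>" for v
 proof -
  define p where "p = frechet_derivative f (at z) v"
  define \<omega> where "\<omega> = cnj (sgn p)"
  define b where "b = v * - \<i>"
  have nb: "cmod b = 1" "b * \<i> = v" "b * cnj b = 1" using v by (auto simp: b_def)
  define V where "V = ball z (2 * r) Int (%y. (z - b * z) + b * y) -` U"
  have V: "open V" unfolding V_def
   by (intro open_Int open_ball open_vimage assms(1) continuous_intros)
  define F where "F y = \<omega> * f ((z - b * z) + b * y)" for y
  have lb: "bounded_linear (%y. b * y)" by (rule bounded_linear_mult_right)
  have smc: "smooth_on V (%y. f ((z - b * z) + b * y))"
   by (rule smo_compose_affine[OF assms(1) V lb assms(2)]) (simp add: V_def)
  have smF: "smooth_on V F"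
   unfolding F_def[abs_def] by (intro smo_mult smo_const V smc)
  have nw: "cmod \<omega> <= 1" by (simp add: \<omega>_def norm_sgn)
  have "Re (frechet_derivative F (at z) \<i>) <= 2 * M / (r / 2) + 4 * N * (r / 2)"
  proof (rule gradient_estimate_aux[OF V smF])
   fix y assume y: "\<bar>Re (y - z)\<bar> <= r / 2" "\<bar>Im (y - z)\<bar> <= r / 2"
   have n: "cmod (y - z) <= r" using cmod_le[of "y - z"] y by simp
   have "dist ((z - b * z) + b * y) z = cmod (b * (y - z))" by (simp add: dist_norm algebra_simps)
   then have c: "(z - b * z) + b * y : cball z r"
    using n nb by (simp only: mem_cball dist_commute norm_mult)
   have yV: "y : V" using c n assms(3,4) by (auto simp: V_def dist_norm norm_minus_commute)
   have "lap F y = \<omega> * lap (%y. f ((z - b * z) + b * y)) y"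
    unfolding F_def[abs_def] by (rule lap_cmult[OF V yV smc])
   also have "lap (%y. f ((z - b * z) + b * y)) y = lap f ((z - b * z) + b * y)"
    using lap_pre_compose[OF assms(1,2) V yV, of "z - b * z" b] nb by (simp add: V_def)
   finally have "cmod (lap F y) <= 1 * N"
    unfolding norm_mult using nw b(2)[OF c] by (simp only: norm_mult) (intro mult_mono, auto)
   moreover have "cmod (F y) <= 1 * M"
    unfolding F_def norm_mult using nw b(1)[OF c] by (intro mult_mono) auto
   ultimately show "y : V & cmod (F y) <= M & cmod (lap F y) <= N" using yV by simp
  qed (use assms in auto)
  moreover have "frechet_derivative F (at z) \<i> = \<omega> * p"
  proof -
   have zU: "z : U" using assms by auto
   have a: "((%y. (z - b * z) + b * y) has_derivative (%h. b * h)) (at z)"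
    by (auto intro!: derivative_eq_intros)
   have "((%y. f ((z - b * z) + b * y)) has_derivative (%h. frechet_derivative f (at z) (b * h))) (at z)"
    using diff_chain_at[OF a, of f "frechet_derivative f (at z)"] smo_has_derivative[OF assms(2) zU]
    by (simp add: o_def)
   then have "(F has_derivative (%h. \<omega> * frechet_derivative f (at z) (b * h))) (at z)"
    unfolding F_def by (rule has_derivative_mult_right)
   then show ?thesis using frechet_derivative_at[of F] nb p_def by metis
  qed
  moreover have "\<omega> * p = of_real (cmod p)"
   by (simp add: \<omega>_def sgn_eq cmod_sq power2_eq_square mult.commute)
  ultimately show ?thesis unfolding p_def E_def by simp
 qed
 have "cmod (dz f z) <= (E + E) / 2"
  using E[of 1] E[of \<i>] norm_triangle_ineq4[of "frechet_derivative f (at z) 1" "\<i> * frechet_derivative f (at z) \<i>"]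
  by (simp add: dz_def norm_divide norm_mult)
 moreover have "cmod (dzbar f z) <= (E + E) / 2"
  using E[of 1] E[of \<i>] norm_triangle_ineq[of "frechet_derivative f (at z) 1" "\<i> * frechet_derivative f (at z) \<i>"]
  by (simp add: dzbar_def norm_divide norm_mult)
 ultimately show "cmod (dz f z) <= 4 * M / r + 2 * N * r" "cmod (dzbar f z) <= 4 * M / r + 2 * N * r"
  by (simp_all add: E_def)
qed

section \<open>Holomorphic functions of two variables\<close>

subsection \<open>Holomorphic functions of two variables\<close>

text \<open>Continuity together with holomorphy in each variable: the form to which the one-variable
  Cauchy theory applies slice by slice. On open sets it agrees with \<open>holomorphic2_on\<close>,
  by \<open>holomorphic2_imp_hol2\<close> and \<open>hol2_imp_holomorphic2\<close>.\<close>

definition hol2 :: "(complex \<times> complex => complex) => (complex \<times> complex) set => bool" where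
 "hol2 G U \<longleftrightarrow> open U & continuous_on U G &
  (ALL x:U. (%z. G (z, snd x)) field_differentiable (at (fst x)) &
   (%w. G (fst x, w)) field_differentiable (at (snd x)))"

definition d1 :: "(complex \<times> complex => complex) => complex \<times> complex => complex" where
 "d1 G x = deriv (%z. G (z, snd x)) (fst x)"

definition d2 :: "(complex \<times> complex => complex) => complex \<times> complex => complex" where
 "d2 G x = deriv (%w. G (fst x, w)) (snd x)"

lemma hol2_open: "hol2 G U ==> open U"
 by (simp add: hol2_def)

lemma hol2_continuous_on: "hol2 G U ==> continuous_on U G"
 by (simp add: hol2_def)

lemma hol2_d1: "hol2 G U ==> (z, w) : U ==> ((%z. G (z, w)) has_field_derivative d1 G (z, w)) (at z)"
 unfolding hol2_def d1_def by (auto dest!: bspec simp: DERIV_deriv_iff_field_differentiable)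

lemma hol2_d2: "hol2 G U ==> (z, w) : U ==> ((%w. G (z, w)) has_field_derivative d2 G (z, w)) (at w)"
 unfolding hol2_def d2_def by (auto dest!: bspec simp: DERIV_deriv_iff_field_differentiable)

lemma open_box:
 fixes x :: "'a::metric_space \<times> 'b::metric_space"
 assumes "open U" "(z, w) : U"
 obtains r where "r > 0" "cball z (2 * r) \<times> cball w (2 * r) <= U"
proof -
 obtain A B where AB: "open A" "open B" "z : A" "w : B" "A \<times> B <= U"
  using assms by (auto elim: open_prod_elim)
 obtain r1 where r1: "r1 > 0" "cball z r1 <= A" using AB open_contains_cball by blast
 obtain r2 where r2: "r2 > 0" "cball w r2 <= B" using AB open_contains_cball by blast
 show ?thesis
 proof (rule that[of "min r1 r2 / 2"])
  show "cball z (2 * (min r1 r2 / 2)) \<times> cball w (2 * (min r1 r2 / 2)) <= U"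
   using r1 r2 AB(5) by (auto simp: subset_iff)
 qed (use r1 r2 in auto)
qed

lemma hol2_swap: "hol2 G U ==> hol2 (%(w, z). G (z, w)) (prod.swap ` U)"
proof -
 assume G: "hol2 G U"
 have sw: "prod.swap ` U = prod.swap -` U" by force
 have "open (prod.swap -` U)"
  using hol2_open[OF G] by (rule open_vimage) (auto simp: prod.swap_def intro!: continuous_intros)
 moreover have "continuous_on (prod.swap -` U) (%x. G (prod.swap x))"
  by (rule continuous_on_compose2[OF hol2_continuous_on[OF G]]) (auto simp: prod.swap_def intro!: continuous_intros)
 ultimately show ?thesis
  using G unfolding hol2_def sw by (auto simp: split_def prod.swap_def)
qed

text \<open>Uniform continuity makes the difference of two nearby slices small on a circle, and the
  Cauchy inequality transfers this to their derivatives, uniformly in \<open>z\<close>. Within one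
  slice the derivative is continuous since it is holomorphic.\<close>

lemma hol2_d1_continuous_on:
 assumes G: "hol2 G U" shows "continuous_on U (d1 G)"
proof (rule continuous_at_imp_continuous_on, rule ballI)
 fix x assume "x : U"
 then obtain z0 w0 where x: "x = (z0, w0)" "(z0, w0) : U" by (cases x) auto
 obtain r where r: "r > 0" "cball z0 (2 * r) \<times> cball w0 (2 * r) <= U"
  using open_box[OF hol2_open[OF G] x(2)] by blast
 define K where "K = cball z0 (2 * r) \<times> cball w0 (2 * r)"
 have uc: "uniformly_continuous_on K G"
  unfolding K_def by (intro compact_uniformly_continuous compact_Times compact_cball
    continuous_on_subset[OF hol2_continuous_on[OF G] r(2)])
 have hol: "(%z. G (z, w)) holomorphic_on cball z0 (2 * r)" if "w : cball w0 (2 * r)" for w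
 proof (rule holomorphic_onI)
  fix z assume "z : cball z0 (2 * r)"
  then have "(z, w) : U" using r(2) that by auto
  from hol2_d1[OF G this] show "(%z. G (z, w)) field_differentiable at z within cball z0 (2 * r)"
   by (meson field_differentiable_def has_field_derivative_at_within)
 qed
 have "((%y. d1 G y) \<longlongrightarrow> d1 G x) (at x)"
 proof (rule tendstoI)
  fix e :: real assume e: "e > 0"
  \<comment> \<open>The Cauchy inequality on a circle of radius \<open>r\<close> divides by
    \<open>r\<close>, so this tolerance yields \<open>e / 4\<close> for the derivatives.\<close>
  obtain d where d: "d > 0" "!!x y. x : K ==> y : K ==> dist y x < d ==> dist (G y) (G x) < e * r / 4"
   using uc e r(1) unfolding uniformly_continuous_on_def by (metis divide_pos_pos mult_pos_pos zero_less_numeral)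
  have est: "cmod (d1 G (z, w) - d1 G (z, w0)) <= e / 4"
   if "z : ball z0 r" "w : ball w0 (min d (2 * r))" for z w
  proof -
   define k where "k \<zeta> = G (\<zeta>, w) - G (\<zeta>, w0)" for \<zeta>
   have sub: "cball z r <= cball z0 (2 * r)"
    using that(1) by (intro cball_subset_cball_iff[THEN iffD2]) (auto simp: dist_commute)
   have k: "k holomorphic_on cball z r"
    unfolding k_def using hol[of w] hol[of w0] that(2) r(1) sub
    by (intro holomorphic_intros) (auto intro: holomorphic_on_subset)
   have "cmod ((deriv ^^ 1) k z) <= fact 1 * (e * r / 4) / r ^ 1"
   proof (rule Cauchy_inequality)
    show "k holomorphic_on ball z r" using k holomorphic_on_subset ball_subset_cball by blast
    show "continuous_on (cball z r) k" using k holomorphic_on_imp_continuous_on by blast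
    fix \<zeta> assume "cmod (z - \<zeta>) = r"
    then have "\<zeta> : cball z r" by (simp add: dist_norm)
    then have "(\<zeta>, w) : K" "(\<zeta>, w0) : K" using sub that(2) r(1) by (auto simp: K_def)
    moreover have "dist (\<zeta>, w) (\<zeta>, w0) < d" using that(2) by (simp add: dist_Pair_Pair dist_commute)
    ultimately show "cmod (k \<zeta>) <= e * r / 4" using d(2) by (fastforce simp: k_def dist_norm)
   qed (rule r(1))
   moreover have "deriv k z = d1 G (z, w) - d1 G (z, w0)"
   proof -
    have "(z, w) : U" "(z, w0) : U" using that r by (auto simp: subset_iff)
    from DERIV_diff[OF hol2_d1[OF G this(1)] hol2_d1[OF G this(2)]]
    show ?thesis unfolding k_def[abs_def] by (rule DERIV_imp_deriv)
   qed
   ultimately show ?thesis using r(1) by simp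
  qed
  have "(deriv (%z. G (z, w0))) holomorphic_on ball z0 (2 * r)"
   using hol[of w0] r(1) by (intro holomorphic_deriv) (auto intro: holomorphic_on_subset)
  then have "isCont (deriv (%z. G (z, w0))) z0"
   using r(1) by (intro continuous_on_interior[of "ball z0 (2 * r)"] holomorphic_on_imp_continuous_on) auto
  then obtain d' where d': "d' > 0" "!!z. dist z z0 < d' ==> dist (d1 G (z, w0)) (d1 G (z0, w0)) < e / 2"
   using e unfolding continuous_at_eps_delta d1_def by (metis fst_conv half_gt_zero snd_conv)
  show "\<forall>\<^sub>F y in at x. dist (d1 G y) (d1 G x) < e"
   unfolding eventually_at
  proof (intro exI conjI ballI impI)
   show "0 < min (min r d') (min d (2 * r))" using r d d' by simp
   fix y assume "y ~= x & dist y x < min (min r d') (min d (2 * r))"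
   moreover obtain z w where y: "y = (z, w)" by force
   ultimately have "dist z z0 < min r d'" "dist w w0 < min d (2 * r)"
    using dist_fst_le[of y x] dist_snd_le[of y x] by (auto simp: x y)
   then have "cmod (d1 G (z, w) - d1 G (z, w0)) <= e / 4" "dist (d1 G (z, w0)) (d1 G (z0, w0)) < e / 2"
    using est[of z w] d'(2)[of z] by (auto simp: dist_commute)
   then show "dist (d1 G y) (d1 G x) < e"
    using e dist_triangle[of "d1 G (z, w)" "d1 G (z0, w0)" "d1 G (z, w0)"] by (simp add: x y dist_norm)
  qed
 qed
 then show "isCont (d1 G) x" by (simp add: continuous_at)
qed

lemma hol2_d2_continuous_on:
 assumes G: "hol2 G U" shows "continuous_on U (d2 G)"
proof -
 have "continuous_on U (%x. d1 (%(w, z). G (z, w)) (prod.swap x))"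
  by (rule continuous_on_compose2[OF hol2_d1_continuous_on[OF hol2_swap[OF G]]])
   (auto simp: prod.swap_def intro!: continuous_intros)
 then show ?thesis by (rule continuous_on_eq) (auto simp: d1_def d2_def)
qed

text \<open>In the second variable the derivative is a locally uniform limit of the difference
  quotients \<open>q n\<close> in the first variable, each of which is holomorphic there.\<close>

lemma hol2_d1_hol2:
 assumes G: "hol2 G U" shows "hol2 (d1 G) U"
proof -
 have "(%z. d1 G (z, w0)) field_differentiable (at z0)" "(%w. d1 G (z0, w)) field_differentiable (at w0)"
  if zw: "(z0, w0) : U" for z0 w0
 proof -
  obtain r where r: "r > 0" "cball z0 (2 * r) \<times> cball w0 (2 * r) <= U"
   using open_box[OF hol2_open[OF G] zw] by blast
  have "(%z. G (z, w0)) holomorphic_on ball z0 (2 * r)"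
  proof (rule holomorphic_onI)
   fix z assume "z : ball z0 (2 * r)"
   then have "(z, w0) : U" using r by auto
   from hol2_d1[OF G this] show "(%z. G (z, w0)) field_differentiable at z within ball z0 (2 * r)"
    by (meson field_differentiable_def has_field_derivative_at_within)
  qed
  then have "deriv (%z. G (z, w0)) holomorphic_on ball z0 (2 * r)"
   by (rule holomorphic_deriv) simp
  then show "(%z. d1 G (z, w0)) field_differentiable (at z0)"
   unfolding d1_def fst_conv snd_conv
   by (rule holomorphic_on_imp_differentiable_at) (use r in auto)
  define K where "K = cball z0 (2 * r) \<times> cball w0 (2 * r)"
  have uc: "uniformly_continuous_on K (d1 G)"
   unfolding K_def by (intro compact_uniformly_continuous compact_Times compact_cball
     continuous_on_subset[OF hol2_d1_continuous_on[OF G] r(2)])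
  define h where "h n = complex_of_real (r / (real n + 1))" for n
  have hn: "cmod (h n) = r / (real n + 1)" for n
   using r(1) unfolding h_def norm_of_real by simp
  have h: "h n ~= 0" "cmod (h n) <= r" for n
  proof -
   have "0 < cmod (h n)" unfolding hn using r(1) by simp
   then show "h n ~= 0" by simp
   have "r / (real n + 1) <= r / 1" using r(1) by (intro divide_left_mono) auto
   then show "cmod (h n) <= r" unfolding hn by simp
  qed
  define q where "q n w = (G (z0 + h n, w) - G (z0, w)) / h n" for n w
  have "(%w. d1 G (z0, w)) holomorphic_on ball w0 (2 * r)"
  proof (rule holomorphic_uniform_sequence[where f = q])
   show "q n holomorphic_on ball w0 (2 * r)" for n
   proof (rule holomorphic_onI)
    fix w assume w: "w : ball w0 (2 * r)"
    have in_U: "(z0 + h n, w) : U" "(z0, w) : U"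
     using r w h(2)[of n] by (auto simp: subset_iff dist_norm)
    have "(q n has_field_derivative (d2 G (z0 + h n, w) - d2 G (z0, w)) / h n) (at w)"
     unfolding q_def[abs_def] by (intro DERIV_cdivide DERIV_diff hol2_d2[OF G] in_U)
    then show "q n field_differentiable at w within ball w0 (2 * r)"
     by (meson field_differentiable_def has_field_derivative_at_within)
   qed
   fix w1 assume "w1 : ball w0 (2 * r)"
   then obtain s where s: "s > 0" "cball w1 s <= ball w0 (2 * r)" using open_contains_cball open_ball by blast
   have "uniform_limit (cball w1 s) q (%w. d1 G (z0, w)) sequentially"
   proof (rule uniform_limitI)
    fix e :: real assume e: "e > 0"
    obtain d where d: "d > 0" "!!x y. x : K ==> y : K ==> dist y x < d ==> dist (d1 G y) (d1 G x) < e / 2"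
     using uc e unfolding uniformly_continuous_on_def by (metis half_gt_zero)
    have "(%n. cmod (h n)) \<longlonglongrightarrow> 0"
    proof -
     have "(%n. r / real (n + 1)) \<longlonglongrightarrow> 0"
      using LIMSEQ_ignore_initial_segment[OF lim_const_over_n[of r], of 1] by simp
     then show ?thesis by (simp add: hn add.commute)
    qed
    then have "\<forall>\<^sub>F n in sequentially. cmod (h n) < d" using d(1) by (rule order_tendstoD)
    then show "\<forall>\<^sub>F n in sequentially. ALL w:cball w1 s. dist (q n w) (d1 G (z0, w)) < e"
    proof (rule eventually_mono, intro ballI)
     fix n w assume n: "cmod (h n) < d" and "w : cball w1 s"
     then have w: "w : cball w0 (2 * r)" using s by auto
     define B where "B = ball z0 (min d (2 * r))"
     have "cmod ((G (z0 + h n, w) - (z0 + h n) * d1 G (z0, w)) - (G (z0, w) - z0 * d1 G (z0, w))) <= (e / 2) * cmod (z0 + h n - z0)"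
     proof (rule field_differentiable_bound[of "B" "%z. G (z, w) - z * d1 G (z0, w)" "%z. d1 G (z, w) - d1 G (z0, w)"])
      show "convex B" by (simp add: B_def)
      fix z assume z: "z : B"
      have "(z, w) : U" using z w r by (auto simp: B_def subset_iff)
      then show "((%z. G (z, w) - z * d1 G (z0, w)) has_field_derivative d1 G (z, w) - d1 G (z0, w)) (at z within B)"
       by (intro has_field_derivative_at_within[OF DERIV_diff] hol2_d1[OF G] DERIV_cmult_right DERIV_ident)
        (auto intro!: derivative_eq_intros)
      have "dist (d1 G (z, w)) (d1 G (z0, w)) < e / 2"
       by (rule d(2)) (use z w r in "auto simp: B_def K_def dist_Pair_Pair dist_commute")
      then show "cmod (d1 G (z, w) - d1 G (z0, w)) <= e / 2" by (simp add: dist_norm)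
     next
      show "z0 + h n : B" using n h(2)[of n] r(1) by (auto simp: B_def dist_norm)
      show "z0 : B" using d(1) r(1) by (simp add: B_def)
     qed
     then have "cmod (h n * (q n w - d1 G (z0, w))) <= (e / 2) * cmod (h n)"
     proof -
      have "h n * q n w = G (z0 + h n, w) - G (z0, w)" using h(1)[of n] by (simp add: q_def)
      then have "h n * (q n w - d1 G (z0, w)) = (G (z0 + h n, w) - (z0 + h n) * d1 G (z0, w)) - (G (z0, w) - z0 * d1 G (z0, w))"
       by (simp only: right_diff_distrib) (simp add: algebra_simps)
      then show ?thesis using \<open>cmod ((G (z0 + h n, w) - _) - _) <= _\<close> by simp
     qed
     then have "cmod (q n w - d1 G (z0, w)) <= e / 2"
      using h(1)[of n] by (simp add: norm_mult mult.commute)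
     then show "dist (q n w) (d1 G (z0, w)) < e" using e by (simp add: dist_norm)
    qed
   qed
   then show "EX d>0. cball w1 d <= ball w0 (2 * r) & uniform_limit (cball w1 d) q (%w. d1 G (z0, w)) sequentially"
    using s by blast
  qed simp
  then show "(%w. d1 G (z0, w)) field_differentiable (at w0)"
   by (rule holomorphic_on_imp_differentiable_at) (use r in auto)
 qed
 then show ?thesis
  using hol2_open[OF G] hol2_d1_continuous_on[OF G] by (auto simp: hol2_def)
qed

lemma hol2_d2_hol2:
 assumes G: "hol2 G U" shows "hol2 (d2 G) U"
proof -
 have "hol2 (%(w, z). d1 (%(w, z). G (z, w)) (z, w)) (prod.swap ` prod.swap ` U)"
  by (rule hol2_swap[OF hol2_d1_hol2[OF hol2_swap[OF G]]])
 moreover have "(%(w, z). d1 (%(w, z). G (z, w)) (z, w)) = d2 G"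
  by (auto simp: d1_def d2_def fun_eq_iff)
 moreover have "prod.swap ` prod.swap ` U = U" by (simp add: image_image)
 ultimately show ?thesis by simp
qed

text \<open>Partial derivatives, one of them continuous, give the total derivative; continuity comes
  from \<open>hol2_d2_continuous_on\<close>.\<close>

lemma hol2_has_derivative:
 assumes G: "hol2 G U" and x: "x : U"
 shows "(G has_derivative (%h. d1 G x * fst h + d2 G x * snd h)) (at x)"
proof -
 obtain z0 w0 where x0: "x = (z0, w0)" by force
 obtain r where r: "r > 0" "cball z0 (2 * r) \<times> cball w0 (2 * r) <= U"
  using open_box[OF hol2_open[OF G]] x x0 by blast
 define X Y where "X = ball z0 (2 * r)" and "Y = ball w0 (2 * r)"
 have XY: "X \<times> Y <= U" using r by (auto simp: X_def Y_def)
 have cont: "continuous (at (z0, w0) within X \<times> Y) (%(x, y). blinfun_mult_right (d2 G (x, y)))"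
 proof -
  have "continuous_on U (%p. blinfun_mult_right (d2 G p))"
   by (intro continuous_intros hol2_d2_continuous_on[OF G])
  then have "isCont (%p. blinfun_mult_right (d2 G p)) (z0, w0)"
   using x x0 hol2_open[OF G] by (simp add: continuous_on_eq_continuous_at)
  then show ?thesis by (simp add: case_prod_beta' continuous_at_imp_continuous_at_within)
 qed
 have "((%(x, y). G (x, y)) has_derivative (%(tx, ty). d1 G (z0, w0) * tx + blinfun_apply (blinfun_mult_right (d2 G (z0, w0))) ty)) (at (z0, w0) within X \<times> Y)"
 proof (rule has_derivative_partialsI[where fx = "%tx. d1 G (z0, w0) * tx" and fy = "%x y. blinfun_mult_right (d2 G (x, y))"])
  show "((%x. G (x, w0)) has_derivative (*) (d1 G (z0, w0))) (at z0 within X)"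
   using hol2_d1[OF G, of z0 w0] x x0 by (auto simp: has_field_derivative_def intro: has_derivative_at_withinI)
  show "((%y. G (x, y)) has_derivative blinfun_apply (blinfun_mult_right (d2 G (x, y)))) (at y within Y)"
   if "x : X" "y : Y" for x y
  proof -
   have "(x, y) : U" using that XY by auto
   from hol2_d2[OF G this] show ?thesis
    unfolding has_field_derivative_def blinfun_mult_right.rep_eq by (rule has_derivative_at_withinI)
  qed
  show "w0 : Y" "convex Y" using r(1) by (auto simp: Y_def)
 qed (rule cont)
 moreover have "open (X \<times> Y)" "(z0, w0) : X \<times> Y" using r(1) by (auto simp: X_def Y_def open_Times)
 ultimately have "((%(x, y). G (x, y)) has_derivative (%(tx, ty). d1 G (z0, w0) * tx + d2 G (z0, w0) * ty)) (at (z0, w0))"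
  unfolding blinfun_mult_right.rep_eq by (simp only: at_within_open)
 then show ?thesis by (simp add: x0 case_prod_beta')
qed

lemma holomorphic2_imp_hol2:
 assumes "holomorphic2_on G U" "open U" shows "hol2 G U"
proof -
 have "isCont G x & (%z. G (z, snd x)) field_differentiable (at (fst x)) & (%w. G (fst x, w)) field_differentiable (at (snd x))"
  if xU: "x : U" for x
 proof -
  obtain D where D: "(G has_derivative D) (at x)" and "ALL a b k. D (k * a, k * b) = k * D (a, b)"
   using bspec[OF assms(1)[unfolded holomorphic2_on_def] xU] by (elim exE conjE)
  then have lin: "D (k * a, k * b) = k * D (a, b)" for a b k by simp
  obtain z w where x: "x = (z, w)" by force
  have a: "((%z. (z, w)) has_derivative (%h. (h, 0))) (at z)" "((%w. (z, w)) has_derivative (%h. (0, h))) (at w)"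
   by (auto intro!: derivative_eq_intros)
  have "((%z. G (z, w)) has_derivative (%h. D (h, 0))) (at z)" "((%w. G (z, w)) has_derivative (%h. D (0, h))) (at w)"
   using diff_chain_at[OF a(1), of G D] diff_chain_at[OF a(2), of G D] D by (simp_all add: o_def x)
  moreover have "(%h. D (h, 0)) = (*) (D (1, 0))" "(%h. D (0, h)) = (*) (D (0, 1))"
  proof -
   have e: "D (h, 0) = D (1, 0) * h" "D (0, h) = D (0, 1) * h" for h
    using lin[of h 1 0] lin[of h 0 1] by (simp_all only: mult_1_right mult_zero_right mult.commute[of _ h])
   show "(%h. D (h, 0)) = (*) (D (1, 0))" by (rule ext) (rule e(1))
   show "(%h. D (0, h)) = (*) (D (0, 1))" by (rule ext) (rule e(2))
  qed
  ultimately have "((%z. G (z, w)) has_field_derivative D (1, 0)) (at z)" "((%w. G (z, w)) has_field_derivative D (0, 1)) (at w)"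
   by (simp_all only: has_field_derivative_def)
  then show ?thesis
   using has_derivative_continuous[OF D] unfolding x fst_conv snd_conv field_differentiable_def by blast
 qed
 then show ?thesis using assms(2) by (simp add: hol2_def continuous_at_imp_continuous_on)
qed

lemma hol2_imp_holomorphic2: "hol2 G U ==> holomorphic2_on G U"
 unfolding holomorphic2_on_def
proof (intro ballI exI conjI allI)
 fix x assume "hol2 G U" "x : U"
 then show "(G has_derivative (%h. d1 G x * fst h + d2 G x * snd h)) (at x)" by (rule hol2_has_derivative)
qed (simp add: algebra_simps)

text \<open>The real directions (1, 0) and (0, 1) already compute the complex partial derivatives,
  so the symmetry of real second derivatives suffices.\<close>

lemma hol2_commute:
 assumes G: "hol2 G U" and x: "x : U"
 shows "d1 (d2 G) x = d2 (d1 G) x"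
proof -
 have fr: "frechet_derivative H (at y) = (%h. d1 H y * fst h + d2 H y * snd h)" if "hol2 H U" "y : U" for H y
  using frechet_derivative_at[OF hol2_has_derivative[OF that]] by simp
 have C0: "Ck_on 0 U H" if "hol2 H U" for H using hol2_continuous_on[OF that] by simp
 have C: "Ck_on (Suc k) U H" if "hol2 H U" "Ck_on k U (d1 H)" "Ck_on k U (d2 H)" for H k
  by (rule Ck_on_SucI[OF hol2_open[OF that(1)] hol2_has_derivative[OF that(1)]], assumption)
   (intro Ck_on_add Ck_on_mult Ck_on_const hol2_open[OF that(1)] that)
 note h = hol2_d1_hol2[OF G] hol2_d2_hol2[OF G]
 have "Ck_on (Suc (Suc 0)) U G"
  by (intro C G C0 h hol2_d1_hol2 hol2_d2_hol2)
 then have "Ck_on 2 U G" by (simp add: numeral_2_eq_2)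
 from frechet_derivative_commute[OF hol2_open[OF G] x this, of "(0, 1)" "(1, 0)"]
 have "frechet_derivative (%y. frechet_derivative G (at y) (0, 1)) (at x) (1, 0) = frechet_derivative (%y. frechet_derivative G (at y) (1, 0)) (at x) (0, 1)" .
 moreover have "frechet_derivative (%y. frechet_derivative G (at y) (0, 1)) (at x) = frechet_derivative (d2 G) (at x)"
  by (rule frechet_derivative_cong_open[OF hol2_open[OF G] x]) (simp add: fr[OF G])
 moreover have "frechet_derivative (%y. frechet_derivative G (at y) (1, 0)) (at x) = frechet_derivative (d1 G) (at x)"
  by (rule frechet_derivative_cong_open[OF hol2_open[OF G] x]) (simp add: fr[OF G])
 ultimately show ?thesis using fr[OF h(1) x] fr[OF h(2) x] by simp
qed

text \<open>Enlarging \<open>N\<close> by \<open>e / (2 * r)\<close> raises the bound by exactly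
  \<open>e\<close>; letting \<open>e\<close> tend to 0 admits the case of a vanishing Laplacian
  bound.\<close>

lemma gradient_estimate':
 assumes "open U" "smooth_on U f" "r > 0" "cball z r <= U"
  and "!!y. y : cball z r ==> cmod (f y) <= M" "!!y. y : cball z r ==> cmod (lap f y) <= N"
 shows "cmod (dz f z) <= 4 * M / r + 2 * N * r" "cmod (dzbar f z) <= 4 * M / r + 2 * N * r"
proof -
 have N: "0 <= N" using order.trans[OF norm_ge_zero assms(6)[of z]] assms(3) by simp
 have *: "cmod (dz f z) <= 4 * M / r + 2 * (N + e / (2 * r)) * r & cmod (dzbar f z) <= 4 * M / r + 2 * (N + e / (2 * r)) * r"
  if "e > 0" for e
 proof -
  have "0 < e / (2 * r)" using that assms(3) by simp
  then show ?thesis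
   using gradient_estimate[OF assms(1-5), of "N + e / (2 * r)"] assms(6) N by force
 qed
 have "2 * (N + e / (2 * r)) * r = 2 * N * r + e" for e using assms(3) by (simp add: field_simps)
 with * have **: "cmod (dz f z) <= 4 * M / r + 2 * N * r + e" "cmod (dzbar f z) <= 4 * M / r + 2 * N * r + e" if "e > 0" for e
  using that by (simp_all add: add.assoc)
 show "cmod (dz f z) <= 4 * M / r + 2 * N * r" "cmod (dzbar f z) <= 4 * M / r + 2 * N * r"
  using **(1) **(2) by (auto intro: field_le_epsilon)
qed

text \<open>The mean value inequality for \<open>f - L\<close>. Since \<open>x\<close> and
  \<open>y\<close> are arbitrary points of the convex set, the resulting linear approximations are
  uniform in the base point.\<close>

lemma increment_bound:
 fixes f :: "'a::real_normed_vector => 'b::real_normed_vector"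
 assumes "convex S" "!!x. x : S ==> (f has_derivative f' x) (at x)" "bounded_linear L"
  and "!!x h. x : S ==> norm (f' x h - L h) <= eps * norm h" "x : S" "y : S" "0 <= eps"
 shows "norm (f y - f x - L (y - x)) <= eps * norm (y - x)"
proof -
 interpret L: bounded_linear L by fact
 have "norm ((f y - L y) - (f x - L x)) <= eps * norm (y - x)"
 proof (rule differentiable_bound[OF assms(1)])
  fix u assume u: "u : S"
  show "((%x. f x - L x) has_derivative (%h. f' u h - L h)) (at u within S)"
   by (rule has_derivative_at_withinI[OF has_derivative_diff[OF assms(2)[OF u] bounded_linear_imp_has_derivative[OF assms(3)]]])
  show "onorm (%h. f' u h - L h) <= eps" by (rule onorm_bound[OF assms(7) assms(4)[OF u]])
 qed (use assms in auto)
 moreover have "(f y - L y) - (f x - L x) = f y - f x - L (y - x)" by (simp add: L.diff)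
 ultimately show ?thesis by simp
qed

lemma isCont_of_uniform_limit:
 fixes H :: "'w::metric_space => 'z::metric_space => 'b::metric_space"
 assumes "rho > 0" "uniform_limit (cball z0 rho) H (H w0) (nhds w0)" "isCont (H w0) z0"
 shows "isCont (%x. H (snd x) (fst x)) (z0, w0)"
 unfolding continuous_at
proof (rule tendstoI)
 fix e :: real assume e: "e > 0"
 have "\<forall>\<^sub>F w in nhds w0. ALL z:cball z0 rho. dist (H w z) (H w0 z) < e / 2"
  using assms(2) e unfolding uniform_limit_iff by (meson half_gt_zero)
 then obtain d1 where d1: "d1 > 0" "!!w z. dist w w0 < d1 ==> z : cball z0 rho ==> dist (H w z) (H w0 z) < e / 2"
  unfolding eventually_nhds_metric by blast
 obtain d2 where d2: "d2 > 0" "!!z. dist z z0 < d2 ==> dist (H w0 z) (H w0 z0) < e / 2"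
  using assms(3) e unfolding continuous_at_eps_delta by (meson half_gt_zero)
 show "\<forall>\<^sub>F x in at (z0, w0). dist (H (snd x) (fst x)) (H (snd (z0, w0)) (fst (z0, w0))) < e"
  unfolding eventually_at
 proof (intro exI conjI ballI impI)
  show "0 < min d1 (min d2 rho)" using d1 d2 assms(1) by simp
  fix x assume "x ~= (z0, w0) & dist x (z0, w0) < min d1 (min d2 rho)"
  then have "dist (fst x) z0 < min d2 rho" "dist (snd x) w0 < d1"
   using dist_fst_le[of x "(z0, w0)"] dist_snd_le[of x "(z0, w0)"] by auto
  then have "dist (H (snd x) (fst x)) (H w0 (fst x)) < e / 2" "dist (H w0 (fst x)) (H w0 z0) < e / 2"
   using d1(2)[of "snd x" "fst x"] d2(2)[of "fst x"] by (auto simp: dist_commute)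
  then show "dist (H (snd x) (fst x)) (H (snd (z0, w0)) (fst (z0, w0))) < e"
   using dist_triangle[of "H (snd x) (fst x)" "H w0 z0" "H w0 (fst x)"] by simp
 qed
qed

text \<open>The tube lemma: finitely many boxes around points of the compact slice cover it, and
  their smallest height in the direction of \<open>w\<close> serves all points at once.\<close>

lemma uniform_limit_of_continuous_on:
 fixes H :: "'z::metric_space \<times> 'w::metric_space => 'b::metric_space"
 assumes "open U" "continuous_on U H" "compact K" "K \<times> {w0} <= U"
 shows "\<forall>\<^sub>F w in nhds w0. ALL z:K. (z, w) : U"
  "uniform_limit K (%w z. H (z, w)) (%z. H (z, w0)) (nhds w0)"
proof -
 have *: "\<forall>\<^sub>F w in nhds w0. ALL z:K. (z, w) : U & dist (H (z, w)) (H (z, w0)) < e" if e: "e > 0" for e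
 proof -
  have "EX dl>0. ALL y:ball z dl. ALL w:ball w0 dl. (y, w) : U & dist (H (y, w)) (H (z, w0)) < e / 2" if "z : K" for z
  proof -
   have zU: "(z, w0) : U" using that assms(4) by auto
   obtain d1 where d1: "d1 > 0" "ball (z, w0) d1 <= U" using assms(1) zU openE by blast
   obtain d2 where d2: "d2 > 0" "!!x. x : U ==> dist x (z, w0) < d2 ==> dist (H x) (H (z, w0)) < e / 2"
    using assms(2) zU e unfolding continuous_on_iff by (metis half_gt_zero)
   show ?thesis
   proof (intro exI conjI ballI)
    show "0 < min d1 d2 / 2" using d1 d2 by simp
    fix y w assume yw: "y : ball z (min d1 d2 / 2)" "w : ball w0 (min d1 d2 / 2)"
    have "dist (z, w0) (y, w) < min d1 d2"
     using yw sqrt_sum_squares_le_sum[of "dist z y" "dist w0 w"] by (simp add: dist_Pair_Pair)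
    then show "(y, w) : U" using d1 by auto
    then show "dist (H (y, w)) (H (z, w0)) < e / 2" using d2(2) \<open>dist (z, w0) (y, w) < min d1 d2\<close>
     by (simp add: dist_commute)
   qed
  qed
  then obtain dl where dl: "!!z. z : K ==> dl z > 0"
   "!!z y w. z : K ==> y : ball z (dl z) ==> w : ball w0 (dl z) ==> (y, w) : U & dist (H (y, w)) (H (z, w0)) < e / 2"
   by metis
  obtain C where C: "C <= K" "finite C" "K <= (\<Union>c\<in>C. ball c (dl c))"
   using compactE_image[OF assms(3), of K "%c. ball c (dl c)"] dl(1) by (metis (no_types, lifting) UN_iff centre_in_ball open_ball subsetI)
  have "\<forall>\<^sub>F w in nhds w0. ALL c:C. w : ball w0 (dl c)"
   using C dl(1) by (intro eventually_ball_finite ballI) (auto simp: eventually_nhds_metric dist_commute)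
  then show ?thesis
  proof (rule eventually_mono, intro ballI)
   fix w z assume w: "ALL c:C. w : ball w0 (dl c)" and "z : K"
   then obtain c where c: "c : C" "z : ball c (dl c)" using C(3) by auto
   then have cK: "c : K" using C(1) by auto
   have "w0 : ball w0 (dl c)" using dl(1)[OF cK] by simp
   then show "(z, w) : U & dist (H (z, w)) (H (z, w0)) < e"
    using dl(2)[OF cK c(2), of w] dl(2)[OF cK c(2), of w0] w c(1)
     dist_triangle[of "H (z, w)" "H (z, w0)" "H (c, w0)"] by (auto simp: dist_commute)
  qed
 qed
 show "\<forall>\<^sub>F w in nhds w0. ALL z:K. (z, w) : U"
  using *[of 1] by (auto elim: eventually_mono)
 show "uniform_limit K (%w z. H (z, w)) (%z. H (z, w0)) (nhds w0)"
  unfolding uniform_limit_iff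
 proof (intro allI impI)
  fix e :: real assume "e > 0"
  from *[OF this] show "\<forall>\<^sub>F w in nhds w0. ALL z:K. dist (H (z, w)) (H (z, w0)) < e"
   by (rule eventually_mono) blast
 qed
qed

text \<open>Twice the logarithm of the modulus is the logarithm of the inner product of
  \<open>f\<close> with itself, which is differentiable away from the zeros of
  \<open>f\<close>.\<close>

lemma has_derivative_ln_cmod:
 assumes "(f has_field_derivative f') (at x)" "f x ~= 0"
 shows "((%x. 2 * ln (cmod (f x))) has_derivative (%h. 2 * Re (f' / f x * h))) (at x)"
proof -
 have f: "(f has_derivative (%h. f' * h)) (at x)"
  using assms(1) by (simp add: has_field_derivative_def)
 have "((%x. ln (f x \<bullet> f x)) has_derivative (%h. (f x \<bullet> (f' * h) + (f' * h) \<bullet> f x) * inverse (f x \<bullet> f x))) (at x)"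
  by (rule has_derivative_ln[OF _ has_derivative_inner[OF f f]]) (use assms(2) in simp)
 moreover have "ln (f y \<bullet> f y) = 2 * ln (cmod (f y))" for y
  by (cases "f y = 0") (simp_all add: power2_norm_eq_inner[symmetric] ln_realpow)
 moreover have "(f x \<bullet> (f' * h) + (f' * h) \<bullet> f x) * inverse (f x \<bullet> f x) = 2 * Re (f' / f x * h)" for h
 proof -
  have "f' / f x * h = (f' * h) * cnj (f x) / of_real ((cmod (f x))\<^sup>2)"
   using assms(2) by (simp only: complex_norm_square) (simp add: field_simps)
  then have "Re (f' / f x * h) = Re ((f' * h) * cnj (f x)) / (cmod (f x))\<^sup>2"
   by (simp only: Re_divide_of_real)
  moreover have "f x \<bullet> (f' * h) + (f' * h) \<bullet> f x = 2 * Re ((f' * h) * cnj (f x))"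
   by (simp add: inner_complex_def algebra_simps)
  moreover have "f x \<bullet> f x = (cmod (f x))\<^sup>2" by (simp only: power2_norm_eq_inner)
  ultimately show ?thesis by (simp only: divide_inverse mult.assoc)
 qed
 ultimately show ?thesis by simp
qed

section \<open>Families of hyperbolic metrics in charts\<close>

lemma continuous_on_box:
 fixes H :: "'z::metric_space \<times> 'w::metric_space => 'b::metric_space"
 assumes "open U" "continuous_on U H" "(z, w0) : U" "e > 0"
 obtains dl where "dl > 0"
  "!!y w. dist y z < dl ==> dist w w0 < dl ==> (y, w) : U & dist (H (y, w)) (H (z, w0)) < e"
proof -
 obtain d1 where d1: "d1 > 0" "ball (z, w0) d1 <= U" using assms(1,3) openE by blast
 obtain d2 where d2: "d2 > 0" "!!x. x : U ==> dist x (z, w0) < d2 ==> dist (H x) (H (z, w0)) < e"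
  using assms(2-4) unfolding continuous_on_iff by metis
 show ?thesis
 proof (rule that)
  show "0 < min d1 d2 / 2" using d1 d2 by simp
  fix y w assume yw: "dist y z < min d1 d2 / 2" "dist w w0 < min d1 d2 / 2"
  have d: "dist (y, w) (z, w0) < min d1 d2"
   using yw sqrt_sum_squares_le_sum[of "dist y z" "dist w w0"] by (simp add: dist_Pair_Pair)
  then have "(y, w) : U" using d1 by (auto simp: dist_commute)
  then show "(y, w) : U & dist (H (y, w)) (H (z, w0)) < e" using d2(2) d by simp
 qed
qed

lemma wirt_ln_cmod:
 assumes "(f has_field_derivative f') (at z)" "f z ~= 0"
 shows "wirt (%z. of_real (2 * ln (cmod (f z)))) (f' / f z) (cnj (f' / f z)) z"
proof -
 have "((%z. complex_of_real (2 * ln (cmod (f z)))) has_derivative (%h. of_real (2 * Re (f' / f z * h)))) (at z)"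
  by (rule has_derivative_of_real[OF has_derivative_ln_cmod[OF assms]])
 moreover have "complex_of_real (2 * Re x) = x + cnj x" for x by (simp add: complex_add_cnj)
 ultimately show ?thesis unfolding wirt_def by (simp only: complex_cnj_mult)
qed

lemma finite_compact_bound:
 fixes h :: "'i => 'a::topological_space => 'b::real_normed_vector"
 assumes "finite F" "!!i. i : F ==> compact (K i)" "!!i. i : F ==> continuous_on (K i) (h i)"
 shows "EX C>=0. ALL i:F. ALL y:K i. norm (h i y) <= C"
proof -
 have "EX C. ALL y:K i. norm (h i y) <= C" if "i : F" for i
  using compact_imp_bounded[OF compact_continuous_image[OF assms(3)[OF that] assms(2)[OF that]]]
  by (auto simp: bounded_iff)
 then obtain C where C: "!!i y. i : F ==> y : K i ==> norm (h i y) <= C i" by metis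
 show ?thesis
 proof (intro exI conjI ballI)
  show "(\<Sum>i\<in>F. \<bar>C i\<bar>) >= 0" by (simp add: sum_nonneg)
  fix i y assume iy: "i : F" "y : K i"
  have "\<bar>C i\<bar> <= (\<Sum>i\<in>F. \<bar>C i\<bar>)" using assms(1) iy(1) by (intro member_le_sum) auto
  then show "norm (h i y) <= (\<Sum>i\<in>F. \<bar>C i\<bar>)" using C[OF iy] by simp
 qed
qed

text \<open>The family over a coordinate domain \<open>W\<close>, reduced to functions of
  coordinates: \<open>Om d\<close> is the image of a chart, \<open>tr d e\<close> the change of the
  fibre coordinate, \<open>ph\<close> the logarithm of the metric, \<open>a\<close> the lift. All
  conditions on \<open>ph\<close> and \<open>a\<close> concern one value of \<open>w\<close> at a
  time, so nothing is presupposed about their dependence on \<open>w\<close>. \<open>cover\<close>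
  is the compactness of the fibre, stated for an arbitrary radius function \<open>R\<close>.\<close>

locale hyperbolic_charts =
 fixes D :: "'d set" and Om :: "'d => (complex \<times> complex) set"
  and ov :: "'d => 'd => (complex \<times> complex) set"
  and tr :: "'d => 'd => complex \<times> complex => complex"
  and ph :: "'d => complex => complex => real"
  and a :: "'d => complex => complex => complex"
  and W :: "complex set"
 assumes open_Om: "d : D ==> open (Om d)"
  and open_W: "open W"
  and Om_W: "d : D ==> (z, w) : Om d ==> w : W"
  and tr_hol2: "d : D ==> e : D ==> hol2 (tr d e) (ov d e)"
  and ov_Om: "d : D ==> e : D ==> (z, w) : ov d e ==> (z, w) : Om d"
  and tr_Om: "d : D ==> e : D ==> (z, w) : ov d e ==> (tr d e (z, w), w) : Om e"
  and tr_d1: "d : D ==> e : D ==> (z, w) : ov d e ==> d1 (tr d e) (z, w) ~= 0"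
  and ph_smooth: "d : D ==> smooth_on {z. (z, w) : Om d} (%z. complex_of_real (ph d w z))"
  and ph_lap: "d : D ==> (z, w) : Om d ==>
   lap (%z. complex_of_real (ph d w z)) z = of_real (exp (ph d w z))"
  and ph_tr: "d : D ==> e : D ==> (z, w) : ov d e ==>
   ph d w z = ph e w (tr d e (z, w)) + 2 * ln (cmod (d1 (tr d e) (z, w)))"
  and a_smooth: "d : D ==> smooth_on {z. (z, w) : Om d} (a d w)"
  and a_tr: "d : D ==> e : D ==> (z, w) : ov d e ==>
   a e w (tr d e (z, w)) = d1 (tr d e) (z, w) * a d w z + d2 (tr d e) (z, w)"
  and harmonic: "d : D ==> (z, w) : Om d ==>
   dzbar (%y. (dz (dzbar (a d w)) y + dz (%z. complex_of_real (ph d w z)) y * dzbar (a d w) y)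
    / of_real (exp (ph d w y))) z = 0"
  and cover: "w : W ==> (!!d z. d : D ==> (z, w) : Om d ==> 0 < R d z) ==>
   EX F. finite F & (ALL i:F. fst i : D & (snd i, w) : Om (fst i)) &
    (ALL d:D. ALL z. (z, w) : Om d -->
     (EX i:F. (z, w) : ov d (fst i) & dist (tr d (fst i) (z, w)) (snd i) < R (fst i) (snd i)))"
begin

definition sl :: "'d => complex => complex set" where "sl d w = {z. (z, w) : Om d}"
definition P :: "'d => complex => complex => complex" where "P d w = (%z. of_real (ph d w z))"
definition G :: "'d => complex => complex => complex" where "G d w = (%z. of_real (exp (ph d w z)))"
definition Pz :: "'d => complex => complex => complex" where "Pz d w = dz (P d w)"
definition A :: "'d => complex => complex => complex" where "A d w = dzbar (a d w)"
text \<open>Minus the divergence of the lift. The identity \<open>ph_w = psi\<close>, to be proved,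
  says that the area density is constant to first order along
  \<open>\<partial>/\<partial>w + a \<partial>/\<partial>z\<close>.\<close>

definition psi :: "'d => complex => complex => complex" where
 "psi d w = (%z. - (dz (a d w) z + Pz d w z * a d w z))"

lemma open_sl: "d : D ==> open (sl d w)"
proof -
 assume "d : D"
 then have "open ((%z. (z, w)) -` Om d)" by (intro open_vimage open_Om) (auto intro!: continuous_intros)
 then show ?thesis by (simp add: sl_def vimage_def)
qed

lemma sm_P: "d : D ==> smooth_on (sl d w) (P d w)"
 using ph_smooth by (simp add: sl_def P_def)

lemma sm_Pz: "d : D ==> smooth_on (sl d w) (Pz d w)"
 unfolding Pz_def by (intro smo_dz open_sl sm_P)

lemma sm_a: "d : D ==> smooth_on (sl d w) (a d w)"
 using a_smooth by (simp add: sl_def)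

lemma sm_A: "d : D ==> smooth_on (sl d w) (A d w)"
 unfolding A_def by (intro smo_dzbar open_sl sm_a)

lemma lap_P: "d : D ==> z : sl d w ==> lap (P d w) z = G d w z"
 using ph_lap by (simp add: sl_def P_def G_def)

text \<open>Smoothness of the exponential comes for free from the metric equation, as
  \<open>G\<close> is the Laplacian of \<open>P\<close>.\<close>

lemma sm_G: "d : D ==> smooth_on (sl d w) (G d w)"
 by (rule smooth_on_cong[OF open_sl lap_P]) (auto intro!: smo_dz smo_dzbar open_sl sm_P)

lemma sm_psi: "d : D ==> smooth_on (sl d w) (psi d w)"
 unfolding psi_def by (intro smo_minus smo_add smo_mult smo_dz open_sl sm_Pz sm_a)

lemma G_nz: "G d w z ~= 0" by (simp add: G_def)

lemma dzbar_P: "d : D ==> z : sl d w ==> dzbar (P d w) z = cnj (Pz d w z)"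
 using wirt_D(2)[OF wirt_cnj[OF wirt_smooth[OF sm_P]], of d z w] by (simp add: P_def Pz_def)

lemma wirt_P: "d : D ==> z : sl d w ==> wirt (P d w) (Pz d w z) (cnj (Pz d w z)) z"
 using wirt_smooth[OF sm_P, of d z w] by (simp add: dzbar_P) (simp add: Pz_def)

lemma wirt_Pz: "d : D ==> z : sl d w ==> wirt (Pz d w) (dz (Pz d w) z) (G d w z) z"
 using wirt_smooth[OF sm_Pz, of d z w] dzbar_dz_commute[OF open_sl sm_P, of d z w] lap_P[of d z w]
 by (simp add: Pz_def)

lemma wirt_G: "d : D ==> z : sl d w ==> wirt (G d w) (G d w z * Pz d w z) (G d w z * cnj (Pz d w z)) z"
 using wirt_exp[OF wirt_P, of d z w] by (simp add: G_def P_def exp_of_real)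

lemma wirt_a: "d : D ==> z : sl d w ==> wirt (a d w) (dz (a d w) z) (A d w z) z"
 using wirt_smooth[OF sm_a, of d z w] by (simp add: A_def)

section \<open>Transformation rules under a change of adapted coordinates\<close>

definition ovs :: "'d => 'd => complex => complex set" where "ovs d e w = {z. (z, w) : ov d e}"

lemma open_ovs: "d : D ==> e : D ==> open (ovs d e w)"
proof -
 assume "d : D" "e : D"
 then have "open ((%z. (z, w)) -` ov d e)"
  by (intro open_vimage hol2_open[OF tr_hol2]) (auto intro!: continuous_intros)
 then show ?thesis by (simp add: ovs_def vimage_def)
qed

lemma ovs_sl: "d : D ==> e : D ==> z : ovs d e w ==> z : sl d w"
 using ov_Om by (auto simp: ovs_def sl_def)

lemma tr_sl: "d : D ==> e : D ==> z : ovs d e w ==> tr d e (z, w) : sl e w"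
 using tr_Om by (auto simp: ovs_def sl_def)

context
 fixes d e w z
 assumes de: "d : D" "e : D" and z: "z : ovs d e w"
begin

private lemma zov: "(z, w) : ov d e" using z by (simp add: ovs_def)

private lemma der: "((%z. tr d e (z, w)) has_field_derivative d1 (tr d e) (y, w)) (at y)"
 "((%z. d1 (tr d e) (z, w)) has_field_derivative d1 (d1 (tr d e)) (y, w)) (at y)"
 "((%z. d2 (tr d e) (z, w)) has_field_derivative d2 (d1 (tr d e)) (y, w)) (at y)"
 if "y : ovs d e w" for y
proof -
 have y: "(y, w) : ov d e" using that by (simp add: ovs_def)
 note h = tr_hol2[OF de]
 show "((%z. tr d e (z, w)) has_field_derivative d1 (tr d e) (y, w)) (at y)" by (rule hol2_d1[OF h y])
 show "((%z. d1 (tr d e) (z, w)) has_field_derivative d1 (d1 (tr d e)) (y, w)) (at y)" by (rule hol2_d1[OF hol2_d1_hol2[OF h] y])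
 show "((%z. d2 (tr d e) (z, w)) has_field_derivative d2 (d1 (tr d e)) (y, w)) (at y)"
  using hol2_d1[OF hol2_d2_hol2[OF h] y] hol2_commute[OF h y] by simp
qed

lemma Pz_tr: "Pz d w z = Pz e w (tr d e (z, w)) * d1 (tr d e) (z, w) + d1 (d1 (tr d e)) (z, w) / d1 (tr d e) (z, w)"
proof -
 have "wirt (%y. P e w (tr d e (y, w)) + of_real (2 * ln (cmod (d1 (tr d e) (y, w)))))
  (Pz e w (tr d e (z, w)) * d1 (tr d e) (z, w) + d1 (d1 (tr d e)) (z, w) / d1 (tr d e) (z, w))
  (cnj (Pz e w (tr d e (z, w))) * cnj (d1 (tr d e) (z, w)) + cnj (d1 (d1 (tr d e)) (z, w) / d1 (tr d e) (z, w))) z"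
  by (rule wirt_add[OF wirt_pre_compose[of "P e w" _ _ "%y. tr d e (y, w)", OF wirt_P[OF de(2) tr_sl[OF de z]] der(1)[OF z]]
    wirt_ln_cmod[OF der(2)[OF z] tr_d1[OF de zov]]])
 then have "wirt (P d w) (Pz e w (tr d e (z, w)) * d1 (tr d e) (z, w) + d1 (d1 (tr d e)) (z, w) / d1 (tr d e) (z, w))
  (cnj (Pz e w (tr d e (z, w))) * cnj (d1 (tr d e) (z, w)) + cnj (d1 (d1 (tr d e)) (z, w) / d1 (tr d e) (z, w))) z"
  by (rule wirt_cong[OF open_ovs[OF de] z, rotated]) (use ph_tr[OF de] in "simp add: P_def ovs_def")
 then show ?thesis unfolding Pz_def by (rule wirt_D)
qed

lemma G_tr: "G d w z = G e w (tr d e (z, w)) * (d1 (tr d e) (z, w) * cnj (d1 (tr d e) (z, w)))"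
proof -
 have "exp (ph d w z) = exp (ph e w (tr d e (z, w))) * (cmod (d1 (tr d e) (z, w)))\<^sup>2"
  unfolding ph_tr[OF de zov] exp_add exp_double
  using tr_d1[OF de zov] by simp
 then show ?thesis unfolding G_def cmod_sq by (simp only: of_real_mult)
qed

lemma a_tr_dz: "dz (a e w) (tr d e (z, w)) * d1 (tr d e) (z, w) =
  d1 (d1 (tr d e)) (z, w) * a d w z + d1 (tr d e) (z, w) * dz (a d w) z + d2 (d1 (tr d e)) (z, w)"
 and A_tr: "A e w (tr d e (z, w)) * cnj (d1 (tr d e) (z, w)) = d1 (tr d e) (z, w) * A d w z"
proof -
 have 1: "wirt (%y. a e w (tr d e (y, w))) (dz (a e w) (tr d e (z, w)) * d1 (tr d e) (z, w))
  (A e w (tr d e (z, w)) * cnj (d1 (tr d e) (z, w))) z"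
  by (rule wirt_pre_compose[of "a e w" _ _ "%y. tr d e (y, w)", OF wirt_a[OF de(2) tr_sl[OF de z]] der(1)[OF z]])
 have "wirt (%y. d1 (tr d e) (y, w) * a d w y + d2 (tr d e) (y, w))
  ((d1 (tr d e) (z, w) * dz (a d w) z + d1 (d1 (tr d e)) (z, w) * a d w z) + d2 (d1 (tr d e)) (z, w))
  ((d1 (tr d e) (z, w) * A d w z + 0 * a d w z) + 0) z"
  by (rule wirt_add[OF wirt_mult[OF wirt_holomorphic[OF der(2)[OF z]] wirt_a[OF de(1) ovs_sl[OF de z]]] wirt_holomorphic[OF der(3)[OF z]]])
 then have 2: "wirt (%y. a e w (tr d e (y, w)))
  ((d1 (tr d e) (z, w) * dz (a d w) z + d1 (d1 (tr d e)) (z, w) * a d w z) + d2 (d1 (tr d e)) (z, w))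
  ((d1 (tr d e) (z, w) * A d w z + 0 * a d w z) + 0) z"
  by (rule wirt_cong[OF open_ovs[OF de] z, rotated]) (use a_tr[OF de] in "simp add: ovs_def")
 show "dz (a e w) (tr d e (z, w)) * d1 (tr d e) (z, w) =
  d1 (d1 (tr d e)) (z, w) * a d w z + d1 (tr d e) (z, w) * dz (a d w) z + d2 (d1 (tr d e)) (z, w)"
  using wirt_D(1)[OF 1] wirt_D(1)[OF 2] by (simp add: add_ac)
 show "A e w (tr d e (z, w)) * cnj (d1 (tr d e) (z, w)) = d1 (tr d e) (z, w) * A d w z"
  using wirt_D(2)[OF 1] wirt_D(2)[OF 2] by simp
qed

text \<open>All terms with \<open>a\<close> cancel. What remains is precisely the result of
  differentiating the rule \<open>ph_tr\<close> formally in \<open>w\<close>: the derivative of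
  \<open>ph e\<close> along the moving point, and that of \<open>2 ln |t_z|\<close>, with
  \<open>t\<close> the transition map.\<close>

lemma psi_tr: "psi d w z = psi e w (tr d e (z, w)) + Pz e w (tr d e (z, w)) * d2 (tr d e) (z, w)
  + d2 (d1 (tr d e)) (z, w) / d1 (tr d e) (z, w)"
proof -
 define t1 where "t1 = d1 (tr d e) (z, w)"
 have t1: "t1 ~= 0" using tr_d1[OF de zov] by (simp add: t1_def)
 have "dz (a e w) (tr d e (z, w)) = (d1 (d1 (tr d e)) (z, w) * a d w z + t1 * dz (a d w) z + d2 (d1 (tr d e)) (z, w)) / t1"
  using a_tr_dz t1 by (simp add: t1_def field_simps)
 then show ?thesis
  unfolding psi_def a_tr[OF de zov] Pz_tr t1_def[symmetric] using t1 by (simp add: field_simps)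
qed

end

text \<open>Differentiating \<open>A_tr\<close> produces the second derivative of the transition
  map, which cancels against the one in \<open>Pz_tr\<close>. The divergence of \<open>A\<close> is
  thus a form of type (0,1), and dividing it by the metric gives a vector field of type
  (1,0).\<close>

lemma N_tr:
 assumes de: "d : D" "e : D" and z: "z : ovs d e w"
 shows "(dz (A e w) (tr d e (z, w)) + Pz e w (tr d e (z, w)) * A e w (tr d e (z, w))) * cnj (d1 (tr d e) (z, w))
  = dz (A d w) z + Pz d w z * A d w z"
proof -
 have zov: "(z, w) : ov d e" using z by (simp add: ovs_def)
 note h = tr_hol2[OF de]
 define t1 t11 where "t1 = d1 (tr d e) (z, w)" and "t11 = d1 (d1 (tr d e)) (z, w)"
 have t1: "t1 ~= 0" using tr_d1[OF de zov] by (simp add: t1_def)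
 have der1: "((%y. tr d e (y, w)) has_field_derivative t1) (at z)" unfolding t1_def by (rule hol2_d1[OF h zov])
 have der2: "((%y. d1 (tr d e) (y, w)) has_field_derivative t11) (at z)" unfolding t11_def by (rule hol2_d1[OF hol2_d1_hol2[OF h] zov])
 have 1: "wirt (%y. A e w (tr d e (y, w)) * cnj (d1 (tr d e) (y, w)))
   (A e w (tr d e (z, w)) * cnj 0 + (dz (A e w) (tr d e (z, w)) * t1) * cnj (d1 (tr d e) (z, w)))
   (A e w (tr d e (z, w)) * cnj t11 + (dzbar (A e w) (tr d e (z, w)) * cnj t1) * cnj (d1 (tr d e) (z, w))) z"
  by (rule wirt_mult[OF wirt_pre_compose[of "A e w" _ _ "%y. tr d e (y, w)", OF wirt_smooth[OF sm_A[OF de(2)] tr_sl[OF de z]] der1]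
     wirt_cnj[OF wirt_holomorphic[OF der2]]])
 have "wirt (%y. d1 (tr d e) (y, w) * A d w y) (d1 (tr d e) (z, w) * dz (A d w) z + t11 * A d w z)
   (d1 (tr d e) (z, w) * dzbar (A d w) z + 0 * A d w z) z"
  by (rule wirt_mult[OF wirt_holomorphic[OF der2] wirt_smooth[OF sm_A[OF de(1)] ovs_sl[OF de z]]])
 then have 2: "wirt (%y. A e w (tr d e (y, w)) * cnj (d1 (tr d e) (y, w))) (d1 (tr d e) (z, w) * dz (A d w) z + t11 * A d w z)
   (d1 (tr d e) (z, w) * dzbar (A d w) z + 0 * A d w z) z"
  by (rule wirt_cong[OF open_ovs[OF de] z, rotated]) (simp add: A_tr[OF de])
 have "dz (A e w) (tr d e (z, w)) * t1 * cnj t1 = t1 * dz (A d w) z + t11 * A d w z"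
  using wirt_D(1)[OF 1] wirt_D(1)[OF 2] by (simp add: t1_def)
 moreover have "A e w (tr d e (z, w)) * cnj t1 = t1 * A d w z"
  using A_tr[OF de z] by (simp add: t1_def)
 moreover have "Pz d w z = Pz e w (tr d e (z, w)) * t1 + t11 / t1"
  using Pz_tr[OF de z] by (simp add: t1_def t11_def)
 moreover have "t1 * ((Ae1 + pe * Ae) * ct) = t1 * (A1 + pd * Ad)"
  if "Ae1 * t1 * ct = t1 * A1 + t11 * Ad" "Ae * ct = t1 * Ad" "pd = pe * t1 + t11 / t1" for Ae1 pe Ae A1 pd Ad ct
 proof -
  have "t1 * ((Ae1 + pe * Ae) * ct) = Ae1 * t1 * ct + t1 * pe * (Ae * ct)" by (simp add: algebra_simps)
  also have "... = t1 * A1 + t11 * Ad + t1 * pe * (t1 * Ad)" unfolding that(1,2) ..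
  also have "... = t1 * (A1 + pd * Ad)" unfolding that(3) using t1 by (simp add: field_simps)
  finally show ?thesis .
 qed
 ultimately show ?thesis using t1 unfolding t1_def[symmetric] by (metis mult_left_cancel)
qed

text \<open>An index is a chart with a centre in its slice. The inner discs of radius
  \<open>r i\<close> cover the fibre over \<open>w0\<close>, while the doubled discs stay inside the
  chart for all nearby \<open>w\<close>: the two radii that \<open>finite_disc_max_principle\<close>
  compares.\<close>

definition good_cover :: "complex => ('d \<times> complex) set => ('d \<times> complex => real) => bool" where
 "good_cover w0 F r \<longleftrightarrow> finite F &
  (ALL i:F. fst i : D & r i > 0 & disc2 r i \<times> cball w0 (2 * r i) <= Om (fst i)) &
  (ALL d:D. ALL z. (z, w0) : Om d -->
   (EX i:F. (z, w0) : ov d (fst i) & dist (tr d (fst i) (z, w0)) (snd i) < r i))"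

lemma good_cover_exists:
 assumes "d0 : D" "(z0, w0) : Om d0"
 obtains F r where "good_cover w0 F r" "(d0, z0) : F"
proof -
 have "EX r>0. cball z (2 * r) \<times> cball w0 (2 * r) <= Om d" if "d : D" "(z, w0) : Om d" for d z
  using open_box[OF open_Om[OF that(1)] that(2)] by blast
 then obtain R where R: "!!d z. d : D ==> (z, w0) : Om d ==> R d z > 0 & cball z (2 * R d z) \<times> cball w0 (2 * R d z) <= Om d"
  by metis
 have w0: "w0 : W" using Om_W[OF assms] .
 have "0 < R d z" if "d : D" "(z, w0) : Om d" for d z using R[OF that] by simp
 from cover[OF w0 this] obtain F where F': "finite F & (ALL i:F. fst i : D & (snd i, w0) : Om (fst i)) &
  (ALL d:D. ALL z. (z, w0) : Om d --> (EX i:F. (z, w0) : ov d (fst i) & dist (tr d (fst i) (z, w0)) (snd i) < R (fst i) (snd i)))"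
  by (rule exE)
 note F = conjunct1[OF F'] conjunct1[OF conjunct2[OF F']] conjunct2[OF conjunct2[OF F']]
 \<comment> \<open>The given point is added as a further centre, so that estimates over the cover
   can be read off on a disc around it.\<close>
 have "good_cover w0 (insert (d0, z0) F) (%i. R (fst i) (snd i))"
  unfolding good_cover_def
 proof (intro conjI ballI)
  fix i assume "i : insert (d0, z0) F"
  then have "fst i : D" "(snd i, w0) : Om (fst i)" using F(2) assms by auto
  then show "fst i : D" "R (fst i) (snd i) > 0"
   "cball (snd i) (2 * R (fst i) (snd i)) \<times> cball w0 (2 * R (fst i) (snd i)) <= Om (fst i)"
   using R by auto
 qed (use F in auto)
 then show ?thesis using that by blast
qed

lemma good_coverD:
 assumes "good_cover w0 F r"
 shows "finite F" "i : F ==> fst i : D" "i : F ==> r i > 0"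
  "i : F ==> z : disc2 r i ==> w : cball w0 (2 * r i) ==> (z, w) : Om (fst i)"
  "i : F ==> z : disc2 r i ==> z : sl (fst i) w0"
  "i : F ==> dist w w0 < r i ==> disc2 r i <= sl (fst i) w"
proof -
 show "finite F" "i : F ==> fst i : D" and r: "i : F ==> r i > 0" using assms by (auto simp: good_cover_def)
 have sub: "i : F ==> disc2 r i \<times> cball w0 (2 * r i) <= Om (fst i)"
  using assms by (simp add: good_cover_def)
 then show *: "i : F ==> z : disc2 r i ==> w : cball w0 (2 * r i) ==> (z, w) : Om (fst i)" for z w
  by blast
 show "i : F ==> z : disc2 r i ==> z : sl (fst i) w0"
  using *[of z w0] r by (simp add: sl_def less_imp_le)
 show "i : F ==> dist w w0 < r i ==> disc2 r i <= sl (fst i) w"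
  using *[of _ w] r by (auto simp: sl_def dist_commute)
qed

text \<open>Matching is asked only near each point of a disc; compactness of the boundary circles
  and finiteness of the cover make it simultaneous. \<open>K\<close> and \<open>M\<close> are
  quantified inside the eventual statement because in the applications they vary with the parameter
  \<open>p\<close>.\<close>

lemma fibre_max_principle:
 fixes U :: "'p => 'd => complex => complex"
 assumes gc: "good_cover w0 F r"
  and sm: "\<forall>\<^sub>F p in FF. ALL i:F. EX V. open V & disc2 r i <= V & smooth_on V (U p (fst i))"
  and match: "!!i j z. i : F ==> j : F ==> z : disc2 r i ==> (z, w0) : ov (fst i) (fst j) ==>
   dist (tr (fst i) (fst j) (z, w0)) (snd j) < r j ==>
   EX dl>0. \<forall>\<^sub>F p in FF. ALL y:ball z dl. EX y':cball (snd j) (r j). Re (U p (fst i) y) <= Re (U p (fst j) y') + \<kappa> p"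
 shows "\<forall>\<^sub>F p in FF. ALL K M. \<kappa> p < 3 * K --> 0 <= K -->
  (ALL i:F. ALL y:ball (snd i) (2 * r i). Re (lap (U p (fst i)) y) <= K / (r i)\<^sup>2 --> Re (U p (fst i) y) <= M) -->
  (ALL i:F. ALL y:disc2 r i. Re (U p (fst i) y) <= M + 4 * K)"
proof -
 note gcD = good_coverD[OF gc]
 have "\<forall>\<^sub>F p in FF. ALL i:F. ALL y:sphere (snd i) (2 * r i). EX j:F. EX y':cball (snd j) (r j). Re (U p (fst i) y) <= Re (U p (fst j) y') + \<kappa> p"
 proof (rule eventually_ball_finite[OF gcD(1)], rule ballI)
  fix i assume i: "i : F"
  define S where "S = sphere (snd i) (2 * r i)"
  define Q where "Q z dl \<longleftrightarrow> (\<forall>\<^sub>F p in FF. ALL y:ball z dl. EX j:F. EX y':cball (snd j) (r j). Re (U p (fst i) y) <= Re (U p (fst j) y') + \<kappa> p)" for z dl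
  have "EX dl>0. Q z dl" if "z : S" for z
  proof -
   have zc: "z : disc2 r i" using that by (auto simp: S_def)
   then have "(z, w0) : Om (fst i)" using gcD(5)[OF i] by (simp add: sl_def)
   then obtain j where j: "j : F" "(z, w0) : ov (fst i) (fst j)" "dist (tr (fst i) (fst j) (z, w0)) (snd j) < r j"
    using gc gcD(2)[OF i] unfolding good_cover_def by blast
   obtain dl where dl: "dl > 0" and
    ev: "\<forall>\<^sub>F p in FF. ALL y:ball z dl. EX y':cball (snd j) (r j). Re (U p (fst i) y) <= Re (U p (fst j) y') + \<kappa> p"
    using match[OF i j(1) zc j(2,3)] by (elim exE conjE)
   have "\<forall>\<^sub>F p in FF. ALL y:ball z dl. EX j:F. EX y':cball (snd j) (r j). Re (U p (fst i) y) <= Re (U p (fst j) y') + \<kappa> p"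
    by (rule eventually_mono[OF ev]) (rule ballI, rule bexI[OF _ j(1)], erule (1) bspec)
   then show ?thesis unfolding Q_def using dl by (intro exI conjI)
  qed
  then obtain dl where dl: "!!z. z : S ==> dl z > 0" "!!z. z : S ==> Q z (dl z)" by metis
  have "compact S" by (simp add: S_def)
  then obtain C where C: "C <= S" "finite C" "S <= (\<Union>c\<in>C. ball c (dl c))"
   using compactE_image[of S S "%c. ball c (dl c)"] dl(1) by (metis (no_types, lifting) UN_iff centre_in_ball open_ball subsetI)
  have "\<forall>\<^sub>F p in FF. ALL c:C. ALL y:ball c (dl c). EX j:F. EX y':cball (snd j) (r j). Re (U p (fst i) y) <= Re (U p (fst j) y') + \<kappa> p"
   using C(1) dl(2) unfolding Q_def by (intro eventually_ball_finite[OF C(2)]) auto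
  then show "\<forall>\<^sub>F p in FF. ALL y:sphere (snd i) (2 * r i). EX j:F. EX y':cball (snd j) (r j). Re (U p (fst i) y) <= Re (U p (fst j) y') + \<kappa> p"
   unfolding S_def[symmetric] by (rule eventually_mono) (use C(3) in blast)
 qed
 from this sm show ?thesis
 proof eventually_elim
  case (elim p)
  show ?case
  proof (intro allI impI ballI)
   fix K M i y
   assume K: "\<kappa> p < 3 * K" "0 <= K" and int: "ALL i:F. ALL y:ball (snd i) (2 * r i). Re (lap (U p (fst i)) y) <= K / (r i)\<^sup>2 --> Re (U p (fst i) y) <= M"
    and iy: "i : F" "y : disc2 r i"
   show "Re (U p (fst i) y) <= M + 4 * K"
    by (rule finite_disc_max_principle[where u = "%i. U p (fst i)" and \<zeta> = snd and r = r and F = F and \<kappa> = "\<kappa> p"])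
     (use gcD(1,3) elim K int iy in "simp_all")
  qed
 qed
qed

text \<open>The maximum principle controls \<open>g u\<close> by a multiple of the inverse square of
  the radius; this constant turns such a bound into one for \<open>u\<close>.\<close>

lemma inverse_metric_bound:
 assumes "good_cover w0 F r"
 shows "EX C>=0. ALL i:F. ALL y:disc2 r i. 1 / ((r i)\<^sup>2 * exp (ph (fst i) w0 y)) <= C"
proof -
 note gcD = good_coverD[OF assms]
 have c: "continuous_on (disc2 r i) (%y. 1 / ((r i)\<^sup>2 * exp (Re (P (fst i) w0 y))))" if i: "i : F" for i
 proof -
  have "disc2 r i <= sl (fst i) w0" using gcD(5)[OF i] by blast
  then have "continuous_on (disc2 r i) (P (fst i) w0)"
   by (rule continuous_on_subset[OF smo_imp_continuous_on[OF sm_P[OF gcD(2)[OF i]]]])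
  then show ?thesis using gcD(3)[OF i] by (intro continuous_intros) auto
 qed
 have "1 / ((r i)\<^sup>2 * exp (Re (P (fst i) w0 y))) <= norm (1 / ((r i)\<^sup>2 * exp (ph (fst i) w0 y)))" for i y
  by (simp add: P_def)
 then show ?thesis
  using finite_compact_bound[where F = F and K = "%i. disc2 r i"
     and h = "%i y. 1 / ((r i)\<^sup>2 * exp (Re (P (fst i) w0 y)))", OF gcD(1) compact_cball c]
  by (auto simp: P_def)
qed

text \<open>Let \<open>V\<close> be the holomorphic vector field of assumption \<open>harmonic\<close>.  The function \<open>g |V|\<^sup>2\<close> has
 the Laplacian \<open>g\<^sup>2 |V|\<^sup>2 + g |\<nabla>V|\<^sup>2\<close>, so its maximum is zero.\<close>

lemma harmonic_divergence_free:
 assumes d0: "d0 : D" and z0: "z0 : sl d0 w0"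
 shows "dz (A d0 w0) z0 + Pz d0 w0 z0 * A d0 w0 z0 = 0"
proof -
 have "(z0, w0) : Om d0" using z0 by (simp add: sl_def)
 from good_cover_exists[OF d0 this] obtain F r where gc: "good_cover w0 F r" and dF: "(d0, z0) : F" .
 note gcD = good_coverD[OF gc]
 define N where "N d = (%z. dz (A d w0) z + Pz d w0 z * A d w0 z)" for d
 define V where "V d = (%z. N d z * inverse (G d w0 z))" for d
 define u where "u d = (%z. G d w0 z * (V d z * cnj (V d z)))" for d
 have smV: "smooth_on (sl d w0) (V d)" if "d : D" for d
  unfolding V_def N_def
  by (intro smo_mult smo_add smo_inverse smo_dz open_sl sm_A sm_Pz sm_G G_nz that)
 have smu: "smooth_on (sl d w0) (u d)" if "d : D" for d
  unfolding u_def by (intro smo_mult smo_cnj open_sl smV sm_G that)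
 have u_real: "u d z = of_real (exp (ph d w0 z) * (cmod (V d z))\<^sup>2)" for d z
  unfolding u_def G_def cmod_sq by simp
 have V0: "dzbar (V d) z = 0" if "d : D" "z : sl d w0" for d z
 proof -
  have "V d = (%y. (dz (dzbar (a d w0)) y + dz (%z. complex_of_real (ph d w0 z)) y * dzbar (a d w0) y)
    / of_real (exp (ph d w0 y)))"
   by (simp add: V_def N_def A_def Pz_def P_def G_def divide_inverse)
  then show ?thesis using harmonic[OF that(1)] that(2) by (simp add: sl_def)
 qed
 have lap_u: "Re (lap (u d) z) >= exp (ph d w0 z) * Re (u d z)" if d: "d : D" and z: "z : sl d w0" for d z
 proof -
  define E where "E = (%y. Pz d w0 y * V d y + dz (V d) y)"
  have wV: "wirt (V d) (dz (V d) y) 0 y" if "y : sl d w0" for y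
   using wirt_smooth[OF smV[OF d] that] V0[OF d that] by simp
  have wV': "wirt (dz (V d)) (dz (dz (V d)) y) 0 y" if y: "y : sl d w0" for y
  proof -
   have "dzbar (dz (V d)) y = dz (dzbar (V d)) y" by (rule dzbar_dz_commute[OF open_sl[OF d] smV[OF d] y])
   also have "... = dz (%_. 0) y" by (rule dz_cong[OF open_sl[OF d] y]) (rule V0[OF d])
   also have "... = 0" using wirt_D(1)[OF wirt_const] .
   finally show ?thesis using wirt_smooth[OF smo_dz[OF open_sl[OF d] smV[OF d]] y] by simp
  qed
  have 1: "wirt (u d) (G d w0 y * (V d y * cnj 0 + dz (V d) y * cnj (V d y)) + G d w0 y * Pz d w0 y * (V d y * cnj (V d y)))
    ((G d w0 y * V d y) * cnj (E y)) y" if y: "y : sl d w0" for y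
   using wirt_mult[OF wirt_G[OF d y] wirt_mult[OF wV[OF y] wirt_cnj[OF wV[OF y]]]]
   by (simp add: u_def E_def algebra_simps)
  have wE: "wirt E (Pz d w0 z * dz (V d) z + dz (Pz d w0) z * V d z + dz (dz (V d)) z) (Pz d w0 z * 0 + G d w0 z * V d z + 0) z"
   unfolding E_def by (rule wirt_add[OF wirt_mult[OF wirt_Pz[OF d z] wV[OF z]] wV'[OF z]])
  have "lap (u d) z = (G d w0 z * V d z) * cnj (Pz d w0 z * 0 + G d w0 z * V d z + 0)
   + (G d w0 z * dz (V d) z + G d w0 z * Pz d w0 z * V d z) * cnj (E z)"
   by (rule lap_I[OF open_sl[OF d] z 1 wirt_mult[OF wirt_mult[OF wirt_G[OF d z] wV[OF z]] wirt_cnj[OF wE]]])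
  also have "... = G d w0 z * u d z + G d w0 z * (E z * cnj (E z))"
   by (simp add: u_def E_def G_def algebra_simps)
  finally have "lap (u d) z = of_real (exp (ph d w0 z)) * of_real (exp (ph d w0 z) * (cmod (V d z))\<^sup>2) + of_real (exp (ph d w0 z) * (cmod (E z))\<^sup>2)"
   unfolding cmod_sq u_real by (simp add: G_def)
  then have "Re (lap (u d) z) = exp (ph d w0 z) * (exp (ph d w0 z) * (cmod (V d z))\<^sup>2) + exp (ph d w0 z) * (cmod (E z))\<^sup>2"
   by (simp flip: of_real_mult of_real_add)
  then show ?thesis unfolding u_real Re_complex_of_real by simp
 qed
 have u_tr: "u d z = u e (tr d e (z, w0))" if de: "d : D" "e : D" and z: "z : ovs d e w0" for d e z
 proof -
  define t where "t = d1 (tr d e) (z, w0)"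
  have t: "t ~= 0" using tr_d1[OF de] z by (simp add: t_def ovs_def)
  have "N d z = N e (tr d e (z, w0)) * cnj t" using N_tr[OF de z] by (simp add: N_def t_def)
  moreover have "G d w0 z = G e w0 (tr d e (z, w0)) * (t * cnj t)" using G_tr[OF de z] by (simp add: t_def)
  moreover have "G e w0 (tr d e (z, w0)) ~= 0" by (rule G_nz)
  moreover have "cnj (G e w0 x) = G e w0 x" "cnj (G d w0 x) = G d w0 x" for x by (simp_all add: G_def)
  ultimately show ?thesis using t by (simp add: u_def V_def field_simps)
 qed
 \<comment> \<open>On a single fibre no parameter varies, so the principle is used along a filter on
   a one-point type and with exact matching.\<close>
 have fin: "\<forall>\<^sub>F p in principal {()}. ALL K M. 0 < 3 * K --> 0 <= K -->
  (ALL i:F. ALL y:ball (snd i) (2 * r i). Re (lap (u (fst i)) y) <= K / (r i)\<^sup>2 --> Re (u (fst i) y) <= M) -->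
  (ALL i:F. ALL y:disc2 r i. Re (u (fst i) y) <= M + 4 * K)"
 proof (rule fibre_max_principle[OF gc, where U = "%p. u" and \<kappa> = "%p. 0"])
  show "\<forall>\<^sub>F p in principal {()}. ALL i:F. EX V. open V & disc2 r i <= V & smooth_on V (u (fst i))"
  proof (rule always_eventually, intro allI ballI)
   fix i assume i: "i : F"
   show "EX V. open V & disc2 r i <= V & smooth_on V (u (fst i))"
    using smu[OF gcD(2)[OF i]] open_sl[OF gcD(2)[OF i]] gcD(5)[OF i] by blast
  qed
  fix i j z assume ij: "i : F" "j : F" "z : disc2 r i" and zov: "(z, w0) : ov (fst i) (fst j)"
   and dist: "dist (tr (fst i) (fst j) (z, w0)) (snd j) < r j"
  have de: "fst i : D" "fst j : D" using gcD(2) ij by auto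
  obtain dl where dl: "dl > 0" "!!y w. dist y z < dl ==> dist w w0 < dl ==> (y, w) : ov (fst i) (fst j) &
    dist (tr (fst i) (fst j) (y, w)) (tr (fst i) (fst j) (z, w0)) < r j - dist (tr (fst i) (fst j) (z, w0)) (snd j)"
   using continuous_on_box[OF hol2_open[OF tr_hol2[OF de]] hol2_continuous_on[OF tr_hol2[OF de]] zov,
     of "r j - dist (tr (fst i) (fst j) (z, w0)) (snd j)"] dist by auto
  have "ALL y:ball z dl. EX y':cball (snd j) (r j). Re (u (fst i) y) <= Re (u (fst j) y') + 0"
  proof
   fix y assume "y : ball z dl"
   then have y: "(y, w0) : ov (fst i) (fst j)" "dist (tr (fst i) (fst j) (y, w0)) (tr (fst i) (fst j) (z, w0)) < r j - dist (tr (fst i) (fst j) (z, w0)) (snd j)"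
    using dl(2)[of y w0] dl(1) by (auto simp: dist_commute)
   then have "tr (fst i) (fst j) (y, w0) : cball (snd j) (r j)"
    using dist_triangle[of "tr (fst i) (fst j) (y, w0)" "snd j" "tr (fst i) (fst j) (z, w0)"] by (simp add: dist_commute)
   then show "EX y':cball (snd j) (r j). Re (u (fst i) y) <= Re (u (fst j) y') + 0"
    using u_tr[OF de, of y] y by (auto simp: ovs_def)
  qed
  then show "EX dl>0. \<forall>\<^sub>F p in principal {()}. ALL y:ball z dl. EX y':cball (snd j) (r j). Re (u (fst i) y) <= Re (u (fst j) y') + 0"
   using dl(1) by auto
 qed
 from inverse_metric_bound[OF gc] obtain C where "C >= 0 & (ALL i:F. ALL y:disc2 r i. 1 / ((r i)\<^sup>2 * exp (ph (fst i) w0 y)) <= C)" ..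
 then have C: "C >= 0" "!!i y. i : F ==> y : disc2 r i ==> 1 / ((r i)\<^sup>2 * exp (ph (fst i) w0 y)) <= C"
  by auto
 have "Re (u d0 z0) <= 0"
 proof (rule field_le_epsilon)
  fix eps :: real assume e: "eps > 0"
  \<comment> \<open>At interior maxima the bound is \<open>K * C\<close> and the weight adds
    \<open>4 * K\<close>; this choice makes the sum \<open>eps\<close>.\<close>
  define K where "K = eps / (C + 4)"
  have K: "K > 0" using e C by (simp add: K_def)
  have int: "ALL i:F. ALL y:ball (snd i) (2 * r i). Re (lap (u (fst i)) y) <= K / (r i)\<^sup>2 --> Re (u (fst i) y) <= K * C"
  proof (intro ballI impI)
   fix i y assume i: "i : F" and y: "y : ball (snd i) (2 * r i)" and l: "Re (lap (u (fst i)) y) <= K / (r i)\<^sup>2"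
   have "exp (ph (fst i) w0 y) * Re (u (fst i) y) <= K / (r i)\<^sup>2"
    using lap_u[OF gcD(2)[OF i], of y] gcD(5)[OF i, of y] y l by simp
   then have "Re (u (fst i) y) <= (K / (r i)\<^sup>2) / exp (ph (fst i) w0 y)"
    by (subst pos_le_divide_eq) (simp_all add: mult.commute)
   also have "... = K * (1 / ((r i)\<^sup>2 * exp (ph (fst i) w0 y)))" by simp
   also have "... <= K * C" using C(2)[OF i, of y] y K by (intro mult_left_mono) auto
   finally show "Re (u (fst i) y) <= K * C" .
  qed
  have "ALL i:F. ALL y:disc2 r i. Re (u (fst i) y) <= K * C + 4 * K"
   using fin[unfolded eventually_principal] int K by simp
  then have "Re (u d0 z0) <= K * C + 4 * K" using dF gcD(3)[OF dF] by force
  also have "... = K * (C + 4)" by (simp add: algebra_simps)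
  also have "... = eps" using C(1) by (simp add: K_def)
  finally show "Re (u d0 z0) <= 0 + eps" by simp
 qed
 then have "V d0 z0 = 0" unfolding u_real Re_complex_of_real by (simp add: mult_le_0_iff not_le)
 then show ?thesis using G_nz[of d0 w0 z0] by (simp add: V_def N_def)
qed

lemma wirt_A: "d : D ==> z : sl d w ==> wirt (A d w) (- Pz d w z * A d w z) (dzbar (A d w) z) z"
 using wirt_smooth[OF sm_A, of d z w] harmonic_divergence_free[of d z w] by (simp add: add_eq_0_iff2)

text \<open>The derivative of \<open>a_z\<close> is \<open>A_z = - ph_z A\<close>, which cancels the
  term \<open>ph_z A\<close> from the product rule; only the curvature term, the derivative
  \<open>G\<close> of \<open>Pz\<close> times \<open>a\<close>, survives. This is where harmonicity
  enters the equation for \<open>psi\<close>.\<close>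

lemma dzbar_psi:
 assumes "d : D" "z : sl d w" shows "dzbar (psi d w) z = - G d w z * a d w z"
proof -
 have c: "dzbar (dz (a d w)) z = - Pz d w z * A d w z"
  using dzbar_dz_commute[OF open_sl sm_a, of d z w] wirt_D(1)[OF wirt_A[OF assms]] assms by (simp add: A_def)
 have "wirt (psi d w) (- (dz (dz (a d w)) z + (Pz d w z * dz (a d w) z + dz (Pz d w) z * a d w z)))
  (- (dzbar (dz (a d w)) z + (Pz d w z * A d w z + G d w z * a d w z))) z"
  unfolding psi_def
  by (rule wirt_minus[OF wirt_add[OF wirt_smooth[OF smo_dz[OF open_sl[OF assms(1)] sm_a[OF assms(1)]] assms(2)]
   wirt_mult[OF wirt_Pz[OF assms] wirt_a[OF assms]]]])
 then show ?thesis using wirt_D(2) c by fastforce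
qed

lemma wirt_psi: "d : D ==> z : sl d w ==> wirt (psi d w) (dz (psi d w) z) (- G d w z * a d w z) z"
 using wirt_smooth[OF sm_psi, of d z w] by (simp add: dzbar_psi)

text \<open>Applying \<open>dz\<close> to \<open>- G a\<close> gives \<open>G\<close> times minus
  the divergence of \<open>a\<close>. The same linear equation results from differentiating
  \<open>lap ph = exp ph\<close> formally in \<open>w\<close>.\<close>

lemma lap_psi:
 assumes "d : D" "z : sl d w" shows "lap (psi d w) z = G d w z * psi d w z"
proof -
 have "lap (psi d w) z = - G d w z * dz (a d w) z + - (G d w z * Pz d w z) * a d w z"
  by (rule lap_I[OF open_sl[OF assms(1)] assms(2) wirt_psi[OF assms(1)]], assumption)
   (rule wirt_mult[OF wirt_minus[OF wirt_G[OF assms]] wirt_a[OF assms]])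
 then show ?thesis by (simp add: psi_def algebra_simps)
qed

end

section \<open>Dependence of the metrics on the parameter\<close>

text \<open>Little-o of \<open>s\<close> along the filter, uniformly on \<open>K\<close>. The weak
  inequality makes sense for \<open>s p = 0\<close> and then forces \<open>f p\<close> to vanish on
  \<open>K\<close>; this occurs at \<open>w = w0\<close> for the scale
  \<open>cmod (w - w0)\<close>.\<close>

definition unif_small :: "'p filter => complex set => ('p => complex => complex) => ('p => real) => bool" where
 "unif_small FF K f s \<longleftrightarrow> (ALL eta>0. \<forall>\<^sub>F p in FF. ALL z:K. cmod (f p z) <= eta * s p)"

abbreviation usmall :: "complex => complex => real => (complex => complex => complex) => (complex => real) => bool" where
 "usmall w0 z0 rho == unif_small (nhds w0) (cball z0 rho)"

lemma unif_smallD: "unif_small FF K f s ==> eta > 0 ==> \<forall>\<^sub>F p in FF. ALL z:K. cmod (f p z) <= eta * s p"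
 by (simp add: unif_small_def)

lemma unif_small_subset: "unif_small FF K f s ==> K' <= K ==> unif_small FF K' f s"
 unfolding unif_small_def
proof (intro allI impI)
 fix eta :: real assume "ALL eta>0. \<forall>\<^sub>F p in FF. ALL z:K. cmod (f p z) <= eta * s p" and K: "K' <= K" "eta > 0"
 then have "\<forall>\<^sub>F p in FF. ALL z:K. cmod (f p z) <= eta * s p" by simp
 then show "\<forall>\<^sub>F p in FF. ALL z:K'. cmod (f p z) <= eta * s p"
  by (rule eventually_mono) (use K in auto)
qed

lemma unif_small_cong:
 assumes "unif_small FF K f s" "\<forall>\<^sub>F p in FF. ALL z:K. h p z = f p z"
 shows "unif_small FF K h s"
 unfolding unif_small_def
proof (intro allI impI)
 fix eta :: real assume "eta > 0"
 from unif_smallD[OF assms(1) this] assms(2)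
 show "\<forall>\<^sub>F p in FF. ALL z:K. cmod (h p z) <= eta * s p" by eventually_elim simp
qed

lemma unif_small_add:
 assumes "unif_small FF K f s" "unif_small FF K h s"
 shows "unif_small FF K (%p z. f p z + h p z) s"
 unfolding unif_small_def
proof (intro allI impI)
 fix eta :: real assume "eta > 0"
 then have e: "eta / 2 > 0" by simp
 from unif_smallD[OF assms(1) e] unif_smallD[OF assms(2) e]
 show "\<forall>\<^sub>F p in FF. ALL z:K. cmod (f p z + h p z) <= eta * s p"
 proof eventually_elim
  case (elim p)
  show ?case
  proof
   fix z assume "z : K"
   then show "cmod (f p z + h p z) <= eta * s p"
    using elim norm_triangle_ineq[of "f p z" "h p z"] by (fastforce simp: field_simps)
  qed
 qed
qed

lemma unif_small_mult:
 assumes "unif_small FF K f s" "C >= 0" "\<forall>\<^sub>F p in FF. ALL z:K. cmod (h p z) <= C * q p" "!!p. q p >= 0"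
 shows "unif_small FF K (%p z. h p z * f p z) (%p. q p * s p)"
 unfolding unif_small_def
proof (intro allI impI)
 fix eta :: real assume "eta > 0"
 then have e: "eta / (C + 1) > 0" using assms(2) by simp
 from unif_smallD[OF assms(1) e] assms(3)
 show "\<forall>\<^sub>F p in FF. ALL z:K. cmod (h p z * f p z) <= eta * (q p * s p)"
 proof eventually_elim
  case (elim p)
  show ?case
  proof
   fix z assume z: "z : K"
   have "cmod (h p z * f p z) <= ((C + 1) * q p) * (eta / (C + 1) * s p)"
    unfolding norm_mult
   proof (rule mult_mono)
    show "cmod (f p z) <= eta / (C + 1) * s p" using elim z by blast
    show "cmod (h p z) <= (C + 1) * q p" using elim z assms(4)[of p] by (fastforce simp: distrib_right)
    show "0 <= (C + 1) * q p" using assms(2) assms(4)[of p] by simp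
   qed simp
   also have "... = eta * (q p * s p)" using assms(2) by (simp add: field_simps)
   finally show "cmod (h p z * f p z) <= eta * (q p * s p)" .
  qed
 qed
qed

text \<open>The interior gradient estimate on discs of radius \<open>rho / 2\<close> is linear in
  the bounds for \<open>f\<close> and \<open>lap f\<close>, so little-o bounds on both pass to the
  first derivatives on the disc of half radius.\<close>

lemma unif_small_gradient:
 assumes rho: "rho > 0" and sm: "\<forall>\<^sub>F p in FF. EX V. open V & cball z0 rho <= V & smooth_on V (f p)"
  and f: "unif_small FF (cball z0 rho) f s" and l: "unif_small FF (cball z0 rho) (%p. lap (f p)) s"
 shows "unif_small FF (cball z0 (rho / 2)) (%p. dz (f p)) s" "unif_small FF (cball z0 (rho / 2)) (%p. dzbar (f p)) s"
proof -
 have "\<forall>\<^sub>F p in FF. ALL z:cball z0 (rho / 2). cmod (dz (f p) z) <= eta * s p & cmod (dzbar (f p) z) <= eta * s p"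
  if eta: "eta > 0" for eta
 proof -
  define c where "c = eta / (4 / (rho / 2) + 2 * (rho / 2))"
  have p: "4 / (rho / 2) + 2 * (rho / 2) > 0" using rho by (simp add: add_pos_pos)
  have c: "c > 0" using eta p by (simp add: c_def)
  from unif_smallD[OF f c] unif_smallD[OF l c] sm
  show ?thesis
  proof eventually_elim
   case (elim p)
   show ?case
   proof
    fix z assume z: "z : cball z0 (rho / 2)"
    have sub: "cball z (rho / 2) <= cball z0 rho"
    proof
     fix y assume "y : cball z (rho / 2)"
     then show "y : cball z0 rho" using z dist_triangle[of z0 y z] by simp
    qed
    obtain V where V: "open V" "cball z0 rho <= V" "smooth_on V (f p)" using elim(3) by blast
    have "4 * (c * s p) / (rho / 2) + 2 * (c * s p) * (rho / 2) = (c * (4 / (rho / 2) + 2 * (rho / 2))) * s p"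
     by (simp add: algebra_simps)
    also have "... = eta * s p" unfolding c_def using p by simp
    finally have e: "4 * (c * s p) / (rho / 2) + 2 * (c * s p) * (rho / 2) = eta * s p" .
    have h: "0 < rho / 2" "cball z (rho / 2) <= V" using rho sub V(2) by auto
    have b: "cmod (f p y) <= c * s p" "cmod (lap (f p) y) <= c * s p" if "y : cball z (rho / 2)" for y
     using elim that sub by blast+
    show "cmod (dz (f p) z) <= eta * s p & cmod (dzbar (f p) z) <= eta * s p"
     using gradient_estimate'[OF V(1,3) h b] unfolding e by blast
   qed
  qed
 qed
 then show "unif_small FF (cball z0 (rho / 2)) (%p. dz (f p)) s" "unif_small FF (cball z0 (rho / 2)) (%p. dzbar (f p)) s"
  unfolding unif_small_def by (fastforce elim: eventually_mono)+
qed

lemma unif_small_isCont: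
 fixes H :: "complex => complex => complex"
 assumes "rho > 0" "usmall w0 z0 rho (%w z. H w z - H w0 z) (%_. 1)" "isCont (H w0) z0"
 shows "isCont (%x. H (snd x) (fst x)) (z0, w0)"
proof (rule isCont_of_uniform_limit[where H = H, OF assms(1) _ assms(3)])
 show "uniform_limit (cball z0 rho) H (H w0) (nhds w0)"
  unfolding uniform_limit_iff
 proof (intro allI impI)
  fix e :: real assume e: "e > 0"
  have "e / 2 > 0" using e by simp
  from unif_smallD[OF assms(2) this]
  show "\<forall>\<^sub>F w in nhds w0. ALL z:cball z0 rho. dist (H w z) (H w0 z) < e"
  proof (rule eventually_mono, intro ballI)
   fix w z assume "ALL z:cball z0 rho. cmod (H w z - H w0 z) <= e / 2 * 1" "z : cball z0 rho"
   then have "cmod (H w z - H w0 z) <= e / 2" by simp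
   then show "dist (H w z) (H w0 z) < e" using e by (simp add: dist_norm)
  qed
 qed
qed

lemma exp_remainder:
 fixes x :: real
 assumes "(abs x) <= 1 / 2"
 shows "\<bar>exp x - 1 - x\<bar> <= x\<^sup>2" "\<bar>exp x - 1\<bar> <= 2 * (abs x)"
proof -
 have "exp x >= 1 + x" by (rule exp_ge_add_one_self)
 moreover have "exp x <= 1 + x + x\<^sup>2"
 proof (cases "x >= 0")
  case True
  then show ?thesis using assms by (intro exp_bound) auto
 next
  case False
  have "exp x * (1 - x) <= exp x * exp (- x)"
   using exp_ge_add_one_self[of "- x"] by (intro mult_left_mono) auto
  also have "... = 1" by (simp add: exp_minus)
  also have "1 <= (1 + x + x\<^sup>2) * (1 - x)"
   using False zero_le_power2[of x] mult_nonneg_nonneg[of "x\<^sup>2" "- x"] by (simp add: power2_eq_square algebra_simps)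
  finally show ?thesis using False by simp
 qed
 ultimately show 1: "\<bar>exp x - 1 - x\<bar> <= x\<^sup>2"
  using zero_le_power2[of x] by linarith
 have "x\<^sup>2 <= (abs x)" using assms mult_left_le[of "(abs x)" "(abs x)"] by (simp add: power2_eq_square flip: abs_mult)
 with 1 show "\<bar>exp x - 1\<bar> <= 2 * (abs x)" by linarith
qed

context hyperbolic_charts
begin

lemma ph_has_derivative:
 assumes "d : D" "z : sl d w"
 shows "(ph d w has_derivative (%h. 2 * Re (Pz d w z * h))) (at z)"
 using has_derivative_Re[OF wirt_P[OF assms, unfolded wirt_def]]
 by (simp add: P_def algebra_simps)

text \<open>\<open>E w0 w d\<close> is the error of the expected first order expansion of \<open>ph\<close> in the base direction.\<close>

definition E :: "complex => complex => 'd => complex => real" where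
 "E w0 w d z = ph d w z - ph d w0 z - 2 * Re ((w - w0) * psi d w0 z)"

text \<open>In the difference of the two errors, \<open>ph e w\<close> at the moved point cancels
  through \<open>ph_tr\<close>. Only \<open>ph e w0\<close>, the metric of the fixed fibre, and the
  transition map remain, and both are smooth in the variables involved; no regularity of the metrics
  in \<open>w\<close> enters. The derivative \<open>B\<close> of the remaining function
  \<open>k\<close> and the difference \<open>C\<close> of the two \<open>psi\<close> agree at the
  centre by \<open>psi_tr\<close>.\<close>

lemma transition_first_order:
 assumes de: "d : D" "e : D" and zov: "(z, w0) : ov d e" and eps: "eps > 0"
 shows "EX dl>0. ALL y w. dist y z < dl --> dist w w0 < dl --> (y, w) : ov d e &
  \<bar>E w0 w d y - E w0 w e (tr d e (y, w))\<bar> <= eps * cmod (w - w0)"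
proof -
 define t where "t = tr d e"
 note h = tr_hol2[OF de, folded t_def]
 define U where "U = {x : ov d e. t x : sl e w0 & fst x : sl d w0}"
 have "open (ov d e Int t -` sl e w0)"
  by (rule continuous_open_preimage[OF hol2_continuous_on[OF h] hol2_open[OF h] open_sl[OF de(2)]])
 moreover have "open (fst -` sl d w0)" by (intro open_vimage open_sl de continuous_intros)
 ultimately have U: "open U"
  using open_Int[of "ov d e Int t -` sl e w0" "fst -` sl d w0"] by (auto simp: U_def Int_def vimage_def conj_ac)
 have zs: "z : ovs d e w0" using zov by (simp add: ovs_def)
 have zU: "(z, w0) : U"
  using zov tr_sl[OF de zs] ovs_sl[OF de zs] by (simp add: U_def t_def)
 define B where "B x = d2 (d1 t) x / d1 t x + Pz e w0 (t x) * d2 t x" for x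
 define C where "C x = psi d w0 (fst x) - psi e w0 (t x)" for x
 have Usub: "U <= ov d e" by (auto simp: U_def)
 have nz: "d1 t x ~= 0" if "x : U" for x
  using tr_d1[OF de, of "fst x" "snd x"] that by (auto simp: U_def t_def)
 have ct: "continuous_on U t" "continuous_on U (d1 t)" "continuous_on U (d2 t)" "continuous_on U (d2 (d1 t))"
  using hol2_continuous_on[OF h] hol2_continuous_on[OF hol2_d1_hol2[OF h]] hol2_continuous_on[OF hol2_d2_hol2[OF h]]
   hol2_continuous_on[OF hol2_d2_hol2[OF hol2_d1_hol2[OF h]]] Usub by (auto intro: continuous_on_subset)
 have cc: "continuous_on U (%x. k (t x))" if "continuous_on (sl e w0) k" for k :: "complex => complex"
  by (rule continuous_on_compose2[OF that ct(1)]) (auto simp: U_def)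
 have cf: "continuous_on U (%x. k (fst x))" if "continuous_on (sl d w0) k" for k :: "complex => complex"
  by (rule continuous_on_compose2[OF that continuous_on_fst[OF continuous_on_id]]) (auto simp: U_def)
 have contB: "continuous_on U B"
  unfolding B_def by (intro continuous_intros ct cc smo_imp_continuous_on sm_Pz de ballI nz)
 have contC: "continuous_on U C"
  unfolding C_def by (intro continuous_intros cc cf smo_imp_continuous_on sm_psi de)
 have BC: "C (z, w0) = B (z, w0)"
  using psi_tr[OF de zs] by (simp add: B_def C_def t_def)
 define c where "c = B (z, w0)"
 have e8: "eps / 8 > 0" using eps by simp
 obtain dl where dl: "dl > 0"
  "!!y w. dist y z < dl ==> dist w w0 < dl ==> (y, w) : U & dist (B (y, w), C (y, w)) (B (z, w0), C (z, w0)) < eps / 8"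
  using continuous_on_box[OF U continuous_on_Pair[OF contB contC] zU e8] by metis
 have near: "(y, w) : U" "cmod (B (y, w) - c) <= eps / 8" "cmod (C (y, w) - c) <= eps / 8"
  if "dist y z < dl" "dist w w0 < dl" for y w
  using dl(2)[OF that] dist_fst_le[of "(B (y, w), C (y, w))" "(B (z, w0), C (z, w0))"]
   dist_snd_le[of "(B (y, w), C (y, w))" "(B (z, w0), C (z, w0))"]
  by (auto simp: c_def BC dist_norm)
 have main: "(y, w) : ov d e & \<bar>E w0 w d y - E w0 w e (t (y, w))\<bar> <= eps * cmod (w - w0)"
  if y: "dist y z < dl" and w: "dist w w0 < dl" for y w
 proof -
  define k where "k = (%w. 2 * ln (cmod (d1 t (y, w))) + ph e w0 (t (y, w)))"
  have der: "(k has_derivative (%h. 2 * Re (B (y, x) * h))) (at x)" if "x : ball w0 dl" for x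
  proof -
   have xU: "(y, x) : U" using near(1)[OF y] that by (simp add: dist_commute)
   then have xov: "(y, x) : ov d e" and ts: "t (y, x) : sl e w0" by (auto simp: U_def)
   have 1: "((%x. 2 * ln (cmod (d1 t (y, x)))) has_derivative (%h. 2 * Re (d2 (d1 t) (y, x) / d1 t (y, x) * h))) (at x)"
    by (rule has_derivative_ln_cmod[OF hol2_d2[OF hol2_d1_hol2[OF h] xov] nz[OF xU]])
   have "((%x. t (y, x)) has_derivative (%h. d2 t (y, x) * h)) (at x)"
    using hol2_d2[OF h xov] by (simp add: has_field_derivative_def)
   from diff_chain_at[OF this ph_has_derivative[OF de(2) ts]]
   have 2: "((%x. ph e w0 (t (y, x))) has_derivative (%h. 2 * Re (Pz e w0 (t (y, x)) * (d2 t (y, x) * h)))) (at x)"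
    by (simp add: o_def)
   show ?thesis
    unfolding k_def by (rule has_derivative_eq_rhs[OF has_derivative_add[OF 1 2]]) (simp add: B_def fun_eq_iff algebra_simps)
  qed
  have "norm (k w - k w0 - 2 * Re (c * (w - w0))) <= eps / 4 * norm (w - w0)"
  proof (rule increment_bound[where f = k and S = "ball w0 dl" and L = "%h. 2 * Re (c * h)", OF convex_ball der])
   show "bounded_linear (%h. 2 * Re (c * h))"
    by (intro bounded_linear_const_mult bounded_linear_compose[OF bounded_linear_Re bounded_linear_mult_right])
   fix x h assume "x : ball w0 dl"
   then have "cmod (B (y, x) - c) <= eps / 8" using near(2)[OF y] by (simp add: dist_commute)
   then have "\<bar>Re ((B (y, x) - c) * h)\<bar> <= eps / 8 * cmod h"
    by (intro order.trans[OF abs_Re_le_cmod]) (unfold norm_mult, rule mult_right_mono[OF _ norm_ge_zero])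
   moreover have "2 * Re (B (y, x) * h) - 2 * Re (c * h) = 2 * Re ((B (y, x) - c) * h)" by (simp add: algebra_simps)
   ultimately show "norm (2 * Re (B (y, x) * h) - 2 * Re (c * h)) <= eps / 4 * norm h"
    unfolding real_norm_def by linarith
  qed (use w dl(1) eps in "auto simp: dist_commute")
  moreover have "\<bar>2 * Re ((w - w0) * C (y, w)) - 2 * Re (c * (w - w0))\<bar> <= eps / 4 * cmod (w - w0)"
  proof -
   have "\<bar>Re ((C (y, w) - c) * (w - w0))\<bar> <= eps / 8 * cmod (w - w0)"
    using near(3)[OF y w]
    by (intro order.trans[OF abs_Re_le_cmod]) (unfold norm_mult, rule mult_right_mono[OF _ norm_ge_zero])
   moreover have "2 * Re ((w - w0) * C (y, w)) - 2 * Re (c * (w - w0)) = 2 * Re ((C (y, w) - c) * (w - w0))"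
    by (simp add: algebra_simps)
   ultimately show ?thesis by linarith
  qed
  moreover have yov: "(y, w) : ov d e" "(y, w0) : ov d e"
   using near(1)[OF y w] near(1)[OF y, of w0] dl(1) by (auto simp: U_def)
  moreover have "k w0 = ph d w0 y" using ph_tr[OF de yov(2)] by (simp add: k_def t_def)
  moreover have "E w0 w d y - E w0 w e (t (y, w)) = k w - ph d w0 y - 2 * Re ((w - w0) * C (y, w))"
   using ph_tr[OF de yov(1)] by (simp add: E_def k_def t_def C_def algebra_simps)
  moreover have "0 <= eps * cmod (w - w0)" using eps by simp
  ultimately show ?thesis unfolding real_norm_def by linarith
 qed
 show ?thesis
  using dl(1) main unfolding t_def by blast
qed

lemma smooth_E:
 assumes "d : D"
 shows "smooth_on (sl d w Int sl d w0) (%z. complex_of_real (E w0 w d z))"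
  and "z : sl d w Int sl d w0 ==> lap (%z. complex_of_real (E w0 w d z)) z =
   of_real (exp (ph d w z) - exp (ph d w0 z) - exp (ph d w0 z) * (2 * Re ((w - w0) * psi d w0 z)))"
  and "z : sl d w Int sl d w0 ==> dz (%z. complex_of_real (E w0 w d z)) z =
   Pz d w z - Pz d w0 z - ((w - w0) * dz (psi d w0) z + cnj ((w - w0) * dzbar (psi d w0) z))"
proof -
 define V where "V = sl d w Int sl d w0"
 have V: "open V" unfolding V_def by (intro open_Int open_sl assms)
 define k where "k = w - w0"
 define q where "q = (%z. k * psi d w0 z)"
 have re: "complex_of_real (2 * Re x) = x + cnj x" for x by (simp add: complex_add_cnj)
 have eq: "(%z. complex_of_real (E w0 w d z)) = (%z. (P d w z - P d w0 z) - (q z + cnj (q z)))"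
  unfolding E_def P_def q_def k_def of_real_diff re ..
 have sm: "smooth_on V (P d w)" "smooth_on V (P d w0)" "smooth_on V (psi d w0)"
  by (rule smo_subset[OF sm_P[OF assms]] smo_subset[OF sm_psi[OF assms]], simp add: V_def)+
 have smq: "smooth_on V q" unfolding q_def by (intro smo_mult smo_const V sm)
 show "smooth_on (sl d w Int sl d w0) (%z. complex_of_real (E w0 w d z))"
  unfolding V_def[symmetric] eq by (intro smo_diff smo_add smo_cnj V sm smq)
 show "lap (%z. complex_of_real (E w0 w d z)) z =
   of_real (exp (ph d w z) - exp (ph d w0 z) - exp (ph d w0 z) * (2 * Re ((w - w0) * psi d w0 z)))"
  if "z : sl d w Int sl d w0"
 proof -
  have z: "z : V" "z : sl d w" "z : sl d w0" using that by (auto simp: V_def)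
  have lq: "lap q z = k * (G d w0 z * psi d w0 z)"
   unfolding q_def lap_cmult[OF V z(1) sm(3)] lap_psi[OF assms z(3)] ..
  have "lap (%z. complex_of_real (E w0 w d z)) z = (lap (P d w) z - lap (P d w0) z) - (lap q z + cnj (lap q z))"
   unfolding eq
   by (simp only: lap_diff[OF V z(1)] lap_add[OF V z(1)] lap_cnj[OF V z(1)] smo_diff[OF V] smo_add[OF V]
     smo_cnj[OF V] sm smq)
  also have "... = (G d w z - G d w0 z) - G d w0 z * (k * psi d w0 z + cnj (k * psi d w0 z))"
   unfolding lq lap_P[OF assms z(2)] lap_P[OF assms z(3)] by (simp add: G_def algebra_simps)
  finally show ?thesis unfolding G_def re[symmetric] k_def by (simp only: of_real_diff of_real_mult)
 qed
 show "dz (%z. complex_of_real (E w0 w d z)) z =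
   Pz d w z - Pz d w0 z - ((w - w0) * dz (psi d w0) z + cnj ((w - w0) * dzbar (psi d w0) z))"
  if "z : sl d w Int sl d w0"
 proof -
  have z: "z : V" "z : sl d w" "z : sl d w0" using that by (auto simp: V_def)
  note wq = wirt_cmult[OF wirt_smooth[OF sm(3) z(1)], of k, folded q_def]
  show ?thesis
   unfolding eq k_def[symmetric]
   by (rule wirt_D(1)[OF wirt_diff[OF wirt_diff[OF wirt_P[OF assms z(2)] wirt_P[OF assms z(3)]] wirt_add[OF wq wirt_cnj[OF wq]]]])
 qed
qed

text \<open>The sign \<sigma> treats upper and lower bounds alike. No bound on the change of
  \<open>ph\<close> is known beforehand, so the exponential cannot be expanded; convexity,
  \<open>exp x >= 1 + x\<close>, settles \<sigma> \<open>= 1\<close>, and a lower bound for the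
  logarithm settles \<sigma> \<open>= -1\<close>. The factor \<open>C + 5\<close> is
  \<open>C + 1\<close> from the interior and 4 from the weight.\<close>

lemma first_order_one_sided:
 assumes gc: "good_cover w0 F r" and \<sigma>: "\<sigma> = 1 | \<sigma> = (-1::real)" and eta: "eta > 0"
  and C: "C >= 0" "!!i y. i : F ==> y : disc2 r i ==> 1 / ((r i)\<^sup>2 * exp (ph (fst i) w0 y)) <= C"
  and B: "B >= 0" "!!i y. i : F ==> y : disc2 r i ==> cmod (psi (fst i) w0 y) <= B"
 shows "\<forall>\<^sub>F w in at w0. ALL i:F. ALL y:disc2 r i. \<sigma> * E w0 w (fst i) y <= eta * (C + 5) * cmod (w - w0)"
proof -
 note gcD = good_coverD[OF gc]
 define U where "U = (%w d z. complex_of_real \<sigma> * complex_of_real (E w0 w d z))"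
 define \<kappa> where "\<kappa> = (%w. eta * cmod (w - w0))"
 have evr: "\<forall>\<^sub>F w in at w0. ALL i:F. dist w w0 < r i"
  by (rule eventually_ball_finite[OF gcD(1)]) (use gcD(3) in "auto simp: eventually_at")
 have "\<forall>\<^sub>F w in at w0. ALL K M. \<kappa> w < 3 * K --> 0 <= K -->
  (ALL i:F. ALL y:ball (snd i) (2 * r i). Re (lap (U w (fst i)) y) <= K / (r i)\<^sup>2 --> Re (U w (fst i) y) <= M) -->
  (ALL i:F. ALL y:disc2 r i. Re (U w (fst i) y) <= M + 4 * K)"
 proof (rule fibre_max_principle[OF gc])
  show "\<forall>\<^sub>F w in at w0. ALL i:F. EX V. open V & disc2 r i <= V & smooth_on V (U w (fst i))"
   using evr
  proof (rule eventually_mono, intro ballI)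
   fix w i assume "ALL i:F. dist w w0 < r i" and i: "i : F"
   then have "disc2 r i <= sl (fst i) w" using gcD(6)[OF i] by blast
   moreover have "disc2 r i <= sl (fst i) w0" using gcD(5)[OF i] by blast
   moreover have "open (sl (fst i) w Int sl (fst i) w0)" by (intro open_Int open_sl gcD(2) i)
   moreover have "smooth_on (sl (fst i) w Int sl (fst i) w0) (U w (fst i))"
    unfolding U_def by (intro smo_mult smo_const smooth_E(1) gcD(2) i open_Int open_sl)
   ultimately show "EX V. open V & disc2 r i <= V & smooth_on V (U w (fst i))" by blast
  qed
  fix i j z assume ij: "i : F" "j : F" "z : disc2 r i" and zov: "(z, w0) : ov (fst i) (fst j)"
   and dist: "dist (tr (fst i) (fst j) (z, w0)) (snd j) < r j"
  have de: "fst i : D" "fst j : D" using gcD(2) ij by auto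
  obtain dl1 where dl1: "dl1 > 0" "ALL y w. dist y z < dl1 --> dist w w0 < dl1 --> (y, w) : ov (fst i) (fst j) &
   \<bar>E w0 w (fst i) y - E w0 w (fst j) (tr (fst i) (fst j) (y, w))\<bar> <= eta * cmod (w - w0)"
   using transition_first_order[OF de zov eta] by blast
  obtain dl2 where dl2: "dl2 > 0" "!!y w. dist y z < dl2 ==> dist w w0 < dl2 ==> (y, w) : ov (fst i) (fst j) &
    dist (tr (fst i) (fst j) (y, w)) (tr (fst i) (fst j) (z, w0)) < r j - dist (tr (fst i) (fst j) (z, w0)) (snd j)"
   using continuous_on_box[OF hol2_open[OF tr_hol2[OF de]] hol2_continuous_on[OF tr_hol2[OF de]] zov,
     of "r j - dist (tr (fst i) (fst j) (z, w0)) (snd j)"] dist by auto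
  have "\<forall>\<^sub>F w in at w0. dist w w0 < min dl1 dl2"
   unfolding eventually_at using dl1 dl2 by (intro exI[of _ "min dl1 dl2"]) auto
  then have "\<forall>\<^sub>F w in at w0. ALL y:ball z (min dl1 dl2). EX y':cball (snd j) (r j). Re (U w (fst i) y) <= Re (U w (fst j) y') + \<kappa> w"
  proof (rule eventually_mono, intro ballI)
   fix w y assume w: "dist w w0 < min dl1 dl2" and y: "y : ball z (min dl1 dl2)"
   define y' where "y' = tr (fst i) (fst j) (y, w)"
   have "dist y' (tr (fst i) (fst j) (z, w0)) < r j - dist (tr (fst i) (fst j) (z, w0)) (snd j)"
    using dl2(2)[of y w] w y by (simp add: y'_def dist_commute)
   then have "y' : cball (snd j) (r j)"
    using dist_triangle[of y' "snd j" "tr (fst i) (fst j) (z, w0)"] by (simp add: dist_commute)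
   moreover have "\<bar>E w0 w (fst i) y - E w0 w (fst j) y'\<bar> <= \<kappa> w"
    using dl1(2) w y by (simp add: y'_def dist_commute \<kappa>_def)
   then have "Re (U w (fst i) y) <= Re (U w (fst j) y') + \<kappa> w"
    using \<sigma> by (auto simp: U_def)
   ultimately show "EX y':cball (snd j) (r j). Re (U w (fst i) y) <= Re (U w (fst j) y') + \<kappa> w" by blast
  qed
  then show "EX dl>0. \<forall>\<^sub>F w in at w0. ALL y:ball z dl. EX y':cball (snd j) (r j). Re (U w (fst i) y) <= Re (U w (fst j) y') + \<kappa> w"
   using dl1(1) dl2(1) by (intro exI[of _ "min dl1 dl2"]) simp
 qed
 moreover define Q where "Q = 2 * B + eta * C"
 have Q: "Q >= 0" using B C eta by (simp add: Q_def)
 \<comment> \<open>The first entry makes \<open>x\<close> below at most 1/2 in modulus, the second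
   makes \<open>2 * x\<^sup>2\<close> at most \<open>K\<close>; \<open>Q\<close> bounds
   \<open>x\<close> relative to the distance of \<open>w\<close> from \<open>w0\<close>.\<close>
 define s where "s = min (1 / (2 * (Q + 1))) (eta / (2 * (Q + 1)\<^sup>2))"
 have s: "s > 0" using Q eta by (simp add: s_def add_nonneg_pos)
 have "\<forall>\<^sub>F w in at w0. w ~= w0 & cmod (w - w0) <= s"
  unfolding eventually_at using s by (intro exI[of _ s]) (auto simp: dist_norm)
 ultimately show ?thesis using evr
 proof eventually_elim
  case (elim w)
  define \<kappa>' where "\<kappa>' = cmod (w - w0)"
  have k: "\<kappa>' > 0" "\<kappa>' <= s" using elim by (auto simp: \<kappa>'_def)
  define K where "K = eta * \<kappa>'"
  have K: "K > 0" using eta k by (simp add: K_def)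
  have "ALL i:F. ALL y:ball (snd i) (2 * r i). Re (lap (U w (fst i)) y) <= K / (r i)\<^sup>2 --> Re (U w (fst i) y) <= K * (C + 1)"
  proof (intro ballI impI)
   fix i y assume i: "i : F" and y: "y : ball (snd i) (2 * r i)" and l: "Re (lap (U w (fst i)) y) <= K / (r i)\<^sup>2"
   have y': "y : disc2 r i" using y by simp
   define g where "g = exp (ph (fst i) w0 y)"
   have g: "g > 0" by (simp add: g_def)
   define L where "L = 2 * Re ((w - w0) * psi (fst i) w0 y)"
   define \<Delta> where "\<Delta> = ph (fst i) w y - ph (fst i) w0 y"
   have ysl: "y : sl (fst i) w Int sl (fst i) w0" using gcD(5,6)[OF i] elim i y' by blast
   have "lap (U w (fst i)) y = of_real \<sigma> * lap (%z. complex_of_real (E w0 w (fst i) z)) y"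
    unfolding U_def by (rule lap_cmult[OF _ ysl smooth_E(1)[OF gcD(2)[OF i]]]) (intro open_Int open_sl gcD(2) i)
   then have "Re (lap (U w (fst i)) y) = \<sigma> * (exp (ph (fst i) w y) - g - g * L)"
    unfolding smooth_E(2)[OF gcD(2)[OF i] ysl] by (simp add: g_def L_def)
   moreover have "exp (ph (fst i) w y) = g * exp \<Delta>" by (simp add: g_def \<Delta>_def flip: exp_add)
   ultimately have "g * (\<sigma> * (exp \<Delta> - 1 - L)) <= K / (r i)\<^sup>2"
    using l by (simp add: algebra_simps)
   then have "\<sigma> * (exp \<Delta> - 1 - L) <= K / (r i)\<^sup>2 / g"
    using g by (subst pos_le_divide_eq) (simp_all add: mult.commute)
   also have "... = K * (1 / ((r i)\<^sup>2 * g))" by simp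
   also have "... <= K * C" using C(2)[OF i y'] K by (intro mult_left_mono) (auto simp: g_def)
   finally have 1: "\<sigma> * (exp \<Delta> - 1 - L) <= K * C" .
   have ReU: "Re (U w (fst i) y) = \<sigma> * (\<Delta> - L)" by (simp add: U_def E_def \<Delta>_def L_def)
   show "Re (U w (fst i) y) <= K * (C + 1)"
   proof (cases "\<sigma> = 1")
    case True
    then have "exp \<Delta> - 1 - L <= K * C" "Re (U w (fst i) y) = \<Delta> - L" using 1 ReU by simp_all
    then show ?thesis using exp_ge_add_one_self[of \<Delta>] K unfolding distrib_left by linarith
   next
    case False
    then have s1: "\<sigma> = -1" using \<sigma> by simp
    \<comment> \<open>From \<open>1 + x <= exp \<Delta>\<close> follows
      \<open>\<Delta> >= ln (1 + x) >= x - 2 x^2\<close>, and the quadratic error is at most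
      \<open>K\<close> by the choice of \<open>s\<close>.\<close>
    define x where "x = L - K * C"
    have x1: "exp \<Delta> >= 1 + x" using 1 s1 by (simp add: x_def)
    have "(abs L) <= 2 * (\<kappa>' * B)"
    proof -
     have "\<bar>Re ((w - w0) * psi (fst i) w0 y)\<bar> <= \<kappa>' * B"
      by (rule order.trans[OF abs_Re_le_cmod])
       (unfold norm_mult \<kappa>'_def, rule mult_left_mono[OF B(2)[OF i y'] norm_ge_zero])
     then show ?thesis unfolding L_def by linarith
    qed
    moreover have "K * C >= 0" using K C(1) by simp
    then have "(abs x) <= (abs L) + K * C" unfolding x_def by linarith
    ultimately have "(abs x) <= \<kappa>' * Q" by (simp add: K_def Q_def algebra_simps)
    also have "... <= \<kappa>' * (Q + 1)" using k by simp
    finally have xQ: "(abs x) <= \<kappa>' * (Q + 1)" .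
    have "\<kappa>' * (Q + 1) <= 1 / 2"
    proof -
     have "\<kappa>' <= 1 / (2 * (Q + 1))" using k by (simp add: s_def)
     then show ?thesis using Q by (simp add: field_simps)
    qed
    then have x2: "(abs x) <= 1 / 2" using xQ by linarith
    have "2 * x\<^sup>2 <= K"
    proof -
     have "2 * x\<^sup>2 <= 2 * (\<kappa>' * (Q + 1))\<^sup>2" using power_mono[OF xQ, of 2] by simp
     also have "... = \<kappa>' * (\<kappa>' * (2 * (Q + 1)\<^sup>2))" by (simp add: power2_eq_square)
     also have "... <= \<kappa>' * eta"
     proof (rule mult_left_mono)
      have "\<kappa>' <= eta / (2 * (Q + 1)\<^sup>2)" using k by (simp add: s_def)
      moreover have "2 * (Q + 1)\<^sup>2 > 0" using Q by (simp add: add_nonneg_pos)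
      ultimately show "\<kappa>' * (2 * (Q + 1)\<^sup>2) <= eta" by (simp only: pos_le_divide_eq)
     qed (use k in simp)
     finally show ?thesis by (simp add: K_def mult.commute)
    qed
    moreover have "ln (1 + x) <= \<Delta>"
    proof -
     have "1 + x > 0" using x2 by simp
     then have "ln (1 + x) <= ln (exp \<Delta>)" using x1 by (intro ln_mono) auto
     then show ?thesis by simp
    qed
    moreover have "\<bar>ln (1 + x) - x\<bar> <= 2 * x\<^sup>2" by (rule abs_ln_one_plus_x_minus_x_bound[OF x2])
    ultimately have "L - \<Delta> <= K * C + K" unfolding x_def by linarith
    then show ?thesis using ReU s1 by (simp add: distrib_left)
   qed
  qed
  moreover have "\<kappa> w < 3 * K" using K by (simp add: K_def \<kappa>_def \<kappa>'_def)
  ultimately have "ALL i:F. ALL y:disc2 r i. Re (U w (fst i) y) <= K * (C + 1) + 4 * K"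
   using elim(1) K by (meson less_imp_le)
  moreover have "K * (C + 1) + 4 * K = eta * (C + 5) * cmod (w - w0)" by (simp add: K_def \<kappa>'_def algebra_simps)
  ultimately show ?case by (simp add: U_def)
 qed
qed

text \<open>The two one-sided bounds combine, with \<open>eta\<close> rescaled by
  \<open>C + 5\<close>. Since the error vanishes at \<open>w = w0\<close>, the punctured
  neighbourhood may be filled.\<close>

lemma ph_first_order:
 assumes gc: "good_cover w0 F r" and eta: "eta > 0"
 shows "\<forall>\<^sub>F w in nhds w0. ALL i:F. ALL y:disc2 r i. \<bar>E w0 w (fst i) y\<bar> <= eta * cmod (w - w0)"
proof -
 note gcD = good_coverD[OF gc]
 from inverse_metric_bound[OF gc] obtain C where "C >= 0 & (ALL i:F. ALL y:disc2 r i. 1 / ((r i)\<^sup>2 * exp (ph (fst i) w0 y)) <= C)" ..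
 then have C: "C >= 0" "!!i y. i : F ==> y : disc2 r i ==> 1 / ((r i)\<^sup>2 * exp (ph (fst i) w0 y)) <= C"
  by auto
 have "continuous_on (disc2 r i) (psi (fst i) w0)" if i: "i : F" for i
  by (rule continuous_on_subset[OF smo_imp_continuous_on[OF sm_psi[OF gcD(2)[OF i]]]]) (use gcD(5)[OF i] in blast)
 from finite_compact_bound[where F = F and K = "%i. disc2 r i" and h = "%i. psi (fst i) w0", OF gcD(1) compact_cball this]
 obtain B where "B >= 0 & (ALL i:F. ALL y:disc2 r i. cmod (psi (fst i) w0 y) <= B)" ..
 then have B: "B >= 0" "!!i y. i : F ==> y : disc2 r i ==> cmod (psi (fst i) w0 y) <= B" by auto
 have eta': "eta / (C + 5) > 0" using eta C(1) by simp
 have e: "eta / (C + 5) * (C + 5) = eta" using C(1) by simp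
 have "\<forall>\<^sub>F w in at w0. ALL i:F. ALL y:disc2 r i. \<bar>E w0 w (fst i) y\<bar> <= eta * cmod (w - w0)"
 proof -
  have one: "\<forall>\<^sub>F w in at w0. ALL i:F. ALL y:disc2 r i. \<sigma> * E w0 w (fst i) y <= eta * cmod (w - w0)"
   if "\<sigma> = 1 | \<sigma> = -1" for \<sigma>
  proof -
   have "\<forall>\<^sub>F w in at w0. ALL i:F. ALL y:disc2 r i. \<sigma> * E w0 w (fst i) y <= eta / (C + 5) * (C + 5) * cmod (w - w0)"
    by (rule first_order_one_sided[OF gc that eta' C(1) _ B(1)]) (use C(2) B(2) in auto)
   then show ?thesis unfolding e .
  qed
  have "\<forall>\<^sub>F w in at w0. (ALL i:F. ALL y:disc2 r i. 1 * E w0 w (fst i) y <= eta * cmod (w - w0)) &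
   (ALL i:F. ALL y:disc2 r i. -1 * E w0 w (fst i) y <= eta * cmod (w - w0))"
   by (intro eventually_conj one) auto
  then show ?thesis by (rule eventually_mono) (auto simp: abs_le_iff)
 qed
 moreover have "E w0 w0 d y = 0" for d y by (simp add: E_def)
 ultimately show ?thesis unfolding eventually_at_filter by (auto elim!: eventually_mono)
qed

end

lemma unif_small_of_tendsto:
 assumes "\<forall>\<^sub>F p in FF. ALL z:K. cmod (f p z) <= C * (q p * s p)" "(q \<longlongrightarrow> 0) FF" "C >= 0" "!!p. s p >= 0"
 shows "unif_small FF K f s"
 unfolding unif_small_def
proof (intro allI impI)
 fix eta :: real assume eta: "eta > 0"
 have "\<forall>\<^sub>F p in FF. \<bar>q p\<bar> < eta / (C + 1)"
  using tendstoD[OF assms(2), of "eta / (C + 1)"] eta assms(3) by (simp add: dist_norm)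
 with assms(1) show "\<forall>\<^sub>F p in FF. ALL z:K. cmod (f p z) <= eta * s p"
 proof eventually_elim
  case (elim p)
  have "C * q p <= C * (eta / (C + 1))"
   using elim(2) assms(3) by (intro mult_left_mono) auto
  also have "... <= (C + 1) * (eta / (C + 1))"
   using eta assms(3) by (intro mult_right_mono) auto
  also have "... = eta" using assms(3) by simp
  finally have "C * q p * s p <= eta * s p" using assms(4) by (rule mult_right_mono)
  then show ?case using elim(1) by (fastforce simp: mult.assoc)
 qed
qed

lemma cball_bound:
 fixes h :: "complex => complex"
 assumes "continuous_on (cball z0 rho) h"
 shows "EX C>=0. ALL z:cball z0 rho. cmod (h z) <= C"
 using finite_compact_bound[where F = "{()}" and K = "%_. cball z0 rho" and h = "%_. h"] assms by simp

lemma unif_small_eventually_bounded: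
 assumes "unif_small FF K (%p z. f p z - f0 z) (%_. 1)" "!!z. z : K ==> cmod (f0 z) <= C"
 shows "\<forall>\<^sub>F p in FF. ALL z:K. cmod (f p z) <= (C + 1) * 1"
 using unif_smallD[OF assms(1) zero_less_one]
proof (rule eventually_mono, intro ballI)
 fix p z assume "ALL z:K. cmod (f p z - f0 z) <= 1 * 1" and z: "z : K"
 then have "cmod (f p z - f0 z) <= 1" by simp
 then show "cmod (f p z) <= (C + 1) * 1" using assms(2)[OF z] norm_triangle_sub[of "f p z" "f0 z"] by simp
qed

lemma unif_small_mult_diff:
 assumes f: "unif_small FF K (%p z. f p z - f0 z) (%_. 1)" and h: "unif_small FF K (%p z. h p z - h0 z) (%_. 1)"
  and "EX C>=0. ALL z:K. cmod (f0 z) <= C" "EX C>=0. ALL z:K. cmod (h0 z) <= C"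
 shows "unif_small FF K (%p z. f p z * h p z - f0 z * h0 z) (%_. 1)"
proof -
 obtain C1 C2 where C: "C1 >= 0" "ALL z:K. cmod (f0 z) <= C1" "C2 >= 0" "ALL z:K. cmod (h0 z) <= C2" using assms(3,4) by blast
 have 1: "unif_small FF K (%p z. f p z * (h p z - h0 z)) (%p. 1 * 1)"
  by (rule unif_small_mult[OF h _ unif_small_eventually_bounded[OF f, of C1]]) (use C in auto)
 have 2: "unif_small FF K (%p z. h0 z * (f p z - f0 z)) (%p. 1 * 1)"
  by (rule unif_small_mult[OF f C(3)]) (use C in auto)
 show ?thesis using unif_small_add[OF 1 2] by (simp add: algebra_simps)
qed

context hyperbolic_charts
begin

section \<open>First derivatives of the metric in the parameter\<close>

lemma sl_eventually:
 assumes "rho > 0" "cball z0 rho \<times> cball w0 rho <= Om d"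
 shows "\<forall>\<^sub>F w in nhds w0. cball z0 rho <= sl d w" "cball z0 rho <= sl d w0"
proof -
 have *: "cball z0 rho <= sl d w" if "w : cball w0 rho" for w
  using assms(2) that by (auto simp: sl_def)
 then show "cball z0 rho <= sl d w0" using assms(1) by simp
 have "\<forall>\<^sub>F w in nhds w0. w : ball w0 rho" using assms(1) by (intro eventually_nhds_in_open) auto
 then show "\<forall>\<^sub>F w in nhds w0. cball z0 rho <= sl d w"
  by (rule eventually_mono) (use * in auto)
qed

lemma E_small:
 assumes "d : D" "(z0, w0) : Om d"
 obtains rho where "rho > 0" "cball z0 rho \<times> cball w0 rho <= Om d"
  "usmall w0 z0 rho (%w z. complex_of_real (E w0 w d z)) (%w. cmod (w - w0))"
proof -
 obtain F r where gc: "good_cover w0 F r" and dF: "(d, z0) : F" by (rule good_cover_exists[OF assms])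
 note gcD = good_coverD[OF gc]
 show ?thesis
 proof (rule that[of "2 * r (d, z0)"])
  show "2 * r (d, z0) > 0" using gcD(3)[OF dF] by simp
  show "cball z0 (2 * r (d, z0)) \<times> cball w0 (2 * r (d, z0)) <= Om d"
   using gcD(4)[OF dF] by auto
  show "unif_small (nhds w0) (cball z0 (2 * r (d, z0))) (%w z. complex_of_real (E w0 w d z)) (%w. cmod (w - w0))"
   unfolding unif_small_def
  proof (intro allI impI)
   fix eta :: real assume "eta > 0"
   from ph_first_order[OF gc this]
   show "\<forall>\<^sub>F w in nhds w0. ALL z:cball z0 (2 * r (d, z0)). cmod (complex_of_real (E w0 w d z)) <= eta * cmod (w - w0)"
    by (rule eventually_mono) (use dF in force)
  qed
 qed
qed

lemma cont_slices:
 assumes "d : D" "K <= sl d w"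
 shows "continuous_on K (P d w)" "continuous_on K (Pz d w)" "continuous_on K (G d w)" "continuous_on K (psi d w)"
  "continuous_on K (dz (psi d w))" "continuous_on K (a d w)" "continuous_on K (dz (Pz d w))"
 by (rule continuous_on_subset[OF smo_imp_continuous_on assms(2)],
   intro sm_P sm_Pz sm_G sm_psi sm_a smo_dz open_sl assms)+

lemma lap_Pz: "d : D ==> z : sl d w ==> lap (Pz d w) z = G d w z * Pz d w z"
 by (rule lap_I[OF open_sl _ wirt_Pz wirt_G])

text \<open>A bootstrap. The expansion of \<open>ph\<close> gives a Lipschitz bound in
  \<open>w\<close>, hence continuity of \<open>G\<close>. As the Laplacians of \<open>P\<close> and
  \<open>Pz\<close> are expressed by \<open>G\<close> and \<open>Pz\<close>, gradient estimates give
  continuity of \<open>Pz\<close> and then of its derivative. The expansion of \<open>ph\<close> may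
  itself be differentiated in \<open>z\<close>, because the Laplacian of the error is again
  small.\<close>

lemma first_regularity:
 assumes d: "d : D" and zw: "(z0, w0) : Om d"
 obtains rho where "rho > 0" "cball z0 rho \<times> cball w0 rho <= Om d"
  "usmall w0 z0 rho (%w z. complex_of_real (E w0 w d z)) (%w. cmod (w - w0))"
  "usmall w0 z0 rho (%w z. P d w z - P d w0 z) (%_. 1)"
  "usmall w0 z0 rho (%w z. G d w z - G d w0 z) (%_. 1)"
  "usmall w0 z0 rho (%w z. Pz d w z - Pz d w0 z) (%_. 1)"
  "usmall w0 z0 rho (%w z. dz (Pz d w) z - dz (Pz d w0) z) (%_. 1)"
  "usmall w0 z0 rho (%w z. Pz d w z - Pz d w0 z -
    ((w - w0) * dz (psi d w0) z + cnj ((w - w0) * dzbar (psi d w0) z))) (%w. cmod (w - w0))"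
proof -
 obtain rho where rho: "rho > 0" "cball z0 rho \<times> cball w0 rho <= Om d"
  and ES: "usmall w0 z0 rho (%w z. complex_of_real (E w0 w d z)) (%w. cmod (w - w0))"
  by (rule E_small[OF d zw])
 note sl0 = sl_eventually(2)[OF rho] and sle = sl_eventually(1)[OF rho]
 define K where "K = cball z0 rho"
 define K2 where "K2 = cball z0 (rho / 2)"
 have K2: "K2 <= K" "K2 <= sl d w0" using rho sl0 by (auto simp: K_def K2_def)
 have k0: "((%w. cmod (w - w0)) \<longlongrightarrow> 0) (nhds w0)"
  using tendsto_norm[OF tendsto_diff[OF filterlim_ident[of "nhds w0"] tendsto_const[of w0]]] by simp
 have small1: "\<forall>\<^sub>F w in nhds w0. cmod (w - w0) <= 1 * 1"
  using tendstoD[OF k0, of 1] by (rule eventually_mono) auto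
 obtain B where B: "B >= 0" "ALL z:K. cmod (psi d w0 z) <= B"
  using cball_bound[OF cont_slices(4)[OF d sl0]] unfolding K_def by blast
 obtain C where C: "C >= 0" "ALL z:K. cmod (G d w0 z) <= C"
  using cball_bound[OF cont_slices(3)[OF d sl0]] unfolding K_def by blast
 have Pdiff: "cmod (P d w z - P d w0 z) = \<bar>ph d w z - ph d w0 z\<bar>" for w z
  unfolding P_def of_real_diff[symmetric] norm_of_real ..
 have Lip: "\<forall>\<^sub>F w in nhds w0. ALL z:K. \<bar>ph d w z - ph d w0 z\<bar> <= (2 * B + 1) * cmod (w - w0)"
  using unif_smallD[OF ES zero_less_one]
 proof (rule eventually_mono, intro ballI)
  fix w z assume "ALL z:cball z0 rho. cmod (complex_of_real (E w0 w d z)) <= 1 * cmod (w - w0)" and z: "z : K"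
  then have "\<bar>E w0 w d z\<bar> <= cmod (w - w0)" by (simp add: K_def)
  moreover have "\<bar>Re ((w - w0) * psi d w0 z)\<bar> <= cmod (w - w0) * B"
   by (rule order.trans[OF abs_Re_le_cmod])
    (unfold norm_mult, rule mult_left_mono, use B z in auto)
  moreover have "(2 * B + 1) * cmod (w - w0) = 2 * (cmod (w - w0) * B) + cmod (w - w0)"
   by (simp add: algebra_simps)
  ultimately show "\<bar>ph d w z - ph d w0 z\<bar> <= (2 * B + 1) * cmod (w - w0)"
   unfolding E_def by linarith
 qed
 have P1: "unif_small (nhds w0) K (%w z. P d w z - P d w0 z) (%_. 1)"
  by (rule unif_small_of_tendsto[OF _ k0, of _ _ "2 * B + 1"]) (use Lip B in "simp_all add: Pdiff")
 have half: "\<forall>\<^sub>F w in nhds w0. ALL z:K. \<bar>ph d w z - ph d w0 z\<bar> <= 1 / 2"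
  using unif_smallD[OF P1, of "1/2"] by (simp add: Pdiff)
 have Gexp: "G d w z - G d w0 z = G d w0 z * of_real (exp (ph d w z - ph d w0 z) - 1)" for w z
  by (simp add: G_def exp_diff field_simps)
 have G1: "unif_small (nhds w0) K (%w z. G d w z - G d w0 z) (%_. 1)"
 proof (rule unif_small_of_tendsto[OF _ k0, of _ _ "C * (2 * (2 * B + 1))"])
  show "\<forall>\<^sub>F w in nhds w0. ALL z:K. cmod (G d w z - G d w0 z) <= C * (2 * (2 * B + 1)) * (cmod (w - w0) * 1)"
   using Lip half
  proof eventually_elim
   case (elim w)
   show ?case
   proof
    fix z assume z: "z : K"
    have "cmod (G d w z - G d w0 z) <= C * (2 * ((2 * B + 1) * cmod (w - w0)))"
     unfolding Gexp norm_mult norm_of_real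
    proof (rule mult_mono)
     have "\<bar>exp (ph d w z - ph d w0 z) - 1\<bar> <= 2 * \<bar>ph d w z - ph d w0 z\<bar>"
      using elim z by (intro exp_remainder) auto
     also have "... <= 2 * ((2 * B + 1) * cmod (w - w0))" using elim(1) z by (intro mult_left_mono) auto
     finally show "\<bar>exp (ph d w z - ph d w0 z) - 1\<bar> <= 2 * ((2 * B + 1) * cmod (w - w0))" .
    qed (use C z in auto)
    then show "cmod (G d w z - G d w0 z) <= C * (2 * (2 * B + 1)) * (cmod (w - w0) * 1)" by (simp add: algebra_simps)
   qed
  qed
 qed (use B C in auto)
 have smd: "\<forall>\<^sub>F w in nhds w0. EX V. open V & cball z0 rho' <= V & smooth_on V (%z. f w z - f w0 z)"
  if f: "!!w. smooth_on (sl d w) (f w)" and rho': "rho' <= rho" for f :: "complex => complex => complex" and rho'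
  using sle
 proof (rule eventually_mono)
  fix w assume w: "cball z0 rho <= sl d w"
  have V: "open (sl d w Int sl d w0)" by (intro open_Int open_sl d)
  have "smooth_on (sl d w Int sl d w0) (f w)" "smooth_on (sl d w Int sl d w0) (f w0)"
   using f[of w] f[of w0] by (auto intro: smo_subset)
  then have "smooth_on (sl d w Int sl d w0) (%z. f w z - f w0 z)" by (rule smo_diff[OF V])
  moreover have "cball z0 rho' <= sl d w Int sl d w0" using w sl0 rho' by (auto simp: subset_iff)
  ultimately show "EX V. open V & cball z0 rho' <= V & smooth_on V (%z. f w z - f w0 z)" using V by blast
 qed
 have dP: "\<forall>\<^sub>F w in nhds w0. ALL z:K. lap (%z. P d w z - P d w0 z) z = G d w z - G d w0 z &
   dz (%z. P d w z - P d w0 z) z = Pz d w z - Pz d w0 z &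
   lap (%z. Pz d w z - Pz d w0 z) z = G d w z * Pz d w z - G d w0 z * Pz d w0 z &
   dz (%z. Pz d w z - Pz d w0 z) z = dz (Pz d w) z - dz (Pz d w0) z"
  using sle
 proof (rule eventually_mono, intro ballI)
  fix w z assume "cball z0 rho <= sl d w" "z : K"
  then have z: "z : sl d w" "z : sl d w0" "z : sl d w Int sl d w0" using sl0 by (auto simp: K_def)
  have V: "open (sl d w Int sl d w0)" by (intro open_Int open_sl d)
  have sm: "smooth_on (sl d w Int sl d w0) (P d w)" "smooth_on (sl d w Int sl d w0) (P d w0)"
   "smooth_on (sl d w Int sl d w0) (Pz d w)" "smooth_on (sl d w Int sl d w0) (Pz d w0)"
   by (rule smo_subset[OF sm_P[OF d]] smo_subset[OF sm_Pz[OF d]], simp)+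
  show "lap (%z. P d w z - P d w0 z) z = G d w z - G d w0 z &
   dz (%z. P d w z - P d w0 z) z = Pz d w z - Pz d w0 z &
   lap (%z. Pz d w z - Pz d w0 z) z = G d w z * Pz d w z - G d w0 z * Pz d w0 z &
   dz (%z. Pz d w z - Pz d w0 z) z = dz (Pz d w) z - dz (Pz d w0) z"
   using lap_diff[OF V z(3) sm(1,2)] lap_diff[OF V z(3) sm(3,4)] lap_P[OF d z(1)] lap_P[OF d z(2)]
    lap_Pz[OF d z(1)] lap_Pz[OF d z(2)] wirt_D(1)[OF wirt_diff[OF wirt_P[OF d z(1)] wirt_P[OF d z(2)]]]
    wirt_D(1)[OF wirt_diff[OF wirt_Pz[OF d z(1)] wirt_Pz[OF d z(2)]]] by simp
 qed
 have Pz2: "unif_small (nhds w0) K2 (%w z. Pz d w z - Pz d w0 z) (%_. 1)"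
 proof (rule unif_small_cong)
  show "unif_small (nhds w0) K2 (%w. dz (%z. P d w z - P d w0 z)) (%_. 1)"
   unfolding K2_def
  proof (rule unif_small_gradient(1)[OF rho(1)])
   show "usmall w0 z0 rho (%w z. P d w z - P d w0 z) (%_. 1)" using P1 by (simp add: K_def)
   show "usmall w0 z0 rho (%w. lap (%z. P d w z - P d w0 z)) (%_. 1)"
    by (rule unif_small_cong[OF G1[unfolded K_def]]) (use dP in "auto simp: K_def elim: eventually_mono")
  qed (rule smd[OF sm_P[OF d] order.refl])
  show "\<forall>\<^sub>F w in nhds w0. ALL z:K2. Pz d w z - Pz d w0 z = dz (%z. P d w z - P d w0 z) z"
   using dP by (rule eventually_mono) (use K2 in auto)
 qed
 have Pz3: "unif_small (nhds w0) (cball z0 (rho / 4)) (%w z. dz (Pz d w) z - dz (Pz d w0) z) (%_. 1)"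
 proof (rule unif_small_cong)
  have "unif_small (nhds w0) K2 (%w z. G d w z * Pz d w z - G d w0 z * Pz d w0 z) (%_. 1)"
   using cball_bound[OF cont_slices(2)[OF d K2(2)[unfolded K2_def]]] cball_bound[OF cont_slices(3)[OF d K2(2)[unfolded K2_def]]]
   by (intro unif_small_mult_diff unif_small_subset[OF G1 K2(1)] Pz2) (simp_all add: K2_def)
  then have l: "unif_small (nhds w0) K2 (%w. lap (%z. Pz d w z - Pz d w0 z)) (%_. 1)"
   by (rule unif_small_cong) (use dP K2(1) in "auto elim!: eventually_mono")
  have "unif_small (nhds w0) (cball z0 (rho / 2 / 2)) (%w. dz (%z. Pz d w z - Pz d w0 z)) (%_. 1)"
   by (rule unif_small_gradient(1)[OF _ _ Pz2[unfolded K2_def] l[unfolded K2_def]])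
    (use rho smd[OF sm_Pz[OF d], of "rho / 2"] in simp_all)
  then show "unif_small (nhds w0) (cball z0 (rho / 4)) (%w. dz (%z. Pz d w z - Pz d w0 z)) (%_. 1)" by simp
  show "\<forall>\<^sub>F w in nhds w0. ALL z:cball z0 (rho / 4). dz (Pz d w) z - dz (Pz d w0) z = dz (%z. Pz d w z - Pz d w0 z) z"
   using dP by (rule eventually_mono) (use rho in "auto simp: K_def")
 qed
 have E2: "unif_small (nhds w0) K2 (%w z. Pz d w z - Pz d w0 z -
    ((w - w0) * dz (psi d w0) z + cnj ((w - w0) * dzbar (psi d w0) z))) (%w. cmod (w - w0))"
 proof (rule unif_small_cong)
  \<comment> \<open>The Laplacian of the error is \<open>G\<close> times the sum of the quadratic
    remainder of the exponential and the error itself. The remainder is of second order by the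
    Lipschitz bound.\<close>
  have "unif_small (nhds w0) K (%w z. G d w0 z * of_real (exp (ph d w z - ph d w0 z) - 1 - (ph d w z - ph d w0 z))) (%w. cmod (w - w0))"
  proof (rule unif_small_of_tendsto[OF _ k0, of _ _ "C * (2 * B + 1)\<^sup>2"])
   show "\<forall>\<^sub>F w in nhds w0. ALL z:K. cmod (G d w0 z * of_real (exp (ph d w z - ph d w0 z) - 1 - (ph d w z - ph d w0 z)))
     <= C * (2 * B + 1)\<^sup>2 * (cmod (w - w0) * cmod (w - w0))"
    using Lip half
   proof eventually_elim
    case (elim w)
    show ?case
    proof
     fix z assume z: "z : K"
     have "cmod (G d w0 z * of_real (exp (ph d w z - ph d w0 z) - 1 - (ph d w z - ph d w0 z))) <= C * ((2 * B + 1) * cmod (w - w0))\<^sup>2"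
      unfolding norm_mult norm_of_real
     proof (rule mult_mono)
      have "\<bar>exp (ph d w z - ph d w0 z) - 1 - (ph d w z - ph d w0 z)\<bar> <= (ph d w z - ph d w0 z)\<^sup>2"
       using elim z by (intro exp_remainder) auto
      also have "... = \<bar>ph d w z - ph d w0 z\<bar>\<^sup>2" by simp
      also have "... <= ((2 * B + 1) * cmod (w - w0))\<^sup>2" using elim(1) z by (intro power_mono) auto
      finally show "\<bar>exp (ph d w z - ph d w0 z) - 1 - (ph d w z - ph d w0 z)\<bar> <= ((2 * B + 1) * cmod (w - w0))\<^sup>2" .
     qed (use C z in auto)
     then show "cmod (G d w0 z * of_real (exp (ph d w z - ph d w0 z) - 1 - (ph d w z - ph d w0 z)))
      <= C * (2 * B + 1)\<^sup>2 * (cmod (w - w0) * cmod (w - w0))"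
      by (simp add: power2_eq_square mult_ac)
    qed
   qed
  qed (use C in auto)
  moreover have "unif_small (nhds w0) K (%w z. G d w0 z * complex_of_real (E w0 w d z)) (%w. 1 * cmod (w - w0))"
   by (rule unif_small_mult[OF ES[folded K_def] C(1)]) (use C in auto)
  ultimately have "unif_small (nhds w0) K (%w z. G d w0 z * of_real (exp (ph d w z - ph d w0 z) - 1 - (ph d w z - ph d w0 z))
   + G d w0 z * complex_of_real (E w0 w d z)) (%w. cmod (w - w0))"
   by (intro unif_small_add) simp_all
  then have lE: "unif_small (nhds w0) K (%w. lap (%z. complex_of_real (E w0 w d z))) (%w. cmod (w - w0))"
  proof (rule unif_small_cong)
   show "\<forall>\<^sub>F w in nhds w0. ALL z:K. lap (%z. complex_of_real (E w0 w d z)) z =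
    G d w0 z * of_real (exp (ph d w z - ph d w0 z) - 1 - (ph d w z - ph d w0 z)) + G d w0 z * complex_of_real (E w0 w d z)"
    using sle
   proof (rule eventually_mono, intro ballI)
    fix w z assume "cball z0 rho <= sl d w" "z : K"
    then have z: "z : sl d w Int sl d w0" using sl0 by (auto simp: K_def)
    have "exp (ph d w z) = exp (ph d w0 z) * exp (ph d w z - ph d w0 z)" by (simp add: exp_diff)
    then have "exp (ph d w z) - exp (ph d w0 z) - exp (ph d w0 z) * (2 * Re ((w - w0) * psi d w0 z))
     = exp (ph d w0 z) * (exp (ph d w z - ph d w0 z) - 1 - (ph d w z - ph d w0 z)) + exp (ph d w0 z) * E w0 w d z"
     unfolding E_def by (simp only: right_diff_distrib)
    then show "lap (%z. complex_of_real (E w0 w d z)) z =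
     G d w0 z * of_real (exp (ph d w z - ph d w0 z) - 1 - (ph d w z - ph d w0 z)) + G d w0 z * complex_of_real (E w0 w d z)"
     unfolding smooth_E(2)[OF d z] G_def by (simp only: of_real_add of_real_mult)
   qed
  qed
  show "unif_small (nhds w0) K2 (%w. dz (%z. complex_of_real (E w0 w d z))) (%w. cmod (w - w0))"
   unfolding K2_def
  proof (rule unif_small_gradient(1)[OF rho(1) _ ES lE[unfolded K_def]])
   show "\<forall>\<^sub>F w in nhds w0. EX V. open V & cball z0 rho <= V & smooth_on V (%z. complex_of_real (E w0 w d z))"
    using sle
   proof (rule eventually_mono)
    fix w assume "cball z0 rho <= sl d w"
    then show "EX V. open V & cball z0 rho <= V & smooth_on V (%z. complex_of_real (E w0 w d z))"
     using sl0 smooth_E(1)[OF d, of w w0] by (intro exI[of _ "sl d w Int sl d w0"] conjI open_Int open_sl d) auto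
   qed
  qed
  show "\<forall>\<^sub>F w in nhds w0. ALL z:K2. Pz d w z - Pz d w0 z - ((w - w0) * dz (psi d w0) z + cnj ((w - w0) * dzbar (psi d w0) z))
    = dz (%z. complex_of_real (E w0 w d z)) z"
   using sle
  proof (rule eventually_mono, intro ballI)
   fix w z assume "cball z0 rho <= sl d w" "z : K2"
   then have "z : sl d w Int sl d w0" using K2 sl0 by (auto simp: K_def)
   from smooth_E(3)[OF d this] show "Pz d w z - Pz d w0 z - ((w - w0) * dz (psi d w0) z + cnj ((w - w0) * dzbar (psi d w0) z))
    = dz (%z. complex_of_real (E w0 w d z)) z" by simp
  qed
 qed
 have s: "cball z0 (rho / 4) <= K" "cball z0 (rho / 4) <= K2" using rho(1) by (auto simp: K_def K2_def)
 \<comment> \<open>Two successive gradient estimates halve the radius twice.\<close>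
 show ?thesis
 proof (rule that[of "rho / 4"])
  show "rho / 4 > 0" using rho by simp
  show "cball z0 (rho / 4) \<times> cball w0 (rho / 4) <= Om d" using rho by (auto simp: subset_iff)
  show "unif_small (nhds w0) (cball z0 (rho / 4)) (%w z. complex_of_real (E w0 w d z)) (%w. cmod (w - w0))"
   by (rule unif_small_subset[OF ES[folded K_def] s(1)])
 qed (rule unif_small_subset[OF P1 s(1)] unif_small_subset[OF G1 s(1)] unif_small_subset[OF Pz2 s(2)] Pz3
   unif_small_subset[OF E2 s(2)])+
qed

lemma continuous_on_first:
 assumes d: "d : D"
 shows "continuous_on (Om d) (%x. P d (snd x) (fst x))" "continuous_on (Om d) (%x. G d (snd x) (fst x))"
  "continuous_on (Om d) (%x. Pz d (snd x) (fst x))" "continuous_on (Om d) (%x. dz (Pz d (snd x)) (fst x))"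
proof -
 have "isCont (%x. P d (snd x) (fst x)) x & isCont (%x. G d (snd x) (fst x)) x & isCont (%x. Pz d (snd x) (fst x)) x
   & isCont (%x. dz (Pz d (snd x)) (fst x)) x" if "x : Om d" for x
 proof -
  obtain z0 w0 where x: "x = (z0, w0)" by force
  have zw: "(z0, w0) : Om d" "z0 : sl d w0" using that x by (auto simp: sl_def)
  obtain rho where rho: "rho > 0"
   "usmall w0 z0 rho (%w z. P d w z - P d w0 z) (%_. 1)"
   "usmall w0 z0 rho (%w z. G d w z - G d w0 z) (%_. 1)"
   "usmall w0 z0 rho (%w z. Pz d w z - Pz d w0 z) (%_. 1)"
   "usmall w0 z0 rho (%w z. dz (Pz d w) z - dz (Pz d w0) z) (%_. 1)"
   by (rule first_regularity[OF d zw(1)])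
  have c: "isCont k z0" if "continuous_on (sl d w0) k" for k :: "complex => complex"
   using that zw(2) open_sl[OF d] by (simp add: continuous_on_eq_continuous_at)
  show ?thesis
   unfolding x
   by (intro conjI unif_small_isCont[OF rho(1)] rho c cont_slices[OF d order.refl])
 qed
 then show "continuous_on (Om d) (%x. P d (snd x) (fst x))" "continuous_on (Om d) (%x. G d (snd x) (fst x))"
  "continuous_on (Om d) (%x. Pz d (snd x) (fst x))" "continuous_on (Om d) (%x. dz (Pz d (snd x)) (fst x))"
  by (auto intro: continuous_at_imp_continuous_on)
qed

end

text \<open>Strict differentiability: continuous Wirtinger derivatives make the quotient converge
  while the point \<open>z\<close> and the base point \<open>w\<close> move as well. The mean value
  inequality applies on a whole ball of parameters.\<close>

lemma strong_dq:
 fixes H :: "'z::metric_space \<times> complex => complex"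
 assumes "open U" "(z0, w0) : U"
  and H: "!!z w. (z, w) : U ==> wirt (%w. H (z, w)) (p (z, w)) (q (z, w)) w"
  and "continuous_on U p" "continuous_on U q" "eps > 0" "cmod v = 1"
 obtains dl where "dl > 0" "!!z w h. dist z z0 < dl ==> dist w w0 < dl ==> 0 < (abs h) ==> (abs h) < dl ==>
  (z, w) : U & (z, w + of_real h * v) : U &
  cmod ((H (z, w + of_real h * v) - H (z, w)) / of_real h - (v * p (z0, w0) + cnj v * q (z0, w0))) <= eps"
proof -
 define L where "L k = p (z0, w0) * k + q (z0, w0) * cnj k" for k
 have e2: "eps / 2 > 0" using assms(6) by simp
 obtain dl where dl: "dl > 0" "!!z w. dist z z0 < dl ==> dist w w0 < dl ==> (z, w) : U &
   dist (p (z, w), q (z, w)) (p (z0, w0), q (z0, w0)) < eps / 2"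
  using continuous_on_box[OF assms(1) continuous_on_Pair[OF assms(4,5)] assms(2) e2] by metis
 show ?thesis
 proof (rule that)
  show "dl / 2 > 0" using dl by simp
  fix z w and h :: real assume z: "dist z z0 < dl / 2" and w: "dist w w0 < dl / 2" and h: "0 < (abs h)" "(abs h) < dl / 2"
  have z': "dist z z0 < dl" using z dl(1) by simp
  have w2: "dist (w + of_real h * v) w0 < dl"
   using w h norm_triangle_ineq[of "w - w0" "of_real h * v"] assms(7) by (simp add: dist_norm norm_mult add_diff_eq diff_add_eq)
  have w1: "dist w w0 < dl" using w dl(1) by simp
  have "norm (H (z, w + of_real h * v) - H (z, w) - L (w + of_real h * v - w)) <= eps * norm (w + of_real h * v - w)"
  proof (rule increment_bound[where S = "ball w0 dl" and f = "%w. H (z, w)" and f' = "%w k. p (z, w) * k + q (z, w) * cnj k"])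
   show "((%w. H (z, w)) has_derivative (%k. p (z, x) * k + q (z, x) * cnj k)) (at x)" if "x : ball w0 dl" for x
    using H[of z x] dl(2)[OF z', of x] that by (simp add: wirt_def dist_commute)
   show "bounded_linear L" unfolding L_def
    by (intro bounded_linear_add bounded_linear_const_mult bounded_linear_ident bounded_linear_cnj)
   show "norm (p (z, x) * k + q (z, x) * cnj k - L k) <= eps * norm k" if "x : ball w0 dl" for x k
   proof -
    have "dist (p (z, x), q (z, x)) (p (z0, w0), q (z0, w0)) < eps / 2" using dl(2)[OF z', of x] that by (simp add: dist_commute)
    then have c: "cmod (p (z, x) - p (z0, w0)) <= eps / 2" "cmod (q (z, x) - q (z0, w0)) <= eps / 2"
     using dist_fst_le[of "(p (z, x), q (z, x))" "(p (z0, w0), q (z0, w0))"] dist_snd_le[of "(p (z, x), q (z, x))" "(p (z0, w0), q (z0, w0))"]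
     by (auto simp: dist_norm)
    note b = mult_right_mono[OF c(1) norm_ge_zero[of k]] mult_right_mono[OF c(2) norm_ge_zero[of k]]
    have "p (z, x) * k + q (z, x) * cnj k - L k = (p (z, x) - p (z0, w0)) * k + (q (z, x) - q (z0, w0)) * cnj k"
     by (simp add: L_def algebra_simps)
    also have "cmod ... <= cmod (p (z, x) - p (z0, w0)) * cmod k + cmod (q (z, x) - q (z0, w0)) * cmod k"
     by (rule order.trans[OF norm_triangle_ineq]) (simp add: norm_mult)
    also have "... <= eps * norm k" using b by (simp add: field_simps)
    finally show ?thesis .
   qed
  qed (use w1 w2 assms(6) in "auto simp: dist_commute")
  then have "norm (H (z, w + of_real h * v) - H (z, w) - L (of_real h * v)) <= eps * (abs h)"
   using assms(7) by (simp add: norm_mult)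
  moreover have "(H (z, w + of_real h * v) - H (z, w)) / of_real h - (v * p (z0, w0) + cnj v * q (z0, w0))
    = (H (z, w + of_real h * v) - H (z, w) - L (of_real h * v)) / of_real h"
   using h by (simp add: L_def field_simps)
  ultimately have "cmod ((H (z, w + of_real h * v) - H (z, w)) / of_real h - (v * p (z0, w0) + cnj v * q (z0, w0))) <= eps"
   using h by (simp add: norm_divide pos_divide_le_eq)
  then show "(z, w) : U & (z, w + of_real h * v) : U &
   cmod ((H (z, w + of_real h * v) - H (z, w)) / of_real h - (v * p (z0, w0) + cnj v * q (z0, w0))) <= eps"
   using dl(2)[OF z' w1] dl(2)[OF z' w2] by blast
 qed
qed

text \<open>A first order expansion in \<open>w\<close> that is uniform in \<open>z\<close>, with
  coefficients continuous in \<open>z\<close>, combines with the derivative in \<open>z\<close> on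
  the single slice \<open>w0\<close> to a total derivative. The four error terms each receive a
  quarter of the tolerance.\<close>

lemma has_derivative_of_unif_small:
 fixes H :: "complex => complex => complex"
 assumes rho: "rho > 0"
  and u: "usmall w0 z0 rho (%w z. H w z - H w0 z - ((w - w0) * p z + cnj (w - w0) * q z)) (%w. cmod (w - w0))"
  and "isCont p z0" "isCont q z0" and wz: "wirt (H w0) p0 q0 z0"
 shows "((%x. H (snd x) (fst x)) has_derivative
  (%h. (p0 * fst h + q0 * cnj (fst h)) + (snd h * p z0 + cnj (snd h) * q z0))) (at (z0, w0))"
 unfolding has_derivative_at_alt
proof (intro conjI allI impI)
 show "bounded_linear (%h. (p0 * fst h + q0 * cnj (fst h)) + (snd h * p z0 + cnj (snd h) * q z0))"
  by (intro bounded_linear_add bounded_linear_const_mult bounded_linear_mult_const bounded_linear_fst bounded_linear_snd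
    bounded_linear_compose[OF bounded_linear_cnj])
 fix e :: real assume "e > 0"
 then have e: "e / 4 > 0" by simp
 obtain d1 where d1: "d1 > 0" "!!w z. dist w w0 < d1 ==> z : cball z0 rho ==>
   cmod (H w z - H w0 z - ((w - w0) * p z + cnj (w - w0) * q z)) <= e / 4 * cmod (w - w0)"
  using unif_smallD[OF u e] unfolding eventually_nhds_metric by blast
 obtain d2 where d2: "d2 > 0" "!!z. dist z z0 < d2 ==> dist (p z) (p z0) < e / 4"
  using assms(3) e unfolding continuous_at_eps_delta by metis
 obtain d3 where d3: "d3 > 0" "!!z. dist z z0 < d3 ==> dist (q z) (q z0) < e / 4"
  using assms(4) e unfolding continuous_at_eps_delta by metis
 obtain d4 where d4: "d4 > 0" "!!z. norm (z - z0) < d4 ==> norm (H w0 z - H w0 z0 - (p0 * (z - z0) + q0 * cnj (z - z0))) <= e / 4 * norm (z - z0)"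
  using wz[unfolded wirt_def has_derivative_at_alt, THEN conjunct2, rule_format, OF e] by auto
 show "EX d>0. ALL y. norm (y - (z0, w0)) < d --> norm (H (snd y) (fst y) - H (snd (z0, w0)) (fst (z0, w0)) -
  ((p0 * fst (y - (z0, w0)) + q0 * cnj (fst (y - (z0, w0)))) + (snd (y - (z0, w0)) * p z0 + cnj (snd (y - (z0, w0))) * q z0)))
   <= e * norm (y - (z0, w0))"
 proof (intro exI[of _ "min (min rho d1) (min d2 (min d3 d4))"] conjI allI impI)
  show "0 < min (min rho d1) (min d2 (min d3 d4))" using rho d1 d2 d3 d4 by simp
  fix y assume y: "norm (y - (z0, w0)) < min (min rho d1) (min d2 (min d3 d4))"
  obtain z w where yzw: "y = (z, w)" by force
  define N where "N = norm (y - (z0, w0))"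
  have n: "norm (z - z0) <= N" "norm (w - w0) <= N"
   using dist_fst_le[of y "(z0, w0)"] dist_snd_le[of y "(z0, w0)"] by (simp_all add: yzw N_def dist_norm)
  have N: "N < rho" "N < d1" "N < d2" "N < d3" "N < d4" using y by (simp_all add: N_def)
  have 1: "cmod (H w z - H w0 z - ((w - w0) * p z + cnj (w - w0) * q z)) <= e / 4 * N"
  proof -
   have "dist w w0 < d1" "z : cball z0 rho" using n N by (simp_all add: dist_norm norm_minus_commute)
   from d1(2)[OF this] show ?thesis using mult_left_mono[OF n(2), of "e / 4"] e by linarith
  qed
  have 2: "cmod ((w - w0) * (p z - p z0)) <= e / 4 * N"
  proof -
   have "cmod (p z - p z0) <= e / 4" using d2(2)[of z] n N by (simp add: dist_norm)
   then have "cmod (w - w0) * cmod (p z - p z0) <= N * (e / 4)" using n(2) e by (intro mult_mono) (auto simp: N_def)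
   then show ?thesis by (simp add: norm_mult mult.commute)
  qed
  have 3: "cmod (cnj (w - w0) * (q z - q z0)) <= e / 4 * N"
  proof -
   have "cmod (q z - q z0) <= e / 4" using d3(2)[of z] n N by (simp add: dist_norm)
   then have "cmod (w - w0) * cmod (q z - q z0) <= N * (e / 4)" using n(2) e by (intro mult_mono) (auto simp: N_def)
   then show ?thesis unfolding norm_mult complex_mod_cnj by (simp only: mult.commute)
  qed
  have 4: "cmod (H w0 z - H w0 z0 - (p0 * (z - z0) + q0 * cnj (z - z0))) <= e / 4 * N"
  proof -
   have "norm (z - z0) < d4" using n N by simp
   from d4(2)[OF this] show ?thesis using mult_left_mono[OF n(1), of "e / 4"] e by linarith
  qed
  have "H w z - H w0 z0 - ((p0 * (z - z0) + q0 * cnj (z - z0)) + ((w - w0) * p z0 + cnj (w - w0) * q z0))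
   = ((H w z - H w0 z - ((w - w0) * p z + cnj (w - w0) * q z)) + (w - w0) * (p z - p z0))
    + (cnj (w - w0) * (q z - q z0) + (H w0 z - H w0 z0 - (p0 * (z - z0) + q0 * cnj (z - z0))))"
   by (simp add: algebra_simps)
  also have "cmod ... <= (e / 4 * N + e / 4 * N) + (e / 4 * N + e / 4 * N)"
   by (intro order.trans[OF norm_triangle_ineq] add_mono 1 2 3 4)
  finally show "norm (H (snd y) (fst y) - H (snd (z0, w0)) (fst (z0, w0)) -
  ((p0 * fst (y - (z0, w0)) + q0 * cnj (fst (y - (z0, w0)))) + (snd (y - (z0, w0)) * p z0 + cnj (snd (y - (z0, w0))) * q z0)))
   <= e * norm (y - (z0, w0))"
   by (simp add: yzw N_def)
 qed
qed

context hyperbolic_charts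
begin

text \<open>If \<open>U\<close> matches between charts and solves \<open>lap U = g U\<close>, both
  up to little-o of \<open>N\<close>, then \<open>U\<close> itself is little-o of \<open>N\<close>,
  since the exact problem has only the zero solution. The principle controls real parts, so it is
  applied to \<open>U\<close> multiplied by 1, -1, \<i> and -\<i>. The scale \<open>N\<close> may be
  unbounded; this is used for difference quotients before they are known to be bounded.\<close>

lemma fibre_linear_bound:
 fixes U :: "'p => 'd => complex => complex" and N :: "'p => real" and g :: "'p => 'd => complex => real"
 assumes gc: "good_cover w0 F r" and N: "!!p. N p > 0"
  and sm: "\<forall>\<^sub>F p in FF. ALL i:F. EX V. open V & disc2 r i <= V & smooth_on V (U p (fst i))"
  and match: "!!i j z eps. i : F ==> j : F ==> z : disc2 r i ==> (z, w0) : ov (fst i) (fst j) ==>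
   dist (tr (fst i) (fst j) (z, w0)) (snd j) < r j ==> eps > 0 ==>
   EX dl>0. \<forall>\<^sub>F p in FF. ALL y:ball z dl. EX y':cball (snd j) (r j). cmod (U p (fst i) y - U p (fst j) y') <= eps * N p"
  and pde: "!!i eps. i : F ==> eps > 0 ==> \<forall>\<^sub>F p in FF. ALL y:disc2 r i.
   cmod (lap (U p (fst i)) y - of_real (g p (fst i) y) * U p (fst i) y) <= eps * N p"
  and gl: "!!i. i : F ==> \<forall>\<^sub>F p in FF. ALL y:disc2 r i. exp (ph (fst i) w0 y) <= 2 * g p (fst i) y"
  and eps: "eps > 0"
 shows "\<forall>\<^sub>F p in FF. ALL i:F. ALL y:disc2 r i. cmod (U p (fst i) y) <= eps * N p"
proof -
 note gcD = good_coverD[OF gc]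
 from inverse_metric_bound[OF gc] obtain C where "C >= 0 & (ALL i:F. ALL y:disc2 r i. 1 / ((r i)\<^sup>2 * exp (ph (fst i) w0 y)) <= C)" ..
 then have C: "C >= 0" "!!i y. i : F ==> y : disc2 r i ==> 1 / ((r i)\<^sup>2 * exp (ph (fst i) w0 y)) <= C"
  by auto
 \<comment> \<open>Interior maxima contribute \<open>4 * C\<close> (errors of the equation and of
   the weight, each doubled because \<open>g\<close> is at least half the metric at
   \<open>w0\<close>), the weight another 4. The factor 2 adds real and imaginary parts.\<close>
 define eta where "eta = eps / (2 * (4 * C + 4))"
 have eta: "eta > 0" using eps C by (simp add: eta_def)
 have part: "\<forall>\<^sub>F p in FF. ALL i:F. ALL y:disc2 r i. Re (\<omega> * U p (fst i) y) <= (4 * C + 4) * (eta * N p)"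
  if \<omega>: "cmod \<omega> = 1" for \<omega>
 proof -
  define U' where "U' p d z = \<omega> * U p d z" for p d z
  have "\<forall>\<^sub>F p in FF. ALL K M. eta * N p < 3 * K --> 0 <= K -->
   (ALL i:F. ALL y:ball (snd i) (2 * r i). Re (lap (U' p (fst i)) y) <= K / (r i)\<^sup>2 --> Re (U' p (fst i) y) <= M) -->
   (ALL i:F. ALL y:disc2 r i. Re (U' p (fst i) y) <= M + 4 * K)"
  proof (rule fibre_max_principle[OF gc])
   show "\<forall>\<^sub>F p in FF. ALL i:F. EX V. open V & disc2 r i <= V & smooth_on V (U' p (fst i))"
    using sm
   proof (rule eventually_mono, intro ballI)
    fix p i assume "ALL i:F. EX V. open V & disc2 r i <= V & smooth_on V (U p (fst i))" "i : F"
    then obtain V where V: "open V" "disc2 r i <= V" "smooth_on V (U p (fst i))" by blast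
    have "smooth_on V (U' p (fst i))"
     unfolding U'_def by (rule smo_mult[OF V(1) smo_const V(3)])
    then show "EX V. open V & disc2 r i <= V & smooth_on V (U' p (fst i))" using V by blast
   qed
   fix i j z assume a: "i : F" "j : F" "z : disc2 r i" "(z, w0) : ov (fst i) (fst j)"
    "dist (tr (fst i) (fst j) (z, w0)) (snd j) < r j"
   obtain dl where dl: "dl > 0" and ev: "\<forall>\<^sub>F p in FF. ALL y:ball z dl. EX y':cball (snd j) (r j). cmod (U p (fst i) y - U p (fst j) y') <= eta * N p"
    using match[OF a eta] by (elim exE conjE)
   from ev have "\<forall>\<^sub>F p in FF. ALL y:ball z dl. EX y':cball (snd j) (r j). Re (U' p (fst i) y) <= Re (U' p (fst j) y') + eta * N p"
   proof (rule eventually_mono, intro ballI)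
    fix p y assume "ALL y:ball z dl. EX y':cball (snd j) (r j). cmod (U p (fst i) y - U p (fst j) y') <= eta * N p" "y : ball z dl"
    then obtain y' where y': "y' : cball (snd j) (r j)" "cmod (U p (fst i) y - U p (fst j) y') <= eta * N p" by blast
    have "Re (U' p (fst i) y) - Re (U' p (fst j) y') = Re (\<omega> * (U p (fst i) y - U p (fst j) y'))"
     by (simp add: U'_def right_diff_distrib)
    also have "... <= cmod (U p (fst i) y - U p (fst j) y')"
     using complex_Re_le_cmod[of "\<omega> * (U p (fst i) y - U p (fst j) y')"] by (simp only: norm_mult \<omega> mult_1)
    finally have "Re (U' p (fst i) y) <= Re (U' p (fst j) y') + eta * N p" using y'(2) by linarith
    then show "EX y':cball (snd j) (r j). Re (U' p (fst i) y) <= Re (U' p (fst j) y') + eta * N p" using y'(1) by blast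
   qed
   then show "EX dl>0. \<forall>\<^sub>F p in FF. ALL y:ball z dl. EX y':cball (snd j) (r j). Re (U' p (fst i) y) <= Re (U' p (fst j) y') + eta * N p"
    using dl by (intro exI conjI)
  qed
  moreover have "\<forall>\<^sub>F p in FF. ALL i:F. ALL y:disc2 r i.
    cmod (lap (U p (fst i)) y - of_real (g p (fst i) y) * U p (fst i) y) <= eta / (r i)\<^sup>2 * N p"
  proof (rule eventually_ball_finite[OF gcD(1)], rule ballI)
   fix i assume i: "i : F"
   have "eta / (r i)\<^sup>2 > 0" using eta gcD(3)[OF i] by simp
   from pde[OF i this] show "\<forall>\<^sub>F p in FF. ALL y:disc2 r i.
    cmod (lap (U p (fst i)) y - of_real (g p (fst i) y) * U p (fst i) y) <= eta / (r i)\<^sup>2 * N p" .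
  qed
  moreover have "\<forall>\<^sub>F p in FF. ALL i:F. ALL y:disc2 r i. exp (ph (fst i) w0 y) <= 2 * g p (fst i) y"
   by (rule eventually_ball_finite[OF gcD(1)]) (use gl in blast)
  ultimately show ?thesis using sm
  proof eventually_elim
   case (elim p)
   define K where "K = eta * N p"
   have K: "K > 0" using eta N by (simp add: K_def)
   have "ALL i:F. ALL y:ball (snd i) (2 * r i). Re (lap (U' p (fst i)) y) <= K / (r i)\<^sup>2 --> Re (U' p (fst i) y) <= 4 * K * C"
   proof (intro ballI impI)
    fix i y assume i: "i : F" and y: "y : ball (snd i) (2 * r i)" and l: "Re (lap (U' p (fst i)) y) <= K / (r i)\<^sup>2"
    have y': "y : disc2 r i" using y by simp
    obtain V where V: "open V" "disc2 r i <= V" "smooth_on V (U p (fst i))" using elim(4) i by blast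
    have lU: "lap (U' p (fst i)) y = \<omega> * lap (U p (fst i)) y"
     unfolding U'_def by (rule lap_cmult[OF V(1) _ V(3)]) (use y' V(2) in blast)
    define h where "h = g p (fst i) y"
    have "\<bar>Re (\<omega> * (lap (U p (fst i)) y - of_real h * U p (fst i) y))\<bar> <= eta / (r i)\<^sup>2 * N p"
     by (rule order.trans[OF abs_Re_le_cmod]) (unfold norm_mult \<omega> mult_1 h_def, use elim(2) i y' in blast)
    moreover have "Re (\<omega> * (lap (U p (fst i)) y - of_real h * U p (fst i) y)) = Re (lap (U' p (fst i)) y) - h * Re (U' p (fst i) y)"
     unfolding lU U'_def by (simp add: algebra_simps)
    ultimately have "h * Re (U' p (fst i) y) <= K / (r i)\<^sup>2 + eta / (r i)\<^sup>2 * N p" using l by linarith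
    also have "... = 2 * K / (r i)\<^sup>2" by (simp add: K_def)
    finally have 1: "h * Re (U' p (fst i) y) <= 2 * K / (r i)\<^sup>2" .
    have 2: "exp (ph (fst i) w0 y) <= 2 * h" using elim(3) i y' unfolding h_def by blast
    show "Re (U' p (fst i) y) <= 4 * K * C"
    proof (cases "Re (U' p (fst i) y) <= 0")
     case True
     moreover have "0 <= 4 * K * C" using K C(1) by simp
     ultimately show ?thesis by linarith
    next
     case False
     then have "exp (ph (fst i) w0 y) * Re (U' p (fst i) y) <= 2 * h * Re (U' p (fst i) y)"
      using 2 by (intro mult_right_mono) auto
     then have "exp (ph (fst i) w0 y) * Re (U' p (fst i) y) <= 4 * K / (r i)\<^sup>2" using 1 by simp
     then have "Re (U' p (fst i) y) <= 4 * K / (r i)\<^sup>2 / exp (ph (fst i) w0 y)"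
      by (subst pos_le_divide_eq) (simp_all add: mult.commute)
     also have "... = 4 * K * (1 / ((r i)\<^sup>2 * exp (ph (fst i) w0 y)))" by simp
     also have "... <= 4 * K * C" using C(2)[OF i y'] K by (intro mult_left_mono) auto
     finally show ?thesis .
    qed
   qed
   moreover have "eta * N p < 3 * K" "0 <= K" using K by (simp_all add: K_def)
   ultimately have "ALL i:F. ALL y:disc2 r i. Re (U' p (fst i) y) <= 4 * K * C + 4 * K"
    using elim(1) by meson
   moreover have "4 * K * C + 4 * K = (4 * C + 4) * (eta * N p)" by (simp add: K_def algebra_simps)
   ultimately show ?case by (simp add: U'_def)
  qed
 qed
 have "\<forall>\<^sub>F p in FF. (ALL i:F. ALL y:disc2 r i. Re (1 * U p (fst i) y) <= (4 * C + 4) * (eta * N p)) &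
  (ALL i:F. ALL y:disc2 r i. Re (-1 * U p (fst i) y) <= (4 * C + 4) * (eta * N p)) &
  (ALL i:F. ALL y:disc2 r i. Re (\<i> * U p (fst i) y) <= (4 * C + 4) * (eta * N p)) &
  (ALL i:F. ALL y:disc2 r i. Re (- \<i> * U p (fst i) y) <= (4 * C + 4) * (eta * N p))"
  by (intro eventually_conj part) auto
 then show ?thesis
 proof (rule eventually_mono, intro ballI)
  fix p i y
  define c where "c = (4 * C + 4) * (eta * N p)"
  assume a: "(ALL i:F. ALL y:disc2 r i. Re (1 * U p (fst i) y) <= (4 * C + 4) * (eta * N p)) &
  (ALL i:F. ALL y:disc2 r i. Re (-1 * U p (fst i) y) <= (4 * C + 4) * (eta * N p)) &
  (ALL i:F. ALL y:disc2 r i. Re (\<i> * U p (fst i) y) <= (4 * C + 4) * (eta * N p)) &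
  (ALL i:F. ALL y:disc2 r i. Re (- \<i> * U p (fst i) y) <= (4 * C + 4) * (eta * N p))"
   and iy: "i : F" "y : disc2 r i"
  then have "Re (U p (fst i) y) <= c" "- Re (U p (fst i) y) <= c" "- Im (U p (fst i) y) <= c" "Im (U p (fst i) y) <= c"
   unfolding c_def by fastforce+
  then have "cmod (U p (fst i) y) <= 2 * c" using cmod_le[of "U p (fst i) y"] by linarith
  also have "2 * c = eps * N p" unfolding c_def eta_def using C(1) by (simp add: field_simps)
  finally show "cmod (U p (fst i) y) <= eps * N p" .
 qed
qed

lemma good_cover_unif_small:
 assumes gc: "good_cover w0 F r" and dF: "(d, z0) : F"
  and b: "!!eps. eps > 0 ==> \<forall>\<^sub>F p in FF. ALL i:F. ALL y:disc2 r i. cmod (U p (fst i) y) <= eps * s p"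
 shows "unif_small FF (cball z0 (2 * r (d, z0))) (%p. U p d) s"
 unfolding unif_small_def
proof (intro allI impI)
 fix eta :: real assume "eta > 0"
 from b[OF this] show "\<forall>\<^sub>F p in FF. ALL z:cball z0 (2 * r (d, z0)). cmod (U p d z) <= eta * s p"
  by (rule eventually_mono) (use dF in force)
qed

lemma G_comparable:
 assumes gc: "good_cover w0 F r" and i: "i : F"
 shows "\<forall>\<^sub>F w in nhds w0. ALL y:disc2 r i. exp (ph (fst i) w0 y) <= 2 * exp (ph (fst i) w y)"
proof -
 note d = good_coverD(2)[OF gc i]
 have sub: "disc2 r i \<times> {w0} <= Om (fst i)" using good_coverD(5)[OF gc i] by (auto simp: sl_def)
 have half: "(1/2::real) > 0" by simp
 from uniform_limit_of_continuous_on(2)[OF open_Om[OF d] continuous_on_first(1)[OF d] compact_cball sub, unfolded uniform_limit_iff, rule_format, OF half]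
 show ?thesis
 proof (rule eventually_mono, intro ballI)
  fix w y assume "ALL z:disc2 r i. dist (P (fst i) (snd (z, w)) (fst (z, w))) (P (fst i) (snd (z, w0)) (fst (z, w0))) < 1 / 2"
   and "y : disc2 r i"
  then have "dist (P (fst i) w y) (P (fst i) w0 y) < 1 / 2" by simp
  then have l: "\<bar>ph (fst i) w y - ph (fst i) w0 y\<bar> < 1 / 2"
   unfolding P_def dist_norm of_real_diff[symmetric] norm_of_real .
  have "exp (ph (fst i) w0 y - ph (fst i) w y) <= 2"
  proof -
   have "\<bar>ph (fst i) w0 y - ph (fst i) w y\<bar> <= 1 / 2" using l by linarith
   moreover from this have "2 * \<bar>ph (fst i) w0 y - ph (fst i) w y\<bar> <= 1" by simp
   ultimately have "exp (ph (fst i) w0 y - ph (fst i) w y) - 1 <= 1"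
    using abs_le_D1[OF exp_remainder(2)] order.trans by metis
   then show ?thesis by simp
  qed
  then show "exp (ph (fst i) w0 y) <= 2 * exp (ph (fst i) w y)"
   by (simp add: exp_diff pos_divide_le_eq)
 qed
qed

section \<open>Continuity of \<open>psi\<close> and of its derivatives along the fibre\<close>

lemma tr_cball:
 assumes de: "d : D" "e : D" and zov: "(z, w0) : ov d e" and dist: "dist (tr d e (z, w0)) c < s"
 obtains dl where "dl > 0" "!!y w. dist y z < dl ==> dist w w0 < dl ==> (y, w) : ov d e & dist (tr d e (y, w)) c < s"
proof -
 have p: "s - dist (tr d e (z, w0)) c > 0" using dist by simp
 obtain dl where dl: "dl > 0" "!!y w. dist y z < dl ==> dist w w0 < dl ==> (y, w) : ov d e &
   dist (tr d e (y, w)) (tr d e (z, w0)) < s - dist (tr d e (z, w0)) c"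
  using continuous_on_box[OF hol2_open[OF tr_hol2[OF de]] hol2_continuous_on[OF tr_hol2[OF de]] zov p] by metis
 show ?thesis
 proof (rule that[OF dl(1)])
  fix y w assume "dist y z < dl" "dist w w0 < dl"
  from dl(2)[OF this] show "(y, w) : ov d e & dist (tr d e (y, w)) c < s"
   using dist_triangle[of "tr d e (y, w)" c "tr d e (z, w0)"] by auto
 qed
qed

definition mt :: "'d => 'd => complex \<times> complex => complex" where
 "mt d e x = Pz e (snd x) (tr d e x) * d2 (tr d e) x + d2 (d1 (tr d e)) x / d1 (tr d e) x"

lemma psi_mt: "d : D ==> e : D ==> (z, w) : ov d e ==> psi d w z = psi e w (tr d e (z, w)) + mt d e (z, w)"
 using psi_tr[of d e z w] by (simp add: mt_def ovs_def)

lemma tr_cont: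
 assumes de: "d : D" "e : D"
 shows "continuous_on (ov d e) (tr d e)" "continuous_on (ov d e) (d1 (tr d e))" "continuous_on (ov d e) (d2 (tr d e))"
  "continuous_on (ov d e) (d2 (d1 (tr d e)))" "continuous_on (ov d e) (d2 (d2 (tr d e)))" "continuous_on (ov d e) (d2 (d2 (d1 (tr d e))))"
 by (intro hol2_continuous_on hol2_d1_hol2 hol2_d2_hol2 tr_hol2 de)+

lemma comp_tr_cont:
 assumes de: "d : D" "e : D" and k: "continuous_on (Om e) (%x. k (snd x) (fst x))"
 shows "continuous_on (ov d e) (%x. k (snd x) (tr d e x))"
 using continuous_on_compose2[OF k continuous_on_Pair[OF tr_cont(1)[OF de] continuous_on_snd[OF continuous_on_id]]]
  tr_Om[OF de] by fastforce

lemma mt_cont: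
 assumes de: "d : D" "e : D" shows "continuous_on (ov d e) (mt d e)"
 unfolding mt_def
 by (intro continuous_intros tr_cont comp_tr_cont continuous_on_first de ballI) (use tr_d1[OF de] in force)

text \<open>The lift is chosen separately on each fibre, so continuity of \<open>psi\<close> in
  \<open>w\<close> is not visible from its definition. The difference \<open>U\<close> of
  \<open>psi\<close> at \<open>w\<close> and at \<open>w0\<close> solves \<open>lap U = G U\<close>
  up to \<open>(G_w - G_w0) psi_w0\<close>, which tends to zero, and its mismatch between charts
  tends to zero too; hence so does \<open>U\<close>.\<close>

lemma psi_small:
 assumes d: "d : D" and zw: "(z0, w0) : Om d"
 obtains rho where "rho > 0" "cball z0 rho \<times> cball w0 rho <= Om d" "usmall w0 z0 rho (%w z. psi d w z - psi d w0 z) (%_. 1)"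
proof -
 obtain F r where gc: "good_cover w0 F r" and dF: "(d, z0) : F" by (rule good_cover_exists[OF assms])
 note gcD = good_coverD[OF gc]
 define U where "U w d z = psi d w z - psi d w0 z" for w d z
 have evr: "\<forall>\<^sub>F w in nhds w0. ALL i:F. dist w w0 < r i"
  by (rule eventually_ball_finite[OF gcD(1)]) (use gcD(3) in "auto simp: eventually_nhds_metric")
 have smU: "smooth_on (sl d w Int sl d w0) (U w d)" "z : sl d w Int sl d w0 ==> lap (U w d) z = G d w z * psi d w z - G d w0 z * psi d w0 z"
  if "d : D" for w d z
 proof -
  have V: "open (sl d w Int sl d w0)" by (intro open_Int open_sl that)
  have s: "smooth_on (sl d w Int sl d w0) (psi d w)" "smooth_on (sl d w Int sl d w0) (psi d w0)"
   by (rule smo_subset[OF sm_psi[OF that]], simp)+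
  show "smooth_on (sl d w Int sl d w0) (U w d)" unfolding U_def by (rule smo_diff[OF V s])
  show "z : sl d w Int sl d w0 ==> lap (U w d) z = G d w z * psi d w z - G d w0 z * psi d w0 z"
   unfolding U_def using lap_diff[OF V _ s] lap_psi[OF that] by simp
 qed
 have "\<forall>\<^sub>F w in nhds w0. ALL i:F. ALL y:disc2 r i. cmod (U w (fst i) y) <= eps * 1" if "eps > 0" for eps
 proof (rule fibre_linear_bound[OF gc _ _ _ _ _ that, where g = "%w d y. exp (ph d w y)"])
  show "\<forall>\<^sub>F w in nhds w0. ALL i:F. EX V. open V & disc2 r i <= V & smooth_on V (U w (fst i))"
   using evr
  proof (rule eventually_mono, intro ballI)
   fix w i assume "ALL i:F. dist w w0 < r i" "i : F"
   then show "EX V. open V & disc2 r i <= V & smooth_on V (U w (fst i))"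
    using gcD(6)[of i w] gcD(5)[of i] smU(1)[OF gcD(2)[of i], of w] open_sl[OF gcD(2)[of i]]
    by (intro exI[of _ "sl (fst i) w Int sl (fst i) w0"]) auto
  qed
  fix i j z and eps :: real assume ij: "i : F" "j : F" "z : disc2 r i" and zov: "(z, w0) : ov (fst i) (fst j)"
   and dist: "dist (tr (fst i) (fst j) (z, w0)) (snd j) < r j" and eps: "eps > 0"
  define d e where "d = fst i" and "e = fst j"
  have de: "d : D" "e : D" using gcD(2) ij by (auto simp: d_def e_def)
  note zov = zov[folded d_def e_def] and dist = dist[folded d_def e_def]
  obtain dl1 where dl1: "dl1 > 0" "!!y w. dist y z < dl1 ==> dist w w0 < dl1 ==> (y, w) : ov d e & dist (tr d e (y, w)) (snd j) < r j"
   using tr_cball[OF de zov dist] by metis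
  have zs: "z : sl d w0" using ov_Om[OF de zov] by (simp add: sl_def)
  \<comment> \<open>The first component is the transition term at \<open>w\<close>, the second the
    mismatch of \<open>psi\<close> at \<open>w0\<close> between \<open>y\<close> and its image under
    the transition at \<open>w\<close>. They agree at \<open>(z, w0)\<close>, and their difference
    is the mismatch of \<open>U\<close>.\<close>
  define Q where "Q = (%x. (mt d e x, psi d w0 (fst x) - psi e w0 (tr d e x)))"
  define V where "V = {x : ov d e. tr d e x : sl e w0 & fst x : sl d w0}"
  have V: "open V"
  proof -
   have "open (ov d e Int tr d e -` sl e w0)"
    by (rule continuous_open_preimage[OF tr_cont(1)[OF de] hol2_open[OF tr_hol2[OF de]] open_sl[OF de(2)]])
   moreover have "open (fst -` sl d w0)" by (intro open_vimage open_sl de continuous_intros)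
   ultimately show ?thesis
    using open_Int[of "ov d e Int tr d e -` sl e w0" "fst -` sl d w0"] by (auto simp: V_def Int_def vimage_def conj_ac)
  qed
  have Vov: "V <= ov d e" by (auto simp: V_def)
  have cQ: "continuous_on V Q"
   unfolding Q_def
  proof (intro continuous_on_Pair continuous_on_diff)
   show "continuous_on V (mt d e)" by (rule continuous_on_subset[OF mt_cont[OF de] Vov])
   show "continuous_on V (%x. psi d w0 (fst x))"
    by (rule continuous_on_compose2[OF cont_slices(4)[OF de(1) order.refl] continuous_on_fst[OF continuous_on_id]]) (auto simp: V_def)
   show "continuous_on V (%x. psi e w0 (tr d e x))"
    by (rule continuous_on_compose2[OF cont_slices(4)[OF de(2) order.refl] continuous_on_subset[OF tr_cont(1)[OF de] Vov]]) (auto simp: V_def)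
  qed
  have zV: "(z, w0) : V" using zov tr_Om[OF de zov] zs by (simp add: V_def sl_def)
  have e2: "eps / 2 > 0" using eps by simp
  obtain dl2 where dl2: "dl2 > 0" "!!y w. dist y z < dl2 ==> dist w w0 < dl2 ==> (y, w) : V & dist (Q (y, w)) (Q (z, w0)) < eps / 2"
   using continuous_on_box[OF V cQ zV e2] by metis
  have Qz: "Q (z, w0) = (mt d e (z, w0), mt d e (z, w0))"
   using psi_mt[OF de zov] by (simp add: Q_def)
  have "\<forall>\<^sub>F w in nhds w0. dist w w0 < min dl1 dl2"
   unfolding eventually_nhds_metric using dl1 dl2 by (intro exI[of _ "min dl1 dl2"]) auto
  then have "\<forall>\<^sub>F w in nhds w0. ALL y:ball z (min dl1 dl2). EX y':cball (snd j) (r j). cmod (U w (fst i) y - U w (fst j) y') <= eps * 1"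
  proof (rule eventually_mono, intro ballI)
   fix w y assume w: "dist w w0 < min dl1 dl2" and y: "y : ball z (min dl1 dl2)"
   define y' where "y' = tr d e (y, w)"
   have 1: "(y, w) : ov d e" "y' : cball (snd j) (r j)" using dl1(2)[of y w] w y by (auto simp: y'_def dist_commute)
   have "dist (Q (y, w)) (Q (z, w0)) < eps / 2" using dl2(2)[of y w] w y by (auto simp: dist_commute)
   then have "dist (fst (Q (y, w))) (mt d e (z, w0)) < eps / 2" "dist (snd (Q (y, w))) (mt d e (z, w0)) < eps / 2"
    using dist_fst_le[of "Q (y, w)" "Q (z, w0)"] dist_snd_le[of "Q (y, w)" "Q (z, w0)"] by (auto simp: Qz)
   then have "dist (fst (Q (y, w))) (snd (Q (y, w))) < eps"
    using dist_triangle2[of "fst (Q (y, w))" "snd (Q (y, w))" "mt d e (z, w0)"] by simp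
   moreover have "U w d y - U w e y' = fst (Q (y, w)) - snd (Q (y, w))"
    using psi_mt[OF de 1(1)] by (simp add: U_def Q_def y'_def)
   ultimately have "cmod (U w (fst i) y - U w (fst j) y') <= eps * 1" by (simp add: dist_norm d_def e_def)
   then show "EX y':cball (snd j) (r j). cmod (U w (fst i) y - U w (fst j) y') <= eps * 1" using 1(2) by blast
  qed
  then show "EX dl>0. \<forall>\<^sub>F w in nhds w0. ALL y:ball z dl. EX y':cball (snd j) (r j). cmod (U w (fst i) y - U w (fst j) y') <= eps * 1"
   using dl1(1) dl2(1) by (intro exI[of _ "min dl1 dl2"]) simp
 next
  fix i and eps :: real assume i: "i : F" and eps: "eps > 0"
  define d where "d = fst i"
  have d: "d : D" using gcD(2) i by (auto simp: d_def)
  have cG: "continuous_on (Om d) (%x. G d (snd x) (fst x))" by (rule continuous_on_first(2)[OF d])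
  have sub0: "disc2 r i <= sl d w0" using gcD(5)[OF i] by (auto simp: d_def)
  obtain B where B: "B >= 0" "ALL z:disc2 r i. cmod (psi d w0 z) <= B" using cball_bound[OF cont_slices(4)[OF d sub0]] by blast
  have "disc2 r i \<times> {w0} <= Om d" using sub0 by (auto simp: sl_def)
  note lim = uniform_limit_of_continuous_on(2)[OF open_Om[OF d] cG compact_cball this]
  have e: "eps / (B + 1) > 0" using eps B by simp
  from lim[unfolded uniform_limit_iff, rule_format, OF e] evr
  show "\<forall>\<^sub>F w in nhds w0. ALL y:disc2 r i. cmod (lap (U w (fst i)) y - of_real (exp (ph (fst i) w y)) * U w (fst i) y) <= eps * 1"
  proof eventually_elim
   case (elim w)
   show ?case
   proof
    fix y assume y: "y : disc2 r i"
    then have ys: "y : sl d w Int sl d w0" using gcD(6)[OF i, of w] elim(2) i sub0 by (auto simp: d_def)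
    have "cmod (G d w y - G d w0 y) <= eps / (B + 1)" using elim(1) y by (simp add: dist_norm less_imp_le)
    moreover have "cmod (psi d w0 y) <= B + 1" using B y by force
    ultimately have "cmod (G d w y - G d w0 y) * cmod (psi d w0 y) <= eps / (B + 1) * (B + 1)"
     using e by (intro mult_mono) auto
    also have "... = eps" using B by simp
    finally have "cmod ((G d w y - G d w0 y) * psi d w0 y) <= eps" by (simp only: norm_mult)
    moreover have "lap (U w d) y - G d w y * U w d y = (G d w y - G d w0 y) * psi d w0 y"
     unfolding smU(2)[OF d ys] by (simp add: U_def algebra_simps)
    ultimately show "cmod (lap (U w (fst i)) y - of_real (exp (ph (fst i) w y)) * U w (fst i) y) <= eps * 1"
     by (simp add: d_def G_def)
   qed
  qed
 next
  fix i assume i: "i : F"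
  show "\<forall>\<^sub>F w in nhds w0. ALL y:disc2 r i. exp (ph (fst i) w0 y) <= 2 * exp (ph (fst i) w y)"
   by (rule G_comparable[OF gc i])
 qed simp
 then have u: "unif_small (nhds w0) (cball z0 (2 * r (d, z0))) (%w. U w d) (%_. 1)"
  by (rule good_cover_unif_small[OF gc dF])
 show ?thesis
 proof (rule that[of "2 * r (d, z0)"])
  show "2 * r (d, z0) > 0" using gcD(3)[OF dF] by simp
  show "cball z0 (2 * r (d, z0)) \<times> cball w0 (2 * r (d, z0)) <= Om d"
   using gcD(4)[OF dF] by auto
 qed (use u in "simp add: U_def[abs_def]")
qed

end

lemma eventually_compact:
 fixes K :: "'a::metric_space set"
 assumes "compact K" "!!z. z : K ==> EX dl>0. \<forall>\<^sub>F x in FF. ALL y:ball z dl. Q x y"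
 shows "\<forall>\<^sub>F x in FF. ALL y:K. Q x y"
proof -
 define R where "R z dl \<longleftrightarrow> (\<forall>\<^sub>F x in FF. ALL y:ball z dl. Q x y)" for z dl
 have "EX dl>0. R z dl" if "z : K" for z using assms(2)[OF that] by (simp add: R_def)
 then obtain dl where dl: "!!z. z : K ==> dl z > 0" "!!z. z : K ==> R z (dl z)" by metis
 obtain C where C: "C <= K" "finite C" "K <= (\<Union>c\<in>C. ball c (dl c))"
  using compactE_image[OF assms(1), of K "%c. ball c (dl c)"] dl(1) by (metis (no_types, lifting) UN_iff centre_in_ball open_ball subsetI)
 have "\<forall>\<^sub>F x in FF. ALL c:C. ALL y:ball c (dl c). Q x y"
  using C(1) dl(2) unfolding R_def by (intro eventually_ball_finite[OF C(2)]) auto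
 then show ?thesis by (rule eventually_mono) (use C(3) in blast)
qed

lemma wirt_of_unif_small:
 assumes "unif_small (nhds w0) K (%w z. H w z - H w0 z - ((w - w0) * p z + cnj (w - w0) * q z)) (%w. cmod (w - w0))" "z : K"
 shows "wirt (%w. H w z) (p z) (q z) w0"
 unfolding wirt_def has_derivative_at_alt
proof (intro conjI allI impI)
 show "bounded_linear (%h. p z * h + q z * cnj h)"
  by (intro bounded_linear_add bounded_linear_const_mult bounded_linear_ident bounded_linear_cnj)
 fix e :: real assume "e > 0"
 from unif_smallD[OF assms(1) this] assms(2)
 obtain d where d: "d > 0" "!!w. dist w w0 < d ==> cmod (H w z - H w0 z - ((w - w0) * p z + cnj (w - w0) * q z)) <= e * cmod (w - w0)"
  unfolding eventually_nhds_metric by blast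
 have eq: "(w - w0) * p z + cnj (w - w0) * q z = p z * (w - w0) + q z * cnj (w - w0)" for w by (simp add: mult.commute)
 show "EX d>0. ALL y. norm (y - w0) < d --> norm (H y z - H w0 z - (p z * (y - w0) + q z * cnj (y - w0))) <= e * norm (y - w0)"
  using d unfolding eq dist_norm by blast
qed

text \<open>Pairs of a base point tending to \<open>w0\<close> (and allowed to equal it) and a
  nonzero real step tending to 0. Since the base point moves as well, convergence along this filter
  makes the limiting derivative continuous in \<open>w\<close>.\<close>

definition dqF :: "complex => (complex \<times> real) filter" where
 "dqF w0 = nhds w0 \<times>\<^sub>F at 0"

lemma dqFI:
 assumes "dl > 0" "!!w h. dist w w0 < dl ==> 0 < (abs h) ==> (abs h) < dl ==> Q (w, h)"
 shows "\<forall>\<^sub>F x in dqF w0. Q x"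
proof -
 have "\<forall>\<^sub>F w in nhds w0. dist w w0 < dl" unfolding eventually_nhds_metric using assms(1) by blast
 moreover have "\<forall>\<^sub>F h in at (0::real). 0 < (abs h) & (abs h) < dl" unfolding eventually_at using assms(1) by (auto simp: dist_norm)
 ultimately show ?thesis
  unfolding dqF_def eventually_prod_filter using assms(2) by (intro exI[of _ "%w. dist w w0 < dl"] exI[of _ "%h. 0 < (abs h) & (abs h) < dl"]) auto
qed

lemma dqFD:
 assumes "\<forall>\<^sub>F x in dqF w0. Q x"
 obtains dl where "dl > 0" "!!w h. dist w w0 < dl ==> 0 < (abs h) ==> (abs h) < dl ==> Q (w, h)"
proof -
 obtain A B where AB: "\<forall>\<^sub>F w in nhds w0. A w" "\<forall>\<^sub>F h in at (0::real). B h" "!!w h. A w ==> B h ==> Q (w, h)"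
  using assms unfolding dqF_def eventually_prod_filter by metis
 obtain d1 where d1: "d1 > 0" "!!w. dist w w0 < d1 ==> A w" using AB(1) unfolding eventually_nhds_metric by blast
 obtain d2 where d2: "d2 > 0" "!!h. h ~= 0 ==> dist h 0 < d2 ==> B h" using AB(2) unfolding eventually_at by blast
 show ?thesis
  by (rule that[of "min d1 d2"]) (use d1 d2 AB(3) in auto)
qed

lemma dqF_base: "\<forall>\<^sub>F w in nhds w0. Q w ==> cmod v = 1 ==> \<forall>\<^sub>F x in dqF w0. Q (fst x) & Q (shift v x) & snd x ~= 0"
proof -
 assume Q: "\<forall>\<^sub>F w in nhds w0. Q w" and v: "cmod v = 1"
 then obtain d where d: "d > 0" "!!w. dist w w0 < d ==> Q w" unfolding eventually_nhds_metric by blast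
 show ?thesis
 proof (rule dqFI[of "d / 2"])
  fix w and h :: real assume a: "dist w w0 < d / 2" "0 < (abs h)" "(abs h) < d / 2"
  have "dist (w + of_real h * v) w0 < d"
   using a norm_triangle_ineq[of "w - w0" "of_real h * v"] v by (simp add: dist_norm norm_mult add_diff_eq diff_add_eq)
  then show "Q (fst (w, h)) & Q (fst (w, h) + of_real (snd (w, h)) * v) & snd (w, h) ~= 0" using a d by auto
 qed (use d in simp)
qed

context hyperbolic_charts
begin

lemma continuous_on_OmI:
 fixes H :: "complex => complex => complex"
 assumes "d : D" "!!z0 w0. (z0, w0) : Om d ==> EX rho>0. usmall w0 z0 rho (%w z. H w z - H w0 z) (%_. 1)"
  "!!w. continuous_on (sl d w) (H w)"
 shows "continuous_on (Om d) (%x. H (snd x) (fst x))"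
proof (rule continuous_at_imp_continuous_on, rule ballI)
 fix x assume "x : Om d"
 then obtain z0 w0 where x: "x = (z0, w0)" "(z0, w0) : Om d" by (cases x) auto
 obtain rho where rho: "rho > 0" "usmall w0 z0 rho (%w z. H w z - H w0 z) (%_. 1)" using assms(2)[OF x(2)] by blast
 have "isCont (H w0) z0"
  using assms(3)[of w0] x(2) open_sl[OF assms(1)] by (simp add: continuous_on_eq_continuous_at sl_def)
 then show "isCont (%x. H (snd x) (fst x)) x" unfolding x by (rule unif_small_isCont[OF rho])
qed

lemma continuous_on_psi:
 assumes d: "d : D"
 shows "continuous_on (Om d) (%x. psi d (snd x) (fst x))" "continuous_on (Om d) (%x. dz (psi d (snd x)) (fst x))"
  "continuous_on (Om d) (%x. dzbar (psi d (snd x)) (fst x))"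
proof -
 have cs: "continuous_on (sl d w) (psi d w)" "continuous_on (sl d w) (dz (psi d w))" "continuous_on (sl d w) (dzbar (psi d w))" for w
  by (intro smo_imp_continuous_on sm_psi smo_dz smo_dzbar open_sl d)+
 have main: "EX rho>0. usmall w0 z0 rho (%w z. psi d w z - psi d w0 z) (%_. 1) &
  usmall w0 z0 rho (%w z. dz (psi d w) z - dz (psi d w0) z) (%_. 1) &
  usmall w0 z0 rho (%w z. dzbar (psi d w) z - dzbar (psi d w0) z) (%_. 1)"
  if zw: "(z0, w0) : Om d" for z0 w0
 proof -
  obtain rho1 where rho1: "rho1 > 0" "cball z0 rho1 \<times> cball w0 rho1 <= Om d" "unif_small (nhds w0) (cball z0 rho1) (%w z. psi d w z - psi d w0 z) (%_. 1)"
   by (rule psi_small[OF d zw])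
  obtain rho2 where rho2: "rho2 > 0" "unif_small (nhds w0) (cball z0 rho2) (%w z. G d w z - G d w0 z) (%_. 1)"
   by (rule first_regularity[OF d zw])
  define rho where "rho = min rho1 rho2"
  have rho: "rho > 0" "cball z0 rho \<times> cball w0 rho <= Om d" using rho1 rho2(1) by (auto simp: rho_def subset_iff)
  note sl0 = sl_eventually(2)[OF rho] and sle = sl_eventually(1)[OF rho]
  have u: "usmall w0 z0 rho (%w z. psi d w z - psi d w0 z) (%_. 1)"
   "usmall w0 z0 rho (%w z. G d w z - G d w0 z) (%_. 1)"
   by (rule unif_small_subset[OF rho1(3)], force simp: rho_def, rule unif_small_subset[OF rho2(2)], force simp: rho_def)
  have facts: "\<forall>\<^sub>F w in nhds w0. (EX V. open V & cball z0 rho <= V & smooth_on V (%z. psi d w z - psi d w0 z)) &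
   (ALL z:cball z0 rho. lap (%z. psi d w z - psi d w0 z) z = G d w z * psi d w z - G d w0 z * psi d w0 z &
    dz (%z. psi d w z - psi d w0 z) z = dz (psi d w) z - dz (psi d w0) z &
    dzbar (%z. psi d w z - psi d w0 z) z = dzbar (psi d w) z - dzbar (psi d w0) z)"
   using sle
  proof (rule eventually_mono)
   fix w assume w: "cball z0 rho <= sl d w"
   define V where "V = sl d w Int sl d w0"
   have V: "open V" "cball z0 rho <= V" unfolding V_def using w sl0 by (auto intro: open_Int open_sl d)
   have sm: "smooth_on V (psi d w)" "smooth_on V (psi d w0)"
    by (rule smo_subset[OF sm_psi[OF d]], simp add: V_def)+
   have "lap (%z. psi d w z - psi d w0 z) z = G d w z * psi d w z - G d w0 z * psi d w0 z &
    dz (%z. psi d w z - psi d w0 z) z = dz (psi d w) z - dz (psi d w0) z &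
    dzbar (%z. psi d w z - psi d w0 z) z = dzbar (psi d w) z - dzbar (psi d w0) z" if "z : V" for z
    using lap_diff[OF V(1) that sm] lap_psi[OF d] that wirt_D[OF wirt_diff[OF wirt_smooth[OF sm(1) that] wirt_smooth[OF sm(2) that]]]
    by (simp add: V_def)
   then show "(EX V. open V & cball z0 rho <= V & smooth_on V (%z. psi d w z - psi d w0 z)) &
   (ALL z:cball z0 rho. lap (%z. psi d w z - psi d w0 z) z = G d w z * psi d w z - G d w0 z * psi d w0 z &
    dz (%z. psi d w z - psi d w0 z) z = dz (psi d w) z - dz (psi d w0) z &
    dzbar (%z. psi d w z - psi d w0 z) z = dzbar (psi d w) z - dzbar (psi d w0) z)"
    using V smo_diff[OF V(1) sm] by blast
  qed
  have sm: "\<forall>\<^sub>F w in nhds w0. EX V. open V & cball z0 rho <= V & smooth_on V (%z. psi d w z - psi d w0 z)"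
   using facts by (rule eventually_mono) blast
  have l: "usmall w0 z0 rho (%w. lap (%z. psi d w z - psi d w0 z)) (%_. 1)"
  proof (rule unif_small_cong)
   show "usmall w0 z0 rho (%w z. G d w z * psi d w z - G d w0 z * psi d w0 z) (%_. 1)"
    by (rule unif_small_mult_diff[OF u(2,1)]) (rule cball_bound, rule cont_slices[OF d sl0])+
  qed (use facts in "auto elim: eventually_mono")
  note g = unif_small_gradient[OF rho(1) sm u(1) l]
  show ?thesis
  proof (intro exI[of _ "rho / 2"] conjI)
   show "unif_small (nhds w0) (cball z0 (rho / 2)) (%w z. psi d w z - psi d w0 z) (%_. 1)"
    by (rule unif_small_subset[OF u(1)]) (use rho(1) in auto)
   show "unif_small (nhds w0) (cball z0 (rho / 2)) (%w z. dz (psi d w) z - dz (psi d w0) z) (%_. 1)"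
    by (rule unif_small_cong[OF g(1)], rule eventually_mono[OF facts]) (use rho(1) in auto)
   show "unif_small (nhds w0) (cball z0 (rho / 2)) (%w z. dzbar (psi d w) z - dzbar (psi d w0) z) (%_. 1)"
    by (rule unif_small_cong[OF g(2)], rule eventually_mono[OF facts]) (use rho(1) in auto)
  qed (use rho(1) in simp)
 qed
 show "continuous_on (Om d) (%x. psi d (snd x) (fst x))" "continuous_on (Om d) (%x. dz (psi d (snd x)) (fst x))"
  "continuous_on (Om d) (%x. dzbar (psi d (snd x)) (fst x))"
  by (rule continuous_on_OmI[OF d _ cs(1)] continuous_on_OmI[OF d _ cs(2)] continuous_on_OmI[OF d _ cs(3)], use main in blast)+
qed

lemma P_unif_small:
 assumes d: "d : D" and zw: "(z0, w0) : Om d"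
 obtains rho where "rho > 0" "usmall w0 z0 rho
  (%w z. P d w z - P d w0 z - ((w - w0) * psi d w0 z + cnj (w - w0) * cnj (psi d w0 z))) (%w. cmod (w - w0))"
proof -
 obtain rho where rho: "rho > 0" and ES: "usmall w0 z0 rho (%w z. complex_of_real (E w0 w d z)) (%w. cmod (w - w0))"
  by (rule E_small[OF assms])
 have re: "complex_of_real (2 * Re x) = x + cnj x" for x by (simp add: complex_add_cnj)
 have "complex_of_real (E w0 w d z) = P d w z - P d w0 z - ((w - w0) * psi d w0 z + cnj (w - w0) * cnj (psi d w0 z))" for w z
  unfolding E_def of_real_diff re by (simp add: P_def)
 then show ?thesis using that[OF rho] ES by simp
qed

lemma wirt_w_P: "d : D ==> (z, w) : Om d ==> wirt (%w. P d w z) (psi d w z) (cnj (psi d w z)) w"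
proof -
 assume a: "d : D" "(z, w) : Om d"
 obtain rho where rho: "rho > 0" "unif_small (nhds w) (cball z rho)
  (%w' z. P d w' z - P d w z - ((w' - w) * psi d w z + cnj (w' - w) * cnj (psi d w z))) (%w'. cmod (w' - w))"
  by (rule P_unif_small[OF a])
 show ?thesis
  by (rule wirt_of_unif_small[where p = "psi d w" and q = "%z. cnj (psi d w z)", OF rho(2)]) (use rho(1) in simp)
qed

lemma wirt_w_G: "d : D ==> (z, w) : Om d ==> wirt (%w. G d w z) (G d w z * psi d w z) (G d w z * cnj (psi d w z)) w"
 using wirt_exp[OF wirt_w_P, of d z w] by (simp add: G_def P_def exp_of_real)

lemma Pz_has_derivative:
 assumes d: "d : D" and zw: "(z, w) : Om d"
 shows "((%x. Pz d (snd x) (fst x)) has_derivative (%h. (dz (Pz d w) z * fst h + G d w z * cnj (fst h)) +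
  (snd h * dz (psi d w) z + cnj (snd h) * cnj (dzbar (psi d w) z)))) (at (z, w))"
proof -
 obtain rho where rho: "rho > 0" "unif_small (nhds w) (cball z rho) (%w' z. Pz d w' z - Pz d w z -
    ((w' - w) * dz (psi d w) z + cnj ((w' - w) * dzbar (psi d w) z))) (%w'. cmod (w' - w))"
  by (rule first_regularity[OF assms])
 have zs: "z : sl d w" using zw by (simp add: sl_def)
 have c: "isCont k z" if "continuous_on (sl d w) k" for k :: "complex => complex"
  using that zs open_sl[OF d] by (simp add: continuous_on_eq_continuous_at)
 have sd: "smooth_on (sl d w) (dz (psi d w))" "smooth_on (sl d w) (dzbar (psi d w))"
  by (intro smo_dz smo_dzbar open_sl sm_psi d)+
 show ?thesis
  by (rule has_derivative_of_unif_small[where H = "Pz d" and p = "dz (psi d w)" and q = "%z. cnj (dzbar (psi d w) z)", OF rho(1) _ _ _ wirt_Pz[OF d zs]])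
   (use rho(2) c[OF smo_imp_continuous_on[OF sd(1)]] c[OF smo_imp_continuous_on[OF smo_cnj[OF open_sl[OF d] sd(2)]]] in simp_all)
qed

text \<open>\<open>mp\<close> and \<open>mq\<close> are the Wirtinger derivatives of
  \<open>mt\<close> in \<open>w\<close>. They are left in the form, zero summands included, in which
  the differentiation rules produce them.\<close>

definition mp :: "'d => 'd => complex \<times> complex => complex" where
 "mp d e x = (Pz e (snd x) (tr d e x) * d2 (d2 (tr d e)) x
  + (dz (Pz e (snd x)) (tr d e x) * d2 (tr d e) x + dz (psi e (snd x)) (tr d e x)) * d2 (tr d e) x)
  + (d2 (d2 (d1 (tr d e))) x * d1 (tr d e) x - d2 (d1 (tr d e)) x * d2 (d1 (tr d e)) x) / (d1 (tr d e) x * d1 (tr d e) x)"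

definition mq :: "'d => 'd => complex \<times> complex => complex" where
 "mq d e x = (Pz e (snd x) (tr d e x) * 0 + (G e (snd x) (tr d e x) * cnj (d2 (tr d e) x) + cnj (dzbar (psi e (snd x)) (tr d e x))) * d2 (tr d e) x) + 0"

lemma wirt_mt:
 assumes de: "d : D" "e : D" and yw: "(y, w) : ov d e"
 shows "wirt (%w. mt d e (y, w)) (mp d e (y, w)) (mq d e (y, w)) w"
proof -
 define t where "t = tr d e"
 note h = tr_hol2[OF de, folded t_def]
 note h' = hol2_d1_hol2[OF h] and h'' = hol2_d2_hol2[OF h] and h3 = hol2_d2_hol2[OF hol2_d1_hol2[OF h]]
 have "((%w. (t (y, w), w)) has_derivative (%k. (d2 t (y, w) * k, k))) (at w)"
  using hol2_d2[OF h yw] by (intro has_derivative_Pair) (simp_all add: has_field_derivative_def)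
 from diff_chain_at[OF this Pz_has_derivative[OF de(2) tr_Om[OF de yw, folded t_def]]]
 have 1: "wirt (%w. Pz e w (t (y, w))) (dz (Pz e w) (t (y, w)) * d2 t (y, w) + dz (psi e w) (t (y, w)))
   (G e w (t (y, w)) * cnj (d2 t (y, w)) + cnj (dzbar (psi e w) (t (y, w)))) w"
  by (simp add: wirt_def o_def algebra_simps)
 have nz: "d1 t (y, w) ~= 0" using tr_d1[OF de yw] by (simp add: t_def)
 show ?thesis
  unfolding mt_def mp_def mq_def t_def[symmetric] fst_conv snd_conv
  by (rule wirt_add[OF wirt_mult[OF 1 wirt_holomorphic[OF hol2_d2[OF h'' yw]]]
     wirt_holomorphic[OF DERIV_divide[OF hol2_d2[OF h3 yw] hol2_d2[OF h' yw] nz]]])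
qed

lemma mpq_cont:
 assumes de: "d : D" "e : D" shows "continuous_on (ov d e) (mp d e)" "continuous_on (ov d e) (mq d e)"
proof -
 have nz: "ALL x:ov d e. d1 (tr d e) x * d1 (tr d e) x ~= 0" using tr_d1[OF de] by force
 note c = comp_tr_cont[OF de continuous_on_first(2)[OF de(2)]] comp_tr_cont[OF de continuous_on_first(3)[OF de(2)]]
  comp_tr_cont[where k = "%w. dz (Pz e w)", OF de continuous_on_first(4)[OF de(2)]]
  comp_tr_cont[where k = "%w. dz (psi e w)", OF de continuous_on_psi(2)[OF de(2)]]
  comp_tr_cont[where k = "%w. dzbar (psi e w)", OF de continuous_on_psi(3)[OF de(2)]]
 show "continuous_on (ov d e) (mp d e)" unfolding mp_def
  by (intro continuous_on_add continuous_on_diff continuous_on_mult continuous_on_divide nz c tr_cont[OF de])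
 show "continuous_on (ov d e) (mq d e)" unfolding mq_def
  by (intro continuous_on_add continuous_on_mult continuous_on_const continuous_on_cnj c tr_cont[OF de])
qed

end

section \<open>Second derivatives in the parameter\<close>

lemma half_absorb:
 fixes a b :: real
 assumes "a <= b + 1 / 2 * (1 + a + b)" shows "a <= 3 * b + 1"
proof -
 have "2 * a <= 2 * (b + 1 / 2 * (1 + a + b))" by (rule mult_left_mono[OF assms]) simp
 also have "... = 2 * b + (1 + a + b)" by (simp add: field_simps)
 finally have "2 * a <= 2 * b + (1 + a + b)" .
 then show ?thesis by linarith
qed

context hyperbolic_charts
begin

definition dq :: "complex => complex \<times> real => 'd => complex => complex" where
 "dq v x d z = (psi d (shift v x) z - psi d (fst x) z) / of_real (snd x)"

lemma smooth_dq:
 fixes v :: complex and x :: "complex \<times> real"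
 assumes d: "d : D" and "snd x ~= 0"
 defines "V == sl d (fst x) Int sl d (shift v x)"
 shows "open V" "smooth_on V (dq v x d)"
  "z : V ==> lap (dq v x d) z = G d (shift v x) z * dq v x d z
   + psi d (fst x) z * ((G d (shift v x) z - G d (fst x) z) / of_real (snd x))"
proof -
 define w w' where "w = fst x" and "w' = shift v x"
 define c where "c = inverse (complex_of_real (snd x))"
 show V: "open V" unfolding V_def by (intro open_Int open_sl d)
 have eq: "dq v x d = (%z. c * (psi d w' z - psi d w z))"
  by (simp add: dq_def fun_eq_iff c_def w_def w'_def divide_inverse mult.commute)
 have sm: "smooth_on V (psi d w')" "smooth_on V (psi d w)"
  by (rule smo_subset[OF sm_psi[OF d]], simp add: V_def w_def w'_def)+
 note smd = smo_diff[OF V sm]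
 show "smooth_on V (dq v x d)" unfolding eq by (rule smo_mult[OF V smo_const smd])
 show "lap (dq v x d) z = G d (shift v x) z * dq v x d z
   + psi d (fst x) z * ((G d (shift v x) z - G d (fst x) z) / of_real (snd x))" if z: "z : V"
 proof -
  have "lap (dq v x d) z = c * (lap (psi d w') z - lap (psi d w) z)"
   unfolding eq lap_cmult[OF V z smd] lap_diff[OF V z sm] ..
  also have "... = c * (G d w' z * psi d w' z - G d w z * psi d w z)"
   using lap_psi[OF d] z by (simp add: V_def w_def w'_def)
  finally have L: "lap (dq v x d) z = c * (G d w' z * psi d w' z - G d w z * psi d w z)" .
  show ?thesis unfolding L by (simp add: dq_def c_def w_def w'_def divide_inverse algebra_simps)
 qed
qed

text \<open>Differentiability of \<open>psi\<close> in \<open>w\<close> is not yet available. With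
  \<open>w'\<close> the shifted parameter, the mismatch of the quotients equals a quotient of
  \<open>psi e w'\<close> along the moving point \<open>t (y, w)\<close>, the fibre
  \<open>w'\<close> being frozen, plus a quotient of \<open>mt\<close>. The former involves only
  derivatives along the fibre, so both converge.\<close>

lemma transition_quotient:
 assumes de: "d : D" "e : D" and zov: "(z, w0) : ov d e" and v: "cmod v = 1"
 obtains \<mu> where "!!eps. eps > 0 ==> EX dl>0. ALL y w h. dist y z < dl --> dist w w0 < dl --> 0 < (abs h) --> (abs h) < dl -->
   (y, w) : ov d e & cmod (dq v (w, h) d y - dq v (w, h) e (tr d e (y, w)) - \<mu>) <= eps"
proof -
 define t where "t = tr d e"
 note h = tr_hol2[OF de, folded t_def]
 define H where "H = (%x. psi e (snd (fst x)) (t (fst (fst x), snd x)))"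
 define Y where "Y = (%x :: (complex \<times> complex) \<times> complex. (fst (fst x), snd x))"
 define Z where "Z = (%x :: (complex \<times> complex) \<times> complex. (t (Y x), snd (fst x)))"
 define U where "U = {x. Y x : ov d e & Z x : Om e}"
 have cY: "continuous_on S Y" for S unfolding Y_def by (intro continuous_intros)
 have oY: "open (Y -` ov d e)" by (rule open_vimage[OF hol2_open[OF h] cY])
 have ct: "continuous_on (ov d e) t" unfolding t_def by (rule tr_cont(1)[OF de])
 have cZ: "continuous_on (Y -` ov d e) Z" unfolding Z_def
  by (intro continuous_on_Pair continuous_on_compose2[OF ct cY] continuous_intros) auto
 have U: "open U"
  using continuous_open_preimage[OF cZ oY open_Om[OF de(2)]] by (simp add: U_def Int_def vimage_def)
 have cZU: "continuous_on U Z" by (rule continuous_on_subset[OF cZ]) (auto simp: U_def)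
 have cO: "continuous_on U (%x. k (snd (fst x)) (t (Y x)))" if "continuous_on (Om e) (%x. k (snd x) (fst x))" for k :: "complex => complex => complex"
  using continuous_on_compose2[OF that cZU] by (force simp: U_def Z_def)
 have cD: "continuous_on U (%x. d2 t (Y x))"
  by (rule continuous_on_compose2[OF hol2_d2_continuous_on[OF h] cY]) (auto simp: U_def)
 define p where "p = (%x. dz (psi e (snd (fst x))) (t (Y x)) * d2 t (Y x))"
 define q where "q = (%x. dzbar (psi e (snd (fst x))) (t (Y x)) * cnj (d2 t (Y x)))"
 have cp: "continuous_on U p" unfolding p_def
  by (intro continuous_on_mult cD cO[where k = "%w. dz (psi e w)"] continuous_on_psi de)
 have cq: "continuous_on U q" unfolding q_def
  by (intro continuous_on_mult continuous_on_cnj cD cO[where k = "%w. dzbar (psi e w)"] continuous_on_psi de)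
 have wH: "wirt (%w. H (y, w)) (p (y, w)) (q (y, w)) w" if "(y, w) : U" for y w
 proof -
  have y: "(fst y, w) : ov d e" "t (fst y, w) : sl e (snd y)" using that by (auto simp: U_def Y_def Z_def sl_def)
  show ?thesis unfolding H_def p_def q_def Y_def fst_conv snd_conv
   by (rule wirt_pre_compose[of "psi e (snd y)" _ _ "%w. t (fst y, w)", OF wirt_smooth[OF sm_psi[OF de(2)] y(2)] hol2_d2[OF h y(1)]])
 qed
 have z0U: "((z, w0), w0) : U" using zov tr_Om[OF de zov] by (simp add: U_def Y_def Z_def t_def)
 define \<mu>1 where "\<mu>1 = v * p ((z, w0), w0) + cnj v * q ((z, w0), w0)"
 define \<mu>2 where "\<mu>2 = v * mp d e (z, w0) + cnj v * mq d e (z, w0)"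
 have "EX dl>0. ALL y w h. dist y z < dl --> dist w w0 < dl --> 0 < (abs h) --> (abs h) < dl -->
   (y, w) : ov d e & cmod (dq v (w, h) d y - dq v (w, h) e (tr d e (y, w)) - (\<mu>1 + \<mu>2)) <= eps" if eps: "eps > 0" for eps
 proof -
  have e2: "eps / 2 > 0" using eps by simp
  obtain dl1 where dl1: "dl1 > 0" "!!y w h. dist y (z, w0) < dl1 ==> dist w w0 < dl1 ==> 0 < (abs h) ==> (abs h) < dl1 ==>
    (y, w) : U & (y, w + of_real h * v) : U & cmod ((H (y, w + of_real h * v) - H (y, w)) / of_real h - \<mu>1) <= eps / 2"
   by (rule strong_dq[where H = H, OF U z0U wH cp cq e2 v, folded \<mu>1_def]) (assumption, rule that, assumption, blast)
  obtain dl2 where dl2: "dl2 > 0" "!!y w h. dist y z < dl2 ==> dist w w0 < dl2 ==> 0 < (abs h) ==> (abs h) < dl2 ==>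
    (y, w) : ov d e & (y, w + of_real h * v) : ov d e & cmod ((mt d e (y, w + of_real h * v) - mt d e (y, w)) / of_real h - \<mu>2) <= eps / 2"
   by (rule strong_dq[where H = "mt d e", OF hol2_open[OF tr_hol2[OF de]] zov wirt_mt[OF de] mpq_cont[OF de] e2 v, folded \<mu>2_def]) (assumption, rule that, assumption, blast)
  define dl where "dl = min (dl1 / 3) dl2"
  show ?thesis
  proof (intro exI[of _ dl] conjI allI impI)
   show "dl > 0" using dl1 dl2 by (simp add: dl_def)
   fix y w and h :: real assume a: "dist y z < dl" "dist w w0 < dl" "0 < (abs h)" "(abs h) < dl"
   define w' where "w' = w + of_real h * v"
   have w': "dist w' w0 < 2 * (dl1 / 3)"
    using a norm_triangle_ineq[of "w - w0" "of_real h * v"] v by (simp add: w'_def dl_def dist_norm norm_mult add_diff_eq diff_add_eq)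
   have "dist (y, w') (z, w0) < dl1"
    using w' a sqrt_sum_squares_le_sum[of "dist y z" "dist w' w0"] by (simp add: dist_Pair_Pair dl_def)
   then have 1: "((y, w'), w) : U" "cmod ((H ((y, w'), w') - H ((y, w'), w)) / of_real h - \<mu>1) <= eps / 2"
    using dl1(2)[of "(y, w')" w h] a dl1(1) by (auto simp: w'_def dl_def)
   have 2: "(y, w) : ov d e" "(y, w') : ov d e" "cmod ((mt d e (y, w') - mt d e (y, w)) / of_real h - \<mu>2) <= eps / 2"
    using dl2(2)[of y w h] a by (auto simp: w'_def dl_def)
   show "(y, w) : ov d e" by (rule 2(1))
   have "dq v (w, h) d y - dq v (w, h) e (t (y, w)) = (H ((y, w'), w') - H ((y, w'), w)) / of_real h + (mt d e (y, w') - mt d e (y, w)) / of_real h"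
    using psi_mt[OF de 2(1)] psi_mt[OF de 2(2)]
    by (simp add: dq_def H_def w'_def[symmetric] t_def diff_divide_distrib add_divide_distrib)
   then have "dq v (w, h) d y - dq v (w, h) e (t (y, w)) - (\<mu>1 + \<mu>2) =
    ((H ((y, w'), w') - H ((y, w'), w)) / of_real h - \<mu>1) + ((mt d e (y, w') - mt d e (y, w)) / of_real h - \<mu>2)"
    by simp
   also have "cmod ... <= eps / 2 + eps / 2" by (rule order.trans[OF norm_triangle_ineq add_mono[OF 1(2) 2(3)]])
   finally show "cmod (dq v (w, h) d y - dq v (w, h) e (tr d e (y, w)) - (\<mu>1 + \<mu>2)) <= eps" by (simp add: t_def)
  qed
 qed
 then show ?thesis by (rule that)
qed

text \<open>\<open>strong_dq\<close> gives the limit near each point, and compactness of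
  \<open>K\<close> makes it uniform.\<close>

lemma G_quotient:
 assumes d: "d : D" and K: "compact K" "K <= sl d w0" and v: "cmod v = 1" and eta: "eta > 0"
 shows "\<forall>\<^sub>F x in dqF w0. ALL y:K. cmod ((G d (shift v x) y - G d (fst x) y) / of_real (snd x) -
  (v * (G d w0 y * psi d w0 y) + cnj v * (G d w0 y * cnj (psi d w0 y)))) <= eta"
proof -
 define T where "T y = v * (G d w0 y * psi d w0 y) + cnj v * (G d w0 y * cnj (psi d w0 y))" for y
 have cT: "continuous_on (sl d w0) T"
  unfolding T_def by (intro continuous_intros cont_slices[OF d order.refl])
 show ?thesis unfolding T_def[symmetric]
 proof (rule eventually_compact[OF K(1)])
  fix z assume z: "z : K"
  have zs: "z : sl d w0" using K(2) z by blast
  have e2: "eta / 2 > 0" using eta by simp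
  obtain dl1 where dl1: "dl1 > 0" "!!y w h. dist y z < dl1 ==> dist w w0 < dl1 ==> 0 < (abs h) ==> (abs h) < dl1 ==>
    (y, w) : Om d & (y, w + of_real h * v) : Om d & cmod (((%x. G d (snd x) (fst x)) (y, w + of_real h * v) - (%x. G d (snd x) (fst x)) (y, w)) / of_real h -
    (v * (%x. G d (snd x) (fst x) * psi d (snd x) (fst x)) (z, w0) + cnj v * (%x. G d (snd x) (fst x) * cnj (psi d (snd x) (fst x))) (z, w0))) <= eta / 2"
  proof (rule strong_dq[where H = "%x. G d (snd x) (fst x)" and U = "Om d" and v = v and eps = "eta / 2" and ?z0.0 = z and ?w0.0 = w0])
   show "wirt (%w. G d (snd (y, w)) (fst (y, w))) (G d (snd (y, w)) (fst (y, w)) * psi d (snd (y, w)) (fst (y, w)))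
    (G d (snd (y, w)) (fst (y, w)) * cnj (psi d (snd (y, w)) (fst (y, w)))) w" if "(y, w) : Om d" for y w
    using wirt_w_G[OF d that] by simp
  qed (use zs e2 v open_Om[OF d] in \<open>auto simp: sl_def intro!: continuous_on_mult continuous_on_cnj continuous_on_first[OF d] continuous_on_psi[OF d]\<close>)
  obtain dl2 where dl2: "dl2 > 0" "!!y. dist y z < dl2 ==> dist (T y) (T z) < eta / 2"
   using cT zs open_sl[OF d] e2 unfolding continuous_on_eq_continuous_at[OF open_sl[OF d]] continuous_at_eps_delta by blast
  have "\<forall>\<^sub>F x in dqF w0. ALL y:ball z (min dl1 dl2). cmod ((G d (shift v x) y - G d (fst x) y) / of_real (snd x) - T y) <= eta"
  proof (rule dqFI[OF dl1(1)], intro ballI)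
   fix w and h :: real and y assume a: "dist w w0 < dl1" "0 < (abs h)" "(abs h) < dl1" "y : ball z (min dl1 dl2)"
   have "cmod ((G d (w + of_real h * v) y - G d w y) / of_real h - T z) <= eta / 2"
    using dl1(2)[of y w h] a by (simp add: T_def dist_commute)
   moreover have "cmod (T z - T y) <= eta / 2" using dl2(2)[of y] a by (simp add: dist_norm norm_minus_commute)
   ultimately have "cmod ((G d (w + of_real h * v) y - G d w y) / of_real h - T y) <= eta"
    using norm_triangle_ineq[of "(G d (w + of_real h * v) y - G d w y) / of_real h - T z" "T z - T y"] by simp
   then show "cmod ((G d (fst (w, h) + of_real (snd (w, h)) * v) y - G d (fst (w, h)) y) / of_real (snd (w, h)) - T y) <= eta"
    by simp
  qed
  then show "EX dl>0. \<forall>\<^sub>F x in dqF w0. ALL y:ball z dl. cmod ((G d (shift v x) y - G d (fst x) y) / of_real (snd x) - T y) <= eta"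
   using dl1(1) dl2(1) by (intro exI[of _ "min dl1 dl2"]) simp
 qed
qed

text \<open>The difference of two quotients solves \<open>lap U = G U\<close> and matches between
  charts, up to small errors, because the inhomogeneous terms \<open>psi T\<close> and \<mu> are
  common to both. These errors are small only relative to the size of the quotients, for which no
  bound is known; hence \<open>fibre_linear_bound\<close> is used with the scale
  \<open>1 + n x + n x'\<close>, and boundedness is extracted from the outcome.\<close>

lemma dq_cauchy:
 assumes gc: "good_cover w0 F r" and ne: "F ~= {}" and v: "cmod v = 1" and eps: "eps > 0"
 shows "\<forall>\<^sub>F p in dqF w0 \<times>\<^sub>F dqF w0. ALL i:F. ALL y:disc2 r i.
  cmod (dq v (fst p) (fst i) y - dq v (snd p) (fst i) y) <= eps"
proof -
 note gcD = good_coverD[OF gc]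
 define K where "K i = disc2 r i" for i :: "'d \<times> complex"
 have K: "compact (K i)" for i by (simp add: K_def)
 define good where "good x \<longleftrightarrow> (ALL i:F. K i <= sl (fst i) (fst x)) &
  (ALL i:F. K i <= sl (fst i) (shift v x)) & snd x ~= 0" for x
 have evr: "\<forall>\<^sub>F w in nhds w0. ALL i:F. K i <= sl (fst i) w"
 proof (rule eventually_ball_finite[OF gcD(1)], rule ballI)
  fix i assume i: "i : F"
  have "\<forall>\<^sub>F w in nhds w0. dist w w0 < r i" unfolding eventually_nhds_metric using gcD(3)[OF i] by blast
  then show "\<forall>\<^sub>F w in nhds w0. K i <= sl (fst i) w"
   by (rule eventually_mono) (use gcD(6)[OF i] in "simp add: K_def")
 qed
 have good: "\<forall>\<^sub>F x in dqF w0. good x"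
  using dqF_base[OF evr v] by (simp add: good_def)
 have K0: "K i <= sl (fst i) w0" if "i : F" for i using gcD(5)[OF that] by (auto simp: K_def)
 have KOm: "K i \<times> {w0} <= Om (fst i)" if "i : F" for i using K0[OF that] by (auto simp: sl_def)
 have gV: "K i <= sl (fst i) (fst x) Int sl (fst i) (shift v x)" "snd x ~= 0" if "good x" "i : F" for x i
  using that by (auto simp: good_def)
 have cdq: "continuous_on (K i) (dq v x (fst i))" if "good x" "i : F" for x i
  by (rule continuous_on_subset[OF smo_imp_continuous_on[OF smooth_dq(2)[OF gcD(2)[OF that(2)] gV(2)[OF that]]] gV(1)[OF that]])
 \<comment> \<open>The maximal size of a quotient over all discs. Up to the end of the argument all
   errors are measured against \<open>1 + n x\<close>.\<close>
 define n where "n x = Sup ((%(i, z). cmod (dq v x (fst i) z)) ` Sigma F K)" for x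
 have n_ge: "cmod (dq v x (fst i) z) <= n x" if g: "good x" "i : F" "z : K i" for x i z
 proof -
  obtain C where "ALL i:F. ALL y:K i. cmod (dq v x (fst i) y) <= C"
   using finite_compact_bound[where h = "%i. dq v x (fst i)", OF gcD(1) K cdq[OF g(1)]] by blast
  then have "bdd_above ((%(i, z). cmod (dq v x (fst i) z)) ` Sigma F K)" unfolding bdd_above_def by (intro exI[of _ C]) auto
  then show ?thesis unfolding n_def by (rule cSup_upper[rotated]) (use g in force)
 qed
 have Kne: "snd i : K i" if "i : F" for i using gcD(3)[OF that] by (simp add: K_def)
 have n_le: "n x <= b" if b: "!!i z. i : F ==> z : K i ==> cmod (dq v x (fst i) z) <= b" for x b
  unfolding n_def
 proof (rule cSup_least)
  obtain i where "i : F" using ne by blast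
  then have "(i, snd i) : Sigma F K" using Kne by blast
  then show "(%(i, z). cmod (dq v x (fst i) z)) ` Sigma F K ~= {}" by blast
  fix s assume "s : (%(i, z). cmod (dq v x (fst i) z)) ` Sigma F K"
  then obtain i z where "i : F" "z : K i" "s = cmod (dq v x (fst i) z)" by auto
  then show "s <= b" using b by simp
 qed
 have n0: "0 <= n x" if "good x" for x
 proof -
  obtain i where "i : F" using ne by blast
  then show ?thesis using order.trans[OF norm_ge_zero n_ge[OF that _ Kne]] by blast
 qed
 define T where "T d y = v * (G d w0 y * psi d w0 y) + cnj v * (G d w0 y * cnj (psi d w0 y))" for d y
 have cT: "continuous_on (sl d w0) (T d)" if "d : D" for d
  unfolding T_def by (intro continuous_intros cont_slices[OF that order.refl])
 have ucl: "\<forall>\<^sub>F x in dqF w0. ALL y:K i. dist (H (y, fst x)) (H (y, w0)) < eta & dist (H (y, shift v x)) (H (y, w0)) < eta"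
  if "i : F" "continuous_on (Om (fst i)) H" "eta > 0" for i eta and H :: "complex \<times> complex => complex"
 proof -
  have "\<forall>\<^sub>F w in nhds w0. ALL y:K i. dist (H (y, w)) (H (y, w0)) < eta"
   using uniform_limit_of_continuous_on(2)[OF open_Om[OF gcD(2)[OF that(1)]] that(2) K KOm[OF that(1)]] that(3)
   unfolding uniform_limit_iff by blast
  from dqF_base[OF this v] show ?thesis by (rule eventually_mono) blast
 qed
 have dG: "\<forall>\<^sub>F x in dqF w0. ALL y:K i. cmod ((G (fst i) (shift v x) y - G (fst i) (fst x) y) / of_real (snd x) - T (fst i) y) <= eta"
  if i: "i : F" and eta: "eta > 0" for i eta
  unfolding T_def by (rule G_quotient[OF gcD(2)[OF i] K K0[OF i] v eta])
 have "continuous_on (K i) (psi (fst i) w0)" "continuous_on (K i) (T (fst i))" "continuous_on (K i) (G (fst i) w0)" if "i : F" for i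
  using cont_slices[OF gcD(2)[OF that] K0[OF that]] continuous_on_subset[OF cT[OF gcD(2)[OF that]] K0[OF that]] by auto
 note c = this
 have "EX C>=0. ALL i:F. ALL y:K i. cmod (psi (fst i) w0 y) <= C"
  by (rule finite_compact_bound[where h = "%i. psi (fst i) w0", OF gcD(1) K c(1)])
 then obtain B1 where B1: "B1 >= 0" "ALL i:F. ALL y:K i. cmod (psi (fst i) w0 y) <= B1" by blast
 have "EX C>=0. ALL i:F. ALL y:K i. cmod (T (fst i) y) <= C"
  by (rule finite_compact_bound[where h = "%i. T (fst i)", OF gcD(1) K c(2)])
 then obtain B2 where B2: "B2 >= 0" "ALL i:F. ALL y:K i. cmod (T (fst i) y) <= B2" by blast
 have "EX C>=0. ALL i:F. ALL y:K i. cmod (G (fst i) w0 y) <= C"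
  by (rule finite_compact_bound[where h = "%i. G (fst i) w0", OF gcD(1) K c(3)])
 then obtain B3 where B3: "B3 >= 0" "ALL i:F. ALL y:K i. cmod (G (fst i) w0 y) <= B3" by blast
 have B: "B1 >= 0" "B2 >= 0" "B3 >= 0" "!!i y. i : F ==> y : K i ==> cmod (psi (fst i) w0 y) <= B1"
  "!!i y. i : F ==> y : K i ==> cmod (T (fst i) y) <= B2" "!!i y. i : F ==> y : K i ==> cmod (G (fst i) w0 y) <= B3"
  using B1 B2 B3 by auto
 define err where "err x d y = lap (dq v x d) y - G d w0 y * dq v x d y - psi d w0 y * T d y" for x d y
 have err: "\<forall>\<^sub>F x in dqF w0. ALL y:K i. cmod (err x (fst i) y) <= eta * (1 + (abs (n x)))" if i: "i : F" and eta: "eta > 0" for i eta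
 proof -
  define d where "d = fst i"
  have d: "d : D" using gcD(2)[OF i] by (simp add: d_def)
  define eta2 where "eta2 = eta / (3 * (B2 + eta + 1))"
  define eta3 where "eta3 = min eta (eta / (3 * (B1 + 1)))"
  have eta': "eta / 3 > 0" "eta2 > 0" "eta3 > 0" using eta B by (auto simp: eta2_def eta3_def add_nonneg_pos)
  from ucl[OF i continuous_on_first(2)[OF gcD(2)[OF i]] eta'(1)] ucl[OF i continuous_on_psi(1)[OF gcD(2)[OF i]] eta'(2)] dG[OF i eta'(3)] good
  show ?thesis
  proof eventually_elim
   case (elim x)
   show ?case
   proof
    fix y assume y: "y : K i"
    define w w' where "w = fst x" and "w' = shift v x"
    define g where "g = (G d w' y - G d w y) / of_real (snd x)"
    define u where "u = dq v x d y"
    have yV: "y : sl d (fst x) Int sl d (shift v x)" using gV(1)[OF elim(4) i] y by (auto simp: d_def)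
    have u: "cmod u <= n x" unfolding u_def d_def by (rule n_ge[OF elim(4) i y])
    have 1: "cmod (G d w' y - G d w0 y) <= eta / 3" using elim(1) y by (auto simp: d_def w'_def dist_norm less_imp_le)
    have 2: "cmod (psi d w y - psi d w0 y) <= eta2" using elim(2) y by (auto simp: d_def w_def dist_norm less_imp_le)
    have 3: "cmod (g - T d y) <= eta3" using elim(3) y by (simp add: d_def g_def w_def w'_def)
    have g: "cmod g <= B2 + eta + 1"
     using 3 B(5)[OF i y] norm_triangle_sub[of g "T d y"] by (simp add: d_def eta3_def)
    have L: "lap (dq v x d) y = G d w' y * u + psi d w y * g"
     using smooth_dq(3)[OF d gV(2)[OF elim(4) i] yV] by (simp add: g_def u_def w_def w'_def)
    have eq: "err x d y = (G d w' y - G d w0 y) * u + ((psi d w y - psi d w0 y) * g + psi d w0 y * (g - T d y))"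
     unfolding err_def L u_def[symmetric] by (simp add: algebra_simps)
    have "cmod (err x d y) <= cmod (G d w' y - G d w0 y) * cmod u + (cmod (psi d w y - psi d w0 y) * cmod g + cmod (psi d w0 y) * cmod (g - T d y))"
     unfolding eq norm_mult[symmetric] by (rule order.trans[OF norm_triangle_ineq add_left_mono[OF norm_triangle_ineq]])
    also have "... <= eta / 3 * (abs (n x)) + (eta2 * (B2 + eta + 1) + (B1 + 1) * (eta / (3 * (B1 + 1))))"
    proof -
     have b1: "cmod u <= (abs (n x))" using u by simp
     have b2: "cmod (psi d w0 y) <= B1 + 1" using B(4)[OF i y] by (simp add: d_def)
     have b3: "cmod (g - T d y) <= eta / (3 * (B1 + 1))" using 3 by (simp add: eta3_def)
     have p: "0 <= eta / 3" "0 <= eta2" "0 <= B1 + 1" using eta'(1,2) B(1) by simp_all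
     show ?thesis
      by (rule add_mono[OF mult_mono[OF 1 b1 p(1) norm_ge_zero] add_mono[OF mult_mono[OF 2 g p(2) norm_ge_zero] mult_mono[OF b2 b3 p(3) norm_ge_zero]]])
    qed
    also have "... = eta / 3 * (abs (n x)) + 2 * (eta / 3)"
    proof -
     have "eta2 * (B2 + eta + 1) = eta / 3" "(B1 + 1) * (eta / (3 * (B1 + 1))) = eta / 3"
      unfolding eta2_def using B eta by (simp_all add: field_simps)
     then show ?thesis by simp
    qed
    also have "... <= eta * (1 + (abs (n x)))" using eta mult_nonneg_nonneg[OF less_imp_le[OF eta] abs_ge_zero[of "n x"]] unfolding distrib_left by linarith
    finally show "cmod (err x (fst i) y) <= eta * (1 + (abs (n x)))" by (simp add: d_def)
   qed
  qed
 qed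
 define C1 where "C1 = B3 + B1 * B2 + 1"
 have C1: "C1 > 0" using B by (simp add: C1_def add_nonneg_pos)
 have lapb: "\<forall>\<^sub>F x in dqF w0. ALL i:F. ALL y:K i. cmod (lap (dq v x (fst i)) y) <= C1 * (1 + (abs (n x)))"
 proof (rule eventually_ball_finite[OF gcD(1)], rule ballI)
  fix i assume i: "i : F"
  from err[OF i zero_less_one] good
  show "\<forall>\<^sub>F x in dqF w0. ALL y:K i. cmod (lap (dq v x (fst i)) y) <= C1 * (1 + (abs (n x)))"
  proof eventually_elim
   case (elim x)
   show ?case
   proof
    fix y assume y: "y : K i"
    have eq: "lap (dq v x (fst i)) y = err x (fst i) y + (G (fst i) w0 y * dq v x (fst i) y + psi (fst i) w0 y * T (fst i) y)"
     by (simp add: err_def)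
    have "cmod (lap (dq v x (fst i)) y) <= cmod (err x (fst i) y) + (cmod (G (fst i) w0 y) * cmod (dq v x (fst i) y) + cmod (psi (fst i) w0 y) * cmod (T (fst i) y))"
     unfolding eq norm_mult[symmetric] by (rule order.trans[OF norm_triangle_ineq add_left_mono[OF norm_triangle_ineq]])
    also have "... <= 1 * (1 + (abs (n x))) + (B3 * (abs (n x)) + B1 * B2)"
    proof -
     have b1: "cmod (err x (fst i) y) <= 1 * (1 + (abs (n x)))" using elim(1) y by blast
     have b2: "cmod (dq v x (fst i) y) <= (abs (n x))" using n_ge[OF elim(2) i y] by simp
     show ?thesis
      by (rule add_mono[OF b1 add_mono[OF mult_mono[OF B(6)[OF i y] b2 B(3) norm_ge_zero] mult_mono[OF B(4)[OF i y] B(5)[OF i y] B(1) norm_ge_zero]]])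
    qed
    also have "... <= C1 * (1 + (abs (n x)))"
     using B(3) mult_nonneg_nonneg[OF mult_nonneg_nonneg[OF B(1,2)] abs_ge_zero[of "n x"]] unfolding C1_def distrib_left distrib_right by linarith
    finally show "cmod (lap (dq v x (fst i)) y) <= C1 * (1 + (abs (n x)))" .
   qed
  qed
 qed
 \<comment> \<open>The image point is taken with the transition at \<open>w0\<close> rather than at
   the base point of \<open>x\<close>: two quotients with different base points have to be compared
   with one and the same point of the other disc.\<close>
 have match: "EX \<mu>. ALL eta>0. EX dl>0. \<forall>\<^sub>F x in dqF w0. ALL y:ball z dl. tr (fst i) (fst j) (y, w0) : cball (snd j) (r j) &
   cmod (dq v x (fst i) y - dq v x (fst j) (tr (fst i) (fst j) (y, w0)) - \<mu>) <= eta * (1 + (abs (n x)))"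
  if ij: "i : F" "j : F" "z : K i" and zov: "(z, w0) : ov (fst i) (fst j)" and dist: "dist (tr (fst i) (fst j) (z, w0)) (snd j) < r j" for i j z
 proof -
  define d e where "d = fst i" and "e = fst j"
  have de: "d : D" "e : D" using gcD(2) ij by (auto simp: d_def e_def)
  note zov = zov[folded d_def e_def] and dist = dist[folded d_def e_def]
  define T0 where "T0 = tr d e (z, w0)"
  define s where "s = r j"
  have s: "s > 0" using gcD(3)[OF ij(2)] by (simp add: s_def)
  have sub: "cball T0 s <= K j"
  proof
   fix y assume "y : cball T0 s"
   then show "y : K j" using dist dist_triangle[of "snd j" y T0] by (simp add: K_def T0_def s_def dist_commute)
  qed
  define C2 where "C2 = 2 * (8 / s + C1 * s)"
  have C2: "C2 > 0" using s C1 by (simp add: C2_def add_pos_pos)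
  \<comment> \<open>The gradient estimate bounds the derivatives of a quotient by a multiple of
    \<open>1 + n x\<close>. This pays for moving from the image under the transition at the base
    point of \<open>x\<close> to the image at \<open>w0\<close>.\<close>
  have lip: "\<forall>\<^sub>F x in dqF w0. ALL a:ball T0 (s / 2). ALL b:ball T0 (s / 2). cmod (dq v x e a - dq v x e b) <= C2 * (1 + (abs (n x))) * cmod (a - b)"
   using lapb good
  proof eventually_elim
   case (elim x)
   define V where "V = sl e (fst x) Int sl e (shift v x)"
   have V: "open V" "smooth_on V (dq v x e)" unfolding V_def by (rule smooth_dq[OF de(2) gV(2)[OF elim(2) ij(2)]])+
   have KV: "K j <= V" using gV(1)[OF elim(2) ij(2)] by (simp add: V_def e_def)
   have grad: "cmod (dz (dq v x e) y) <= (8 / s + C1 * s) * (1 + (abs (n x))) & cmod (dzbar (dq v x e) y) <= (8 / s + C1 * s) * (1 + (abs (n x)))"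
    if y: "y : ball T0 (s / 2)" for y
   proof -
    have sb: "cball y (s / 2) <= K j"
    proof
     fix b assume "b : cball y (s / 2)"
     then have "b : cball T0 s" using y dist_triangle[of T0 b y] by simp
     then show "b : K j" using sub by blast
    qed
    have b: "cmod (dq v x e b) <= n x" "cmod (lap (dq v x e) b) <= C1 * (1 + (abs (n x)))" if "b : cball y (s / 2)" for b
     using n_ge[OF elim(2) ij(2)] elim(1) ij(2) sb that by (auto simp: e_def)
    have "4 * n x / (s / 2) + 2 * (C1 * (1 + (abs (n x)))) * (s / 2) <= (8 / s + C1 * s) * (1 + (abs (n x)))"
    proof -
     have "4 * n x / (s / 2) = 8 / s * n x" by simp
     also have "... <= 8 / s * (1 + (abs (n x)))" using s by (intro mult_left_mono) auto
     finally show ?thesis by (simp add: algebra_simps)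
    qed
    moreover have s2: "0 < s / 2" "cball y (s / 2) <= V" using s sb KV by auto
    ultimately show ?thesis
     using gradient_estimate'[OF V s2 b] by fastforce
   qed
   show ?case
   proof (intro ballI)
    fix a b assume ab: "a : ball T0 (s / 2)" "b : ball T0 (s / 2)"
    have "norm (dq v x e a - dq v x e b - 0) <= (C2 * (1 + (abs (n x)))) * norm (a - b)"
    proof (rule increment_bound[where S = "ball T0 (s / 2)" and L = "%_. 0" and f' = "%y h. dz (dq v x e) y * h + dzbar (dq v x e) y * cnj h"])
     fix y assume y: "y : ball T0 (s / 2)"
     have "y : V" using y sub KV s by (auto simp: subset_iff)
     from wirt_smooth[OF V(2) this] show "(dq v x e has_derivative (%h. dz (dq v x e) y * h + dzbar (dq v x e) y * cnj h)) (at y)"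
      by (simp add: wirt_def)
     fix h
     have "cmod (dz (dq v x e) y * h + dzbar (dq v x e) y * cnj h) <= cmod (dz (dq v x e) y) * cmod h + cmod (dzbar (dq v x e) y) * cmod h"
      by (rule order.trans[OF norm_triangle_ineq]) (simp add: norm_mult)
     also have "... <= (8 / s + C1 * s) * (1 + (abs (n x))) * cmod h + (8 / s + C1 * s) * (1 + (abs (n x))) * cmod h"
      using grad[OF y] by (intro add_mono mult_right_mono) auto
     finally show "norm (dz (dq v x e) y * h + dzbar (dq v x e) y * cnj h - 0) <= C2 * (1 + (abs (n x))) * norm h"
      by (simp add: C2_def algebra_simps)
    qed (use ab C2 in auto)
    then show "cmod (dq v x e a - dq v x e b) <= C2 * (1 + (abs (n x))) * cmod (a - b)" by simp
   qed
  qed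
  obtain \<mu> where \<mu>: "!!eps. eps > 0 ==> EX dl>0. ALL y w h. dist y z < dl --> dist w w0 < dl --> 0 < (abs h) --> (abs h) < dl -->
   (y, w) : ov d e & cmod (dq v (w, h) d y - dq v (w, h) e (tr d e (y, w)) - \<mu>) <= eps"
   using transition_quotient[OF de zov v] by metis
  have "EX dl>0. \<forall>\<^sub>F x in dqF w0. ALL y:ball z dl. tr d e (y, w0) : cball (snd j) (r j) &
   cmod (dq v x d y - dq v x e (tr d e (y, w0)) - \<mu>) <= eta * (1 + (abs (n x)))" if eta: "eta > 0" for eta
  proof -
   have e2: "eta / 2 > 0" using eta by simp
   obtain dl1 where dl1: "dl1 > 0" "ALL y w h. dist y z < dl1 --> dist w w0 < dl1 --> 0 < (abs h) --> (abs h) < dl1 -->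
    (y, w) : ov d e & cmod (dq v (w, h) d y - dq v (w, h) e (tr d e (y, w)) - \<mu>) <= eta / 2" using \<mu>[OF e2] by blast
   define c where "c = min (s / 2) (min (eta / (4 * C2)) (r j - dist (tr d e (z, w0)) (snd j)))"
   have c: "c > 0" using s C2 eta dist by (simp add: c_def)
   obtain dl2 where dl2: "dl2 > 0" "!!y w. dist y z < dl2 ==> dist w w0 < dl2 ==> (y, w) : ov d e & dist (tr d e (y, w)) T0 < c"
    using continuous_on_box[OF hol2_open[OF tr_hol2[OF de]] tr_cont(1)[OF de] zov c] unfolding T0_def by metis
   have ev: "\<forall>\<^sub>F x in dqF w0. dist (fst x) w0 < min dl1 dl2 & 0 < \<bar>snd x\<bar> & \<bar>snd x\<bar> < dl1"
    by (rule dqFI[of "min dl1 dl2"]) (use dl1(1) dl2(1) in auto)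
   from ev lip have "\<forall>\<^sub>F x in dqF w0. ALL y:ball z (min dl1 dl2). tr d e (y, w0) : cball (snd j) (r j) &
    cmod (dq v x d y - dq v x e (tr d e (y, w0)) - \<mu>) <= eta * (1 + (abs (n x)))"
   proof eventually_elim
    case (elim x)
    show ?case
    proof
     fix y assume y: "y : ball z (min dl1 dl2)"
     define a b where "a = tr d e (y, fst x)" and "b = tr d e (y, w0)"
     have yd: "dist y z < dl1" "dist y z < dl2" using y by (auto simp: dist_commute)
     have a: "dist a T0 < c" using dl2(2)[OF yd(2), of "fst x"] elim(1) by (simp add: a_def)
     have b: "dist b T0 < c" using dl2(2)[OF yd(2), of w0] dl2(1) by (simp add: b_def)
     have "dist b (snd j) <= dist b T0 + dist T0 (snd j)" by (rule dist_triangle)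
     then have bj: "b : cball (snd j) (r j)" using b by (simp add: c_def T0_def dist_commute)
     have ab: "a : ball T0 (s / 2)" "b : ball T0 (s / 2)" using a b by (auto simp: c_def dist_commute)
     have "dist a b <= dist a T0 + dist b T0" by (rule dist_triangle2)
     then have "cmod (a - b) <= eta / (2 * C2)" using a b by (simp add: c_def dist_norm field_simps)
     then have "C2 * (1 + (abs (n x))) * cmod (a - b) <= C2 * (1 + (abs (n x))) * (eta / (2 * C2))"
      using C2 by (intro mult_left_mono) auto
     also have "... = eta / 2 * (1 + (abs (n x)))" using C2 by simp
     finally have 1: "cmod (dq v x e a - dq v x e b) <= eta / 2 * (1 + (abs (n x)))"
      using elim(2) ab by fastforce
     have 2: "cmod (dq v x d y - dq v x e a - \<mu>) <= eta / 2"
      unfolding a_def using dl1(2)[rule_format, of y "fst x" "snd x"] yd(1) elim(1) by simp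
     have "dq v x d y - dq v x e b - \<mu> = (dq v x d y - dq v x e a - \<mu>) + (dq v x e a - dq v x e b)" by simp
     also have "cmod ... <= eta / 2 + eta / 2 * (1 + (abs (n x)))" by (rule order.trans[OF norm_triangle_ineq add_mono[OF 2 1]])
     also have "... <= eta * (1 + (abs (n x)))" using eta mult_nonneg_nonneg[OF less_imp_le[OF eta] abs_ge_zero[of "n x"]] unfolding distrib_left by linarith
     finally show "tr d e (y, w0) : cball (snd j) (r j) & cmod (dq v x d y - dq v x e (tr d e (y, w0)) - \<mu>) <= eta * (1 + (abs (n x)))"
      using bj by (simp add: b_def)
    qed
   qed
   then show ?thesis using dl1(1) dl2(1) by (intro exI[of _ "min dl1 dl2"]) simp
  qed
  then show ?thesis unfolding d_def e_def by blast
 qed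
 define FF where "FF = dqF w0 \<times>\<^sub>F dqF w0"
 have pair: "\<forall>\<^sub>F p in FF. Q (fst p) & Q (snd p)" if "\<forall>\<^sub>F x in dqF w0. Q x" for Q
  unfolding FF_def eventually_prod_filter using that by (intro exI[of _ Q]) auto
 define N where "N p = 1 + \<bar>n (fst p)\<bar> + \<bar>n (snd p)\<bar>" for p
 define U where "U p d z = dq v (fst p) d z - dq v (snd p) d z" for p d z
 have rel: "\<forall>\<^sub>F p in FF. ALL i:F. ALL y:disc2 r i. cmod (U p (fst i) y) <= eta * N p" if eta: "eta > 0" for eta
 proof (rule fibre_linear_bound[OF gc _ _ _ _ _ eta, where g = "%_ d y. exp (ph d w0 y)"])
  show "N p > 0" for p by (simp add: N_def add_pos_nonneg)
  show "\<forall>\<^sub>F p in FF. ALL i:F. EX V. open V & disc2 r i <= V & smooth_on V (U p (fst i))"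
   using pair[OF good]
  proof (rule eventually_mono, intro ballI)
   fix p i assume g: "good (fst p) & good (snd p)" and i: "i : F"
   define V where "V x = sl (fst i) (fst x) Int sl (fst i) (shift v x)" for x
   have s: "open (V x)" "smooth_on (V x) (dq v x (fst i))" "K i <= V x" if "good x" for x
    using smooth_dq(1,2)[OF gcD(2)[OF i] gV(2)[OF that i]] gV(1)[OF that i] by (simp_all add: V_def)
   have o: "open (V (fst p) Int V (snd p))" using s(1) g by (intro open_Int) auto
   have "smooth_on (V (fst p) Int V (snd p)) (U p (fst i))" unfolding U_def
    by (rule smo_diff[OF o smo_subset[OF s(2)[OF conjunct1[OF g]] Int_lower1] smo_subset[OF s(2)[OF conjunct2[OF g]] Int_lower2]])
   moreover have "K i <= V (fst p) Int V (snd p)" using s(3) g by blast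
   ultimately show "EX V. open V & disc2 r i <= V & smooth_on V (U p (fst i))"
    using o unfolding K_def by blast
  qed
  fix i j z and eta :: real assume ij: "i : F" "j : F" "z : disc2 r i" "(z, w0) : ov (fst i) (fst j)"
   "dist (tr (fst i) (fst j) (z, w0)) (snd j) < r j" and eta: "eta > 0"
  have e2: "eta / 2 > 0" using eta by simp
  obtain \<mu> where "ALL eta>0. EX dl>0. \<forall>\<^sub>F x in dqF w0. ALL y:ball z dl. tr (fst i) (fst j) (y, w0) : cball (snd j) (r j) &
   cmod (dq v x (fst i) y - dq v x (fst j) (tr (fst i) (fst j) (y, w0)) - \<mu>) <= eta * (1 + (abs (n x)))"
   using match[OF ij(1,2) ij(3)[folded K_def] ij(4,5)] by (rule exE)
  from this[rule_format, OF e2] obtain dl where dl: "dl > 0" "\<forall>\<^sub>F x in dqF w0. ALL y:ball z dl. tr (fst i) (fst j) (y, w0) : cball (snd j) (r j) &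
   cmod (dq v x (fst i) y - dq v x (fst j) (tr (fst i) (fst j) (y, w0)) - \<mu>) <= eta / 2 * (1 + (abs (n x)))" by (elim exE conjE)
  from pair[OF dl(2)] have "\<forall>\<^sub>F p in FF. ALL y:ball z dl. EX y':cball (snd j) (r j). cmod (U p (fst i) y - U p (fst j) y') <= eta * N p"
  proof (rule eventually_mono, intro ballI)
   fix p y
   define y' where "y' = tr (fst i) (fst j) (y, w0)"
   define k where "k x = dq v x (fst i) y - dq v x (fst j) y' - \<mu>" for x
   assume a: "(ALL y:ball z dl. tr (fst i) (fst j) (y, w0) : cball (snd j) (r j) &
     cmod (dq v (fst p) (fst i) y - dq v (fst p) (fst j) (tr (fst i) (fst j) (y, w0)) - \<mu>) <= eta / 2 * (1 + \<bar>n (fst p)\<bar>)) &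
    (ALL y:ball z dl. tr (fst i) (fst j) (y, w0) : cball (snd j) (r j) &
     cmod (dq v (snd p) (fst i) y - dq v (snd p) (fst j) (tr (fst i) (fst j) (y, w0)) - \<mu>) <= eta / 2 * (1 + \<bar>n (snd p)\<bar>))" "y : ball z dl"
   then have b: "y' : cball (snd j) (r j)" "cmod (k (fst p)) <= eta / 2 * (1 + \<bar>n (fst p)\<bar>)" "cmod (k (snd p)) <= eta / 2 * (1 + \<bar>n (snd p)\<bar>)"
    unfolding y'_def k_def by blast+
   have "U p (fst i) y - U p (fst j) y' = k (fst p) - k (snd p)" by (simp add: U_def k_def)
   also have "cmod ... <= eta / 2 * (1 + \<bar>n (fst p)\<bar>) + eta / 2 * (1 + \<bar>n (snd p)\<bar>)"
    by (rule order.trans[OF norm_triangle_ineq4 add_mono[OF b(2,3)]])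
   also have "... = eta / 2 * (N p + 1)" by (simp add: N_def algebra_simps)
   also have "... <= eta / 2 * (N p + N p)" using eta by (intro mult_left_mono add_left_mono) (auto simp: N_def)
   finally have "cmod (U p (fst i) y - U p (fst j) y') <= eta * N p" by simp
   then show "EX y':cball (snd j) (r j). cmod (U p (fst i) y - U p (fst j) y') <= eta * N p" using b(1) by blast
  qed
  then show "EX dl>0. \<forall>\<^sub>F p in FF. ALL y:ball z dl. EX y':cball (snd j) (r j). cmod (U p (fst i) y - U p (fst j) y') <= eta * N p"
   using dl(1) by (intro exI conjI)
 next
  fix i and eta :: real assume i: "i : F" and eta: "eta > 0"
  have e2: "eta / 2 > 0" using eta by simp
  from pair[OF eventually_conj[OF good err[OF i e2]]]
  show "\<forall>\<^sub>F p in FF. ALL y:disc2 r i. cmod (lap (U p (fst i)) y - complex_of_real (exp (ph (fst i) w0 y)) * U p (fst i) y) <= eta * N p"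
  proof (rule eventually_mono, intro ballI)
   fix p y assume a: "(good (fst p) & (ALL y:K i. cmod (err (fst p) (fst i) y) <= eta / 2 * (1 + \<bar>n (fst p)\<bar>))) &
    (good (snd p) & (ALL y:K i. cmod (err (snd p) (fst i) y) <= eta / 2 * (1 + \<bar>n (snd p)\<bar>)))" and y: "y : disc2 r i"
   have yK: "y : K i" using y by (simp add: K_def)
   define V where "V x = sl (fst i) (fst x) Int sl (fst i) (shift v x)" for x
   have s: "open (V x)" "smooth_on (V x) (dq v x (fst i))" "y : V x" if "good x" for x
    using smooth_dq(1,2)[OF gcD(2)[OF i] gV(2)[OF that i]] gV(1)[OF that i] yK by (auto simp: V_def)
   have o: "open (V (fst p) Int V (snd p))" using s(1) a by (intro open_Int) auto
   have "lap (U p (fst i)) y = lap (dq v (fst p) (fst i)) y - lap (dq v (snd p) (fst i)) y" unfolding U_def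
    by (rule lap_diff[OF o _ smo_subset[OF s(2)[OF conjunct1[OF conjunct1[OF a]]] Int_lower1] smo_subset[OF s(2)[OF conjunct1[OF conjunct2[OF a]]] Int_lower2]])
     (use s(3) a in blast)
   then have "lap (U p (fst i)) y - complex_of_real (exp (ph (fst i) w0 y)) * U p (fst i) y = err (fst p) (fst i) y - err (snd p) (fst i) y"
    by (simp add: err_def U_def G_def algebra_simps)
   also have "cmod ... <= eta / 2 * (1 + \<bar>n (fst p)\<bar>) + eta / 2 * (1 + \<bar>n (snd p)\<bar>)"
    by (rule order.trans[OF norm_triangle_ineq4 add_mono]) (use a yK in auto)
   also have "... = eta / 2 * (N p + 1)" by (simp add: N_def algebra_simps)
   also have "... <= eta / 2 * (N p + N p)" using eta by (intro mult_left_mono add_left_mono) (auto simp: N_def)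
   finally show "cmod (lap (U p (fst i)) y - complex_of_real (exp (ph (fst i) w0 y)) * U p (fst i) y) <= eta * N p" by simp
  qed
 next
  show "\<forall>\<^sub>F p in FF. ALL y:disc2 r i. exp (ph (fst i) w0 y) <= 2 * exp (ph (fst i) w0 y)" for i by simp
 qed
 have bot: "dqF w0 ~= bot" unfolding dqF_def by (simp add: prod_filter_eq_bot)
 \<comment> \<open>With tolerance 1/2 and one fixed quotient \<open>x0\<close>, the estimate reads
   \<open>n x <= n x0 + (1 + n x + n x0) / 2\<close>; half of \<open>n x\<close> is absorbed on the
   left.\<close>
 obtain C where C: "C >= 0" "\<forall>\<^sub>F x in dqF w0. (abs (n x)) <= C"
 proof -
  have "(1/2::real) > 0" by simp
  from rel[OF this] obtain A B where AB: "\<forall>\<^sub>F x in dqF w0. A x" "\<forall>\<^sub>F x in dqF w0. B x"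
   "!!x x'. A x ==> B x' ==> ALL i:F. ALL y:disc2 r i. cmod (U (x, x') (fst i) y) <= 1 / 2 * N (x, x')"
   unfolding FF_def eventually_prod_filter by metis
  obtain x0 where x0: "B x0" "good x0" using eventually_happens'[OF bot eventually_conj[OF AB(2) good]] by blast
  from AB(1) good have "\<forall>\<^sub>F x in dqF w0. (abs (n x)) <= 3 * n x0 + 1"
  proof eventually_elim
   case (elim x)
   have "n x <= n x0 + 1 / 2 * (1 + n x + n x0)"
   proof (rule n_le)
    fix i z assume iz: "i : F" "z : K i"
    have "cmod (U (x, x0) (fst i) z) <= 1 / 2 * N (x, x0)" using AB(3)[OF elim(1) x0(1)] iz by (simp add: K_def)
    then have "cmod (dq v x (fst i) z - dq v x0 (fst i) z) <= 1 / 2 * (1 + n x + n x0)"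
     using n0[OF elim(2)] n0[OF x0(2)] by (simp add: U_def N_def)
    then show "cmod (dq v x (fst i) z) <= n x0 + 1 / 2 * (1 + n x + n x0)"
     using n_ge[OF x0(2) iz] norm_triangle_sub[of "dq v x (fst i) z" "dq v x0 (fst i) z"] by linarith
   qed
   then have "n x <= 3 * n x0 + 1" by (rule half_absorb)
   then show ?case using n0[OF elim(2)] by simp
  qed
  then show ?thesis using that[of "3 * n x0 + 1"] n0[OF x0(2)] by simp
 qed
 have e: "eps / (1 + 2 * C) > 0" using eps C(1) by simp
 from rel[OF e] pair[OF C(2)] show ?thesis
  unfolding FF_def[symmetric]
 proof eventually_elim
  case (elim p)
  have "eps / (1 + 2 * C) * N p <= eps / (1 + 2 * C) * (1 + 2 * C)"
   using elim(2) e by (intro mult_left_mono) (auto simp: N_def)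
  also have "... = eps" using C(1) by simp
  finally show ?case using elim(1) unfolding U_def by fastforce
 qed
qed

end

section \<open>Differentiability of \<open>psi\<close> in the parameter\<close>

lemma open_slices:
 assumes "open U" shows "open {w. (w, t) : U}" "open {t. (w, t) : U}"
proof -
 have "continuous_on UNIV (%w. (w, t))" "continuous_on UNIV (%t. (w, t))" by (intro continuous_intros)+
 then show "open {w. (w, t) : U}" "open {t. (w, t) : U}"
  using open_vimage[OF assms, of "%w. (w, t)"] open_vimage[OF assms, of "%t. (w, t)"] by (simp_all add: vimage_def)
qed

lemma dqF_seq:
 assumes "\<forall>\<^sub>F x in dqF w0. Q x"
 shows "\<forall>\<^sub>F n in sequentially. Q (w0, 1 / real (Suc n))"
proof -
 obtain dl where dl: "dl > 0" "!!w h. dist w w0 < dl ==> 0 < (abs h) ==> (abs h) < dl ==> Q (w, h)"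
  by (rule dqFD[OF assms]) (rule that, assumption, blast)
 have "\<forall>\<^sub>F n in sequentially. 1 / real (Suc n) < dl"
  using order_tendstoD(2)[OF LIMSEQ_inverse_real_of_nat dl(1)] by (simp add: inverse_eq_divide)
 then show ?thesis by (rule eventually_mono) (use dl in simp)
qed

lemma dqF_at:
 assumes "\<forall>\<^sub>F x in dqF w0. Q x"
 shows "\<forall>\<^sub>F h in at 0. Q (w0, h)"
proof -
 obtain dl where dl: "dl > 0" "!!w h. dist w w0 < dl ==> 0 < (abs h) ==> (abs h) < dl ==> Q (w, h)"
  by (rule dqFD[OF assms]) (rule that, assumption, blast)
 then show ?thesis unfolding eventually_at by (intro exI[of _ dl]) (auto simp: dist_norm)
qed

lemma dqF_neq_bot: "dqF w0 ~= bot"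
 unfolding dqF_def by (simp add: prod_filter_eq_bot)

lemma wirt_joint:
 assumes "((%x. F (snd x) (fst x)) has_derivative (%h. (p * fst h + q * cnj (fst h)) + (snd h * r + cnj (snd h) * s))) (at (u w, w))"
  and "(u has_field_derivative u') (at w)"
 shows "wirt (%w. F w (u w)) (p * u' + r) (q * cnj u' + s) w"
proof -
 have "((%w. (u w, w)) has_derivative (%h. (u' * h, h))) (at w)"
  by (intro has_derivative_Pair has_derivative_ident assms(2)[unfolded has_field_derivative_def])
 from has_derivative_compose[OF this assms(1)] show ?thesis
  unfolding wirt_def by (simp add: algebra_simps)
qed

context hyperbolic_charts
begin

text \<open>The derivative of \<open>psi\<close> in the direction \<open>v\<close>, named through
  one sequence of steps; \<open>dq_limit\<close> shows that the quotients converge to it along all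
  of \<open>dqF\<close>, uniformly near each point.\<close>

definition dlim :: "complex => 'd => complex => complex => complex" where
 "dlim v d w z = lim (%n. dq v (w, 1 / real (Suc n)) d z)"

lemma dq_limit:
 assumes d: "d : D" and zw: "(z0, w0) : Om d" and v: "cmod v = 1"
 shows "EX rho>0. cball z0 rho \<times> cball w0 rho <= Om d &
  unif_small (dqF w0) (cball z0 rho) (%x z. dq v x d z - dlim v d w0 z) (%_. 1) &
  (ALL z:cball z0 rho. (%n. dq v (w0, 1 / real (Suc n)) d z) \<longlonglongrightarrow> dlim v d w0 z)"
proof -
 obtain F r where gc: "good_cover w0 F r" and dF: "(d, z0) : F" by (rule good_cover_exists[OF d zw])
 have ne: "F ~= {}" using dF by blast
 define rho where "rho = r (d, z0)"
 have rho: "rho > 0" using good_coverD(3)[OF gc dF] by (simp add: rho_def)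
 have cauchy: "EX A B. (\<forall>\<^sub>F x in dqF w0. A x) & (\<forall>\<^sub>F x in dqF w0. B x) &
   (ALL x x'. A x --> B x' --> (ALL z:cball z0 rho. cmod (dq v x d z - dq v x' d z) <= eps))" if eps: "eps > 0" for eps
 proof -
  have "\<forall>\<^sub>F p in dqF w0 \<times>\<^sub>F dqF w0. ALL z:cball z0 rho. cmod (dq v (fst p) d z - dq v (snd p) d z) <= eps"
   using dq_cauchy[OF gc ne v eps]
  proof (rule eventually_mono)
   fix p assume "ALL i:F. ALL y:disc2 r i. cmod (dq v (fst p) (fst i) y - dq v (snd p) (fst i) y) <= eps"
   from bspec[OF this dF] show "ALL z:cball z0 rho. cmod (dq v (fst p) d z - dq v (snd p) d z) <= eps"
    using rho by (auto simp: rho_def)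
  qed
  then show ?thesis unfolding eventually_prod_filter by simp
 qed
 have lim: "(%n. dq v (w0, 1 / real (Suc n)) d z) \<longlonglongrightarrow> dlim v d w0 z" if z: "z : cball z0 rho" for z
 proof -
  have "Cauchy (%n. dq v (w0, 1 / real (Suc n)) d z)"
  proof (rule CauchyI)
   fix e :: real assume "e > 0"
   then have "e / 2 > 0" by simp
   from cauchy[OF this] obtain A B where AB: "\<forall>\<^sub>F x in dqF w0. A x" "\<forall>\<^sub>F x in dqF w0. B x"
    "ALL x x'. A x --> B x' --> (ALL z:cball z0 rho. cmod (dq v x d z - dq v x' d z) <= e / 2)" by (elim exE conjE)
   from dqF_seq[OF eventually_conj[OF AB(1,2)]] obtain M where
    M: "!!n. n >= M ==> A (w0, 1 / real (Suc n)) & B (w0, 1 / real (Suc n))" unfolding eventually_sequentially by blast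
   show "EX M. ALL m>=M. ALL n>=M. norm (dq v (w0, 1 / real (Suc m)) d z - dq v (w0, 1 / real (Suc n)) d z) < e"
   proof (intro exI[of _ M] allI impI)
    fix m n assume "m >= M" "n >= M"
    then have "cmod (dq v (w0, 1 / real (Suc m)) d z - dq v (w0, 1 / real (Suc n)) d z) <= e / 2"
     using AB(3) M z by blast
    then show "cmod (dq v (w0, 1 / real (Suc m)) d z - dq v (w0, 1 / real (Suc n)) d z) < e" using \<open>e > 0\<close> by simp
   qed
  qed
  then show ?thesis unfolding dlim_def by (simp add: Cauchy_convergent convergent_LIMSEQ_iff[symmetric])
 qed
 have "unif_small (dqF w0) (cball z0 rho) (%x z. dq v x d z - dlim v d w0 z) (%_. 1)"
  unfolding unif_small_def
 proof (intro allI impI)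
  fix eta :: real assume "eta > 0"
  from cauchy[OF this] obtain A B where AB: "\<forall>\<^sub>F x in dqF w0. A x" "\<forall>\<^sub>F x in dqF w0. B x"
   "ALL x x'. A x --> B x' --> (ALL z:cball z0 rho. cmod (dq v x d z - dq v x' d z) <= eta)" by (elim exE conjE)
  show "\<forall>\<^sub>F x in dqF w0. ALL z:cball z0 rho. cmod (dq v x d z - dlim v d w0 z) <= eta * 1"
   using AB(1)
  proof (rule eventually_mono, intro ballI)
   fix x z assume x: "A x" and z: "z : cball z0 rho"
   have "(%n. cmod (dq v x d z - dq v (w0, 1 / real (Suc n)) d z)) \<longlonglongrightarrow> cmod (dq v x d z - dlim v d w0 z)"
    by (intro tendsto_intros lim z)
   moreover have "\<forall>\<^sub>F n in sequentially. cmod (dq v x d z - dq v (w0, 1 / real (Suc n)) d z) <= eta"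
    using dqF_seq[OF AB(2)] by (rule eventually_mono) (use AB(3) x z in blast)
   ultimately show "cmod (dq v x d z - dlim v d w0 z) <= eta * 1"
    by (simp add: tendsto_upperbound)
  qed
 qed
 moreover have "cball z0 rho \<times> cball w0 rho <= Om d" using good_coverD(4)[OF gc dF] rho by (force simp: rho_def)
 ultimately show ?thesis using rho lim by blast
qed

text \<open>Quotients with base point \<open>w\<close> near \<open>w0\<close> and small step lie
  close to the limit at \<open>w0\<close>. Letting the step tend to 0 at fixed \<open>w\<close>
  gives the same bound for the limit at \<open>w\<close>.\<close>

lemma dlim_small:
 assumes d: "d : D" and zw: "(z0, w0) : Om d" and v: "cmod v = 1"
 shows "EX rho>0. usmall w0 z0 rho (%w z. dlim v d w z - dlim v d w0 z) (%_. 1)"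
proof -
 obtain rho where rho: "rho > 0" "cball z0 rho \<times> cball w0 rho <= Om d"
  and u: "unif_small (dqF w0) (cball z0 rho) (%x z. dq v x d z - dlim v d w0 z) (%_. 1)"
  using dq_limit[OF assms] by blast
 have "usmall w0 z0 rho (%w z. dlim v d w z - dlim v d w0 z) (%_. 1)"
  unfolding unif_small_def
 proof (intro allI impI)
  fix eta :: real assume eta: "eta > 0"
  obtain dl where dl: "dl > 0" "!!w h. dist w w0 < dl ==> 0 < (abs h) ==> (abs h) < dl ==>
    ALL z:cball z0 rho. cmod (dq v (w, h) d z - dlim v d w0 z) <= eta * 1"
   by (rule dqFD[OF unif_smallD[OF u eta]]) (rule that, assumption, blast)
  have "cmod (dlim v d w z - dlim v d w0 z) <= eta * 1" if w: "dist w w0 < min dl rho" and z: "z : cball z0 rho" for w z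
  proof -
   have "(z, w) : Om d" using rho(2) w z by (auto simp: dist_commute)
   then have lim: "(%n. dq v (w, 1 / real (Suc n)) d z) \<longlonglongrightarrow> dlim v d w z"
    using dq_limit[OF d _ v, of z w] by force
   have "(%n. cmod (dq v (w, 1 / real (Suc n)) d z - dlim v d w0 z)) \<longlonglongrightarrow> cmod (dlim v d w z - dlim v d w0 z)"
    by (intro tendsto_intros lim)
   moreover have "\<forall>\<^sub>F n in sequentially. 1 / real (Suc n) < dl"
    using order_tendstoD(2)[OF LIMSEQ_inverse_real_of_nat dl(1)] by (simp add: inverse_eq_divide)
   then have "\<forall>\<^sub>F n in sequentially. cmod (dq v (w, 1 / real (Suc n)) d z - dlim v d w0 z) <= eta"
    by (rule eventually_mono) (use dl(2)[of w] w z in auto)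
   ultimately show ?thesis by (simp add: tendsto_upperbound)
  qed
  then show "\<forall>\<^sub>F w in nhds w0. ALL z:cball z0 rho. cmod (dlim v d w z - dlim v d w0 z) <= eta * 1"
   unfolding eventually_nhds_metric using dl(1) rho(1) by (intro exI[of _ "min dl rho"]) auto
 qed
 then show ?thesis using rho(1) by blast
qed

lemma dq_good:
 assumes d: "d : D" and rho: "rho > 0" "cball z0 rho \<times> cball w0 rho <= Om d" and v: "cmod v = 1"
 shows "\<forall>\<^sub>F x in dqF w0. cball z0 rho <= sl d (fst x) Int sl d (shift v x) & snd x ~= 0"
 using dqF_base[OF sl_eventually(1)[OF rho] v] by (rule eventually_mono) blast

lemma continuous_on_dlim_slice:
 assumes d: "d : D" and v: "cmod v = 1" shows "continuous_on (sl d w) (dlim v d w)"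
proof (rule continuous_at_imp_continuous_on, rule ballI)
 fix z assume "z : sl d w"
 then have zw: "(z, w) : Om d" by (simp add: sl_def)
 obtain rho where rho: "rho > 0" "cball z rho \<times> cball w rho <= Om d"
  and u: "unif_small (dqF w) (cball z rho) (%x z. dq v x d z - dlim v d w z) (%_. 1)"
  using dq_limit[OF d zw v] by blast
 have "continuous_on (cball z rho) (dlim v d w)"
 proof (rule uniform_limit_theorem[OF _ _ dqF_neq_bot])
  show "\<forall>\<^sub>F x in dqF w. continuous_on (cball z rho) (dq v x d)"
   using dq_good[OF d rho v]
  proof (rule eventually_mono, elim conjE)
   fix x assume x: "cball z rho <= sl d (fst x) Int sl d (shift v x)" "snd x ~= 0"
   show "continuous_on (cball z rho) (dq v x d)"
    by (rule continuous_on_subset[OF smo_imp_continuous_on[OF smooth_dq(2)[OF d x(2)]] x(1)])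
  qed
  show "uniform_limit (cball z rho) (%x. dq v x d) (dlim v d w) (dqF w)"
   unfolding uniform_limit_iff
  proof (intro allI impI)
   fix e :: real assume e: "e > 0"
   then have "e / 2 > 0" by simp
   from unif_smallD[OF u this] show "\<forall>\<^sub>F x in dqF w. ALL z:cball z rho. dist (dq v x d z) (dlim v d w z) < e"
    by (rule eventually_mono) (use e in "fastforce simp: dist_norm")
  qed
 qed
 then have "continuous_on (ball z rho) (dlim v d w)" by (rule continuous_on_subset) auto
 then show "isCont (dlim v d w) z" using rho(1) by (simp add: continuous_on_eq_continuous_at)
qed

lemma continuous_on_dlim:
 assumes d: "d : D" and v: "cmod v = 1" shows "continuous_on (Om d) (%x. dlim v d (snd x) (fst x))"
 by (rule continuous_on_OmI[OF d dlim_small[OF d _ v] continuous_on_dlim_slice[OF d v]])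

text \<open>The Wirtinger combinations of the derivatives in the directions 1 and \<i>; only these
  two directions are examined, and \<open>psi_second\<close> shows that they determine the full
  expansion.\<close>

definition psiw :: "'d => complex => complex => complex" where
 "psiw d w z = (dlim 1 d w z - \<i> * dlim \<i> d w z) / 2"
definition psiwb :: "'d => complex => complex => complex" where
 "psiwb d w z = (dlim 1 d w z + \<i> * dlim \<i> d w z) / 2"

lemma continuous_on_psiw:
 assumes d: "d : D"
 shows "continuous_on (Om d) (%x. psiw d (snd x) (fst x))" "continuous_on (Om d) (%x. psiwb d (snd x) (fst x))"
  "continuous_on (sl d w) (psiw d w)" "continuous_on (sl d w) (psiwb d w)"
 unfolding psiw_def psiwb_def
 by (intro continuous_intros continuous_on_dlim continuous_on_dlim_slice d; simp)+

lemma psi_second: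
 assumes d: "d : D" and zw: "(z0, w0) : Om d"
 shows "EX rho>0. usmall w0 z0 rho
  (%w z. psi d w z - psi d w0 z - ((w - w0) * psiw d w0 z + cnj (w - w0) * psiwb d w0 z)) (%w. cmod (w - w0))"
proof -
 obtain rho1 where rho1: "rho1 > 0" "unif_small (dqF w0) (cball z0 rho1) (%x z. dq 1 x d z - dlim 1 d w0 z) (%_. 1)"
  using dq_limit[OF d zw, of 1] by auto
 obtain rho2 where rho2: "rho2 > 0" "unif_small (dqF w0) (cball z0 rho2) (%x z. dq \<i> x d z - dlim \<i> d w0 z) (%_. 1)"
  using dq_limit[OF d zw, of \<i>] by auto
 define rho where "rho = min rho1 rho2"
 have "usmall w0 z0 rho
  (%w z. psi d w z - psi d w0 z - ((w - w0) * psiw d w0 z + cnj (w - w0) * psiwb d w0 z)) (%w. cmod (w - w0))"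
  unfolding unif_small_def
 proof (intro allI impI)
  fix eta :: real assume eta: "eta > 0"
  then have e: "eta / 2 > 0" by simp
  obtain dl1 where dl1: "dl1 > 0" "!!w h. dist w w0 < dl1 ==> 0 < (abs h) ==> (abs h) < dl1 ==>
    ALL z:cball z0 rho1. cmod (dq 1 (w, h) d z - dlim 1 d w0 z) <= eta / 2 * 1"
   by (rule dqFD[OF unif_smallD[OF rho1(2) e]]) (rule that, assumption, blast)
  obtain dl2 where dl2: "dl2 > 0" "!!w h. dist w w0 < dl2 ==> 0 < (abs h) ==> (abs h) < dl2 ==>
    ALL z:cball z0 rho2. cmod (dq \<i> (w, h) d z - dlim \<i> d w0 z) <= eta / 2 * 1"
   by (rule dqFD[OF unif_smallD[OF rho2(2) e]]) (rule that, assumption, blast)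
  have step: "cmod (psi d (w + of_real h * v) z - psi d w z - of_real h * c) <= eta / 2 * (abs h)"
   if "h ~= 0 ==> cmod (dq v (w, h) d z - c) <= eta / 2" for v w z c and h :: real
  proof (cases "h = 0")
   case False
   have "psi d (w + of_real h * v) z - psi d w z - of_real h * c = of_real h * (dq v (w, h) d z - c)"
    using False by (simp add: dq_def field_simps)
   then have "cmod (psi d (w + of_real h * v) z - psi d w z - of_real h * c) = (abs h) * cmod (dq v (w, h) d z - c)"
    by (simp add: norm_mult)
   also have "... <= (abs h) * (eta / 2)" by (rule mult_left_mono) (use that False in auto)
   finally show ?thesis by (simp add: mult.commute)
  qed simp
  have "cmod (psi d w z - psi d w0 z - ((w - w0) * psiw d w0 z + cnj (w - w0) * psiwb d w0 z)) <= eta * cmod (w - w0)"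
   if w: "dist w w0 < min dl1 dl2" and z: "z : cball z0 rho" for w z
  proof -
   define k where "k = w - w0"
   \<comment> \<open>The path from \<open>w0\<close> to \<open>w\<close> is broken at
     \<open>m\<close>: a real step from \<open>w0\<close>, then an imaginary step from
     \<open>m\<close>. The second leg uses the quotient with base point \<open>m\<close>, uniformly
     as \<open>m\<close> approaches \<open>w0\<close>.\<close>
   define m where "m = w0 + of_real (Re k) * 1"
   have "cmod k < dl1" "cmod k < dl2" using w by (auto simp: k_def dist_norm)
   note k = abs_Re_le_cmod[of k] abs_Im_le_cmod[of k] this
   have m: "m + of_real (Im k) * \<i> = w" unfolding m_def k_def by (simp add: complex_eq_iff)
   have 1: "cmod (psi d m z - psi d w0 z - of_real (Re k) * dlim 1 d w0 z) <= eta / 2 * \<bar>Re k\<bar>"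
    unfolding m_def by (rule step) (use dl1(2)[of w0 "Re k"] dl1(1) k z in \<open>auto simp: rho_def\<close>)
   have dm: "dist m w0 < dl2" unfolding m_def dist_norm using k by simp
   have 2: "cmod (psi d (m + of_real (Im k) * \<i>) z - psi d m z - of_real (Im k) * dlim \<i> d w0 z) <= eta / 2 * \<bar>Im k\<bar>"
    by (rule step) (use dl2(2)[OF dm, of "Im k"] k z in \<open>auto simp: rho_def\<close>)
   have K: "k = of_real (Re k) + \<i> * of_real (Im k)" "cnj k = of_real (Re k) - \<i> * of_real (Im k)"
    by (simp_all add: complex_eq_iff)
   have "k * psiw d w0 z + cnj k * psiwb d w0 z = of_real (Re k) * dlim 1 d w0 z + of_real (Im k) * dlim \<i> d w0 z"
    unfolding psiw_def psiwb_def by (subst K(1), subst K(2)) (simp add: field_simps)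
   then have "psi d w z - psi d w0 z - (k * psiw d w0 z + cnj k * psiwb d w0 z) =
    (psi d m z - psi d w0 z - of_real (Re k) * dlim 1 d w0 z) + (psi d (m + of_real (Im k) * \<i>) z - psi d m z - of_real (Im k) * dlim \<i> d w0 z)"
    by (simp add: m)
   also have "cmod ... <= eta / 2 * \<bar>Re k\<bar> + eta / 2 * \<bar>Im k\<bar>" by (rule order.trans[OF norm_triangle_ineq add_mono[OF 1 2]])
   also have "... <= eta / 2 * cmod k + eta / 2 * cmod k" using k eta by (intro add_mono mult_left_mono) auto
   finally show ?thesis by (simp add: k_def)
  qed
  then show "\<forall>\<^sub>F w in nhds w0. ALL z:cball z0 rho. cmod (psi d w z - psi d w0 z - ((w - w0) * psiw d w0 z + cnj (w - w0) * psiwb d w0 z)) <= eta * cmod (w - w0)"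
   unfolding eventually_nhds_metric using dl1(1) dl2(1) by (intro exI[of _ "min dl1 dl2"]) auto
 qed
 then show ?thesis using rho1(1) rho2(1) by (intro exI[of _ rho]) (simp add: rho_def)
qed

lemma wirt_w_psi:
 assumes "d : D" "(z, w) : Om d" shows "wirt (%w. psi d w z) (psiw d w z) (psiwb d w z) w"
proof -
 obtain rho where "rho > 0" "unif_small (nhds w) (cball z rho)
  (%u z. psi d u z - psi d w z - ((u - w) * psiw d w z + cnj (u - w) * psiwb d w z)) (%u. cmod (u - w))"
  using psi_second[OF assms] by blast
 then show ?thesis by (intro wirt_of_unif_small[where K = "cball z rho"]) auto
qed

lemma psi_has_derivative:
 assumes d: "d : D" and zw: "(z, w) : Om d"
 shows "((%x. psi d (snd x) (fst x)) has_derivative (%h. (dz (psi d w) z * fst h + (- G d w z * a d w z) * cnj (fst h)) +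
  (snd h * psiw d w z + cnj (snd h) * psiwb d w z))) (at (z, w))"
proof -
 obtain rho where rho: "rho > 0" and u: "unif_small (nhds w) (cball z rho)
  (%u z. psi d u z - psi d w z - ((u - w) * psiw d w z + cnj (u - w) * psiwb d w z)) (%u. cmod (u - w))"
  using psi_second[OF assms] by blast
 have z: "z : sl d w" using zw by (simp add: sl_def)
 have "isCont (psiw d w) z" "isCont (psiwb d w) z"
  using continuous_on_psiw(3,4)[OF d, of w] z by (simp_all add: continuous_on_eq_continuous_at open_sl[OF d])
 then show ?thesis by (rule has_derivative_of_unif_small[OF rho u _ _ wirt_psi[OF d z]])
qed

text \<open>Differentiating the transformation rule of \<open>psi\<close> in the conjugate of
  \<open>w\<close> gives terms in \<open>G\<close>, \<open>a\<close> and \<open>t_w\<close>, the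
  parameter derivative of the transition map; they are exactly those by which \<open>G |a|^2\<close>
  changes. The invariant function is the complex Hessian of log \<open>g\<close> on the total space,
  evaluated on the lift \<open>\<partial>/\<partial>w + a \<partial>/\<partial>z\<close>.\<close>

lemma curvature_tr:
 assumes de: "d : D" "e : D" and zov: "(z, w) : ov d e"
 shows "psiwb d w z - G d w z * (a d w z * cnj (a d w z)) =
  psiwb e w (tr d e (z, w)) - G e w (tr d e (z, w)) * (a e w (tr d e (z, w)) * cnj (a e w (tr d e (z, w))))"
proof -
 define y where "y = tr d e (z, w)"
 define k where "k = d2 (tr d e) (z, w)"
 define j where "j = d1 (tr d e) (z, w)"
 have yO: "(y, w) : Om e" unfolding y_def by (rule tr_Om[OF de zov])
 define V where "V = {u. (z, u) : ov d e}"
 have V: "open V" "w : V" unfolding V_def using zov hol2_open[OF tr_hol2[OF de]]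
  by (auto intro: open_slices(2))
 have tw: "((%u. tr d e (z, u)) has_field_derivative k) (at w)" unfolding k_def by (rule hol2_d2[OF tr_hol2[OF de] zov])
 have "wirt (%u. psi e u (tr d e (z, u)) + mt d e (z, u))
  ((dz (psi e w) y * k + psiw e w y) + mp d e (z, w)) ((- G e w y * a e w y * cnj k + psiwb e w y) + mq d e (z, w)) w"
  unfolding y_def by (intro wirt_add wirt_joint[where u = "%u. tr d e (z, u)"] wirt_mt[OF de zov] tw psi_has_derivative[OF de(2) yO[unfolded y_def]])
 then have "wirt (%u. psi d u z)
  ((dz (psi e w) y * k + psiw e w y) + mp d e (z, w)) ((- G e w y * a e w y * cnj k + psiwb e w y) + mq d e (z, w)) w"
  by (rule wirt_cong[OF V, rotated]) (use psi_mt[OF de] in "simp add: V_def")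
 from wirt_D(2)[OF this] wirt_D(2)[OF wirt_w_psi[OF de(1) ov_Om[OF de zov]]]
 have 1: "psiwb d w z = (- G e w y * a e w y * cnj k + psiwb e w y) + mq d e (z, w)" by simp
 have 2: "mq d e (z, w) = (G e w y * cnj k - G e w y * cnj (a e w y)) * k"
  unfolding mq_def using dzbar_psi[OF de(2), of y w] yO by (simp add: y_def k_def sl_def G_def)
 have 3: "G d w z = G e w y * (j * cnj j)" unfolding y_def j_def by (rule G_tr) (use de zov in "auto simp: ovs_def")
 have 4: "a e w y = j * a d w z + k" unfolding y_def j_def k_def by (rule a_tr[OF de zov])
 show ?thesis unfolding y_def[symmetric] 1 2 3 4 by (simp add: algebra_simps)
qed

text \<open>The derivative in the conjugate variable is \<open>G A cnj a - G a cnj psi\<close>. In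
  the next differentiation \<open>A_z + ph_z A = 0\<close> removes the derivative of
  \<open>G A\<close>, and the divergence of \<open>a\<close> reassembles to
  \<open>psi\<close>.\<close>

lemma lap_Ga:
 assumes d: "d : D" and z: "z : sl d w"
 shows "lap (%z. G d w z * a d w z * cnj (a d w z)) z =
  G d w z * (psi d w z * cnj (psi d w z) + G d w z * (a d w z * cnj (a d w z)) + A d w z * cnj (A d w z))"
proof (rule lap_I[OF open_sl[OF d] z])
 fix y assume y: "y : sl d w"
 show "wirt (%z. G d w z * a d w z * cnj (a d w z))
  ((G d w y * a d w y) * cnj (A d w y) + (G d w y * dz (a d w) y + G d w y * Pz d w y * a d w y) * cnj (a d w y))
  ((%y. G d w y * A d w y * cnj (a d w y) - G d w y * a d w y * cnj (psi d w y)) y) y"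
  using wirt_mult[OF wirt_mult[OF wirt_G[OF d y] wirt_a[OF d y]] wirt_cnj[OF wirt_a[OF d y]]]
  by (simp add: psi_def algebra_simps)
next
 have N: "dz (A d w) z + Pz d w z * A d w z = 0" by (rule harmonic_divergence_free[OF d z])
 show "wirt (%y. G d w y * A d w y * cnj (a d w y) - G d w y * a d w y * cnj (psi d w y))
  (G d w z * (psi d w z * cnj (psi d w z) + G d w z * (a d w z * cnj (a d w z)) + A d w z * cnj (A d w z)))
  ((G d w z * A d w z) * cnj (dz (a d w) z) + (G d w z * dzbar (A d w) z + G d w z * cnj (Pz d w z) * A d w z) * cnj (a d w z) -
  ((G d w z * a d w z) * cnj (dz (psi d w) z) + (G d w z * A d w z + G d w z * cnj (Pz d w z) * a d w z) * cnj (psi d w z))) z"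
  using wirt_diff[OF wirt_mult[OF wirt_mult[OF wirt_G[OF d z] wirt_A[OF d z]] wirt_cnj[OF wirt_a[OF d z]]]
   wirt_mult[OF wirt_mult[OF wirt_G[OF d z] wirt_a[OF d z]] wirt_cnj[OF wirt_psi[OF d z]]]]
  by (simp add: psi_def algebra_simps G_def)
qed

text \<open>The local limits are patched by compactness of the disc. The limit of the Laplacians is
  read off from the equation in \<open>smooth_dq\<close>; the limit function itself is not
  differentiated.\<close>

lemma dq_uniform:
 assumes d: "d : D" and R: "R > 0" "cball z0 R <= sl d w0" and v: "cmod v = 1"
 shows "unif_small (dqF w0) (cball z0 R) (%x z. dq v x d z - dlim v d w0 z) (%_. 1)" (is ?A)
  and "unif_small (dqF w0) (cball z0 R) (%x z. lap (dq v x d) z -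
   (G d w0 z * dlim v d w0 z + psi d w0 z * (v * (G d w0 z * psi d w0 z) + cnj v * (G d w0 z * cnj (psi d w0 z))))) (%_. 1)" (is ?B)
  and "\<forall>\<^sub>F x in dqF w0. cball z0 R <= sl d (fst x) Int sl d (shift v x) & snd x ~= 0" (is ?C)
proof -
 define K where "K = cball z0 R"
 have K: "compact K" "K <= sl d w0" "K \<times> {w0} <= Om d" using R by (auto simp: K_def sl_def)
 have loc: "EX rho>0. ball z rho <= cball z rho & cball z rho \<times> cball w0 rho <= Om d & unif_small (dqF w0) (cball z rho) (%x z. dq v x d z - dlim v d w0 z) (%_. 1)" if "z : K" for z
  using dq_limit[OF d _ v, of z w0] K(3) that by (force simp: subset_iff)
 show A: ?A unfolding unif_small_def K_def[symmetric]
 proof (intro allI impI eventually_compact[OF K(1)])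
  fix eta :: real and z assume eta: "eta > 0" and z: "z : K"
  from loc[OF z] obtain rho where rho: "rho > 0" "unif_small (dqF w0) (cball z rho) (%x z. dq v x d z - dlim v d w0 z) (%_. 1)" by blast
  have "\<forall>\<^sub>F x in dqF w0. ALL y:ball z rho. cmod (dq v x d y - dlim v d w0 y) <= eta * 1"
   using unif_smallD[OF rho(2) eta] by (rule eventually_mono) auto
  then show "EX dl>0. \<forall>\<^sub>F x in dqF w0. ALL y:ball z dl. cmod (dq v x d y - dlim v d w0 y) <= eta * 1" using rho(1) by blast
 qed
 have "\<forall>\<^sub>F x in dqF w0. ALL y:K. y : sl d (fst x) Int sl d (shift v x) & snd x ~= 0"
 proof (rule eventually_compact[OF K(1)])
  fix z assume z: "z : K"
  from loc[OF z] obtain rho where rho: "rho > 0" "cball z rho \<times> cball w0 rho <= Om d" by blast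
  have "\<forall>\<^sub>F x in dqF w0. ALL y:ball z rho. y : sl d (fst x) Int sl d (shift v x) & snd x ~= 0"
   using dq_good[OF d rho v] by (rule eventually_mono) auto
  then show "EX dl>0. \<forall>\<^sub>F x in dqF w0. ALL y:ball z dl. y : sl d (fst x) Int sl d (shift v x) & snd x ~= 0"
   using rho(1) by blast
 qed
 then show C: ?C unfolding K_def[symmetric]
 proof (rule eventually_mono)
  have "z0 : K" using R by (simp add: K_def)
  then show "K <= sl d (fst x) Int sl d (shift v x) & snd x ~= 0"
   if "ALL y:K. y : sl d (fst x) Int sl d (shift v x) & snd x ~= 0" for x
   using that by blast
 qed
 have us: "unif_small (dqF w0) K (%x y. H (y, fst x) - H (y, w0)) (%_. 1)"
   "unif_small (dqF w0) K (%x y. H (y, shift v x) - H (y, w0)) (%_. 1)"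
  if H: "continuous_on (Om d) H" for H :: "complex \<times> complex => complex"
 proof -
  have "\<forall>\<^sub>F x in dqF w0. (ALL y:K. dist (H (y, fst x)) (H (y, w0)) < eta) & (ALL y:K. dist (H (y, shift v x)) (H (y, w0)) < eta)"
   if "eta > 0" for eta
  proof -
   have "\<forall>\<^sub>F w in nhds w0. ALL y:K. dist (H (y, w)) (H (y, w0)) < eta"
    using uniform_limit_of_continuous_on(2)[OF open_Om[OF d] H K(1,3)] that unfolding uniform_limit_iff by blast
   from dqF_base[OF this v] show ?thesis by (rule eventually_mono) blast
  qed
  note ev = this
  show "unif_small (dqF w0) K (%x y. H (y, fst x) - H (y, w0)) (%_. 1)"
   unfolding unif_small_def by (intro allI impI, rule eventually_mono[OF ev]) (auto simp: dist_norm less_imp_le)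
  show "unif_small (dqF w0) K (%x y. H (y, shift v x) - H (y, w0)) (%_. 1)"
   unfolding unif_small_def by (intro allI impI, rule eventually_mono[OF ev]) (auto simp: dist_norm less_imp_le)
 qed
 have b: "EX C>=0. ALL z:K. cmod (h z) <= C" if "continuous_on (sl d w0) h" for h
  unfolding K_def by (rule cball_bound, rule continuous_on_subset[OF that R(2)])
 define T where "T y = v * (G d w0 y * psi d w0 y) + cnj v * (G d w0 y * cnj (psi d w0 y))" for y
 have cT: "continuous_on (sl d w0) T" unfolding T_def by (intro continuous_intros cont_slices[OF d order.refl])
 have Q: "unif_small (dqF w0) K (%x y. (G d (shift v x) y - G d (fst x) y) / of_real (snd x) - T y) (%_. 1)"
  unfolding unif_small_def T_def using G_quotient[OF d K(1,2) v] by simp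
 show ?B unfolding K_def[symmetric] T_def[symmetric]
 proof (rule unif_small_cong[OF unif_small_add])
  show "unif_small (dqF w0) K (%x z. G d (shift v x) z * dq v x d z - G d w0 z * dlim v d w0 z) (%_. 1)"
   using us(2)[OF continuous_on_first(2)[OF d]] A[folded K_def]
   by (intro unif_small_mult_diff b cont_slices(3)[OF d order.refl] continuous_on_dlim_slice[OF d v]) simp_all
  show "unif_small (dqF w0) K (%x z. psi d (fst x) z * ((G d (shift v x) z - G d (fst x) z) / of_real (snd x)) - psi d w0 z * T z) (%_. 1)"
   using us(1)[OF continuous_on_psi(1)[OF d]] Q
   by (intro unif_small_mult_diff b cont_slices(4)[OF d order.refl] cT) simp_all
  show "\<forall>\<^sub>F x in dqF w0. ALL z:K. lap (dq v x d) z - (G d w0 z * dlim v d w0 z + psi d w0 z * T z) =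
   (G d (shift v x) z * dq v x d z - G d w0 z * dlim v d w0 z) +
   (psi d (fst x) z * ((G d (shift v x) z - G d (fst x) z) / of_real (snd x)) - psi d w0 z * T z)"
   using C
  proof (rule eventually_mono, intro ballI)
   fix x z assume x: "cball z0 R <= sl d (fst x) Int sl d (shift v x) & snd x ~= 0" and z: "z : K"
   have "z : sl d (fst x) Int sl d (shift v x)" "snd x ~= 0" using x z by (auto simp: K_def)
   from smooth_dq(3)[OF d this(2,1)] show "lap (dq v x d) z - (G d w0 z * dlim v d w0 z + psi d w0 z * T z) =
   (G d (shift v x) z * dq v x d z - G d w0 z * dlim v d w0 z) +
   (psi d (fst x) z * ((G d (shift v x) z - G d (fst x) z) / of_real (snd x)) - psi d w0 z * T z)" by simp
  qed
 qed
qed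

text \<open>The curvature \<open>c = psiwb - g |a|\<^sup>2\<close> of the fibrewise metric solves \<open>lap c = g (c - |A|\<^sup>2)\<close>. As \<open>c\<close> is not known
 to be twice differentiable, the maximum principle is applied to difference quotients of \<open>psi\<close>.\<close>

lemma curvature_bound:
 assumes d0: "d0 : D" and z0: "z0 : sl d0 w0"
  and N: "!!d z. d : D ==> z : sl d w0 ==> cmod (A d w0 z) <= N"
 shows "Re (psiwb d0 w0 z0) - exp (ph d0 w0 z0) * (cmod (a d0 w0 z0))\<^sup>2 <= N\<^sup>2"
proof -
 have zO: "(z0, w0) : Om d0" using z0 by (simp add: sl_def)
 obtain F r where gc: "good_cover w0 F r" and dF: "(d0, z0) : F" by (rule good_cover_exists[OF d0 zO])
 note gcD = good_coverD[OF gc]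
 define C where "C d z = psiwb d w0 z - G d w0 z * (a d w0 z * cnj (a d w0 z)) - of_real (N\<^sup>2)" for d z
 \<comment> \<open>The combination of the quotients in the directions 1 and \<i> approximates
   \<open>psiwb\<close>, so \<open>U h\<close> is a smooth approximation of \<open>C\<close>, and
   its Laplacian approximates \<open>g\<close> times curvature minus squared modulus of
   \<open>A\<close>.\<close>
 define U where "U h d z = 1/2 * (dq 1 (w0, h) d z + \<i> * dq \<i> (w0, h) d z) - (G d w0 z * a d w0 z * cnj (a d w0 z) + of_real (N\<^sup>2))" for h d z
 have U: "(\<forall>\<^sub>F h in at 0. ALL z:cball y R. cmod (U h d z - C d z) <= eps) &
   (\<forall>\<^sub>F h in at 0. ALL z:cball y R. cmod (lap (U h d) z - G d w0 z * (C d z + of_real (N\<^sup>2) - A d w0 z * cnj (A d w0 z))) <= eps) &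
   (\<forall>\<^sub>F h in at 0. EX V. open V & cball y R <= V & smooth_on V (U h d))"
  if d: "d : D" and R: "R > 0" "cball y R <= sl d w0" and eps: "eps > 0" for d y R eps
 proof -
  have v: "cmod 1 = 1" "cmod \<i> = 1" by simp_all
  note q1 = dq_uniform[OF d R v(1)] and q2 = dq_uniform[OF d R v(2)]
  have c: "\<forall>\<^sub>F h in at 0. (ALL z:cball y R. cmod (dq 1 (w0, h) d z - dlim 1 d w0 z) <= eps) & (ALL z:cball y R. cmod (dq \<i> (w0, h) d z - dlim \<i> d w0 z) <= eps)"
   using eventually_conj[OF dqF_at[OF unif_smallD[OF q1(1) eps]] dqF_at[OF unif_smallD[OF q2(1) eps]]] by simp
  have half: "cmod (1/2 * (p + \<i> * q)) <= eps" if "cmod p <= eps" "cmod q <= eps" for p q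
   using norm_triangle_ineq[of p "\<i> * q"] that by (simp add: norm_mult)
  have 1: "\<forall>\<^sub>F h in at 0. ALL z:cball y R. cmod (U h d z - C d z) <= eps"
   using c
  proof (rule eventually_mono, intro ballI)
   fix h z assume a: "(ALL z:cball y R. cmod (dq 1 (w0, h) d z - dlim 1 d w0 z) <= eps) & (ALL z:cball y R. cmod (dq \<i> (w0, h) d z - dlim \<i> d w0 z) <= eps)" and z: "z : cball y R"
   have eq: "U h d z - C d z = 1/2 * ((dq 1 (w0, h) d z - dlim 1 d w0 z) + \<i> * (dq \<i> (w0, h) d z - dlim \<i> d w0 z))"
    by (simp add: U_def C_def psiwb_def field_simps)
   show "cmod (U h d z - C d z) <= eps" unfolding eq by (rule half) (use a z in blast)+
  qed
  define l where "l v z = G d w0 z * dlim v d w0 z + psi d w0 z * (v * (G d w0 z * psi d w0 z) + cnj v * (G d w0 z * cnj (psi d w0 z)))" for v z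
  define V where "V h = sl d w0 Int (sl d (w0 + of_real h * 1) Int sl d (w0 + of_real h * \<i>))" for h :: real
  have oV: "open (V h)" for h unfolding V_def by (intro open_Int open_sl d)
  have good: "\<forall>\<^sub>F h in at 0. cball y R <= V h & h ~= 0"
   using eventually_conj[OF dqF_at[OF q1(3)] dqF_at[OF q2(3)]] by (rule eventually_mono) (auto simp: V_def)
  have sm: "smooth_on (V h) (dq 1 (w0, h) d)" "smooth_on (V h) (dq \<i> (w0, h) d)" if "h ~= 0" for h
   using smooth_dq(2)[OF d, of "(w0, h)" 1] smooth_dq(2)[OF d, of "(w0, h)" \<i>] that
   by (auto intro: smo_subset simp: V_def)
  have smG: "smooth_on (V h) (%z. G d w0 z * a d w0 z * cnj (a d w0 z))" for h
   by (rule smo_subset[of "sl d w0"]) (intro smo_mult smo_cnj open_sl sm_G sm_a d, simp add: V_def)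
  have smU: "smooth_on (V h) (%z. dq 1 (w0, h) d z + \<i> * dq \<i> (w0, h) d z)" "smooth_on (V h) (%z. \<i> * dq \<i> (w0, h) d z)"
   "smooth_on (V h) (%z. 1/2 * (dq 1 (w0, h) d z + \<i> * dq \<i> (w0, h) d z))"
   "smooth_on (V h) (%z. G d w0 z * a d w0 z * cnj (a d w0 z) + of_real (N\<^sup>2))" if "h ~= 0" for h
   by (intro smo_add smo_mult smo_const sm[OF that] oV smG)+
  have lapU: "lap (U h d) z = 1/2 * (lap (dq 1 (w0, h) d) z + \<i> * lap (dq \<i> (w0, h) d) z) -
   G d w0 z * (psi d w0 z * cnj (psi d w0 z) + G d w0 z * (a d w0 z * cnj (a d w0 z)) + A d w0 z * cnj (A d w0 z))"
   if h: "h ~= 0" and z: "z : V h" for h z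
  proof -
   have lc: "lap (%z. of_real (N\<^sup>2)) z = 0" using lap_I[OF open_UNIV UNIV_I wirt_const wirt_const] by simp
   have zs: "z : sl d w0" using z by (simp add: V_def)
   show ?thesis unfolding U_def
    by (simp only: lap_diff[OF oV z smU(3,4)[OF h]] lap_cmult[OF oV z smU(1)[OF h]] lap_add[OF oV z sm(1)[OF h] smU(2)[OF h]]
     lap_cmult[OF oV z sm(2)[OF h]] lap_add[OF oV z smG smo_const] lap_Ga[OF d zs] lc add_0_right)
  qed
  have 2: "\<forall>\<^sub>F h in at 0. ALL z:cball y R. cmod (lap (U h d) z - G d w0 z * (C d z + of_real (N\<^sup>2) - A d w0 z * cnj (A d w0 z))) <= eps"
   using dqF_at[OF unif_smallD[OF q1(2) eps]] dqF_at[OF unif_smallD[OF q2(2) eps]] good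
  proof eventually_elim
   case (elim h)
   show ?case
   proof
    fix z assume z: "z : cball y R"
    have "cmod (lap (dq 1 (w0, h) d) z - l 1 z) <= eps" "cmod (lap (dq \<i> (w0, h) d) z - l \<i> z) <= eps"
     using elim(1,2) z by (auto simp: l_def)
    note b = half[OF this]
    have zV: "z : V h" "h ~= 0" using elim(3) z by auto
    have "1/2 * (l 1 z + \<i> * l \<i> z) = G d w0 z * (psiwb d w0 z + psi d w0 z * cnj (psi d w0 z))"
     unfolding l_def psiwb_def by (simp add: field_simps)
    then have e: "G d w0 z * (C d z + of_real (N\<^sup>2) - A d w0 z * cnj (A d w0 z)) = 1/2 * (l 1 z + \<i> * l \<i> z) -
     G d w0 z * (psi d w0 z * cnj (psi d w0 z) + G d w0 z * (a d w0 z * cnj (a d w0 z)) + A d w0 z * cnj (A d w0 z))"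
     by (simp add: C_def algebra_simps)
    show "cmod (lap (U h d) z - G d w0 z * (C d z + of_real (N\<^sup>2) - A d w0 z * cnj (A d w0 z))) <= eps"
     unfolding e lapU[OF zV(2,1)] using b by (simp add: algebra_simps)
   qed
  qed
  have 3: "\<forall>\<^sub>F h in at 0. EX V. open V & cball y R <= V & smooth_on V (U h d)"
   using good
  proof (rule eventually_mono)
   fix h assume h: "cball y R <= V h & h ~= 0"
   have "smooth_on (V h) (U h d)" unfolding U_def using h by (intro smo_diff smU oV) auto
   then show "EX V. open V & cball y R <= V & smooth_on V (U h d)" using h oV by blast
  qed
  show ?thesis using 1 2 3 by blast
 qed
 have Ki: "2 * r i > 0" "disc2 r i <= sl (fst i) w0" if "i : F" for i using gcD(3,5)[OF that] by auto
 obtain B where B: "B >= 0" "ALL i:F. ALL y:disc2 r i. 1 / ((r i)\<^sup>2 * exp (ph (fst i) w0 y)) <= B"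
  using inverse_metric_bound[OF gc] by blast
 define R where "R = (\<Sum>i\<in>F. (r i)\<^sup>2)"
 have R: "(r i)\<^sup>2 <= R" if "i : F" for i unfolding R_def using gcD(1) that by (intro member_le_sum) auto
 have R0: "R >= 0" unfolding R_def by (intro sum_nonneg) auto
 \<comment> \<open>The weight is used with \<open>K = eps\<close>, and the mismatch
   \<open>2 * eps\<close> is below \<open>3 * K\<close>. Interior maxima give
   \<open>eps * (1 + R) * B + eps\<close>, the weight \<open>4 * eps\<close>, and the return from
   \<open>U\<close> to \<open>C\<close> another \<open>eps\<close>.\<close>
 have main: "Re (C d0 z0) <= eps * (6 + B + R * B)" if eps: "eps > 0" for eps
 proof -
  have sm: "\<forall>\<^sub>F h in at 0. ALL i:F. EX V. open V & disc2 r i <= V & smooth_on V (U h (fst i))"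
   using U[OF gcD(2) Ki eps] by (intro eventually_ball_finite[OF gcD(1)]) blast
  have match: "EX dl>0. \<forall>\<^sub>F h in at 0. ALL y:ball z dl. EX y':cball (snd j) (r j). Re (U h (fst i) y) <= Re (U h (fst j) y') + 2 * eps"
   if ij: "i : F" "j : F" "z : disc2 r i" and zov: "(z, w0) : ov (fst i) (fst j)"
    and dist: "dist (tr (fst i) (fst j) (z, w0)) (snd j) < r j" for i j z
  proof -
   note de = gcD(2)[OF ij(1)] gcD(2)[OF ij(2)]
   obtain dl1 where dl1: "dl1 > 0" "!!y w. dist y z < dl1 ==> dist w w0 < dl1 ==>
     (y, w) : ov (fst i) (fst j) & dist (tr (fst i) (fst j) (y, w)) (snd j) < r j"
    by (rule tr_cball[OF de zov dist]) (rule that, assumption, blast)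
   obtain dl2 where dl2: "dl2 > 0" "cball z dl2 <= sl (fst i) w0"
    using open_contains_cball[of "sl (fst i) w0"] open_sl[OF de(1)] Ki(2)[OF ij(1)] ij(3) by blast
   have "\<forall>\<^sub>F h in at 0. ALL y:ball z (min dl1 dl2). EX y':cball (snd j) (r j). Re (U h (fst i) y) <= Re (U h (fst j) y') + 2 * eps"
    using conjunct1[OF U[OF de(1) dl2 eps]] conjunct1[OF U[OF de(2) Ki[OF ij(2)] eps]]
   proof eventually_elim
    case (elim h)
    show ?case
    proof
     fix y assume y: "y : ball z (min dl1 dl2)"
     define y' where "y' = tr (fst i) (fst j) (y, w0)"
     have o: "(y, w0) : ov (fst i) (fst j)" "dist y' (snd j) < r j" using dl1(2)[of y w0] dl1(1) y by (auto simp: y'_def dist_commute)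
     have y': "y' : cball (snd j) (r j)" "y' : cball (snd j) (2 * r j)" using o(2) gcD(3)[OF ij(2)] by (auto simp: dist_commute)
     have "C (fst i) y = C (fst j) y'" unfolding C_def y'_def using curvature_tr[OF de o(1)] by simp
     moreover have "cmod (U h (fst i) y - C (fst i) y) <= eps" using elim(1) y by auto
     moreover have "cmod (U h (fst j) y' - C (fst j) y') <= eps" using elim(2) y'(2) by auto
     ultimately have "Re (U h (fst i) y) <= Re (U h (fst j) y') + 2 * eps"
      using abs_Re_le_cmod[of "U h (fst i) y - C (fst i) y"] abs_Re_le_cmod[of "U h (fst j) y' - C (fst j) y'"] by simp
     then show "EX y':cball (snd j) (r j). Re (U h (fst i) y) <= Re (U h (fst j) y') + 2 * eps" using y'(1) by blast
    qed
   qed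
   then show ?thesis using dl1(1) dl2(1) by (intro exI[of _ "min dl1 dl2"]) simp
  qed
  have conv: "\<forall>\<^sub>F h in at 0. ALL i:F. ALL z:disc2 r i. cmod (U h (fst i) z - C (fst i) z) <= eps"
   using U[OF gcD(2) Ki eps] by (intro eventually_ball_finite[OF gcD(1)]) blast
  have conv2: "\<forall>\<^sub>F h in at 0. ALL i:F. ALL z:disc2 r i. cmod (lap (U h (fst i)) z - G (fst i) w0 z * (C (fst i) z + of_real (N\<^sup>2) - A (fst i) w0 z * cnj (A (fst i) w0 z))) <= eps"
   using U[OF gcD(2) Ki eps] by (intro eventually_ball_finite[OF gcD(1)]) blast
  have fm: "\<forall>\<^sub>F h in at 0. ALL K M. 2 * eps < 3 * K --> 0 <= K -->
   (ALL i:F. ALL y:ball (snd i) (2 * r i). Re (lap (U h (fst i)) y) <= K / (r i)\<^sup>2 --> Re (U h (fst i) y) <= M) -->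
   (ALL i:F. ALL y:disc2 r i. Re (U h (fst i) y) <= M + 4 * K)"
   by (rule fibre_max_principle[where \<kappa> = "%_. 2 * eps" and U = U, OF gc sm]) (rule match)
  have "\<forall>\<^sub>F h in at (0::real). Re (C d0 z0) + 0 * h <= eps * (6 + B + R * B)"
   using fm conv conv2
  proof eventually_elim
   case (elim h)
   have "Re (U h (fst i) y) <= eps * (1 + B + R * B)"
    if i: "i : F" and y: "y : ball (snd i) (2 * r i)" and l: "Re (lap (U h (fst i)) y) <= eps / (r i)\<^sup>2" for i y
   proof -
    have yc: "y : disc2 r i" using y by auto
    define g where "g = exp (ph (fst i) w0 y)"
    have g: "g > 0" by (simp add: g_def)
    have r: "r i > 0" by (rule gcD(3)[OF i])
    have AN: "(cmod (A (fst i) w0 y))\<^sup>2 <= N\<^sup>2"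
     by (rule power_mono[OF N[OF gcD(2)[OF i]]]) (use Ki(2)[OF i] yc in auto)
    have "Re (G (fst i) w0 y * (C (fst i) y + of_real (N\<^sup>2) - A (fst i) w0 y * cnj (A (fst i) w0 y))) <= eps / (r i)\<^sup>2 + eps"
     using elim(3) i yc l abs_Re_le_cmod[of "lap (U h (fst i)) y - G (fst i) w0 y * (C (fst i) y + of_real (N\<^sup>2) - A (fst i) w0 y * cnj (A (fst i) w0 y))"]
     by fastforce
    moreover have "Re (G (fst i) w0 y * (C (fst i) y + of_real (N\<^sup>2) - A (fst i) w0 y * cnj (A (fst i) w0 y))) =
     g * (Re (C (fst i) y) + (N\<^sup>2 - (cmod (A (fst i) w0 y))\<^sup>2))"
     by (simp only: G_def g_def cmod_sq Re_complex_of_real minus_complex.simps plus_complex.simps times_complex.simps Im_complex_of_real) simp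
    ultimately have "g * Re (C (fst i) y) + g * (N\<^sup>2 - (cmod (A (fst i) w0 y))\<^sup>2) <= eps / (r i)\<^sup>2 + eps" by (simp only: distrib_left)
    moreover have "0 <= g * (N\<^sup>2 - (cmod (A (fst i) w0 y))\<^sup>2)" using g AN by (intro mult_nonneg_nonneg) auto
    ultimately have "g * Re (C (fst i) y) <= eps / (r i)\<^sup>2 + eps" by linarith
    then have "Re (C (fst i) y) <= (eps / (r i)\<^sup>2 + eps) / g" using g by (simp add: field_simps)
    also have "... = eps * (1 + (r i)\<^sup>2) * (1 / ((r i)\<^sup>2 * g))" using g r by (simp add: field_simps)
    also have "... <= eps * (1 + R) * B"
     using B i yc R[OF i] eps R0 g by (intro mult_mono) (auto simp: g_def)
    finally have "Re (C (fst i) y) <= eps * (1 + R) * B" .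
    moreover have "Re (U h (fst i) y) <= Re (C (fst i) y) + eps"
     using elim(2) i yc abs_Re_le_cmod[of "U h (fst i) y - C (fst i) y"] by fastforce
    ultimately show ?thesis by (simp add: algebra_simps)
   qed
   then have "Re (U h (fst (d0, z0)) z0) <= eps * (1 + B + R * B) + 4 * eps"
    using elim(1)[rule_format, of eps "eps * (1 + B + R * B)" "(d0, z0)" z0] eps dF Ki(1)[OF dF] by auto
   moreover have "cmod (U h d0 z0 - C d0 z0) <= eps" using bspec[OF elim(2) dF] Ki(1)[OF dF] by simp
   then have "Re (C d0 z0) <= Re (U h d0 z0) + eps" using abs_Re_le_cmod[of "U h d0 z0 - C d0 z0"] by simp
   ultimately show ?case by (simp add: algebra_simps)
  qed
  then show ?thesis by (simp add: eventually_const_iff)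
 qed
 have "Re (C d0 z0) <= 0"
 proof (rule field_le_epsilon)
  fix e :: real assume e: "e > 0"
  have p: "6 + B + R * B > 0" using B(1) R0 by (intro add_pos_nonneg mult_nonneg_nonneg) auto
  from main[of "e / (6 + B + R * B)"] e p show "Re (C d0 z0) <= 0 + e" by simp
 qed
 moreover have "Re (C d0 z0) = Re (psiwb d0 w0 z0) - exp (ph d0 w0 z0) * (cmod (a d0 w0 z0))\<^sup>2 - N\<^sup>2"
  unfolding C_def G_def cmod_sq by (simp add: power2_eq_square)
 ultimately show ?thesis by simp
qed

end

section \<open>Variation of geodesics\<close>

text \<open>The counterpart of \<open>wirt\<close> for functions of a complex parameter
  \<open>w\<close> and a real time \<open>t\<close>: \<open>p\<close> and \<open>q\<close> are the
  Wirtinger derivatives in \<open>w\<close>, and \<open>s\<close> is the derivative in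
  \<open>t\<close>.\<close>

definition wt :: "(complex \<times> real => complex) => complex => complex => complex => complex \<times> real => bool" where
 "wt H p q s x \<longleftrightarrow> (H has_derivative (%h. (p * fst h + q * cnj (fst h)) + of_real (snd h) * s)) (at x)"

definition Dw :: "(complex \<times> real => complex) => complex \<times> real => complex" where
 "Dw H x = (frechet_derivative H (at x) (1, 0) - \<i> * frechet_derivative H (at x) (\<i>, 0)) / 2"
definition Dwb :: "(complex \<times> real => complex) => complex \<times> real => complex" where
 "Dwb H x = (frechet_derivative H (at x) (1, 0) + \<i> * frechet_derivative H (at x) (\<i>, 0)) / 2"
definition Dt :: "(complex \<times> real => complex) => complex \<times> real => complex" where
 "Dt H x = frechet_derivative H (at x) (0, 1)"

lemma wt_D:
 assumes "wt H p q s x" shows "Dw H x = p" "Dwb H x = q" "Dt H x = s"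
 unfolding Dw_def Dwb_def Dt_def frechet_derivative_at[OF assms[unfolded wt_def], symmetric]
 by (simp_all add: algebra_simps)

lemma wt_differentiable:
 assumes "H differentiable (at x)" shows "wt H (Dw H x) (Dwb H x) (Dt H x) x"
proof -
 define L where "L = frechet_derivative H (at x)"
 have L: "(H has_derivative L) (at x)" using assms by (simp add: L_def frechet_derivative_works)
 then interpret bounded_linear L by (rule has_derivative_bounded_linear)
 have "L h = (Dw H x * fst h + Dwb H x * cnj (fst h)) + of_real (snd h) * Dt H x" for h
 proof -
  have h: "h = Re (fst h) *\<^sub>R (1, 0) + Im (fst h) *\<^sub>R (\<i>, 0) + snd h *\<^sub>R (0, 1)"
   by (simp add: prod_eq_iff complex_eq_iff)
  have "L h = Re (fst h) *\<^sub>R L (1, 0) + Im (fst h) *\<^sub>R L (\<i>, 0) + snd h *\<^sub>R L (0, 1)"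
   by (subst h) (simp only: add scaleR)
  also have "... = (Dw H x * (of_real (Re (fst h)) + \<i> * of_real (Im (fst h))) + Dwb H x * (of_real (Re (fst h)) - \<i> * of_real (Im (fst h)))) + of_real (snd h) * Dt H x"
   unfolding Dw_def Dwb_def Dt_def L_def[symmetric] scaleR_conv_of_real by (simp add: field_simps)
  also have "of_real (Re (fst h)) + \<i> * of_real (Im (fst h)) = fst h" by (simp add: complex_eq_iff)
  also have "of_real (Re (fst h)) - \<i> * of_real (Im (fst h)) = cnj (fst h)" by (simp add: complex_eq_iff)
  finally show ?thesis .
 qed
 then have "L = (%h. (Dw H x * fst h + Dwb H x * cnj (fst h)) + of_real (snd h) * Dt H x)" by blast
 then show ?thesis using L unfolding wt_def by simp
qed

lemma wt_smooth: "smooth_on U H ==> x : U ==> wt H (Dw H x) (Dwb H x) (Dt H x) x"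
 by (intro wt_differentiable) (auto dest: smo_has_derivative simp: differentiable_def)

lemma smo_Dw:
 assumes "open U" "smooth_on U H"
 shows "smooth_on U (Dw H)" "smooth_on U (Dwb H)" "smooth_on U (Dt H)"
proof -
 have "smooth_on U (%x. (1/2) * (frechet_derivative H (at x) (1, 0) - \<i> * frechet_derivative H (at x) (\<i>, 0)))"
  "smooth_on U (%x. (1/2) * (frechet_derivative H (at x) (1, 0) + \<i> * frechet_derivative H (at x) (\<i>, 0)))"
  by (intro smo_mult smo_diff smo_add smo_const smo_frechet assms)+
 then show "smooth_on U (Dw H)" "smooth_on U (Dwb H)" by (simp_all add: Dw_def[abs_def] Dwb_def[abs_def])
 show "smooth_on U (Dt H)" unfolding Dt_def[abs_def] by (intro smo_frechet assms)
qed

lemma D_commute: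
 assumes U: "open U" "smooth_on U H" "x : U"
 shows "Dt (Dw H) x = Dw (Dt H) x" "Dt (Dwb H) x = Dwb (Dt H) x" "Dw (Dwb H) x = Dwb (Dw H) x"
proof -
 define F where "F v y = frechet_derivative H (at y) v" for v y
 define C where "C v = frechet_derivative (F v) (at x)" for v
 have F: "(F v has_derivative C v) (at x)" for v
  unfolding C_def F_def by (rule smo_has_derivative[OF smo_frechet[OF U(2)] U(3)])
 have sym: "C v u = C u v" for u v
  unfolding C_def F_def by (rule frechet_derivative_commute[OF U(1,3)]) (use U(2) in "simp add: smooth_on_def")
 have "(Dw H has_derivative (%u. (C (1, 0) u - \<i> * C (\<i>, 0) u) / 2)) (at x)"
  "(Dwb H has_derivative (%u. (C (1, 0) u + \<i> * C (\<i>, 0) u) / 2)) (at x)"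
  unfolding Dw_def[abs_def] Dwb_def[abs_def] F_def[symmetric] divide_inverse
  by (intro has_derivative_mult_left has_derivative_diff has_derivative_add has_derivative_mult_right F)+
 note hd = this
 have 1: "frechet_derivative (Dw H) (at x) = (%u. (C (1, 0) u - \<i> * C (\<i>, 0) u) / 2)"
  "frechet_derivative (Dwb H) (at x) = (%u. (C (1, 0) u + \<i> * C (\<i>, 0) u) / 2)"
  by (rule frechet_derivative_at[symmetric], rule hd)+
 have 2: "frechet_derivative (Dt H) (at x) = C (0, 1)" by (simp add: C_def F_def[abs_def] Dt_def[abs_def])
 have d: "Dw K x = (frechet_derivative K (at x) (1, 0) - \<i> * frechet_derivative K (at x) (\<i>, 0)) / 2"
  "Dwb K x = (frechet_derivative K (at x) (1, 0) + \<i> * frechet_derivative K (at x) (\<i>, 0)) / 2"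
  "Dt K x = frechet_derivative K (at x) (0, 1)" for K by (simp_all add: Dw_def Dwb_def Dt_def)
 show "Dt (Dw H) x = Dw (Dt H) x" "Dt (Dwb H) x = Dwb (Dt H) x" "Dw (Dwb H) x = Dwb (Dw H) x"
  unfolding d(1,2,3)[of "Dw H"] d(1,2,3)[of "Dwb H"] d(1,2,3)[of "Dt H"] 1 2
  using sym[of "(0, 1)"] sym[of "(\<i>, 0)" "(1, 0)"] by (simp_all add: field_simps)
qed

lemma D_cong:
 assumes "open U" "x : U" "!!y. y : U ==> f y = h y"
 shows "Dw f x = Dw h x" "Dwb f x = Dwb h x" "Dt f x = Dt h x"
proof -
 have "frechet_derivative f (at x) = frechet_derivative h (at x)"
  by (rule frechet_derivative_cong_open[OF assms(1,2)]) (rule assms(3))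
 then show "Dw f x = Dw h x" "Dwb f x = Dwb h x" "Dt f x = Dt h x" by (simp_all add: Dw_def Dwb_def Dt_def)
qed

lemma D_shift:
 assumes U: "open U" "x : U" "!!y. y : U ==> f (y + k) = f y" and f: "f differentiable (at x)"
 shows "Dw f (x + k) = Dw f x" "Dwb f (x + k) = Dwb f x" "Dt f (x + k) = Dt f x"
proof -
 have "((%y. f (y + k)) has_derivative frechet_derivative f (at x)) (at x)"
  by (rule has_derivative_transform_within_open[OF _ U(1,2)]) (use f U(3) in "simp_all add: frechet_derivative_works")
 then have "((%y. f ((y - k) + k)) has_derivative (%h. frechet_derivative f (at x) h)) (at (x + k))"
  by (intro has_derivative_compose[where f = "%y. y - k" and g = "%y. f (y + k)" and f' = "%h. h"])
   (auto intro!: derivative_eq_intros)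
 then have "frechet_derivative f (at (x + k)) = frechet_derivative f (at x)" by (intro frechet_derivative_at[symmetric]) simp
 then show "Dw f (x + k) = Dw f x" "Dwb f (x + k) = Dwb f x" "Dt f (x + k) = Dt f x"
  unfolding Dw_def Dwb_def Dt_def by simp_all
qed

lemma wt_cong: "open U ==> x : U ==> (!!y. y : U ==> f y = h y) ==> wt f p q s x ==> wt h p q s x"
 unfolding wt_def by (rule has_derivative_transform_within_open)

lemma wt_eq: "wt f p q s x ==> p = p' ==> q = q' ==> s = s' ==> wt f p' q' s' x" by simp

lemma wt_add: "wt f p q s x ==> wt h p' q' s' x ==> wt (%x. f x + h x) (p + p') (q + q') (s + s') x"
 unfolding wt_def by (drule has_derivative_add, assumption) (simp add: algebra_simps)

lemma wt_mult: "wt f p q s x ==> wt h p' q' s' x ==>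
  wt (%x. f x * h x) (f x * p' + p * h x) (f x * q' + q * h x) (f x * s' + s * h x) x"
 unfolding wt_def by (drule has_derivative_mult, assumption) (simp add: algebra_simps)

lemma wt_wirt: "wt f p q s x ==> wirt F P Q (f x) ==>
  wt (%x. F (f x)) (P * p + Q * cnj q) (P * q + Q * cnj p) (P * s + Q * cnj s) x"
 unfolding wt_def wirt_def by (drule has_derivative_compose, assumption) (simp add: algebra_simps)

lemma wt_divide:
 assumes "wt f p q s x" "wt h p' q' s' x" "h x ~= 0"
 shows "wt (%x. f x / h x) ((p * h x - f x * p') / (h x * h x)) ((q * h x - f x * q') / (h x * h x)) ((s * h x - f x * s') / (h x * h x)) x"
proof -
 have "wirt inverse (- (inverse (h x) * inverse (h x))) 0 (h x)"
  by (rule wirt_holomorphic) (use DERIV_inverse'[OF DERIV_ident assms(3)] in simp)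
 from wt_mult[OF assms(1) wt_wirt[OF assms(2) this]] show ?thesis
  unfolding divide_inverse[of "f _" "h _"] by (rule wt_eq) (use assms(3) in "simp_all add: field_simps")
qed

lemma wt_compose:
 assumes "((%x. F (snd x) (fst x)) has_derivative (%h. (Fz * fst h + Fb * cnj (fst h)) + (snd h * Fw + cnj (snd h) * Fv))) (at (Z x, fst x))"
  and "wt Z p q s x"
 shows "wt (%x. F (fst x) (Z x)) (Fz * p + Fb * cnj q + Fw) (Fz * q + Fb * cnj p + Fv) (Fz * s + Fb * cnj s) x"
proof -
 have "((%x. (Z x, fst x)) has_derivative (%h. ((p * fst h + q * cnj (fst h)) + of_real (snd h) * s, fst h))) (at x)"
  using assms(2) unfolding wt_def by (intro has_derivative_Pair has_derivative_fst has_derivative_ident)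
 from has_derivative_compose[OF this assms(1)] show ?thesis unfolding wt_def by (simp add: algebra_simps)
qed

lemma wt_slice_w:
 assumes "wt H p q s (w, t)" shows "wirt (%w. H (w, t)) p q w"
proof -
 have "((%w. (w, t)) has_derivative (%h. (h, 0))) (at w)" by (intro has_derivative_Pair has_derivative_ident has_derivative_const)
 from has_derivative_compose[OF this assms[unfolded wt_def]] show ?thesis unfolding wirt_def by simp
qed

lemma wt_slice_t:
 assumes "wt H p q s (w, t)" shows "((%t. H (w, t)) has_vector_derivative s) (at t)"
proof -
 have "((%t. (w, t)) has_derivative (%h. (0, h))) (at t)" by (intro has_derivative_Pair has_derivative_ident has_derivative_const)
 from has_derivative_compose[OF this assms[unfolded wt_def]] show ?thesis
  unfolding has_vector_derivative_def by (simp add: scaleR_conv_of_real)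
qed

lemma wirt_curve:
 assumes "wirt F p q (z t)" "(z has_vector_derivative s) (at t)"
 shows "((%t. F (z t)) has_vector_derivative (p * s + q * cnj s)) (at t)"
proof -
 from has_derivative_compose[OF assms(2)[unfolded has_vector_derivative_def] assms(1)[unfolded wirt_def]]
 show ?thesis unfolding has_vector_derivative_def by (simp add: scaleR_conv_of_real algebra_simps)
qed

lemma hv_mult:
 fixes f h :: "real => complex"
 shows "(f has_vector_derivative f') (at t) ==> (h has_vector_derivative h') (at t) ==>
  ((%t. f t * h t) has_vector_derivative (f t * h' + f' * h t)) (at t)"
 by (rule has_vector_derivative_mult)

lemma hv_divide:
 fixes f h :: "real => complex"
 assumes "(f has_vector_derivative f') (at t)" "(h has_vector_derivative h') (at t)" "h t ~= 0"
 shows "((%t. f t / h t) has_vector_derivative ((f' * h t - f t * h') / (h t * h t))) (at t)"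
proof -
 have "wirt inverse (- (inverse (h t) * inverse (h t))) 0 (h t)"
  by (rule wirt_holomorphic) (use DERIV_inverse'[OF DERIV_ident assms(3)] in simp)
 from hv_mult[OF assms(1) wirt_curve[OF this assms(2)]] show ?thesis
  unfolding divide_inverse[of "f _" "h _"] using assms(3) by (elim has_vector_derivative_eq_rhs) (simp add: field_simps)
qed

lemma Ck_on_local:
 assumes "!!x. x : W ==> EX U. open U & x : U & Ck_on k U f" shows "Ck_on k W f"
 using assms
proof (induction k arbitrary: f)
 case 0
 show ?case unfolding Ck_on.simps
 proof (rule continuous_at_imp_continuous_on, rule ballI)
  fix x assume "x : W"
  from 0[OF this] show "isCont f x" by (auto simp: continuous_on_eq_continuous_at)
 qed
next
 case (Suc k)
 show ?case unfolding Ck_on.simps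
 proof (intro conjI ballI allI)
  fix x assume "x : W"
  from Suc.prems[OF this] show "f differentiable (at x)" by auto
 next
  fix v show "Ck_on k W (%x. frechet_derivative f (at x) v)"
  proof (rule Suc.IH)
   fix x assume "x : W"
   from Suc.prems[OF this] show "EX U. open U & x : U & Ck_on k U (%x. frechet_derivative f (at x) v)" by auto
  qed
 qed
qed

lemma Ck2_wirt:
 assumes U: "open U" and f: "!!w. w : U ==> wirt f (p w) (q w) w"
  and p: "!!w. w : U ==> wirt p (pp w) (pq w) w" and q: "!!w. w : U ==> wirt q (qp w) (qq w) w"
  and c: "continuous_on U pp" "continuous_on U pq" "continuous_on U qp" "continuous_on U qq"
 shows "Ck_on 2 U f"
 unfolding numeral_2_eq_2
proof (rule Ck_on_SucI[OF U f[unfolded wirt_def]])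
 fix v
 show "Ck_on (Suc 0) U (%w. p w * v + q w * cnj v)"
 proof (rule Ck_on_SucI[OF U])
  fix w assume w: "w : U"
  show "((%w. p w * v + q w * cnj v) has_derivative (%h. (pp w * h + pq w * cnj h) * v + (qp w * h + qq w * cnj h) * cnj v)) (at w)"
   by (intro has_derivative_add has_derivative_mult_left p[OF w, unfolded wirt_def] q[OF w, unfolded wirt_def])
 next
  fix h show "Ck_on 0 U (%w. (pp w * h + pq w * cnj h) * v + (qp w * h + qq w * cnj h) * cnj v)"
   unfolding Ck_on.simps by (intro continuous_intros c)
 qed
qed

lemma wirt_2ln_cmod: "z ~= 0 ==> wirt (%z. of_real (2 * ln (cmod z))) (1 / z) (cnj (1 / z)) z"
 by (rule wirt_ln_cmod[OF DERIV_ident])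

text \<open>With \<open>m = H + cnj K -\<close> \<alpha>, right minus left side equals \<open>L |cnj
  x - y|^2 + |m - 2 cnj K|^2 / 2 + (N^2 - |\<alpha>|^2) / 2 + (N^2 - c)\<close>. Every summand is
  nonnegative; the last two are the source of the constant 3/2.\<close>

lemma geodesic_inequality:
 fixes H K x y \<alpha> :: complex and L N c :: real
 assumes "L >= 0" "cmod \<alpha> <= N" "c <= N\<^sup>2"
 shows "c + L * ((cmod x)\<^sup>2 - (cmod y)\<^sup>2) + (cmod (H + cnj K))\<^sup>2 / 2 - 3 / 2 * N\<^sup>2
  <= Re (- 2 * (of_real L * (y - cnj x) * x + K * (H - \<alpha>)) + cnj (H + cnj K) * ((H - \<alpha>) + cnj K))"
proof -
 define m where "m = H + cnj K - \<alpha>"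
 have H: "H = m + \<alpha> - cnj K" by (simp add: m_def)
 have 1: "0 <= L * ((Re x - Re y)\<^sup>2 + (Im x + Im y)\<^sup>2)" using assms(1) by simp
 have 2: "0 <= ((Re m - 2 * Re K)\<^sup>2 + (Im m + 2 * Im K)\<^sup>2)" by simp
 have 3: "(Re \<alpha>)\<^sup>2 + (Im \<alpha>)\<^sup>2 <= N\<^sup>2"
  using power_mono[OF assms(2) norm_ge_zero, of 2] by (simp add: cmod_power2)
 show ?thesis using 1 2 3 assms(3) unfolding H cmod_power2 unfolding power2_eq_square
  by (simp add: algebra_simps add_divide_distrib, linarith?)
qed

text \<open>\<open>T d\<close> consists of the parameters for which the geodesic lies in the chart
  \<open>d\<close>, and \<open>Z d\<close> is its fibre coordinate there. As the period is 1 and the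
  speed constant, the length equals the speed; this is the clause \<open>len\<close>.\<close>

locale geodesic_charts = hyperbolic_charts D Om ov tr ph a W
 for D :: "'d set" and Om ov tr ph a W +
 fixes T :: "'d => (complex \<times> real) set" and Z :: "'d => complex \<times> real => complex" and len :: "complex => real"
 assumes open_T: "d : D ==> open (T d)"
  and sm_Z: "d : D ==> smooth_on (T d) (Z d)"
  and T_Om: "d : D ==> x : T d ==> (Z d x, fst x) : Om d"
  and T_tr: "d : D ==> e : D ==> x : T d ==> x : T e ==>
   (Z d x, fst x) : ov d e & Z e x = tr d e (Z d x, fst x)"
  and T_per: "d : D ==> x : T d ==> x + (0, 1) : T d & Z d (x + (0, 1)) = Z d x"
  and T_cover: "w : W ==> EX d:D. (w, t) : T d"
  and geod: "d : D ==> x : T d ==> Dt (Dt (Z d)) x = - (Pz d (fst x) (Z d x) * (Dt (Z d) x * Dt (Z d) x))"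
  and len_pos: "w : W ==> len w > 0"
  and len: "d : D ==> (w, t) : T d ==> exp (ph d w (Z d (w, t))) * (cmod (Dt (Z d) (w, t)))\<^sup>2 = (len w)\<^sup>2"
begin

abbreviation "Zw d == Dw (Z d)"
abbreviation "Zb d == Dwb (Z d)"
abbreviation "Zt d == Dt (Z d)"

section \<open>The variation field of the geodesics in coordinates\<close>

lemma T_sl: "d : D ==> x : T d ==> Z d x : sl d (fst x)" using T_Om by (simp add: sl_def)
lemma T_W: "d : D ==> x : T d ==> fst x : W" using T_Om Om_W by blast

lemma Zt_nz: "d : D ==> x : T d ==> Zt d x ~= 0"
 using len[of d "fst x" "snd x"] len_pos[OF T_W, of d x] by auto

lemmas sm_D = smo_Dw[OF open_T sm_Z]
lemmas sm_Dt = smo_Dw[OF open_T sm_D(3)]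

lemma wt_Z:
 assumes d: "d : D" and x: "x : T d"
 shows "wt (Z d) (Zw d x) (Zb d x) (Zt d x) x"
  and "wt (Zw d) (Dw (Zw d) x) (Dw (Zb d) x) (Dw (Zt d) x) x"
  and "wt (Zb d) (Dw (Zb d) x) (Dwb (Zb d) x) (Dwb (Zt d) x) x"
  and "wt (Zt d) (Dw (Zt d) x) (Dwb (Zt d) x) (- (Pz d (fst x) (Z d x) * (Zt d x * Zt d x))) x"
  and "wt (Dw (Zt d)) (Dw (Dw (Zt d)) x) (Dw (Dwb (Zt d)) x) (Dw (Dt (Zt d)) x) x"
  and "wt (Dwb (Zt d)) (Dw (Dwb (Zt d)) x) (Dwb (Dwb (Zt d)) x) (Dwb (Dt (Zt d)) x) x"
proof -
 note c = D_commute[OF open_T[OF d] sm_Z[OF d] x] and ct = D_commute[OF open_T[OF d] sm_D(3)[OF d d] x]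
 show "wt (Z d) (Zw d x) (Zb d x) (Zt d x) x" by (rule wt_smooth[OF sm_Z[OF d] x])
 show "wt (Zw d) (Dw (Zw d) x) (Dw (Zb d) x) (Dw (Zt d) x) x"
  using wt_smooth[OF sm_D(1)[OF d d] x] by (simp add: c)
 show "wt (Zb d) (Dw (Zb d) x) (Dwb (Zb d) x) (Dwb (Zt d) x) x"
  using wt_smooth[OF sm_D(2)[OF d d] x] by (simp add: c)
 show "wt (Zt d) (Dw (Zt d) x) (Dwb (Zt d) x) (- (Pz d (fst x) (Z d x) * (Zt d x * Zt d x))) x"
  using wt_smooth[OF sm_D(3)[OF d d] x] geod[OF d x] by simp
 show "wt (Dw (Zt d)) (Dw (Dw (Zt d)) x) (Dw (Dwb (Zt d)) x) (Dw (Dt (Zt d)) x) x"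
  using wt_smooth[OF sm_Dt(1)[OF d d d] x] by (simp add: ct)
 show "wt (Dwb (Zt d)) (Dw (Dwb (Zt d)) x) (Dwb (Dwb (Zt d)) x) (Dwb (Dt (Zt d)) x) x"
  using wt_smooth[OF sm_Dt(2)[OF d d d] x] by (simp add: ct)
qed

definition zp where "zp d x = dz (Pz d (fst x)) (Z d x) * Zw d x + G d (fst x) (Z d x) * cnj (Zb d x) + dz (psi d (fst x)) (Z d x)"
definition zq where "zq d x = dz (Pz d (fst x)) (Z d x) * Zb d x + G d (fst x) (Z d x) * cnj (Zw d x) + cnj (dzbar (psi d (fst x)) (Z d x))"
definition zs where "zs d x = dz (Pz d (fst x)) (Z d x) * Zt d x + G d (fst x) (Z d x) * cnj (Zt d x)"

lemma wt_Pz: "d : D ==> x : T d ==> wt (%x. Pz d (fst x) (Z d x)) (zp d x) (zq d x) (zs d x) x"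
 unfolding zp_def zq_def zs_def
 by (rule wt_compose[OF Pz_has_derivative wt_Z(1)]) (simp_all add: T_Om)

lemma wt_psi:
 assumes d: "d : D" and x: "x : T d"
 shows "wt (%x. psi d (fst x) (Z d x))
  (dz (psi d (fst x)) (Z d x) * Zw d x + dzbar (psi d (fst x)) (Z d x) * cnj (Zb d x) + psiw d (fst x) (Z d x))
  (dz (psi d (fst x)) (Z d x) * Zb d x + dzbar (psi d (fst x)) (Z d x) * cnj (Zw d x) + psiwb d (fst x) (Z d x))
  (dz (psi d (fst x)) (Z d x) * Zt d x + dzbar (psi d (fst x)) (Z d x) * cnj (Zt d x)) x"
 unfolding dzbar_psi[OF d T_sl[OF d x]]
 by (rule wt_compose[OF psi_has_derivative[OF d T_Om[OF d x]] wt_Z(1)[OF d x]])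

lemma P_has_derivative:
 assumes d: "d : D" and zw: "(z, w) : Om d"
 shows "((%x. P d (snd x) (fst x)) has_derivative (%h. (Pz d w z * fst h + cnj (Pz d w z) * cnj (fst h)) +
  (snd h * psi d w z + cnj (snd h) * cnj (psi d w z)))) (at (z, w))"
proof -
 obtain rho where rho: "rho > 0" and u: "unif_small (nhds w) (cball z rho)
  (%u z. P d u z - P d w z - ((u - w) * psi d w z + cnj (u - w) * cnj (psi d w z))) (%u. cmod (u - w))"
  by (rule P_unif_small[OF d zw])
 have z: "z : sl d w" using zw by (simp add: sl_def)
 have c: "isCont (psi d w) z"
  using cont_slices(4)[OF d order.refl, of w] z by (simp add: continuous_on_eq_continuous_at open_sl[OF d])
 show ?thesis by (rule has_derivative_of_unif_small[OF rho u c _ wirt_P[OF d z]]) (use c in "intro continuous_intros")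
qed

text \<open>\<open>yy\<close> and \<open>xx\<close> are the derivatives of the geodesic in the
  conjugate of \<open>w\<close> and in \<open>w\<close>, the latter relative to the lift
  \<open>a\<close>, expressed as multiples of the velocity. The division by \<open>Zt\<close> makes
  them independent of the chart.\<close>

definition yy where "yy d x = Zb d x / Zt d x"
definition xx where "xx d x = (Zw d x - a d (fst x) (Z d x)) / Zt d x"
text \<open>\<open>HH\<close> is \<open>x' +\<close> \<alpha> by \<open>x_derivative\<close>, and
  \<open>KK\<close> is \<open>y'\<close> by \<open>wt_y\<close>. Written through the derivatives of
  \<open>Zt\<close>, both can be differentiated once more in \<open>w\<close>; \<open>Hp\<close>,
  \<open>Hq\<close>, \<open>Kp\<close> and \<open>Kq\<close> are those derivatives as the product
  and quotient rules give them.\<close>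

definition HH where "HH d x = (Pz d (fst x) (Z d x) * Zw d x + psi d (fst x) (Z d x)) + Dw (Zt d) x / Zt d x"
definition KK where "KK d x = Pz d (fst x) (Z d x) * Zb d x + Dwb (Zt d) x / Zt d x"
definition Hp where "Hp d x = ((Pz d (fst x) (Z d x) * Dw (Zw d) x + zp d x * Zw d x) +
  (dz (psi d (fst x)) (Z d x) * Zw d x + dzbar (psi d (fst x)) (Z d x) * cnj (Zb d x) + psiw d (fst x) (Z d x))) +
  (Dw (Dw (Zt d)) x * Zt d x - Dw (Zt d) x * Dw (Zt d) x) / (Zt d x * Zt d x)"
definition Hq where "Hq d x = ((Pz d (fst x) (Z d x) * Dw (Zb d) x + zq d x * Zw d x) +
  (dz (psi d (fst x)) (Z d x) * Zb d x + dzbar (psi d (fst x)) (Z d x) * cnj (Zw d x) + psiwb d (fst x) (Z d x))) +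
  (Dw (Dwb (Zt d)) x * Zt d x - Dw (Zt d) x * Dwb (Zt d) x) / (Zt d x * Zt d x)"
definition Kp where "Kp d x = (Pz d (fst x) (Z d x) * Dw (Zb d) x + zp d x * Zb d x) +
  (Dw (Dwb (Zt d)) x * Zt d x - Dwb (Zt d) x * Dw (Zt d) x) / (Zt d x * Zt d x)"
definition Kq where "Kq d x = (Pz d (fst x) (Z d x) * Dwb (Zb d) x + zq d x * Zb d x) +
  (Dwb (Dwb (Zt d)) x * Zt d x - Dwb (Zt d) x * Dwb (Zt d) x) / (Zt d x * Zt d x)"

lemma cnj_G: "cnj (G d w z) = G d w z" by (simp add: G_def)

lemma wt_H:
 assumes d: "d : D" and x: "x : T d" shows "EX s. wt (HH d) (Hp d x) (Hq d x) s x"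
 unfolding HH_def Hp_def Hq_def
 by (rule exI, rule wt_add[OF wt_add[OF wt_mult[OF wt_Pz[OF d x] wt_Z(2)[OF d x]] wt_psi[OF d x]]
  wt_divide[OF wt_Z(5)[OF d x] wt_Z(4)[OF d x] Zt_nz[OF d x]]])

text \<open>The derivative in \<open>t\<close> is Jacobi's equation in complex form,
  \<open>y'' = len^2 (y - cnj x)\<close>. It results from differentiating the geodesic equation in
  the conjugate of \<open>w\<close> (fact \<open>tt\<close>) and inserting the derivatives of
  \<open>Pz\<close>.\<close>

lemma wt_K:
 assumes d: "d : D" and x: "x : T d"
 shows "wt (KK d) (Kp d x) (Kq d x) (of_real ((len (fst x))\<^sup>2) * (yy d x - cnj (xx d x))) x"
proof -
 note nz = Zt_nz[OF d x]
 have tt: "Dwb (Dt (Zt d)) x = - (zq d x * (Zt d x * Zt d x) + Pz d (fst x) (Z d x) * (2 * Zt d x * Dwb (Zt d) x))"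
 proof -
  have "Dwb (Dt (Zt d)) x = Dwb (%x. (- 1) * (Pz d (fst x) (Z d x) * (Zt d x * Zt d x))) x"
   by (rule D_cong(2)[OF open_T[OF d] x]) (use geod[OF d] in simp)
  also have "... = (- 1) * (Pz d (fst x) (Z d x) * (Zt d x * Dwb (Zt d) x + Dwb (Zt d) x * Zt d x) + zq d x * (Zt d x * Zt d x)) + 0 * (Pz d (fst x) (Z d x) * (Zt d x * Zt d x))"
  proof (rule wt_D(2))
   have "wt (%x. - 1) 0 0 0 x" by (simp add: wt_def)
   from wt_mult[OF this wt_mult[OF wt_Pz[OF d x] wt_mult[OF wt_Z(4)[OF d x] wt_Z(4)[OF d x]]]]
   show "wt (%x. (- 1) * (Pz d (fst x) (Z d x) * (Zt d x * Zt d x)))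
    ((- 1) * (Pz d (fst x) (Z d x) * (Zt d x * Dw (Zt d) x + Dw (Zt d) x * Zt d x) + zp d x * (Zt d x * Zt d x)) + 0 * (Pz d (fst x) (Z d x) * (Zt d x * Zt d x)))
    ((- 1) * (Pz d (fst x) (Z d x) * (Zt d x * Dwb (Zt d) x + Dwb (Zt d) x * Zt d x) + zq d x * (Zt d x * Zt d x)) + 0 * (Pz d (fst x) (Z d x) * (Zt d x * Zt d x)))
    ((- 1) * (Pz d (fst x) (Z d x) * (Zt d x * - (Pz d (fst x) (Z d x) * (Zt d x * Zt d x)) + - (Pz d (fst x) (Z d x) * (Zt d x * Zt d x)) * Zt d x) + zs d x * (Zt d x * Zt d x)) + 0 * (Pz d (fst x) (Z d x) * (Zt d x * Zt d x))) x" .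
  qed
  finally show ?thesis by (simp add: algebra_simps)
 qed
 have l: "of_real ((len (fst x))\<^sup>2) = G d (fst x) (Z d x) * (Zt d x * cnj (Zt d x))"
  using len[OF d, of "fst x" "snd x"] x by (simp add: G_def cmod_sq flip: of_real_mult of_real_power)
 have db: "cnj (dzbar (psi d (fst x)) (Z d x)) = - (G d (fst x) (Z d x) * cnj (a d (fst x) (Z d x)))"
  using dzbar_psi[OF d T_sl[OF d x]] by (simp add: cnj_G)
 have e: "(Pz d (fst x) (Z d x) * Dwb (Zt d) x + zs d x * Zb d x) +
  (Dwb (Dt (Zt d)) x * Zt d x - Dwb (Zt d) x * - (Pz d (fst x) (Z d x) * (Zt d x * Zt d x))) / (Zt d x * Zt d x)
  = of_real ((len (fst x))\<^sup>2) * (yy d x - cnj (xx d x))"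
 proof -
  have e1: "(Dwb (Dt (Zt d)) x * Zt d x - Dwb (Zt d) x * - (Pz d (fst x) (Z d x) * (Zt d x * Zt d x))) / (Zt d x * Zt d x)
   = - (zq d x * Zt d x) - Pz d (fst x) (Z d x) * Dwb (Zt d) x"
   unfolding tt using nz by (simp add: field_simps)
  have e2: "of_real ((len (fst x))\<^sup>2) * (yy d x - cnj (xx d x)) = G d (fst x) (Z d x) * (cnj (Zt d x) * Zb d x - Zt d x * cnj (Zw d x - a d (fst x) (Z d x)))"
   unfolding l yy_def xx_def using nz by (simp add: field_simps)
  show ?thesis unfolding e1 e2 zs_def zq_def db by (simp add: algebra_simps)
 qed
 show ?thesis unfolding KK_def Kp_def Kq_def
  by (rule wt_eq[OF wt_add[OF wt_mult[OF wt_Pz[OF d x] wt_Z(3)[OF d x]] wt_divide[OF wt_Z(6)[OF d x] wt_Z(4)[OF d x] nz]] refl refl e])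
qed

lemma wt_y:
 assumes d: "d : D" and x: "x : T d"
 shows "Dt (yy d) x = KK d x"
proof -
 note nz = Zt_nz[OF d x]
 have "Dt (yy d) x = (Dwb (Zt d) x * Zt d x - Zb d x * - (Pz d (fst x) (Z d x) * (Zt d x * Zt d x))) / (Zt d x * Zt d x)"
  unfolding yy_def[abs_def] by (rule wt_D(3)[OF wt_divide[OF wt_Z(3)[OF d x] wt_Z(4)[OF d x] nz]])
 also have "... = KK d x" unfolding KK_def using nz by (simp add: field_simps)
 finally show ?thesis .
qed

lemma sm_y: "d : D ==> smooth_on (T d) (yy d)"
 unfolding yy_def[abs_def] divide_inverse
 by (intro smo_mult smo_inverse open_T sm_D Zt_nz)

lemma x_derivative:
 assumes d: "d : D" and x: "(w, t) : T d"
 shows "((%t. xx d (w, t)) has_vector_derivative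
  (HH d (w, t) - A d w (Z d (w, t)) * cnj (Zt d (w, t)) / Zt d (w, t))) (at t)"
proof -
 note nz = Zt_nz[OF d x]
 have zs: "Z d (w, t) : sl d w" using T_sl[OF d x] by simp
 note Z' = wt_slice_t[OF wt_Z(1)[OF d x]] wt_slice_t[OF wt_Z(2)[OF d x]] wt_slice_t[OF wt_Z(4)[OF d x]]
 note a' = wirt_curve[where z = "%t. Z d (w, t)", OF wirt_a[OF d zs] Z'(1)]
 from hv_divide[OF has_vector_derivative_diff[OF Z'(2) a'] Z'(3) nz] show ?thesis
  unfolding xx_def[abs_def] HH_def fst_conv
  by (rule has_vector_derivative_eq_rhs) (use nz in \<open>simp add: field_simps psi_def\<close>)
qed

text \<open>Both sides contain the same mixed derivatives of \<open>Z\<close> and \<open>Zt\<close>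
  in \<open>w\<close> and its conjugate, and these cancel. What remains is algebraic: the curvature
  of the fibrewise metric along the lift and the quadratic form in \<open>x\<close> and
  \<open>y\<close>. Moreover \<open>Kp\<close> is a derivative in \<open>t\<close>, namely of
  \<open>Dw yy\<close>.\<close>

lemma Hq_Kp:
 assumes d: "d : D" and x: "x : T d"
 shows "Hq d x = Kp d x + (psiwb d (fst x) (Z d x) - G d (fst x) (Z d x) * (a d (fst x) (Z d x) * cnj (a d (fst x) (Z d x)))) +
  of_real ((len (fst x))\<^sup>2 * ((cmod (xx d x))\<^sup>2 - (cmod (yy d x))\<^sup>2))"
proof -
 note nz = Zt_nz[OF d x]
 have l: "of_real ((len (fst x))\<^sup>2) = G d (fst x) (Z d x) * (Zt d x * cnj (Zt d x))"
  using len[OF d, of "fst x" "snd x"] x by (simp add: G_def cmod_sq flip: of_real_mult of_real_power)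
 have db: "dzbar (psi d (fst x)) (Z d x) = - (G d (fst x) (Z d x) * a d (fst x) (Z d x))"
  "cnj (dzbar (psi d (fst x)) (Z d x)) = - (G d (fst x) (Z d x) * cnj (a d (fst x) (Z d x)))"
  using dzbar_psi[OF d T_sl[OF d x]] by (simp_all add: cnj_G)
 have "of_real ((len (fst x))\<^sup>2 * ((cmod (xx d x))\<^sup>2 - (cmod (yy d x))\<^sup>2)) =
  of_real ((len (fst x))\<^sup>2) * (xx d x * cnj (xx d x) - yy d x * cnj (yy d x))"
  by (simp add: cmod_sq)
 also have "... = G d (fst x) (Z d x) * ((Zw d x - a d (fst x) (Z d x)) * cnj (Zw d x - a d (fst x) (Z d x)) - Zb d x * cnj (Zb d x))"
  unfolding l yy_def xx_def using nz by (simp add: field_simps)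
 finally have E: "of_real ((len (fst x))\<^sup>2 * ((cmod (xx d x))\<^sup>2 - (cmod (yy d x))\<^sup>2)) =
  G d (fst x) (Z d x) * ((Zw d x - a d (fst x) (Z d x)) * cnj (Zw d x - a d (fst x) (Z d x)) - Zb d x * cnj (Zb d x))" .
 show ?thesis unfolding E Hq_def Kp_def zp_def zq_def db
  by (simp add: algebra_simps cnj_G)
qed

text \<open>The logarithm of the relation between metric, velocity and length is differentiated in
  \<open>w\<close> at fixed \<open>t\<close>. The left side does not involve \<open>t\<close>, so
  \<open>HH + cnj KK\<close> is constant along the geodesic.\<close>

lemma wirt_log_length:
 assumes d: "d : D" and x: "(w, t) : T d"
 shows "wirt (%w. of_real (2 * ln (len w))) (HH d (w, t) + cnj (KK d (w, t))) (cnj (HH d (w, t) + cnj (KK d (w, t)))) w"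
proof -
 note nz = Zt_nz[OF d x]
 have zO: "(Z d (w, t), fst (w, t)) : Om d" by (rule T_Om[OF d x])
 have U: "open {w. (w, t) : T d}" by (rule open_slices(1)[OF open_T[OF d]])
 have "wt (%x. P d (fst x) (Z d x) + of_real (2 * ln (cmod (Zt d x)))) (HH d (w, t) + cnj (KK d (w, t))) (cnj (HH d (w, t) + cnj (KK d (w, t))))
  ((Pz d (fst (w, t)) (Z d (w, t)) * Zt d (w, t) + cnj (Pz d (fst (w, t)) (Z d (w, t))) * cnj (Zt d (w, t))) +
   (1 / Zt d (w, t) * - (Pz d (fst (w, t)) (Z d (w, t)) * (Zt d (w, t) * Zt d (w, t))) + cnj (1 / Zt d (w, t)) * cnj (- (Pz d (fst (w, t)) (Z d (w, t)) * (Zt d (w, t) * Zt d (w, t)))))) (w, t)"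
  by (rule wt_eq[OF wt_add[OF wt_compose[OF P_has_derivative[OF d zO] wt_Z(1)[OF d x]] wt_wirt[OF wt_Z(4)[OF d x] wirt_2ln_cmod[OF nz]]]])
   (simp_all add: HH_def KK_def algebra_simps)
 from wt_slice_w[OF this] show ?thesis
 proof (rule wirt_cong[OF U, rotated 2])
  show "w : {w. (w, t) : T d}" using x by simp
  fix y assume y: "y : {w. (w, t) : T d}"
  have "len y > 0" using len_pos[OF T_W[OF d, of "(y, t)"]] y by simp
  have "2 * ln (len y) = ln ((len y)\<^sup>2)" using \<open>len y > 0\<close> by (simp add: ln_realpow)
  also have "... = ln (exp (ph d y (Z d (y, t))) * (cmod (Zt d (y, t)))\<^sup>2)" using len[OF d, of y t] y by simp
  also have "... = ph d y (Z d (y, t)) + 2 * ln (cmod (Zt d (y, t)))" using Zt_nz[OF d, of "(y, t)"] y by (simp add: ln_mult ln_realpow)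
  finally show "P d (fst (y, t)) (Z d (y, t)) + of_real (2 * ln (cmod (Zt d (y, t)))) = of_real (2 * ln (len y))" by (simp add: P_def)
 qed
qed

lemma continuous_on_Z:
 assumes d: "d : D" and F: "continuous_on (Om d) (%x. F (snd x) (fst x))"
 shows "continuous_on (T d) (%x. F (fst x) (Z d x))"
proof -
 have "continuous_on (T d) (%x. (Z d x, fst x))" by (intro continuous_intros smo_imp_continuous_on sm_Z d)
 from continuous_on_compose2[OF F this] show ?thesis using T_Om[OF d] by force
qed

lemma continuous_on_HK:
 assumes d: "d : D"
 shows "continuous_on (T d) (Hp d)" "continuous_on (T d) (Hq d)" "continuous_on (T d) (Kp d)" "continuous_on (T d) (Kq d)"
  "continuous_on (T d) (HH d)" "continuous_on (T d) (KK d)"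
proof -
 note s = sm_D[OF d d] sm_Dt[OF d d d] smo_Dw[OF open_T[OF d] sm_D(1)[OF d d]] smo_Dw[OF open_T[OF d] sm_D(2)[OF d d]]
  smo_Dw[OF open_T[OF d] sm_Dt(1)[OF d d d]] smo_Dw[OF open_T[OF d] sm_Dt(2)[OF d d d]]
 note cs = s[THEN smo_imp_continuous_on]
 note cO = continuous_on_first(2-)[OF d, THEN continuous_on_Z[OF d]] continuous_on_psi[OF d, THEN continuous_on_Z[OF d]] continuous_on_psiw(1,2)[OF d, THEN continuous_on_Z[OF d]]
 have nz: "ALL x:T d. Zt d x * Zt d x ~= 0" "ALL x:T d. Zt d x ~= 0" using Zt_nz[OF d] by auto
 show "continuous_on (T d) (Hp d)" "continuous_on (T d) (Hq d)" "continuous_on (T d) (Kp d)" "continuous_on (T d) (Kq d)"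
  "continuous_on (T d) (HH d)" "continuous_on (T d) (KK d)"
  unfolding Hp_def[abs_def] Hq_def[abs_def] Kp_def[abs_def] Kq_def[abs_def] HH_def[abs_def] KK_def[abs_def] zp_def zq_def
  by (intro continuous_on_add continuous_on_mult continuous_on_diff continuous_on_divide continuous_on_cnj cs cO nz)+
qed

text \<open>A chart change multiplies numerators and velocity by the same factor
  \<open>d1 (tr d e)\<close>, and the inhomogeneous term of \<open>Zw\<close> is the one in the
  transformation of \<open>a\<close>.\<close>

lemma y_tr:
 assumes de: "d : D" "e : D" and x: "x : T d" "x : T e"
 shows "yy d x = yy e x" "xx d x = xx e x"
proof -
 define y where "y = (Z d x, fst x)"
 have o: "open (T d Int T e)" by (intro open_Int open_T de)
 have ovx: "y : ov d e" and eq: "Z e x = tr d e y" unfolding y_def using T_tr[OF de x] by auto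
 have j: "d1 (tr d e) y ~= 0" using tr_d1[OF de, of "fst y" "snd y"] ovx by simp
 have "((%x. (%w z. tr d e (z, w)) (snd x) (fst x)) has_derivative (%h. (d1 (tr d e) y * fst h + 0 * cnj (fst h)) + (snd h * d2 (tr d e) y + cnj (snd h) * 0))) (at (Z d x, fst x))"
  using hol2_has_derivative[OF tr_hol2[OF de] ovx] by (simp add: y_def mult.commute)
 from wt_compose[OF this wt_Z(1)[OF de(1) x(1)]]
 have w: "wt (%x. tr d e (Z d x, fst x)) (d1 (tr d e) y * Zw d x + d2 (tr d e) y) (d1 (tr d e) y * Zb d x) (d1 (tr d e) y * Zt d x) x" by simp
 have "wt (Z e) (d1 (tr d e) y * Zw d x + d2 (tr d e) y) (d1 (tr d e) y * Zb d x) (d1 (tr d e) y * Zt d x) x"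
  by (rule wt_cong[OF o _ _ w]) (use x T_tr[OF de] in auto)
 note D = wt_D[OF this]
 have "a e (fst x) (Z e x) = d1 (tr d e) y * a d (fst x) (Z d x) + d2 (tr d e) y"
  unfolding eq y_def by (rule a_tr[OF de ovx[unfolded y_def]])
 then show "yy d x = yy e x" "xx d x = xx e x" unfolding yy_def xx_def D using j
  by (simp_all flip: right_diff_distrib)
qed

lemma y_shift:
 assumes d: "d : D" and x: "x : T d"
 shows "yy d (x + (0, 1)) = yy d x" "xx d (x + (0, 1)) = xx d x" "KK d (x + (0, 1)) = KK d x" "Dw (yy d) (x + (0, 1)) = Dw (yy d) x"
proof -
 have df: "H differentiable (at y)" if "smooth_on (T d) H" "y : T d" for H :: "complex \<times> real => complex" and y
  using smo_has_derivative[OF that] by (auto simp: differentiable_def)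
 have Z: "Zw d (y + (0, 1)) = Zw d y" "Zb d (y + (0, 1)) = Zb d y" "Zt d (y + (0, 1)) = Zt d y" if y: "y : T d" for y
  using D_shift[OF open_T[OF d] y _ df[OF sm_Z[OF d] y], of "(0, 1)"] T_per[OF d] by auto
 have yy: "yy d (y + (0, 1)) = yy d y" if "y : T d" for y unfolding yy_def Z[OF that] ..
 show "yy d (x + (0, 1)) = yy d x" by (rule yy[OF x])
 show "xx d (x + (0, 1)) = xx d x" unfolding xx_def Z[OF x] using T_per[OF d x] by simp
 have "x + (0, 1) : T d" using T_per[OF d x] ..
 from wt_y[OF d this] wt_y[OF d x] D_shift(3)[OF open_T[OF d] x yy df[OF sm_y[OF d] x]]
 show "KK d (x + (0, 1)) = KK d x" by simp
 show "Dw (yy d) (x + (0, 1)) = Dw (yy d) x" by (rule D_shift(1)[OF open_T[OF d] x yy df[OF sm_y[OF d] x]])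
qed

text \<open>The variation formula expresses the second derivative of the logarithm of the length as a function of \<open>t\<close> that
 differs from the bound by the derivative of a periodic function \<open>\<Phi>\<close>, which vanishes somewhere.\<close>

lemma second_variation:
 assumes w: "w : W" and N: "!!d z. d : D ==> z : sl d w ==> cmod (A d w z) <= N"
 shows "EX d:D. EX t. (w, t) : T d &
  Re (Hq d (w, t) + cnj (Kp d (w, t))) + (cmod (HH d (w, t) + cnj (KK d (w, t))))\<^sup>2 / 2 <= 3 / 2 * N\<^sup>2"
proof -
 define lam where "lam = dz (%w. of_real (2 * ln (len w))) w"
 have lam: "HH d (w, t) + cnj (KK d (w, t)) = lam" if "d : D" "(w, t) : T d" for d t
  unfolding lam_def using wirt_D(1)[OF wirt_log_length[OF that]] by simp
 \<comment> \<open>The derivative of \<open>2 * Dw yy\<close> is \<open>2 * Kp\<close>, the unknown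
   part of the second variation. The product \<open>KK * xx\<close> brings in the quadratic terms
   through Jacobi's equation, and \<open>xx + cnj yy\<close> has derivative \<open>lam\<close> minus
   \<alpha>, which yields the square of \<open>lam\<close>.\<close>
 define \<Phi> where "\<Phi> d t = Re (- 2 * (KK d (w, t) * xx d (w, t)) + cnj lam * (xx d (w, t) + cnj (yy d (w, t))) + 2 * Dw (yy d) (w, t))" for d t
 define \<Phi>' where "\<Phi>' d t = Re (- 2 * (of_real ((len w)\<^sup>2) * (yy d (w, t) - cnj (xx d (w, t))) * xx d (w, t)
   + KK d (w, t) * (HH d (w, t) - A d w (Z d (w, t)) * cnj (Zt d (w, t)) / Zt d (w, t)))
   + cnj lam * ((HH d (w, t) - A d w (Z d (w, t)) * cnj (Zt d (w, t)) / Zt d (w, t)) + cnj (KK d (w, t))) + 2 * Kp d (w, t))" for d t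
 have der: "(\<Phi> d has_real_derivative \<Phi>' d t) (at t)" if d: "d : D" and x: "(w, t) : T d" for d t
 proof -
  have K': "((%t. KK d (w, t)) has_vector_derivative (of_real ((len w)\<^sup>2) * (yy d (w, t) - cnj (xx d (w, t))))) (at t)"
   using wt_slice_t[OF wt_K[OF d x]] by simp
  have y': "((%t. yy d (w, t)) has_vector_derivative KK d (w, t)) (at t)"
   using wt_slice_t[OF wt_smooth[OF sm_y[OF d] x]] unfolding wt_y[OF d x] .
  have "Dt (Dw (yy d)) (w, t) = Dw (Dt (yy d)) (w, t)" by (rule D_commute(1)[OF open_T[OF d] sm_y[OF d] x])
  also have "... = Dw (KK d) (w, t)" by (rule D_cong(1)[OF open_T[OF d] x wt_y[OF d]])
  also have "... = Kp d (w, t)" by (rule wt_D(1)[OF wt_K[OF d x]])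
  finally have yw': "((%t. Dw (yy d) (w, t)) has_vector_derivative Kp d (w, t)) (at t)"
   using wt_slice_t[OF wt_smooth[OF smo_Dw(1)[OF open_T[OF d] sm_y[OF d]] x]] by simp
  note x' = x_derivative[OF d x]
  have "((%t. - 2 * (KK d (w, t) * xx d (w, t)) + cnj lam * (xx d (w, t) + cnj (yy d (w, t))) + 2 * Dw (yy d) (w, t)) has_vector_derivative
   (- 2 * (KK d (w, t) * (HH d (w, t) - A d w (Z d (w, t)) * cnj (Zt d (w, t)) / Zt d (w, t)) + of_real ((len w)\<^sup>2) * (yy d (w, t) - cnj (xx d (w, t))) * xx d (w, t))
   + cnj lam * ((HH d (w, t) - A d w (Z d (w, t)) * cnj (Zt d (w, t)) / Zt d (w, t)) + cnj (KK d (w, t))) + 2 * Kp d (w, t))) (at t)"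
   by (intro has_vector_derivative_add has_vector_derivative_mult_right has_vector_derivative_cnj hv_mult[OF K' x'] x' y' yw')
  from bounded_linear.has_vector_derivative[OF bounded_linear_Re this]
  show ?thesis unfolding \<Phi>_def[abs_def] \<Phi>'_def has_real_derivative_iff_has_vector_derivative
   by (simp add: algebra_simps)
 qed
 \<comment> \<open>No single chart need contain the geodesic. By \<open>inv\<close> the local
   functions agree on overlaps, so a choice of chart for each \<open>t\<close> defines a
   differentiable function on the whole line.\<close>
 define ch where "ch t = (SOME d. d : D & (w, t) : T d)" for t
 have ch: "ch t : D & (w, t) : T (ch t)" for t
  unfolding ch_def by (rule someI_ex) (use T_cover[OF w] in blast)
 have inv: "\<Phi> d t = \<Phi> e t" if "d : D" "e : D" "(w, t) : T d" "(w, t) : T e" for d e t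
 proof -
  have o: "open (T d Int T e)" "(w, t) : T d Int T e" using that by (auto intro: open_Int open_T)
  have y: "yy d y = yy e y" if "y : T d Int T e" for y
   by (rule y_tr(1)) (use that \<open>d : D\<close> \<open>e : D\<close> in auto)
  have "Dw (yy d) (w, t) = Dw (yy e) (w, t)" by (rule D_cong(1)[OF o]) (rule y)
  moreover have "Dt (yy d) (w, t) = Dt (yy e) (w, t)" by (rule D_cong(3)[OF o]) (rule y)
  ultimately have "Dw (yy d) (w, t) = Dw (yy e) (w, t)" "KK d (w, t) = KK e (w, t)"
   using wt_y that by auto
  then show ?thesis unfolding \<Phi>_def using y_tr[OF that] by simp
 qed
 define \<Psi> where "\<Psi> t = \<Phi> (ch t) t" for t
 have \<Psi>: "(\<Psi> has_real_derivative \<Phi>' (ch t) t) (at t)" for t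
 proof (rule has_field_derivative_transform_within_open[OF der])
  show "open {s. (w, s) : T (ch t)}" by (rule open_slices(2)[OF open_T[OF conjunct1[OF ch]]])
  fix s assume "s : {s. (w, s) : T (ch t)}"
  then show "\<Phi> (ch t) s = \<Psi> s" unfolding \<Psi>_def by (intro inv) (use ch in auto)
 qed (use ch in auto)
 have "\<Psi> 1 = \<Psi> 0"
 proof -
  have 0: "ch 0 : D" "(w, 0) : T (ch 0)" using ch by auto
  have 1: "(w, 1) : T (ch 0)" using T_per[OF 0] by simp
  have "\<Psi> 1 = \<Phi> (ch 0) 1" unfolding \<Psi>_def by (rule inv) (use ch 0 1 in auto)
  also have "... = \<Phi> (ch 0) 0" using y_shift[OF 0] by (simp add: \<Phi>_def)
  finally show ?thesis by (simp add: \<Psi>_def)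
 qed
 \<comment> \<open>Rolle's theorem for the periodic function. A single zero of the derivative is
   enough, since the formulas for the derivatives of the length hold at every
   \<open>t\<close>.\<close>
 moreover obtain \<xi> where "\<Psi> 1 - \<Psi> 0 = (1 - 0) * \<Phi>' (ch \<xi>) \<xi>"
  using MVT2[of 0 1 \<Psi> "%t. \<Phi>' (ch t) t"] \<Psi> by auto
 ultimately have 0: "\<Phi>' (ch \<xi>) \<xi> = 0" by simp
 define d where "d = ch \<xi>"
 have d: "d : D" and x: "(w, \<xi>) : T d" using ch[of \<xi>] by (auto simp: d_def)
 have zs: "Z d (w, \<xi>) : sl d w" using T_sl[OF d x] by simp
 define \<alpha> where "\<alpha> = A d w (Z d (w, \<xi>)) * cnj (Zt d (w, \<xi>)) / Zt d (w, \<xi>)"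
 have \<alpha>: "cmod \<alpha> <= N" using N[OF d zs] Zt_nz[OF d x] by (simp add: \<alpha>_def norm_mult norm_divide)
 define c where "c = Re (psiwb d w (Z d (w, \<xi>))) - exp (ph d w (Z d (w, \<xi>))) * (cmod (a d w (Z d (w, \<xi>))))\<^sup>2"
 have c: "c <= N\<^sup>2" unfolding c_def by (rule curvature_bound[OF d zs N])
 have "Re (Hq d (w, \<xi>)) = Re (Kp d (w, \<xi>)) + c + (len w)\<^sup>2 * ((cmod (xx d (w, \<xi>)))\<^sup>2 - (cmod (yy d (w, \<xi>)))\<^sup>2)"
  unfolding Hq_Kp[OF d x] c_def fst_conv cmod_sq G_def by (simp flip: of_real_mult of_real_power)
 moreover have "c + (len w)\<^sup>2 * ((cmod (xx d (w, \<xi>)))\<^sup>2 - (cmod (yy d (w, \<xi>)))\<^sup>2) + (cmod (HH d (w, \<xi>) + cnj (KK d (w, \<xi>))))\<^sup>2 / 2 - 3 / 2 * N\<^sup>2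
  <= Re (- 2 * (of_real ((len w)\<^sup>2) * (yy d (w, \<xi>) - cnj (xx d (w, \<xi>))) * xx d (w, \<xi>) + KK d (w, \<xi>) * (HH d (w, \<xi>) - \<alpha>))
   + cnj (HH d (w, \<xi>) + cnj (KK d (w, \<xi>))) * ((HH d (w, \<xi>) - \<alpha>) + cnj (KK d (w, \<xi>))))"
  by (rule geodesic_inequality[OF _ \<alpha> c]) simp
 moreover have "\<Phi>' d \<xi> = Re (- 2 * (of_real ((len w)\<^sup>2) * (yy d (w, \<xi>) - cnj (xx d (w, \<xi>))) * xx d (w, \<xi>) + KK d (w, \<xi>) * (HH d (w, \<xi>) - \<alpha>))
   + cnj (HH d (w, \<xi>) + cnj (KK d (w, \<xi>))) * ((HH d (w, \<xi>) - \<alpha>) + cnj (KK d (w, \<xi>)))) + 2 * Re (Kp d (w, \<xi>))"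
  unfolding \<Phi>'_def \<alpha>_def lam[OF d x] by simp
 ultimately have "Re (Hq d (w, \<xi>) + cnj (Kp d (w, \<xi>))) + (cmod (HH d (w, \<xi>) + cnj (KK d (w, \<xi>))))\<^sup>2 / 2 <= 3 / 2 * N\<^sup>2"
  using 0 unfolding d_def[symmetric] by simp
 then show ?thesis using d x by blast
qed

text \<open>At a fixed \<open>t\<close> everything follows from the first derivative
  \<open>l\<close> of \<open>2 * ln len\<close>: half of it gives \<open>ln len\<close>, and the
  exponential of that gives \<open>len\<close>, which accounts for the square of \<open>l\<close>
  divided by 4. The derivatives \<open>Hp\<close>, \<open>Hq\<close>, \<open>Kp\<close>,
  \<open>Kq\<close> are continuous, whence the class C^2.\<close>

lemma length_derivatives:
 assumes d: "d : D" and x: "(w0, t) : T d"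
 defines "U == {w. (w, t) : T d}" and "l == %w. HH d (w, t) + cnj (KK d (w, t))"
 shows "Ck_on 2 U (%w. complex_of_real (len w))"
  and "lap (%w. of_real (len w)) w0 = cnj (of_real (len w0) * ((Hq d (w0, t) + cnj (Kp d (w0, t))) / 2 + l w0 * cnj (l w0) / 4))"
  and "lap (%w. of_real (ln (len w))) w0 = cnj ((Hq d (w0, t) + cnj (Kp d (w0, t))) / 2)"
proof -
 have U: "open U" unfolding U_def by (rule open_slices(1)[OF open_T[OF d]])
 have w0: "w0 : U" using x by (simp add: U_def)
 have E: "wirt (%w. of_real (2 * ln (len w))) (l w) (cnj (l w)) w" if "w : U" for w
  unfolding l_def by (rule wirt_log_length[OF d]) (use that in "simp add: U_def")
 have l': "wirt l (Hp d (w, t) + cnj (Kq d (w, t))) (Hq d (w, t) + cnj (Kp d (w, t))) w" if "w : U" for w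
 proof -
  have w: "(w, t) : T d" using that by (simp add: U_def)
  obtain s where "wt (HH d) (Hp d (w, t)) (Hq d (w, t)) s (w, t)" using wt_H[OF d w] ..
  from wirt_add[OF wt_slice_w[OF this] wirt_cnj[OF wt_slice_w[OF wt_K[OF d w]]]] show ?thesis unfolding l_def .
 qed
 have half: "wirt (%w. of_real (ln (len w))) (1/2 * l w) (1/2 * cnj (l w)) w" if "w : U" for w
  using wirt_cmult[OF E[OF that], of "1/2"] by simp
 have len': "wirt (%w. of_real (len w)) (of_real (len w) * (1/2 * l w)) (of_real (len w) * (1/2 * cnj (l w))) w" if w: "w : U" for w
 proof -
  have p: "len y > 0" if "y : U" for y using len_pos[OF T_W[OF d, of "(y, t)"]] that by (simp add: U_def)
  then have e: "exp (complex_of_real (ln (len y))) = of_real (len y)" if "y : U" for y using that by (simp add: exp_of_real)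
  from wirt_exp[OF half[OF w]] show ?thesis unfolding e[OF w]
   by (rule wirt_cong[OF U w, rotated]) (rule e)
 qed
 define p where "p w = of_real (len w) * (1/2 * l w)" for w
 define pp where "pp w = of_real (len w) * (1/2 * (Hp d (w, t) + cnj (Kq d (w, t)))) + of_real (len w) * (1/2 * l w) * (1/2 * l w)" for w
 define pq where "pq w = of_real (len w) * (1/2 * (Hq d (w, t) + cnj (Kp d (w, t)))) + of_real (len w) * (1/2 * cnj (l w)) * (1/2 * l w)" for w
 have p: "wirt p (pp w) (pq w) w" if "w : U" for w
  unfolding p_def[abs_def] pp_def pq_def by (rule wirt_mult[OF len'[OF that] wirt_cmult[OF l'[OF that]]])
 have lp: "wirt (%w. of_real (len w)) (p w) (cnj (p w)) w" if "w : U" for w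
  using len'[OF that] by (simp add: p_def)
 have c: "continuous_on U (%w. H (w, t))" if "continuous_on (T d) H" for H :: "complex \<times> real => complex"
  by (rule continuous_on_compose2[OF that]) (auto intro!: continuous_intros simp: U_def)
 note cHK = continuous_on_HK[OF d, THEN c]
 have cl: "continuous_on U l" unfolding l_def by (intro continuous_intros cHK)
 have clen: "continuous_on U (%w. complex_of_real (len w))"
  using lp unfolding wirt_def by (intro continuous_at_imp_continuous_on ballI) (blast dest: has_derivative_continuous)
 have cp: "continuous_on U pp" "continuous_on U pq"
  unfolding pp_def pq_def by (intro continuous_intros cl clen cHK; simp)+
 show "Ck_on 2 U (%w. complex_of_real (len w))"
  by (rule Ck2_wirt[OF U lp p wirt_cnj[OF p] cp continuous_on_cnj[OF cp(2)] continuous_on_cnj[OF cp(1)]])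
 show "lap (%w. of_real (len w)) w0 = cnj (of_real (len w0) * ((Hq d (w0, t) + cnj (Kp d (w0, t))) / 2 + l w0 * cnj (l w0) / 4))"
  using lap_I[OF U w0 lp wirt_cnj[OF p[OF w0]]] by (simp add: pq_def field_simps)
 show "lap (%w. of_real (ln (len w))) w0 = cnj ((Hq d (w0, t) + cnj (Kp d (w0, t))) / 2)"
  using lap_I[OF U w0 half wirt_cmult[OF wirt_cnj[OF l'[OF w0]]]] by simp
qed

text \<open>Both estimates come from the inequality in \<open>second_variation\<close>. For the
  logarithm the square of \<open>l\<close> is discarded; for the length, \<open>lap len\<close>
  divided by \<open>len\<close> is half the left side of that inequality, hence at most
  \<open>3/4 * N\<^sup>2\<close>.\<close>

theorem length_bounds:
 shows "Ck_on 2 W len"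
  and "w : W ==> (!!d z. d : D ==> z : sl d w ==> cmod (A d w z) <= N) ==>
   Re (lap (%w. of_real (len w)) w) <= len w * N\<^sup>2 & Re (lap (%w. of_real (ln (len w))) w) <= 3 / 4 * N\<^sup>2"
proof -
 show "Ck_on 2 W len"
 proof (rule Ck_on_local)
  fix w assume "w : W"
  then obtain d where d: "d : D" "(w, 0) : T d" using T_cover by blast
  have U: "open {w. (w, 0) : T d}" by (rule open_slices(1)[OF open_T[OF d(1)]])
  have "Ck_on 2 {w. (w, 0) : T d} (%w. Re (complex_of_real (len w)))"
   by (rule Ck_on_bounded_linear[OF U bounded_linear_Re length_derivatives(1)[OF d]])
  then show "EX U. open U & w : U & Ck_on 2 U len" using U d(2) by auto
 qed
next
 assume w: "w : W" and N: "!!d z. d : D ==> z : sl d w ==> cmod (A d w z) <= N"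
 obtain d t where d: "d : D" "(w, t) : T d"
  and b: "Re (Hq d (w, t) + cnj (Kp d (w, t))) + (cmod (HH d (w, t) + cnj (KK d (w, t))))\<^sup>2 / 2 <= 3 / 2 * N\<^sup>2"
  using second_variation[OF w N] by blast
 define S where "S = Hq d (w, t) + cnj (Kp d (w, t))"
 define l where "l = HH d (w, t) + cnj (KK d (w, t))"
 have b: "Re S + (cmod l)\<^sup>2 / 2 <= 3 / 2 * N\<^sup>2" using b by (simp add: S_def l_def)
 have "Re (lap (%w. of_real (len w)) w) = len w * (Re S / 2 + (cmod l)\<^sup>2 / 4)"
  unfolding length_derivatives(2)[OF d] S_def[symmetric] l_def[symmetric] cmod_sq
  by (simp flip: of_real_power)
 also have "... <= len w * N\<^sup>2" using b len_pos[OF w] zero_le_power2[of N] by (intro mult_left_mono) linarith+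
 finally have 1: "Re (lap (%w. of_real (len w)) w) <= len w * N\<^sup>2" .
 have "Re (lap (%w. of_real (ln (len w))) w) = Re S / 2"
  unfolding length_derivatives(3)[OF d] S_def[symmetric] by simp
 also have "... <= 3 / 4 * N\<^sup>2" using b zero_le_power2[of "cmod l"] by linarith
 finally show "Re (lap (%w. of_real (len w)) w) <= len w * N\<^sup>2 & Re (lap (%w. of_real (ln (len w))) w) <= 3 / 4 * N\<^sup>2" using 1 by simp
qed

end

section \<open>Adapted charts\<close>

lemma holomorphic2_on_subset: "holomorphic2_on F U ==> V <= U ==> holomorphic2_on F V"
 unfolding holomorphic2_on_def by blast

lemma holomorphic2_on_cong:
 assumes "open U" "!!x. x : U ==> F x = H x" "holomorphic2_on F U"
 shows "holomorphic2_on H U"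
 unfolding holomorphic2_on_def
proof
 fix x assume x: "x : U"
 then obtain D where D: "(F has_derivative D) (at x)" "ALL a b k. D (k * a, k * b) = k * D (a, b)"
  using assms(3) unfolding holomorphic2_on_def by blast
 have "(H has_derivative D) (at x)" by (rule has_derivative_transform_within_open[OF D(1) assms(1) x assms(2)])
 then show "EX D. (H has_derivative D) (at x) & (ALL a b k. D (k * a, k * b) = k * D (a, b))" using D(2) by blast
qed

lemma holomorphic2_on_compose:
 assumes "holomorphic2_on F V" "holomorphic2_on P U" "holomorphic2_on Q U" "!!x. x : U ==> (P x, Q x) : V"
 shows "holomorphic2_on (%x. F (P x, Q x)) U"
 unfolding holomorphic2_on_def
proof
 fix x assume x: "x : U"
 obtain DP where P: "(P has_derivative DP) (at x)" "ALL a b k. DP (k * a, k * b) = k * DP (a, b)"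
  using assms(2) x unfolding holomorphic2_on_def by blast
 obtain DQ where Q: "(Q has_derivative DQ) (at x)" "ALL a b k. DQ (k * a, k * b) = k * DQ (a, b)"
  using assms(3) x unfolding holomorphic2_on_def by blast
 obtain DF where F: "(F has_derivative DF) (at (P x, Q x))" "ALL a b k. DF (k * a, k * b) = k * DF (a, b)"
  using assms(1) assms(4)[OF x] unfolding holomorphic2_on_def by blast
 have "((%x. F (P x, Q x)) has_derivative (%h. DF (DP h, DQ h))) (at x)"
  by (rule has_derivative_compose[OF has_derivative_Pair[OF P(1) Q(1)] F(1)])
 then show "EX D. ((%x. F (P x, Q x)) has_derivative D) (at x) & (ALL a b k. D (k * a, k * b) = k * D (a, b))"
  using P(2) Q(2) F(2) by (intro exI[of _ "%h. DF (DP h, DQ h)"] conjI) auto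
qed

lemma chart_basics:
 assumes c: "is_chart T c"
 shows "openin T (fst c)" "open (snd c ` fst c)" "inj_on (snd c) (fst c)"
  and "p : fst c ==> chart_inv c (snd c p) = p"
  and "x : snd c ` fst c ==> chart_inv c x : fst c & snd c (chart_inv c x) = x"
  and "openin T U ==> U <= fst c ==> open (snd c ` U)"
  and "open V ==> openin T {p : fst c. snd c p : V}"
proof -
 show o: "openin T (fst c)" and oi: "open (snd c ` fst c)" using c by (simp_all add: is_chart_def)
 have hom: "homeomorphic_map (subtopology T (fst c)) (top_of_set (snd c ` fst c)) (snd c)" using c by (simp add: is_chart_def)
 have top: "topspace (subtopology T (fst c)) = fst c" using openin_subset[OF o] by auto
 show inj: "inj_on (snd c) (fst c)" using homeomorphic_imp_injective_map[OF hom] by (simp only: top)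
 show "p : fst c ==> chart_inv c (snd c p) = p" unfolding chart_inv_def by (rule inv_into_f_f[OF inj])
 show "x : snd c ` fst c ==> chart_inv c x : fst c & snd c (chart_inv c x) = x"
  unfolding chart_inv_def using inv_into_into f_inv_into_f by metis
 show "open (snd c ` U)" if "openin T U" "U <= fst c"
 proof -
  have "openin (subtopology T (fst c)) U" using that openin_open_subtopology[OF o] by blast
  then have "openin (top_of_set (snd c ` fst c)) (snd c ` U)"
   using homeomorphic_map_openness[OF hom, of U] that(2) top by blast
  then show ?thesis using openin_open_eq[OF oi] by blast
 qed
 show "openin T {p : fst c. snd c p : V}" if "open V"
 proof -
  have "openin (top_of_set (snd c ` fst c)) (snd c ` fst c Int V)" using that openin_open_eq[OF oi] oi by auto
  from openin_continuous_map_preimage[OF homeomorphic_imp_continuous_map[OF hom] this]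
  have "openin (subtopology T (fst c)) {p : fst c. snd c p : V}"
   unfolding top by (rule back_subst[of "openin _"]) auto
  then show ?thesis using openin_open_subtopology[OF o] by blast
 qed
qed

lemma chart_change:
 assumes d: "is_chart T d" and U: "open U" "U <= snd d ` fst d" and V: "open V" and hom: "homeomorphism U V \<Phi> \<Psi>"
 shows "is_chart T ({q : fst d. snd d q : U}, \<Phi> \<circ> snd d)"
proof -
 define Q where "Q = {q : fst d. snd d q : U}"
 have QU: "snd d ` Q = U" using U(2) by (auto simp: Q_def)
 have QV: "(\<Phi> \<circ> snd d) ` Q = V" by (simp only: image_comp[symmetric] QU homeomorphism_image1[OF hom])
 have oQ: "openin T Q" unfolding Q_def by (rule chart_basics(7)[OF d U(1)])
 have h1: "homeomorphic_map (subtopology T (fst d)) (top_of_set (snd d ` fst d)) (snd d)" using d by (simp add: is_chart_def)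
 have "homeomorphic_map (subtopology (subtopology T (fst d)) Q) (subtopology (top_of_set (snd d ` fst d)) U) (snd d)"
  by (rule homeomorphic_map_subtopologies[OF h1])
   (use QU U(2) openin_subset[OF oQ] openin_subset[OF chart_basics(1)[OF d]] in "auto simp: Q_def")
 moreover have "fst d Int Q = Q" "snd d ` fst d Int U = U" using U(2) by (auto simp: Q_def)
 ultimately have "homeomorphic_map (subtopology T Q) (top_of_set U) (snd d)" by (simp add: subtopology_subtopology)
 moreover have "homeomorphic_map (top_of_set U) (top_of_set V) \<Phi>"
  unfolding homeomorphic_map_maps homeomorphic_maps_def
  by (rule exI[of _ \<Psi>]) (use hom in "auto simp: homeomorphism_def")
 ultimately have "homeomorphic_map (subtopology T Q) (top_of_set V) (\<Phi> \<circ> snd d)" by (rule homeomorphic_map_compose)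
 then show ?thesis unfolding is_chart_def fst_conv snd_conv Q_def[symmetric] QV using oQ V by blast
qed

text \<open>The real inverse function theorem applies since the complex Jacobian determinant is
  nonzero; \<open>I\<close> is Cramer's rule. The inverse map is holomorphic because the inverse of
  a complex linear bijection is complex linear.\<close>

lemma holomorphic_inverse_function:
 assumes k: "hol2 k V" and h: "hol2 h V" and x0: "x0 : V"
  and J: "d1 k x0 * d2 h x0 - d2 k x0 * d1 h x0 ~= 0"
 shows "EX U V' \<Psi>. open U & U <= V & x0 : U & open V' & homeomorphism U V' (%x. (k x, h x)) \<Psi> &
  holomorphic2_on (fst \<circ> \<Psi>) V' & holomorphic2_on (snd \<circ> \<Psi>) V'"
proof -
 define L where "L x v = (d1 k x * fst v + d2 k x * snd v, d1 h x * fst v + d2 h x * snd v)" for x v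
 have bl: "bounded_linear (L x)" for x
  unfolding L_def[abs_def]
  by (intro bounded_linear_Pair bounded_linear_add bounded_linear_const_mult bounded_linear_fst bounded_linear_snd)
 define F where "F x = Blinfun (L x)" for x
 have F: "blinfun_apply (F x) = L x" for x unfolding F_def by (rule bounded_linear_Blinfun_apply[OF bl])
 define j where "j = d1 k x0 * d2 h x0 - d2 k x0 * d1 h x0"
 define I where "I v = ((d2 h x0 * fst v - d2 k x0 * snd v) / j, (d1 k x0 * snd v - d1 h x0 * fst v) / j)" for v
 have blI: "bounded_linear I"
  unfolding I_def[abs_def] divide_inverse
  by (intro bounded_linear_Pair bounded_linear_mult_const bounded_linear_sub bounded_linear_const_mult bounded_linear_fst bounded_linear_snd)
 have IL: "I (L x0 v) = v" for v
 proof -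
  have "d2 h x0 * (d1 k x0 * fst v + d2 k x0 * snd v) - d2 k x0 * (d1 h x0 * fst v + d2 h x0 * snd v) = fst v * j"
   "d1 k x0 * (d1 h x0 * fst v + d2 h x0 * snd v) - d1 h x0 * (d1 k x0 * fst v + d2 k x0 * snd v) = snd v * j"
   by (simp_all add: j_def algebra_simps)
  then show ?thesis unfolding I_def L_def fst_conv snd_conv using J by (simp add: j_def[symmetric])
 qed
 have der: "((%x. (k x, h x)) has_derivative blinfun_apply (F x)) (at x)" if "x : V" for x
  unfolding F L_def[abs_def] by (rule has_derivative_Pair[OF hol2_has_derivative[OF k that] hol2_has_derivative[OF h that]])
 have cont: "continuous_on V F"
 proof (rule continuous_on_blinfun_componentwise)
  fix i show "continuous_on V (%x. blinfun_apply (F x) i)" unfolding F L_def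
   by (intro continuous_intros hol2_d1_continuous_on[OF k] hol2_d2_continuous_on[OF k] hol2_d1_continuous_on[OF h] hol2_d2_continuous_on[OF h])
 qed
 have inv: "Blinfun I o\<^sub>L F x0 = id_blinfun"
  by (rule blinfun_eqI) (simp add: bounded_linear_Blinfun_apply[OF blI] F IL)
 show ?thesis
 proof (rule inverse_function_theorem[where ?x0.0 = x0 and U = V and f = "%x. (k x, h x)" and f' = F and invf = "Blinfun I"])
  show "open V" by (rule hol2_open[OF k])
  show "((%x. (k x, h x)) has_derivative blinfun_apply (F x)) (at x)" if "x : V" for x by (rule der[OF that])
  show "continuous_on V F" by (rule cont)
  show "x0 : V" by (rule x0)
  show "Blinfun I o\<^sub>L F x0 = id_blinfun" by (rule inv)
  fix U V' \<Psi> g'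
  assume U: "open U" "U <= V" "x0 : U" "open V'" "homeomorphism U V' (%x. (k x, h x)) \<Psi>"
   and g: "!!y. y : V' ==> (\<Psi> has_derivative (g' y)) (at y)" "!!y. y : V' ==> g' y = inv_into UNIV (blinfun_apply (F (\<Psi> y)))"
    "!!y. y : V' ==> bij (blinfun_apply (F (\<Psi> y)))"
  \<comment> \<open>Homogeneity of the inverse derivative: both candidates are sent to the same
    vector by the injective complex linear map \<open>L (\<Psi> y)\<close>.\<close>
  have hom: "fst (g' y (c * a, c * b)) = c * fst (g' y (a, b)) & snd (g' y (c * a, c * b)) = c * snd (g' y (a, b))" if y: "y : V'" for y a b c
  proof -
   have bij: "bij (L (\<Psi> y))" using g(3)[OF y] by (simp add: F)
   have gi: "L (\<Psi> y) (g' y u) = u" for u unfolding g(2)[OF y] F by (rule surj_f_inv_f[OF bij_is_surj[OF bij]])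
   define u where "u = (c * fst (g' y (a, b)), c * snd (g' y (a, b)))"
   have "L (\<Psi> y) u = (c * fst (L (\<Psi> y) (g' y (a, b))), c * snd (L (\<Psi> y) (g' y (a, b))))"
    by (simp add: L_def u_def algebra_simps)
   then have "L (\<Psi> y) u = L (\<Psi> y) (g' y (c * a, c * b))" by (simp add: gi)
   then have "u = g' y (c * a, c * b)" using bij_is_inj[OF bij] by (simp add: inj_eq)
   then show ?thesis by (metis u_def fst_conv snd_conv)
  qed
  have h1: "holomorphic2_on (fst \<circ> \<Psi>) V'" unfolding holomorphic2_on_def comp_def
   by (intro ballI exI conjI, rule has_derivative_fst, rule g(1)) (use hom in auto)
  have h2: "holomorphic2_on (snd \<circ> \<Psi>) V'" unfolding holomorphic2_on_def comp_def
   by (intro ballI exI conjI, rule has_derivative_snd, rule g(1)) (use hom in auto)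
  show ?thesis
   by (intro exI[of _ U] exI[of _ V'] exI[of _ \<Psi>] conjI U h1 h2)
 qed
qed

lemma hol2_fst: "open V ==> hol2 fst V" and hol2_snd: "open V ==> hol2 snd V"
 unfolding hol2_def by (auto intro!: continuous_intros)

lemma d_fst: "d1 fst x = 1" "d2 fst x = 0" and d_snd: "d1 snd x = 0" "d2 snd x = 1"
 unfolding d1_def d2_def by simp_all

text \<open>The coordinate expression \<open>h\<close> of \<open>f\<close> has a nonzero partial
  derivative at the point, so it can be completed by one of the old coordinates to a holomorphic
  coordinate system. This system is compatible with the atlas and thus belongs to it by
  maximality.\<close>

lemma adapted_chart_exists:
 assumes X: "complex_surface X \<X>" and S: "complex_curve S \<S>" and f: "holomorphic_submersion X \<X> S \<S> f"
  and c: "c : \<S>" and p: "p : topspace X" "f p : fst c"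
 shows "EX d:adapted \<X> f c. p : fst d"
proof -
 have ch: "is_chart X e" if "e : \<X>" for e using X that by (simp add: complex_surface_def complex_structure_def)
 have chc: "is_chart S c" using S c by (simp add: complex_curve_def complex_structure_def)
 obtain d where d: "d : \<X>" "p : fst d" using X p(1) unfolding complex_surface_def complex_structure_def by blast
 define h where "h = snd c \<circ> f \<circ> chart_inv d"
 define V where "V = snd d ` (fst d Int f -` fst c)"
 define x0 where "x0 = snd d p"
 have x0: "x0 : V" using d(2) p(2) by (auto simp: V_def x0_def)
 have "openin X {q : topspace X. f q : fst c}"
  by (rule openin_continuous_map_preimage[OF _ chart_basics(1)[OF chc]]) (use f in "simp add: holomorphic_submersion_def")
 then have "openin X (fst d Int {q : topspace X. f q : fst c})" by (rule openin_Int[OF chart_basics(1)[OF ch[OF d(1)]]])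
 moreover have "fst d Int {q : topspace X. f q : fst c} = fst d Int f -` fst c"
  using openin_subset[OF chart_basics(1)[OF ch[OF d(1)]]] by blast
 ultimately have oV: "open V" unfolding V_def by (intro chart_basics(6)[OF ch[OF d(1)]]) auto
 have h: "hol2 h V" by (rule holomorphic2_imp_hol2[OF _ oV]) (use f d c in "simp add: holomorphic_submersion_def V_def h_def")
 have "surj (frechet_derivative h (at x0))" using f d c p(2) by (simp add: holomorphic_submersion_def h_def x0_def)
 then have sj: "surj (%v. d1 h x0 * fst v + d2 h x0 * snd v)"
  unfolding frechet_derivative_at[OF hol2_has_derivative[OF h x0], symmetric] .
 have nz: "d1 h x0 ~= 0 | d2 h x0 ~= 0"
 proof (rule ccontr)
  assume "~ ?thesis"
  then have "range (%v. d1 h x0 * fst v + d2 h x0 * snd v) <= {0}" by auto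
  then show False using sj by (metis UNIV_I singletonD subsetD zero_neq_one)
 qed
 \<comment> \<open>The Jacobian is \<open>d2 h\<close> for \<open>k = fst\<close> and
   \<open>- d1 h\<close> for \<open>k = snd\<close>; at least one of them is nonzero.\<close>
 obtain k where k: "k = fst | k = snd" and J: "d1 k x0 * d2 h x0 - d2 k x0 * d1 h x0 ~= 0"
 proof (cases "d2 h x0 = 0")
  case True
  then show ?thesis using nz by (intro that[of snd]) (auto simp: d_snd)
 next
  case False
  then show ?thesis by (intro that[of fst]) (auto simp: d_fst)
 qed
 have hk: "hol2 k V" using k hol2_fst[OF oV] hol2_snd[OF oV] by blast
 define \<Phi> where "\<Phi> = (%x. (k x, h x))"
 obtain U V' \<Psi> where U: "open U" "U <= V" "x0 : U" "open V'" "homeomorphism U V' \<Phi> \<Psi>"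
  and \<Psi>: "holomorphic2_on (fst \<circ> \<Psi>) V'" "holomorphic2_on (snd \<circ> \<Psi>) V'"
  using holomorphic_inverse_function[OF hk h x0 J] unfolding \<Phi>_def by blast
 have Ud: "U <= snd d ` fst d" using U(2) by (auto simp: V_def)
 define d' where "d' = ({q : fst d. snd d q : U}, \<Phi> \<circ> snd d)"
 have d': "is_chart X d'" unfolding d'_def by (rule chart_change[OF ch[OF d(1)] U(1) Ud U(4,5)])
 have sub: "fst d' <= fst d" by (auto simp: d'_def)
 have Usub: "snd d q : U" "\<Phi> (snd d q) : V'" "snd d' q = \<Phi> (snd d q)" "\<Psi> (snd d' q) = snd d q" if "q : fst d'" for q
  using that homeomorphism_image1[OF U(5)] homeomorphism_apply1[OF U(5)] by (auto simp: d'_def)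
 have hol\<Phi>: "holomorphic2_on (fst \<circ> \<Phi>) V" "holomorphic2_on (snd \<circ> \<Phi>) V"
  using hol2_imp_holomorphic2[OF hk] hol2_imp_holomorphic2[OF h] by (simp_all add: \<Phi>_def comp_def)
 have "compatible (%F U. holomorphic2_on (fst \<circ> F) U & holomorphic2_on (snd \<circ> F) U) d' e" if e: "e : \<X>" for e
 proof -
  have de: "holomorphic2_on (fst \<circ> (snd e \<circ> chart_inv d)) (snd d ` (fst d Int fst e))" "holomorphic2_on (snd \<circ> (snd e \<circ> chart_inv d)) (snd d ` (fst d Int fst e))"
   "holomorphic2_on (fst \<circ> (snd d \<circ> chart_inv e)) (snd e ` (fst d Int fst e))" "holomorphic2_on (snd \<circ> (snd d \<circ> chart_inv e)) (snd e ` (fst d Int fst e))"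
   using X d(1) e unfolding complex_surface_def complex_structure_def compatible_def by blast+
  have oe: "openin X (fst d' Int fst e)" by (rule openin_Int[OF chart_basics(1)[OF d'] chart_basics(1)[OF ch[OF e]]])
  define O1 where "O1 = snd d' ` (fst d' Int fst e)"
  have O1: "open O1" unfolding O1_def by (rule chart_basics(6)[OF d' oe]) simp
  define O2 where "O2 = snd e ` (fst d' Int fst e)"
  have O1V: "O1 <= V'" using Usub by (auto simp: O1_def)
  have \<Psi>O: "\<Psi> y : snd d ` (fst d Int fst e) & chart_inv d' y = chart_inv d (\<Psi> y)" if yO: "y : O1" for y
  proof -
   obtain q where q: "q : fst d'" "q : fst e" "y = snd d' q" using yO unfolding O1_def by blast
   then show ?thesis using Usub(4)[OF q(1)] chart_basics(4)[OF d' q(1)] chart_basics(4)[OF ch[OF d(1)], of q] sub by auto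
  qed
  have 1: "holomorphic2_on (T \<circ> (snd e \<circ> chart_inv d')) O1" if "holomorphic2_on (T \<circ> (snd e \<circ> chart_inv d)) (snd d ` (fst d Int fst e))" for T :: "complex \<times> complex => complex"
  proof (rule holomorphic2_on_cong[OF O1])
   show "holomorphic2_on (%x. (T \<circ> (snd e \<circ> chart_inv d)) ((fst \<circ> \<Psi>) x, (snd \<circ> \<Psi>) x)) O1"
    by (rule holomorphic2_on_compose[OF that holomorphic2_on_subset[OF \<Psi>(1) O1V] holomorphic2_on_subset[OF \<Psi>(2) O1V]]) (use \<Psi>O in simp)
   show "(T \<circ> (snd e \<circ> chart_inv d)) ((fst \<circ> \<Psi>) x, (snd \<circ> \<Psi>) x) = (T \<circ> (snd e \<circ> chart_inv d')) x" if "x : O1" for x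
    using \<Psi>O[OF that] by simp
  qed
  have O2s: "O2 <= snd e ` (fst d Int fst e)" using sub by (auto simp: O2_def)
  have 2: "holomorphic2_on (T \<circ> (snd d' \<circ> chart_inv e)) O2" if "holomorphic2_on (T \<circ> \<Phi>) V" for T :: "complex \<times> complex => complex"
  proof -
   have "holomorphic2_on (%x. (T \<circ> \<Phi>) ((fst \<circ> (snd d \<circ> chart_inv e)) x, (snd \<circ> (snd d \<circ> chart_inv e)) x)) O2"
   proof (rule holomorphic2_on_compose[OF that holomorphic2_on_subset[OF de(3) O2s] holomorphic2_on_subset[OF de(4) O2s]])
    fix x assume "x : O2"
    then obtain q where "q : fst d'" "q : fst e" "x = snd e q" unfolding O2_def by blast
    then show "((fst \<circ> (snd d \<circ> chart_inv e)) x, (snd \<circ> (snd d \<circ> chart_inv e)) x) : V"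
     using chart_basics(4)[OF ch[OF e], of q] Usub(1)[of q] U(2) by auto
   qed
   then show ?thesis by (simp add: comp_def d'_def)
  qed
  show ?thesis unfolding compatible_def O1_def[symmetric] O2_def[symmetric]
   using 1[OF de(1)] 1[OF de(2)] 2[OF hol\<Phi>(1)] 2[OF hol\<Phi>(2)] by blast
 qed
 \<comment> \<open>Here the maximality clause of \<open>complex_structure\<close> is used.\<close>
 then have "d' : \<X>" using X d' unfolding complex_surface_def complex_structure_def by blast
 moreover have "f q : fst c & snd (snd d' q) = snd c (f q)" if q: "q : fst d'" for q
 proof -
  have qd: "q : fst d" using q sub by blast
  have "snd d q : V" using Usub(1)[OF q] U(2) by blast
  then obtain q' where q': "q' : fst d" "f q' : fst c" "snd d q = snd d q'" by (auto simp: V_def)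
  have "q = q'" using inj_onD[OF chart_basics(3)[OF ch[OF d(1)]] q'(3) qd q'(1)] .
  then show ?thesis using q' chart_basics(4)[OF ch[OF d(1)] qd] by (simp add: d'_def \<Phi>_def h_def)
 qed
 ultimately have "d' : adapted \<X> f c" by (simp add: adapted_def)
 moreover have "p : fst d'" using d(2) U(3) by (simp add: d'_def x0_def)
 ultimately show ?thesis by blast
qed

section \<open>From manifolds to charts\<close>

text \<open>Several clauses of \<open>hyperbolic_charts\<close> range over all complex
  \<open>w\<close>. Outside the image of the base chart the slices are empty, and this lemma settles
  them.\<close>

lemma smo_empty: "smooth_on {} f"
proof -
 have "Ck_on k {} f" for k and f :: "'a::euclidean_space => 'b::real_normed_vector" by (induction k arbitrary: f) auto
 then show ?thesis by (simp add: smooth_on_def)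
qed

lemma (in hyperbolic_charts) speed_derivative:
 assumes d: "d : D" and z: "z t : sl d w" and z': "(z has_vector_derivative z' t) (at t)"
  and z'': "(z' has_vector_derivative - (Pz d w (z t) * (z' t * z' t))) (at t)"
 shows "((%t. G d w (z t) * (z' t * cnj (z' t))) has_vector_derivative 0) (at t)"
proof -
 have "((%t. G d w (z t) * (z' t * cnj (z' t))) has_vector_derivative
  (G d w (z t) * (z' t * cnj (- (Pz d w (z t) * (z' t * z' t))) + - (Pz d w (z t) * (z' t * z' t)) * cnj (z' t)) +
   (G d w (z t) * Pz d w (z t) * z' t + G d w (z t) * cnj (Pz d w (z t)) * cnj (z' t)) * (z' t * cnj (z' t)))) (at t)"
  by (intro hv_mult wirt_curve[where z = z, OF wirt_G[OF d z] z'] z'' has_vector_derivative_cnj)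
 then show ?thesis by (simp add: algebra_simps)
qed

text \<open>The hypotheses of the final theorem for one base chart \<open>c\<close>. The purpose of
  this locale is to verify those of \<open>geodesic_charts\<close> for the charts adapted to
  \<open>c\<close>.\<close>

locale hyperbolic_family_chart =
 fixes X :: "'x topology" and \<X> :: "('x, complex \<times> complex) chart set"
  and S :: "'s topology" and \<S> :: "('s, complex) chart set"
  and f :: "'x => 's" and g :: "'s => ('x, complex) chart => 'x => real"
  and \<gamma> :: "'s => real => 'x" and c :: "('s, complex) chart"
  and AA :: "'s => ('x, complex) chart => 'x => complex"
 assumes fam: "hyperbolic_family X \<X> S \<S> f"
  and met: "!!s. s : topspace S ==> hyperbolic_metric (fibre_atlas \<X> \<S> f s) (g s)"
  and geo: "geodesic_family X \<X> S \<S> f g \<gamma>"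
  and c: "c : \<S>"
  and ks: "!!s. s : fst c ==> AA s : kodaira_spencer \<X> \<S> f c s"
  and har: "!!s. s : fst c ==> harmonic_beltrami (fibre_atlas \<X> \<S> f s) (g s) (AA s)"
begin

abbreviation "DD == adapted \<X> f c"
abbreviation "sI == chart_inv c"
abbreviation "fat s == fibre_atlas \<X> \<S> f s"
abbreviation "fc s d == fibre_chart f s d"
definition "WW = snd c ` fst c"
definition OM :: "('x, complex \<times> complex) chart => (complex \<times> complex) set" where "OM d = snd d ` fst d"
definition OV :: "('x, complex \<times> complex) chart => ('x, complex \<times> complex) chart => (complex \<times> complex) set" where "OV d e = snd d ` (fst d Int fst e)"
definition TR :: "('x, complex \<times> complex) chart => ('x, complex \<times> complex) chart => complex \<times> complex => complex" where "TR d e x = fst (snd e (chart_inv d x))"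
definition "phi d w z = ln (in_coord (fc (sI w) d) (g (sI w)) z)"
definition "KS s b v \<longleftrightarrow> differentiable_lift \<X> f c b & vector_field (fat s) v &
    (ALL d:DD. ALL p:fst d. f p = s -->
     AA s (fc s d) p = dzbar (%z. in_coord d b (z, snd c s)) (fst (snd d p)) + dbar v (fc s d) p)"
text \<open>The lift and the correcting vector field are chosen for each \<open>s\<close> on its
  own, so that no relation between neighbouring fibres is available.\<close>

definition "bb s = (SOME b. EX v. KS s b v)"
definition "vv s = (SOME v. KS s (bb s) v)"
text \<open>The lift from the Kodaira--Spencer class corrected by a vertical field: the sum
  transforms as a lift again, and its \<open>dzbar\<close> is the harmonic representative itself
  rather than a cohomologous form.\<close>

definition "aa d w z = in_coord d (bb (sI w)) (z, w) + in_coord (fc (sI w) d) (vv (sI w)) z"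

lemma KS: assumes "s : fst c" shows "KS s (bb s) (vv s)"
proof -
 have "EX b v. KS s b v" using ks[OF assms] unfolding kodaira_spencer_def KS_def by blast
 then have "EX v. KS s (bb s) v" unfolding bb_def by (rule someI_ex)
 then show ?thesis unfolding vv_def by (rule someI_ex)
qed

section \<open>Adapted charts as coordinates on the total space and on the fibres\<close>

lemma surf: "complex_surface X \<X>" and curv: "complex_curve S \<S>" and subm: "holomorphic_submersion X \<X> S \<S> f"
 and comp: "s : topspace S ==> compact_space (fibre X f s)"
 using fam by (simp_all add: hyperbolic_family_def)

lemma chX: "d : \<X> ==> is_chart X d" using surf by (simp add: complex_surface_def complex_structure_def)
lemma chS: "e : \<S> ==> is_chart S e" using curv by (simp add: complex_curve_def complex_structure_def)
lemmas chc = chS[OF c]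

lemma c_top: "s : fst c ==> s : topspace S" using openin_subset[OF chart_basics(1)[OF chc]] by blast
lemma d_top: "d : \<X> ==> p : fst d ==> p : topspace X" using openin_subset[OF chart_basics(1)[OF chX]] by blast
lemma ad: "d : adapted \<X> f e ==> d : \<X>" "d : adapted \<X> f e ==> p : fst d ==> f p : fst e"
 "d : adapted \<X> f e ==> p : fst d ==> snd (snd d p) = snd e (f p)"
 by (simp_all add: adapted_def)
lemma sI: "s : fst c ==> sI (snd c s) = s" by (rule chart_basics(4)[OF chc])
lemma sIW: "w : WW ==> sI w : fst c" "w : WW ==> snd c (sI w) = w"
 using chart_basics(5)[OF chc] by (auto simp: WW_def)
lemma sWW: "s : fst c ==> snd c s : WW" by (simp add: WW_def)

lemma pt:
 assumes d: "d : DD" and z: "(z, w) : OM d"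
 shows "chart_inv d (z, w) : fst d" "snd d (chart_inv d (z, w)) = (z, w)" "f (chart_inv d (z, w)) = sI w" "sI w : fst c" "snd c (sI w) = w" "w : WW"
proof -
 have p: "chart_inv d (z, w) : fst d" "snd d (chart_inv d (z, w)) = (z, w)"
  using chart_basics(5)[OF chX[OF ad(1)[OF d]]] z by (auto simp: OM_def)
 have w: "snd c (f (chart_inv d (z, w))) = w" using ad(3)[OF d p(1)] p(2) by simp
 have fp: "f (chart_inv d (z, w)) : fst c" by (rule ad(2)[OF d p(1)])
 have i: "f (chart_inv d (z, w)) = sI w" using sI[OF fp] w by simp
 show "chart_inv d (z, w) : fst d" "snd d (chart_inv d (z, w)) = (z, w)" "f (chart_inv d (z, w)) = sI w" "sI w : fst c" "snd c (sI w) = w" "w : WW"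
  using p i fp w sWW[OF fp] by simp_all
qed

lemma snd_chart: "d : DD ==> p : fst d ==> snd d p = (fst (snd d p), snd c (f p))"
 using ad(3) by (metis prod.collapse)

lemma chart_inv_chart: "d : \<X> ==> p : fst d ==> chart_inv d (snd d p) = p"
 by (rule chart_basics(4)[OF chX])

lemma fc_inv:
 assumes d: "d : DD" and p: "p : fst d" shows "chart_inv (fc (f p) d) (fst (snd d p)) = p"
proof -
 have inj: "inj_on (%p. fst (snd d p)) (fst d Int f -` {f p})"
 proof (rule inj_onI)
  fix q r assume q: "q : fst d Int f -` {f p}" "r : fst d Int f -` {f p}" "fst (snd d q) = fst (snd d r)"
  then have "snd d q = snd d r" using snd_chart[OF d, of q] snd_chart[OF d, of r] by (metis IntD1 IntD2 vimage_singleton_eq)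
  then show "q = r" using inj_onD[OF chart_basics(3)[OF chX[OF ad(1)[OF d]]]] q by blast
 qed
 show ?thesis unfolding chart_inv_def fibre_chart_def fst_conv snd_conv
  by (rule inv_into_f_f[OF inj]) (use p in simp)
qed

lemma fc_pt:
 assumes d: "d : DD" and z: "(z, w) : OM d"
 shows "chart_inv (fc (sI w) d) z = chart_inv d (z, w)" "chart_inv d (z, w) : fst (fc (sI w) d)" "snd (fc (sI w) d) (chart_inv d (z, w)) = z"
 using fc_inv[OF d pt(1)[OF d z]] pt[OF d z] by (simp_all add: fibre_chart_def)

lemma fc_image: assumes d: "d : DD" and w: "w : WW" shows "snd (fc (sI w) d) ` fst (fc (sI w) d) = {z. (z, w) : OM d}"
proof (intro equalityI subsetI)
 fix z assume "z : snd (fc (sI w) d) ` fst (fc (sI w) d)"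
 then obtain p where p: "p : fst d" "f p = sI w" "z = fst (snd d p)" by (auto simp: fibre_chart_def)
 then have "snd d p = (z, w)" using snd_chart[OF d p(1)] sIW(2)[OF w] by simp
 then show "z : {z. (z, w) : OM d}" using p(1) unfolding OM_def by (metis imageI mem_Collect_eq)
next
 fix z assume "z : {z. (z, w) : OM d}"
 then show "z : snd (fc (sI w) d) ` fst (fc (sI w) d)" using fc_pt(2,3)[OF d] by (metis imageI mem_Collect_eq)
qed

lemma fc_atlas: "d : DD ==> s : fst c ==> fc s d : fat s"
 unfolding fibre_atlas_def using c by blast

lemma open_OM: "d : \<X> ==> open (OM d)" unfolding OM_def by (rule chart_basics(2)[OF chX])

lemma TR_hol2: assumes "d : \<X>" "e : \<X>" shows "hol2 (TR d e) (OV d e)"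
proof (rule holomorphic2_imp_hol2)
 have "holomorphic2_on (fst \<circ> (snd e \<circ> chart_inv d)) (snd d ` (fst d Int fst e))"
  using surf assms unfolding complex_surface_def complex_structure_def compatible_def by blast
 then show "holomorphic2_on (TR d e) (OV d e)" by (simp add: TR_def[abs_def] OV_def comp_def)
 show "open (OV d e)" unfolding OV_def
  by (rule chart_basics(6)[OF chX[OF assms(1)] openin_Int[OF chart_basics(1)[OF chX[OF assms(1)]] chart_basics(1)[OF chX[OF assms(2)]]]]) simp
qed

lemma OVE:
 assumes "d : DD" "(z, w) : OV d e"
 obtains p where "p : fst d" "p : fst e" "snd d p = (z, w)" "chart_inv d (z, w) = p" "f p = sI w" "w : WW" "TR d e (z, w) = fst (snd e p)" "(z, w) : OM d"
proof -
 obtain p where p: "p : fst d" "p : fst e" "snd d p = (z, w)" using assms(2) by (auto simp: OV_def)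
 have o: "(z, w) : OM d" using p(1,3) unfolding OM_def by (metis imageI)
 have i: "chart_inv d (z, w) = p" using chart_inv_chart[OF ad(1)[OF assms(1)] p(1)] p(3) by simp
 show ?thesis by (rule that[OF p i _ _ _ o]) (use pt[OF assms(1) o] i in "simp_all add: TR_def")
qed

lemma TR_OM: assumes "d : DD" "e : DD" "(z, w) : OV d e" shows "(TR d e (z, w), w) : OM e"
proof -
 obtain p where p: "p : fst d" "p : fst e" "f p = sI w" "w : WW" "TR d e (z, w) = fst (snd e p)" by (rule OVE[OF assms(1,3)])
 then have "snd e p = (TR d e (z, w), w)" using snd_chart[OF assms(2) p(2)] sIW(2)[OF p(4)] by simp
 then show ?thesis using p(2) unfolding OM_def by (metis imageI)
qed

lemma TR_TR: assumes "d : DD" "e : DD" "(z, w) : OV d e" shows "(TR d e (z, w), w) : OV e d" "TR e d (TR d e (z, w), w) = z"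
proof -
 obtain p where p: "p : fst d" "p : fst e" "snd d p = (z, w)" "f p = sI w" "w : WW" "TR d e (z, w) = fst (snd e p)" by (rule OVE[OF assms(1,3)])
 have e: "snd e p = (TR d e (z, w), w)" using snd_chart[OF assms(2) p(2)] sIW(2)[OF p(5)] p(4,6) by simp
 then show "(TR d e (z, w), w) : OV e d" using p(1,2) unfolding OV_def by (metis IntI imageI)
 have "chart_inv e (TR d e (z, w), w) = p" using chart_inv_chart[OF ad(1)[OF assms(2)] p(2)] e by simp
 then show "TR e d (TR d e (z, w), w) = z" using p(3) by (simp add: TR_def[of e d])
qed

lemma open_OV_slice: "d : \<X> ==> e : \<X> ==> open {z. (z, w) : OV d e}"
 by (rule open_slices(1)[OF hol2_open[OF TR_hol2]])

text \<open>The reverse transition is an inverse on the slice, so by the chain rule the two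
  derivatives have product 1.\<close>

lemma TR_d1: assumes d: "d : DD" and e: "e : DD" and z: "(z, w) : OV d e" shows "d1 (TR d e) (z, w) ~= 0"
proof -
 note D1 = hol2_d1[OF TR_hol2[OF ad(1)[OF d] ad(1)[OF e]] z] and D2 = hol2_d1[OF TR_hol2[OF ad(1)[OF e] ad(1)[OF d]] TR_TR(1)[OF d e z]]
 have "((%z. TR e d (TR d e (z, w), w)) has_field_derivative d1 (TR e d) (TR d e (z, w), w) * d1 (TR d e) (z, w)) (at z)"
  using DERIV_chain[OF D2 D1] by (simp add: comp_def)
 moreover have "((%z. TR e d (TR d e (z, w), w)) has_field_derivative 1) (at z)"
  by (rule has_field_derivative_transform_within_open[OF DERIV_ident open_OV_slice[OF ad(1)[OF d] ad(1)[OF e]]])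
   (use z TR_TR(2)[OF d e] in auto)
 ultimately have "d1 (TR e d) (TR d e (z, w), w) * d1 (TR d e) (z, w) = 1" by (rule DERIV_unique)
 then show ?thesis by auto
qed

text \<open>The second chart is only required to lie in the atlas. This admits charts adapted to
  another base coordinate, which also occur in the fibre atlas; the comparison of speeds relies on
  it.\<close>

lemma jac_TR:
 assumes d: "d : DD" and e: "e : \<X>" and z: "(z, w) : OV d e"
 shows "jac (fc (sI w) d) (fc (sI w) e) (chart_inv d (z, w)) = d1 (TR d e) (z, w)"
proof -
 have o: "(z, w) : OM d" by (rule OVE[OF d z])
 have "((%z. TR d e (z, w)) has_field_derivative d1 (TR d e) (z, w)) (at z)"
  by (rule hol2_d1[OF TR_hol2[OF ad(1)[OF d] e] z])
 then have "((snd (fc (sI w) e) \<circ> chart_inv (fc (sI w) d)) has_field_derivative d1 (TR d e) (z, w)) (at z)"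
 proof (rule has_field_derivative_transform_within_open[OF _ open_OV_slice[OF ad(1)[OF d] e]])
  fix y assume "y : {z. (z, w) : OV d e}"
  then have "(y, w) : OV d e" by simp
  then have "(y, w) : OM d" by (rule OVE[OF d])
  from fc_pt(1)[OF d this] show "TR d e (y, w) = (snd (fc (sI w) e) \<circ> chart_inv (fc (sI w) d)) y"
   by (simp add: TR_def fibre_chart_def)
 qed (use z in simp)
 then show ?thesis unfolding jac_def fc_pt(3)[OF d o] by (rule DERIV_imp_deriv)
qed

section \<open>Metric, lift and harmonicity in adapted coordinates\<close>

lemma metric: assumes "s : fst c"
 shows "smooth_components (fat s) (g s)" "e : fat s ==> p : fst e ==> g s e p > 0"
  "e : fat s ==> e' : fat s ==> p : fst e ==> p : fst e' ==> g s e p = g s e' p * (cmod (jac e e' p))\<^sup>2"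
  "e : fat s ==> z : snd e ` fst e ==> complex_of_real (in_coord e (g s) z) = dz (dzbar (log_metric (g s) e)) z"
proof -
 note h = met[OF c_top[OF assms], unfolded hyperbolic_metric_def conformal_metric_def]
 show "smooth_components (fat s) (g s)" using h by blast
 show "e : fat s ==> p : fst e ==> g s e p > 0" using h by blast
 show "e : fat s ==> e' : fat s ==> p : fst e ==> p : fst e' ==> g s e p = g s e' p * (cmod (jac e e' p))\<^sup>2" using h by blast
 show "e : fat s ==> z : snd e ` fst e ==> complex_of_real (in_coord e (g s) z) = dz (dzbar (log_metric (g s) e)) z" using h by blast
qed

lemma phi_log: "(%z. complex_of_real (phi d w z)) = log_metric (g (sI w)) (fc (sI w) d)"
 by (simp add: fun_eq_iff phi_def log_metric_def)

lemma exp_phi: assumes d: "d : DD" and z: "(z, w) : OM d"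
 shows "exp (phi d w z) = in_coord (fc (sI w) d) (g (sI w)) z" "in_coord (fc (sI w) d) (g (sI w)) z = g (sI w) (fc (sI w) d) (chart_inv d (z, w))"
proof -
 show e: "in_coord (fc (sI w) d) (g (sI w)) z = g (sI w) (fc (sI w) d) (chart_inv d (z, w))"
  by (simp add: in_coord_def fc_pt(1)[OF d z])
 show "exp (phi d w z) = in_coord (fc (sI w) d) (g (sI w)) z"
  using metric(2)[OF pt(4)[OF d z] fc_atlas[OF d pt(4)[OF d z]] fc_pt(2)[OF d z]] e by (simp add: phi_def)
qed

lemma sm_fc: assumes d: "d : DD" and T: "w : WW ==> smooth_components (fat (sI w)) T"
 shows "smooth_on {z. (z, w) : OM d} (in_coord (fc (sI w) d) T)"
proof (cases "w : WW")
 case True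
 then show ?thesis using T[OF True] fc_atlas[OF d sIW(1)[OF True]] fc_image[OF d True] unfolding smooth_components_def by metis
next
 case False
 then have "{z. (z, w) : OM d} = {}" using pt(6)[OF d] by blast
 then show ?thesis by (simp add: smo_empty)
qed

lemma open_OM_slice: "d : DD ==> open {z. (z, w) : OM d}" by (rule open_slices(1)[OF open_OM[OF ad(1)]])

lemma sm_b: assumes d: "d : DD" shows "smooth_on {z. (z, w) : OM d} (%z. in_coord d (bb (sI w)) (z, w))"
proof (cases "w : WW")
 case True
 then have "smooth_on (OM d) (in_coord d (bb (sI w)))"
  using KS[OF sIW(1)[OF True]] d unfolding KS_def differentiable_lift_def smooth_components_def OM_def by blast
 then have "smooth_on {z. (z, w) : OM d} (%z. in_coord d (bb (sI w)) ((0, w) + (z, 0)))"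
  by (rule smo_compose_affine[OF open_OM[OF ad(1)[OF d]] open_OM_slice[OF d], where L = "%z. (z, 0)" and c = "(0, w)", rotated])
   (auto intro!: bounded_linear_Pair bounded_linear_ident bounded_linear_zero)
 then show ?thesis by simp
next
 case False
 then have "{z. (z, w) : OM d} = {}" using pt(6)[OF d] by blast
 then show ?thesis by (simp add: smo_empty)
qed

lemma sm_v: "d : DD ==> smooth_on {z. (z, w) : OM d} (in_coord (fc (sI w) d) (vv (sI w)))"
 by (rule sm_fc) (use KS[OF sIW(1)] in "auto simp: KS_def vector_field_def")

lemma sm_aa: "d : DD ==> smooth_on {z. (z, w) : OM d} (aa d w)"
 unfolding aa_def[abs_def] by (rule smo_add[OF open_OM_slice sm_b sm_v])

lemma dzbar_aa: assumes d: "d : DD" and z: "(z, w) : OM d"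
 shows "dzbar (aa d w) z = AA (sI w) (fc (sI w) d) (chart_inv d (z, w))"
  "in_coord (fc (sI w) d) (AA (sI w)) z = dzbar (aa d w) z"
proof -
 define p where "p = chart_inv d (z, w)"
 have z': "z : {z. (z, w) : OM d}" using z by simp
 have "dzbar (aa d w) z = dzbar (%z. in_coord d (bb (sI w)) (z, w)) z + dzbar (in_coord (fc (sI w) d) (vv (sI w))) z"
  unfolding aa_def[abs_def] by (rule wirt_D(2)[OF wirt_add[OF wirt_smooth[OF sm_b[OF d] z'] wirt_smooth[OF sm_v[OF d] z']]])
 moreover have "AA (sI w) (fc (sI w) d) p = dzbar (%z. in_coord d (bb (sI w)) (z, snd c (sI w))) (fst (snd d p)) + dbar (vv (sI w)) (fc (sI w) d) p"
  using KS[OF pt(4)[OF d z]] d pt(1,3)[OF d z] unfolding KS_def p_def by blast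
 ultimately show e: "dzbar (aa d w) z = AA (sI w) (fc (sI w) d) (chart_inv d (z, w))"
  using pt(2,5)[OF d z] fc_pt(3)[OF d z] by (simp add: p_def dbar_def)
 show "in_coord (fc (sI w) d) (AA (sI w)) z = dzbar (aa d w) z" unfolding e by (simp add: in_coord_def fc_pt(1)[OF d z])
qed

lemma aa_harmonic:
 assumes d: "d : DD" and z: "(z, w) : OM d"
 shows "dzbar (%y. (dz (dzbar (aa d w)) y + dz (%z. complex_of_real (phi d w z)) y * dzbar (aa d w) y) / of_real (exp (phi d w y))) z = 0"
proof -
 define s e U where "s = sI w" and "e = fc s d" and "U = {z. (z, w) : OM d}"
 define F where "F y = (dz (dzbar (aa d w)) y + dz (%z. complex_of_real (phi d w z)) y * dzbar (aa d w) y) / of_real (exp (phi d w y))" for y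
 have U: "open U" "z : U" using open_OM_slice[OF d] z by (simp_all add: U_def)
 have s: "s : fst c" using pt(4)[OF d z] by (simp add: s_def)
 have smg: "smooth_on U (in_coord e (g s))" unfolding U_def e_def s_def by (rule sm_fc[OF d metric(1)[OF sIW(1)]])
 have pos: "in_coord e (g s) y > 0" if "y : U" for y
  using exp_phi(1)[OF d, of y w] that exp_gt_zero[of "phi d w y"] by (simp add: U_def e_def s_def)
 have nz: "complex_of_real (in_coord e (g s) y) ~= 0" if "y : U" for y using pos[OF that] by simp
 \<comment> \<open>The formal adjoint is \<open>- F\<close>; differentiability of \<open>F\<close>
   allows the sign to be moved out of \<open>dzbar\<close>. Smoothness is shown with the component
   of \<open>g\<close>, which equals \<open>exp (phi d w y)\<close> on the slice only.\<close>
 have smF: "smooth_on U F"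
 proof (rule smooth_on_cong[OF U(1)])
  show "smooth_on U (%y. (dz (dzbar (aa d w)) y + dz (%z. complex_of_real (phi d w z)) y * dzbar (aa d w) y) * inverse (complex_of_real (in_coord e (g s) y)))"
   unfolding phi_def s_def[symmetric] e_def[symmetric]
   by (intro smo_mult smo_add smo_inverse smo_of_real smo_dz smo_dzbar U smo_ln smg pos
    sm_aa[OF d, of w, folded U_def] nz)
  show "(dz (dzbar (aa d w)) y + dz (%z. complex_of_real (phi d w z)) y * dzbar (aa d w) y) * inverse (complex_of_real (in_coord e (g s) y)) = F y" if "y : U" for y
   using exp_phi(1)[OF d, of y w] that by (simp add: F_def U_def e_def s_def divide_inverse)
 qed
 have adj: "in_coord e (dbar_adjoint (g s) (AA s)) y = - F y" if y: "y : U" for y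
 proof -
  have yO: "(y, w) : OM d" using y by (simp add: U_def)
  have "dz (in_coord e (AA s)) y = dz (dzbar (aa d w)) y"
   by (rule dz_cong[OF U(1) y]) (use dzbar_aa(2)[OF d] in "simp add: U_def e_def s_def")
  moreover have "AA s e (chart_inv d (y, w)) = dzbar (aa d w) y" using dzbar_aa(1)[OF d yO] by (simp add: e_def s_def)
  ultimately show ?thesis
   unfolding in_coord_def[of e "dbar_adjoint (g s) (AA s)"] comp_def dbar_adjoint_def F_def phi_log
   using fc_pt[OF d yO] exp_phi[OF d yO] by (simp add: e_def s_def divide_inverse algebra_simps)
 qed
 have p: "chart_inv d (z, w) : fst e" "snd e (chart_inv d (z, w)) = z" using fc_pt[OF d z] by (simp_all add: e_def s_def)
 have "dbar (dbar_adjoint (g s) (AA s)) e (chart_inv d (z, w)) = 0"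
  using har[OF s] fc_atlas[OF d s] p(1) unfolding harmonic_beltrami_def e_def by blast
 then have "dzbar (in_coord e (dbar_adjoint (g s) (AA s))) z = 0" by (simp add: dbar_def p(2))
 moreover have "dzbar (in_coord e (dbar_adjoint (g s) (AA s))) z = dzbar (%y. - F y) z" by (rule dzbar_cong[OF U adj])
 moreover have "dzbar (%y. - F y) z = - dzbar F z" by (rule wirt_D(2)[OF wirt_minus[OF wirt_smooth[OF smF U(2)]]])
 ultimately show ?thesis unfolding F_def[abs_def] by simp
qed

lemma chart_at:
 assumes "p : topspace X" "f p : fst c" shows "EX d:DD. p : fst d"
 by (rule adapted_chart_exists[OF surf curv subm c assms])

text \<open>Compactness of the fibre: the preimages of the balls prescribed by \<open>R\<close> are
  open in it, and they cover it because every point has an adapted chart whose coordinate may serve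
  as centre.\<close>

lemma fibre_cover:
 assumes w: "w : WW" and R: "!!d z. d : DD ==> (z, w) : OM d ==> 0 < (R d z :: real)"
 shows "EX F. finite F & (ALL i:F. fst i : DD & (snd i, w) : OM (fst i)) &
    (ALL p:topspace X. f p = sI w --> (EX i:F. p : fst (fst i) & dist (fst (snd (fst i) p)) (snd i) < R (fst i) (snd i)))"
proof -
 define s where "s = sI w"
 have s: "s : fst c" "snd c s = w" using sIW[OF w] by (simp_all add: s_def)
 define I where "I = {i. fst i : DD & (snd i, w) : OM (fst i)}"
 define N where "N i = {q : fst (fst i). snd (fst i) q : ball (snd i) (R (fst i) (snd i)) \<times> UNIV} Int {p. f p = s}" for i
 have o: "ALL V:N ` I. openin (fibre X f s) V"
 proof
  fix V assume "V : N ` I"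
  then obtain i where i: "i : I" "V = N i" by blast
  show "openin (fibre X f s) V" unfolding i(2) N_def fibre_def
   by (rule openin_subtopology_Int, rule chart_basics(7)[OF chX]) (use i(1) ad(1)[of "fst i" c] in "auto simp: I_def intro: open_Times")
 qed
 have cov: "topspace (fibre X f s) <= \<Union>(N ` I)"
 proof
  fix p assume "p : topspace (fibre X f s)"
  then have p: "p : topspace X" "f p = s" by (auto simp: fibre_def)
  then obtain d where d: "d : DD" "p : fst d" using chart_at s by blast
  have dp: "snd d p = (fst (snd d p), w)" using snd_chart[OF d] p s by simp
  then have O: "(fst (snd d p), w) : OM d" unfolding OM_def using d(2) by (metis imageI)
  have "(d, fst (snd d p)) : I" using d O by (simp add: I_def)
  moreover have "p : N (d, fst (snd d p))" using d p R[OF d(1) O] by (simp add: N_def mem_Times_iff)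
  ultimately show "p : \<Union>(N ` I)" by blast
 qed
 have cs: "ALL \<U>. (ALL U:\<U>. openin (fibre X f s) U) & topspace (fibre X f s) <= \<Union>\<U>
  --> (EX \<F>. finite \<F> & \<F> <= \<U> & topspace (fibre X f s) <= \<Union>\<F>)"
  using comp[OF c_top[OF s(1)]] unfolding compact_space_alt .
 from mp[OF spec[OF cs, of "N ` I"] conjI[OF o cov]]
 obtain \<F> where \<F>: "finite \<F>" "\<F> <= N ` I" "topspace (fibre X f s) <= \<Union>\<F>" by (elim exE conjE) (rule that)
 from finite_subset_image[OF \<F>(1,2)] obtain F where F0: "F <= I" "finite F" "\<F> = N ` F" by (elim exE conjE) (rule that)
 have F: "F <= I" "finite F" "topspace (fibre X f s) <= \<Union>(N ` F)" using F0 \<F>(3) by simp_all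
 show ?thesis
 proof (intro exI[of _ F] conjI ballI impI)
  fix p assume "p : topspace X" "f p = sI w"
  then have "p : topspace (fibre X f s)" by (simp add: fibre_def s_def)
  then obtain i where "i : F" "p : N i" using F(3) by blast
  then show "EX i:F. p : fst (fst i) & dist (fst (snd (fst i) p)) (snd i) < R (fst i) (snd i)"
   by (intro bexI[of _ i]) (auto simp: N_def mem_Times_iff dist_commute)
 qed (use F in "auto simp: I_def")
qed

sublocale hyperbolic_charts DD OM OV TR phi aa WW
proof
 show "open (OM d)" if "d : DD" for d by (rule open_OM[OF ad(1)[OF that]])
 show "open WW" unfolding WW_def by (rule chart_basics(2)[OF chc])
 show "w : WW" if "d : DD" "(z, w) : OM d" for d z w by (rule pt(6)[OF that])
 show "hol2 (TR d e) (OV d e)" if "d : DD" "e : DD" for d e by (rule TR_hol2[OF ad(1)[OF that(1)] ad(1)[OF that(2)]])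
 show "(z, w) : OM d" if "d : DD" "e : DD" "(z, w) : OV d e" for d e z w by (rule OVE[OF that(1,3)])
 show "(TR d e (z, w), w) : OM e" if "d : DD" "e : DD" "(z, w) : OV d e" for d e z w by (rule TR_OM[OF that])
 show "d1 (TR d e) (z, w) ~= 0" if "d : DD" "e : DD" "(z, w) : OV d e" for d e z w by (rule TR_d1[OF that])
 show "smooth_on {z. (z, w) : OM d} (%z. complex_of_real (phi d w z))" if d: "d : DD" for d w
  unfolding phi_def
  by (intro smo_of_real smo_ln open_OM_slice[OF d] sm_fc[OF d metric(1)[OF sIW(1)]])
   (use exp_phi(1)[OF d] in "metis exp_gt_zero mem_Collect_eq")
 show "lap (%z. complex_of_real (phi d w z)) z = of_real (exp (phi d w z))" if d: "d : DD" "(z, w) : OM d" for d z w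
  unfolding phi_log exp_phi(1)[OF d]
  by (rule metric(4)[OF pt(4)[OF d] fc_atlas[OF d(1) pt(4)[OF d]], symmetric]) (use fc_image[OF d(1) pt(6)[OF d]] d(2) in simp)
 show "phi d w z = phi e w (TR d e (z, w)) + 2 * ln (cmod (d1 (TR d e) (z, w)))" if d: "d : DD" and e: "e : DD" and z: "(z, w) : OV d e" for d e z w
 proof -
  obtain p where p: "p : fst d" "p : fst e" "snd d p = (z, w)" "chart_inv d (z, w) = p" "f p = sI w" "w : WW" "TR d e (z, w) = fst (snd e p)" and o: "(z, w) : OM d"
   by (rule OVE[OF d z])
  note s = sIW(1)[OF p(6)]
  have o': "(TR d e (z, w), w) : OM e" by (rule TR_OM[OF d e z])
  have ie: "chart_inv e (TR d e (z, w), w) = p"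
   using chart_inv_chart[OF ad(1)[OF e] p(2)] snd_chart[OF e p(2)] p(5,7) sIW(2)[OF p(6)] by simp
  have "g (sI w) (fc (sI w) d) p = g (sI w) (fc (sI w) e) p * (cmod (jac (fc (sI w) d) (fc (sI w) e) p))\<^sup>2"
   by (rule metric(3)[OF s fc_atlas[OF d s] fc_atlas[OF e s]]) (use p in "simp_all add: fibre_chart_def")
  then have eq: "exp (phi d w z) = exp (phi e w (TR d e (z, w))) * (cmod (d1 (TR d e) (z, w)))\<^sup>2"
   unfolding exp_phi[OF d o] exp_phi[OF e o'] using jac_TR[OF d ad(1)[OF e] z] p(4) ie by simp
  have "phi d w z = ln (exp (phi d w z))" by simp
  also have "... = phi e w (TR d e (z, w)) + 2 * ln (cmod (d1 (TR d e) (z, w)))"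
   unfolding eq using TR_d1[OF d e z] by (simp add: ln_mult ln_realpow)
  finally show ?thesis .
 qed
 show "smooth_on {z. (z, w) : OM d} (aa d w)" if "d : DD" for d w by (rule sm_aa[OF that])
 \<comment> \<open>The inhomogeneous term comes from the lift \<open>b\<close> alone; the vertical
   field \<open>v\<close> contributes only the factor \<open>d1 (TR d e)\<close>.\<close>
 show "aa e w (TR d e (z, w)) = d1 (TR d e) (z, w) * aa d w z + d2 (TR d e) (z, w)" if d: "d : DD" and e: "e : DD" and z: "(z, w) : OV d e" for d e z w
 proof -
  obtain p where p: "p : fst d" "p : fst e" "snd d p = (z, w)" "chart_inv d (z, w) = p" "f p = sI w" "w : WW" "TR d e (z, w) = fst (snd e p)" and o: "(z, w) : OM d"
   by (rule OVE[OF d z])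
  note s = sIW(1)[OF p(6)]
  have o': "(TR d e (z, w), w) : OM e" by (rule TR_OM[OF d e z])
  have ie: "chart_inv e (TR d e (z, w), w) = p"
   using chart_inv_chart[OF ad(1)[OF e] p(2)] snd_chart[OF e p(2)] p(5,7) sIW(2)[OF p(6)] by simp
  have b: "bb (sI w) e p = d1 (TR d e) (z, w) * bb (sI w) d p + d2 (TR d e) (z, w)"
   using KS[OF s] d e p(1,2,3) unfolding KS_def differentiable_lift_def Let_def d1_def d2_def TR_def by fastforce
  have "vector_field (fat (sI w)) (vv (sI w))" using KS[OF s] unfolding KS_def by (elim conjE)
  then have vf: "ALL e:fat (sI w). ALL e':fat (sI w). ALL p:fst e Int fst e'. vv (sI w) e' p = vv (sI w) e p * jac e e' p"
   unfolding vector_field_def by (elim conjE)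
  have v: "vv (sI w) (fc (sI w) e) p = vv (sI w) (fc (sI w) d) p * jac (fc (sI w) d) (fc (sI w) e) p"
   by (rule bspec[OF bspec[OF bspec[OF vf fc_atlas[OF d s]] fc_atlas[OF e s]]]) (use p(1,2,5) in "simp add: fibre_chart_def")
  show ?thesis
   unfolding aa_def in_coord_def comp_def fc_pt(1)[OF d o] fc_pt(1)[OF e o'] ie p(4) b v
   using jac_TR[OF d ad(1)[OF e] z] p(4) by (simp add: algebra_simps)
 qed
 show "dzbar (%y. (dz (dzbar (aa d w)) y + dz (%z. complex_of_real (phi d w z)) y * dzbar (aa d w) y) / of_real (exp (phi d w y))) z = 0"
  if "d : DD" "(z, w) : OM d" for d z w by (rule aa_harmonic[OF that])
 show "EX F. finite F & (ALL i:F. fst i : DD & (snd i, w) : OM (fst i)) &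
    (ALL d:DD. ALL z. (z, w) : OM d -->
     (EX i:F. (z, w) : OV d (fst i) & dist (TR d (fst i) (z, w)) (snd i) < R (fst i) (snd i)))"
  if w: "w : WW" and R: "!!d z. d : DD ==> (z, w) : OM d ==> 0 < R d z" for w and R :: "('x, complex \<times> complex) chart => complex => real"
 proof -
  have "EX F. finite F & (ALL i:F. fst i : DD & (snd i, w) : OM (fst i)) &
    (ALL p:topspace X. f p = sI w --> (EX i:F. p : fst (fst i) & dist (fst (snd (fst i) p)) (snd i) < R (fst i) (snd i)))"
   by (rule fibre_cover[OF w]) (rule R)
  then obtain F where F: "finite F" "ALL i:F. fst i : DD & (snd i, w) : OM (fst i)"
   "ALL p:topspace X. f p = sI w --> (EX i:F. p : fst (fst i) & dist (fst (snd (fst i) p)) (snd i) < R (fst i) (snd i))"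
   by (elim exE conjE) (rule that)
  show ?thesis
  proof (intro exI[of _ F] conjI F(1,2) ballI allI impI)
   fix d z assume d: "d : DD" "(z, w) : OM d"
   note p = pt[OF d]
   obtain i where i: "i : F" "chart_inv d (z, w) : fst (fst i)" "dist (fst (snd (fst i) (chart_inv d (z, w)))) (snd i) < R (fst i) (snd i)"
    using F(3) d_top[OF ad(1)[OF d(1)] p(1)] p(3) by blast
   have "(z, w) : OV d (fst i)" using p(1,2) i(2) unfolding OV_def by (metis IntI imageI)
   then show "EX i:F. (z, w) : OV d (fst i) & dist (TR d (fst i) (z, w)) (snd i) < R (fst i) (snd i)"
    using i by (auto simp: TR_def)
  qed
 qed
qed

text \<open>The supremum in \<open>beltrami_norm\<close> dominates its members only if the set is
  bounded. Locally it is so by continuity, globally by compactness of the fibre; charts adapted to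
  other base coordinates give the same moduli, because the transformation factor of a Beltrami
  differential is unimodular.\<close>

lemma A_bound:
 assumes d: "d : DD" and z: "z : sl d w"
 shows "cmod (A d w z) <= beltrami_norm (fat (sI w)) (AA (sI w))"
proof -
 have zO: "(z, w) : OM d" using z by (simp add: sl_def)
 define s where "s = sI w"
 have s: "s : fst c" "w : WW" using pt(4,6)[OF d zO] by (simp_all add: s_def)
 have Ab: "A d w y = AA s (fc s d) (chart_inv d (y, w))" if "d : DD" "(y, w) : OM d" for d y
  unfolding A_def s_def by (rule dzbar_aa(1)[OF that])
 have "EX R>0. EX B. ALL y:ball \<zeta> R. (y, w) : OM d --> cmod (A d w y) <= B" if d: "d : DD" "(\<zeta>, w) : OM d" for d \<zeta>
 proof -
  have z: "\<zeta> : sl d w" using d(2) by (simp add: sl_def)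
  have "isCont (A d w) \<zeta>"
   using smo_imp_continuous_on[OF sm_A[OF d(1)], of w] z by (simp add: continuous_on_eq_continuous_at open_sl[OF d(1)])
  then obtain R where R: "R > 0" "!!y. dist y \<zeta> < R ==> dist (A d w y) (A d w \<zeta>) < 1"
   unfolding continuous_at_eps_delta using zero_less_one by blast
  have "cmod (A d w y) <= cmod (A d w \<zeta>) + 1" if "y : ball \<zeta> R" for y
  proof -
   have "dist y \<zeta> < R" using that by (simp add: dist_commute)
   from R(2)[OF this] have "cmod (A d w y - A d w \<zeta>) < 1" by (simp add: dist_norm)
   then show ?thesis using norm_triangle_sub[of "A d w y" "A d w \<zeta>"] by linarith
  qed
  then show ?thesis using R(1) by blast
 qed
 note loc = this
 define Q where "Q d \<zeta> r \<longleftrightarrow> r > 0 & (EX B. ALL y:ball \<zeta> r. (y, w) : OM d --> cmod (A d w y) <= B)" for d \<zeta> and r :: real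
 define R where "R d \<zeta> = (SOME r. Q d \<zeta> r)" for d \<zeta>
 define B where "B d \<zeta> = (SOME B. ALL y:ball \<zeta> (R d \<zeta>). (y, w) : OM d --> cmod (A d w y) <= B)" for d \<zeta>
 have R: "Q d \<zeta> (R d \<zeta>)" if "d : DD" "(\<zeta>, w) : OM d" for d \<zeta>
  unfolding R_def by (rule someI_ex) (use loc[OF that] in "simp add: Q_def")
 have R0: "0 < R d \<zeta>" if "d : DD" "(\<zeta>, w) : OM d" for d \<zeta> using R[OF that] by (simp add: Q_def)
 have B: "cmod (A d w y) <= B d \<zeta>" if "d : DD" "(\<zeta>, w) : OM d" "y : ball \<zeta> (R d \<zeta>)" "(y, w) : OM d" for d \<zeta> y
 proof -
  have "ALL y:ball \<zeta> (R d \<zeta>). (y, w) : OM d --> cmod (A d w y) <= B d \<zeta>"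
   unfolding B_def by (rule someI_ex) (use R[OF that(1,2)] in "simp add: Q_def")
  then show ?thesis using that(3,4) by blast
 qed
 have "EX F. finite F & (ALL i:F. fst i : DD & (snd i, w) : OM (fst i)) &
    (ALL p:topspace X. f p = sI w --> (EX i:F. p : fst (fst i) & dist (fst (snd (fst i) p)) (snd i) < R (fst i) (snd i)))"
  by (rule fibre_cover[OF s(2)]) (rule R0)
 then obtain F where F: "finite F" "ALL i:F. fst i : DD & (snd i, w) : OM (fst i)"
   "ALL p:topspace X. f p = sI w --> (EX i:F. p : fst (fst i) & dist (fst (snd (fst i) p)) (snd i) < R (fst i) (snd i))"
   by (elim exE conjE) (rule that)
 have bel: "beltrami (fat s) (AA s)" using har[OF s(1)] by (simp add: harmonic_beltrami_def)
 have bdd: "bdd_above {cmod (AA s e p) | e p. e : fat s & p : fst e}"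
  unfolding bdd_above_def
 proof (intro exI[of _ "\<Sum>i\<in>F. \<bar>B (fst i) (snd i)\<bar>"] ballI)
  fix r assume "r : {cmod (AA s e p) | e p. e : fat s & p : fst e}"
  then obtain e p where e: "e : fat s" "p : fst e" "r = cmod (AA s e p)" by blast
  then obtain c' d' where d': "c' : \<S>" "d' : adapted \<X> f c'" "e = fc s d'" unfolding fibre_atlas_def by blast
  have p: "p : fst d'" "f p = s" using e(2) d'(3) by (auto simp: fibre_chart_def)
  have pX: "p : topspace X" by (rule d_top[OF ad(1)[OF d'(2)] p(1)])
  obtain i where i: "i : F" "p : fst (fst i)" "dist (fst (snd (fst i) p)) (snd i) < R (fst i) (snd i)"
   using F(3) pX p(2) by (auto simp: s_def)
  have iD: "fst i : DD" "(snd i, w) : OM (fst i)" using F(2) i(1) by auto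
  define y where "y = fst (snd (fst i) p)"
  have sp: "snd (fst i) p = (y, w)" using snd_chart[OF iD(1) i(2)] p(2) s sIW(2)[OF s(2)] by (simp add: y_def s_def)
  have yO: "(y, w) : OM (fst i)" unfolding OM_def using sp i(2) by (metis imageI)
  have "chart_inv (fst i) (y, w) = p" using chart_inv_chart[OF ad(1)[OF iD(1)] i(2)] sp by simp
  then have "cmod (AA s (fc s (fst i)) p) <= B (fst i) (snd i)"
   using B[OF iD _ yO] Ab[OF iD(1) yO] i(3) by (simp add: y_def dist_commute)
  also have "... <= \<bar>B (fst i) (snd i)\<bar>" by simp
  also have "... <= (\<Sum>i\<in>F. \<bar>B (fst i) (snd i)\<bar>)" by (rule member_le_sum[OF i(1) _ F(1)]) simp
  finally have 1: "cmod (AA s (fc s (fst i)) p) <= (\<Sum>i\<in>F. \<bar>B (fst i) (snd i)\<bar>)" .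
  have bf: "ALL e:fat s. ALL e':fat s. ALL p:fst e Int fst e'. AA s e' p = AA s e p * jac e e' p / cnj (jac e e' p)"
   using bel unfolding beltrami_def by (elim conjE)
  have "AA s e p = AA s (fc s (fst i)) p * jac (fc s (fst i)) e p / cnj (jac (fc s (fst i)) e p)"
   by (rule bspec[OF bspec[OF bspec[OF bf fc_atlas[OF iD(1) s(1)]] e(1)]]) (use i(2) p(2) e(2) in "simp add: fibre_chart_def")
  \<comment> \<open>If the Jacobian were 0, the quotient by 0 would be 0 and the inequality would
    still hold, so nonvanishing need not be established here.\<close>
  then have "cmod (AA s e p) <= cmod (AA s (fc s (fst i)) p)"
   by (cases "jac (fc s (fst i)) e p = 0") (simp_all add: norm_mult norm_divide)
  then show "r <= (\<Sum>i\<in>F. \<bar>B (fst i) (snd i)\<bar>)" using 1 e(3) by simp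
 qed
 have "fc s d : fat s" "chart_inv d (z, w) : fst (fc s d)"
  using fc_atlas[OF d s(1)] fc_pt(2)[OF d zO] by (simp_all only: s_def)
 then have "cmod (A d w z) : {cmod (AA s e p) | e p. e : fat s & p : fst e}" unfolding Ab[OF d zO] by blast
 then show ?thesis unfolding beltrami_norm_def s_def[symmetric] by (rule cSup_upper[OF _ bdd])
qed

definition TT :: "('x, complex \<times> complex) chart => (complex \<times> real) set" where "TT d = {(w, t). w : WW & \<gamma> (sI w) t : fst d}"
definition ZZ :: "('x, complex \<times> complex) chart => complex \<times> real => complex" where "ZZ d x = fst (snd d (\<gamma> (sI (fst x)) (snd x)))"
definition len :: "complex => real" where "len w = curve_length (fat (sI w)) (g (sI w)) (\<gamma> (sI w))"

section \<open>The geodesics in adapted coordinates\<close>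

lemma cg: "s : fst c ==> closed_geodesic (fibre X f s) (fat s) (g s) (\<gamma> s)"
 using geo c_top by (simp add: geodesic_family_def)

lemma \<gamma>_fibre: assumes "s : fst c" shows "\<gamma> s t : topspace X" "f (\<gamma> s t) = s"
proof -
 have "continuous_map euclideanreal (fibre X f s) (\<gamma> s)" using cg[OF assms] by (simp add: closed_geodesic_def)
 then have "\<gamma> s t : topspace (fibre X f s)" by (auto simp: continuous_map_def)
 then show "\<gamma> s t : topspace X" "f (\<gamma> s t) = s" by (auto simp: fibre_def)
qed

lemma TT_snd: assumes d: "d : DD" and x: "(w, t) : TT d"
 shows "snd d (\<gamma> (sI w) t) = (ZZ d (w, t), w)" "(ZZ d (w, t), w) : OM d" "chart_inv d (ZZ d (w, t), w) = \<gamma> (sI w) t" "w : WW"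
proof -
 show w: "w : WW" using x by (simp add: TT_def)
 have p: "\<gamma> (sI w) t : fst d" using x by (simp add: TT_def)
 show e: "snd d (\<gamma> (sI w) t) = (ZZ d (w, t), w)"
  using snd_chart[OF d p] \<gamma>_fibre(2)[OF sIW(1)[OF w]] sIW(2)[OF w] by (simp add: ZZ_def)
 show "(ZZ d (w, t), w) : OM d" unfolding OM_def using p e by (metis imageI)
 show "chart_inv d (ZZ d (w, t), w) = \<gamma> (sI w) t" using chart_inv_chart[OF ad(1)[OF d] p] e by simp
qed

text \<open>Joint continuity of the family on the product of base and line makes the condition open
  there, and the base chart carries product neighbourhoods over to coordinates.\<close>

lemma open_TT: assumes d: "d : \<X>" shows "open (TT d)"
 unfolding open_prod_def
proof
 fix x assume "x : TT d"
 then obtain w t where x: "x = (w, t)" "w : WW" "\<gamma> (sI w) t : fst d" by (auto simp: TT_def)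
 define T0 where "T0 = {x : topspace (prod_topology S euclideanreal). (%(s, t). \<gamma> s t) x : fst d}"
 have "openin (prod_topology S euclideanreal) T0" unfolding T0_def
  by (rule openin_continuous_map_preimage[OF _ chart_basics(1)[OF chX[OF d]]]) (use geo in "simp add: geodesic_family_def")
 moreover have "(sI w, t) : T0" using x c_top[OF sIW(1)[OF x(2)]] by (simp add: T0_def)
 ultimately obtain U V where UV: "openin S U" "openin euclideanreal V" "sI w : U" "t : V" "U \<times> V <= T0"
 proof -
  assume o: "openin (prod_topology S euclideanreal) T0" and i: "(sI w, t) : T0"
  from o[unfolded openin_prod_topology_alt, rule_format, OF i] show thesis by (elim exE conjE) (rule that)
 qed
 define B where "B = snd c ` (U Int fst c)"
 have "open B" unfolding B_def by (rule chart_basics(6)[OF chc openin_Int[OF UV(1) chart_basics(1)[OF chc]]]) simp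
 moreover have "open V" using UV(2) by simp
 moreover have "x : B \<times> V" unfolding x(1) B_def using UV(3,4) sIW[OF x(2)] by (metis IntI SigmaI imageI)
 moreover have "B \<times> V <= TT d"
 proof
  fix y assume "y : B \<times> V"
  then obtain s t' where y: "s : U" "s : fst c" "t' : V" "y = (snd c s, t')" by (auto simp: B_def)
  have "(s, t') : T0" using y UV(5) by blast
  then show "y : TT d" using y sI[OF y(2)] sWW[OF y(2)] by (simp add: T0_def TT_def)
 qed
 ultimately show "EX A B. open A & open B & x : A \<times> B & A \<times> B <= TT d" by blast
qed

lemma sm_ZZ: assumes d: "d : \<X>" shows "smooth_on (TT d) (ZZ d)"
proof -
 have "smooth_on (TT d) (%(w, t). snd d (\<gamma> (sI w) t))"
  using geo c d unfolding geodesic_family_def TT_def WW_def by blast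
 from smo_bounded_linear[OF open_TT[OF d] bounded_linear_fst this] show ?thesis
  by (simp add: ZZ_def[abs_def] case_prod_beta')
qed

lemma ZZ_derivative:
 assumes d: "d : \<X>" and x: "(w, t) : TT d"
 shows "((%t. ZZ d (w, t)) has_vector_derivative Dt (ZZ d) (w, t)) (at t)"
  "((%t. Dt (ZZ d) (w, t)) has_vector_derivative Dt (Dt (ZZ d)) (w, t)) (at t)"
  "velocity (fc (sI w) d) (\<gamma> (sI w)) t = Dt (ZZ d) (w, t)"
proof -
 show 1: "((%t. ZZ d (w, t)) has_vector_derivative Dt (ZZ d) (w, t)) (at t)"
  by (rule wt_slice_t[OF wt_smooth[OF sm_ZZ[OF d] x]])
 show "((%t. Dt (ZZ d) (w, t)) has_vector_derivative Dt (Dt (ZZ d)) (w, t)) (at t)"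
  by (rule wt_slice_t[OF wt_smooth[OF smo_Dw(3)[OF open_TT[OF d] sm_ZZ[OF d]] x]])
 show "velocity (fc (sI w) d) (\<gamma> (sI w)) t = Dt (ZZ d) (w, t)"
  unfolding velocity_def using vector_derivative_at[OF 1] by (simp add: fibre_chart_def comp_def ZZ_def)
qed

lemma geod_ZZ:
 assumes d: "d : DD" and x: "(w, t) : TT d"
 shows "Dt (Dt (ZZ d)) (w, t) = - (Pz d w (ZZ d (w, t)) * (Dt (ZZ d) (w, t) * Dt (ZZ d) (w, t)))"
proof -
 note dX = ad(1)[OF d]
 note w = TT_snd(4)[OF d x]
 define s e where "s = sI w" and "e = fc s d"
 have s: "s : fst c" using sIW(1)[OF w] by (simp add: s_def)
 have te: "\<gamma> s t : fst e" using x \<gamma>_fibre(2)[OF s] by (simp add: e_def fibre_chart_def TT_def s_def)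
 have eq: "vector_derivative (velocity e (\<gamma> s)) (at t) + dz (log_metric (g s) e) (snd e (\<gamma> s t)) * (velocity e (\<gamma> s) t)\<^sup>2 = 0"
  using cg[OF s] fc_atlas[OF d s] te unfolding closed_geodesic_def e_def by blast
 have "(velocity e (\<gamma> s) has_vector_derivative Dt (Dt (ZZ d)) (w, t)) (at t)"
 proof (rule has_vector_derivative_transform_within_open[OF ZZ_derivative(2)[OF dX x] open_slices(2)[OF open_TT[OF dX], of w]])
  show "Dt (ZZ d) (w, y) = velocity e (\<gamma> s) y" if "y : {t. (w, t) : TT d}" for y
   using ZZ_derivative(3)[OF dX, of w y] that by (simp add: e_def s_def)
 qed (use x in simp)
 then have vd: "vector_derivative (velocity e (\<gamma> s)) (at t) = Dt (Dt (ZZ d)) (w, t)" by (rule vector_derivative_at)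
 have pz: "dz (log_metric (g s) e) (snd e (\<gamma> s t)) = Pz d w (ZZ d (w, t))"
  unfolding Pz_def P_def phi_log by (simp add: e_def s_def fibre_chart_def ZZ_def)
 have "velocity e (\<gamma> s) t = Dt (ZZ d) (w, t)" using ZZ_derivative(3)[OF dX x] by (simp add: e_def s_def)
 then show ?thesis using eq unfolding vd pz by (simp add: power2_eq_square eq_neg_iff_add_eq_0)
qed

lemma TT_cover: assumes w: "w : WW" shows "EX d:DD. (w, t) : TT d"
 using chart_at[OF \<gamma>_fibre(1)[OF sIW(1)[OF w], of t]] \<gamma>_fibre(2)[OF sIW(1)[OF w], of t] sIW(1)[OF w] w by (auto simp: TT_def)

text \<open>\<open>speed\<close> is a definite description over all charts of the fibre atlas, so
  its value must be shown not to depend on the chart. The chain rule multiplies the velocity by the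
  Jacobian that the metric rule compensates; the competing chart may be adapted to a different base
  coordinate.\<close>

lemma speed_ZZ:
 assumes d: "d : DD" and x: "(w, t) : TT d"
 shows "speed (fat (sI w)) (g (sI w)) (\<gamma> (sI w)) t = sqrt (exp (phi d w (ZZ d (w, t))) * (cmod (Dt (ZZ d) (w, t)))\<^sup>2)"
 unfolding speed_def
proof (rule the_equality)
 define s where "s = sI w"
 note T = TT_snd[OF d x]
 have s: "s : fst c" "s = sI w" using sIW(1)[OF T(4)] by (simp_all add: s_def)
 have ge: "g s (fc s d) (\<gamma> s t) = exp (phi d w (ZZ d (w, t)))" using exp_phi[OF d T(2)] T(3) by (simp add: s_def)
 have p: "\<gamma> s t : fst d" "f (\<gamma> s t) = s" using x \<gamma>_fibre(2)[OF s(1)] by (simp_all add: TT_def s_def)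
 have ve: "velocity (fc s d) (\<gamma> s) t = Dt (ZZ d) (w, t)" using ZZ_derivative(3)[OF ad(1)[OF d] x] by (simp add: s_def)
 show "EX e:fat (sI w). \<gamma> (sI w) t : fst e & sqrt (exp (phi d w (ZZ d (w, t))) * (cmod (Dt (ZZ d) (w, t)))\<^sup>2) =
  sqrt (g (sI w) e (\<gamma> (sI w) t) * (cmod (velocity e (\<gamma> (sI w)) t))\<^sup>2)"
  unfolding s(2)[symmetric] using fc_atlas[OF d s(1)] p ge ve by (intro bexI[of _ "fc s d"]) (simp_all add: fibre_chart_def)
 fix r assume "EX e:fat (sI w). \<gamma> (sI w) t : fst e & r = sqrt (g (sI w) e (\<gamma> (sI w) t) * (cmod (velocity e (\<gamma> (sI w)) t))\<^sup>2)"
 then obtain e where e: "e : fat s" "\<gamma> s t : fst e" "r = sqrt (g s e (\<gamma> s t) * (cmod (velocity e (\<gamma> s) t))\<^sup>2)" unfolding s_def by blast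
 then obtain c' d' where d': "c' : \<S>" "d' : adapted \<X> f c'" "e = fc s d'" unfolding fibre_atlas_def by blast
 have dX: "d' : \<X>" by (rule ad(1)[OF d'(2)])
 have p': "\<gamma> s t : fst d'" using e(2) d'(3) by (simp add: fibre_chart_def)
 have x': "(w, t) : TT d'" using p' T(4) by (simp add: TT_def s_def)
 have ov: "(ZZ d (w, t), w) : OV d d'" unfolding OV_def using p(1) p' T(1) by (metis IntI imageI s_def)
 have j: "jac (fc s d) e (\<gamma> s t) = d1 (TR d d') (ZZ d (w, t), w)"
  using jac_TR[OF d dX ov] T(3) by (simp add: s_def d'(3))
 have "((%t. TR d d' (ZZ d (w, t), w)) has_vector_derivative (Dt (ZZ d) (w, t) * d1 (TR d d') (ZZ d (w, t), w))) (at t)"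
  using field_vector_diff_chain_at[OF ZZ_derivative(1)[OF ad(1)[OF d] x] hol2_d1[OF TR_hol2[OF ad(1)[OF d] dX] ov]] by (simp add: comp_def)
 then have "((%t. ZZ d' (w, t)) has_vector_derivative (Dt (ZZ d) (w, t) * d1 (TR d d') (ZZ d (w, t), w))) (at t)"
 proof (rule has_vector_derivative_transform_within_open)
  show "open {t. (w, t) : TT d Int TT d'}" by (rule open_slices(2)[OF open_Int[OF open_TT[OF ad(1)[OF d]] open_TT[OF dX]]])
  show "TR d d' (ZZ d (w, y), w) = ZZ d' (w, y)" if "y : {t. (w, t) : TT d Int TT d'}" for y
   using TT_snd(3)[OF d, of w y] that by (simp add: TR_def ZZ_def)
 qed (use x x' in simp)
 then have v: "velocity e (\<gamma> s) t = Dt (ZZ d) (w, t) * d1 (TR d d') (ZZ d (w, t), w)"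
  using ZZ_derivative(1,3)[OF dX x'] vector_derivative_unique_at by (metis d'(3) s_def)
 have "g s (fc s d) (\<gamma> s t) = g s e (\<gamma> s t) * (cmod (jac (fc s d) e (\<gamma> s t)))\<^sup>2"
  by (rule metric(3)[OF s(1) fc_atlas[OF d s(1)] e(1) _ e(2)]) (use p in "simp add: fibre_chart_def")
 then show "r = sqrt (exp (phi d w (ZZ d (w, t))) * (cmod (Dt (ZZ d) (w, t)))\<^sup>2)"
  unfolding e(3) v ge j by (simp add: norm_mult power_mult_distrib)
qed

text \<open>By the geodesic equation the squared speed has zero derivative, so the speed is constant
  and equals its integral over one period. It cannot be zero, since the curve would then be
  constant.\<close>

lemma len_props:
 assumes w: "w : WW"
 shows "len w > 0" "d : DD ==> (w, t) : TT d ==> exp (phi d w (ZZ d (w, t))) * (cmod (Dt (ZZ d) (w, t)))\<^sup>2 = (len w)\<^sup>2"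
proof -
 define s where "s = sI w"
 have s: "s : fst c" using sIW(1)[OF w] by (simp add: s_def)
 define v where "v = speed (fat s) (g s) (\<gamma> s)"
 have v: "(v t)\<^sup>2 = exp (phi d w (ZZ d (w, t))) * (cmod (Dt (ZZ d) (w, t)))\<^sup>2" "v t >= 0" if "d : DD" "(w, t) : TT d" for d t
  using speed_ZZ[OF that] by (simp_all add: v_def s_def)
 have "((%t. (v t)\<^sup>2) has_real_derivative 0) (at t)" for t
 proof -
  obtain d where d: "d : DD" "(w, t) : TT d" using TT_cover[OF w] by blast
  note dX = ad(1)[OF d(1)]
  have zs: "ZZ d (w, t) : sl d w" using TT_snd(2)[OF d] by (simp add: sl_def)
  note sd = speed_derivative[where z = "%t. ZZ d (w, t)" and z' = "%t. Dt (ZZ d) (w, t)", OF d(1) zs ZZ_derivative(1)[OF dX d(2)]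
    ZZ_derivative(2)[OF dX d(2), unfolded geod_ZZ[OF d]]]
  have "((%t. Re (G d w (ZZ d (w, t)) * (Dt (ZZ d) (w, t) * cnj (Dt (ZZ d) (w, t))))) has_real_derivative 0) (at t)"
   using bounded_linear.has_vector_derivative[OF bounded_linear_Re sd] unfolding has_real_derivative_iff_has_vector_derivative by (simp only: zero_complex.simps)
  then show ?thesis
  proof (rule has_field_derivative_transform_within_open)
   show "open {t. (w, t) : TT d}" by (rule open_slices(2)[OF open_TT[OF dX]])
   show "Re (G d w (ZZ d (w, y)) * (Dt (ZZ d) (w, y) * cnj (Dt (ZZ d) (w, y)))) = (v y)\<^sup>2" if "y : {t. (w, t) : TT d}" for y
    using v(1)[OF d(1), of y] that unfolding G_def cmod_sq by (simp flip: of_real_mult of_real_power)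
  qed (use d in simp)
 qed
 then have dv: "ALL t. ((%t. (v t)\<^sup>2) has_real_derivative 0) (at t)" ..
 have const: "(v t)\<^sup>2 = (v 0)\<^sup>2" for t using DERIV_isconst_all[OF dv, of t 0] by simp
 have v0: "v t >= 0" for t using TT_cover[OF w, of t] v(2) by blast
 have vc: "v t = v 0" for t using const[of t] v0[of t] v0[of 0] by (simp add: power2_eq_iff_nonneg)
 have fv: "v = (%t. v 0)" by (rule ext) (rule vc)
 have "len w = integral {0..1} v" by (simp only: len_def curve_length_def s_def v_def)
 also have "... = integral {0..1} (%t::real. v 0)" by (rule arg_cong[OF fv, where f = "integral {0..1}"])
 finally have "len w = integral {0..1} (%t::real. v 0)" .
 then have l: "len w = v 0" by simp
 show "exp (phi d w (ZZ d (w, t))) * (cmod (Dt (ZZ d) (w, t)))\<^sup>2 = (len w)\<^sup>2" if "d : DD" "(w, t) : TT d"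
  using v(1)[OF that] const[of t] l by simp
 have "v 0 ~= 0"
 proof
  assume 0: "v 0 = 0"
  have D0: "Dt (ZZ d) (w, t) = 0" if "d : DD" "(w, t) : TT d" for d t using v(1)[OF that] vc[of t] 0 by simp
  \<comment> \<open>With zero velocity the coordinate is constant on each small interval, so the
    curve is locally constant on the connected line; this contradicts the clause of
    \<open>closed_geodesic\<close> that excludes constant curves.\<close>
  have "\<gamma> s a = \<gamma> s b" for a b
  proof (rule connected_local_const[OF connected_UNIV UNIV_I UNIV_I], rule ballI)
   fix t :: real
   obtain d where d: "d : DD" "(w, t) : TT d" using TT_cover[OF w] by blast
   note dX = ad(1)[OF d(1)]
   have "open {t. (w, t) : TT d}" by (rule open_slices(2)[OF open_TT[OF dX]])
   then obtain r where r: "r > 0" "ball t r <= {t. (w, t) : TT d}" using d(2) open_contains_ball by blast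
   have hz: "((%t. ZZ d (w, t)) has_vector_derivative 0) (at y within ball t r)" if "y : ball t r" for y
   proof -
    have y: "(w, y) : TT d" using r(2) that by blast
    show ?thesis using ZZ_derivative(1)[OF dX y] unfolding D0[OF d(1) y] by (rule has_vector_derivative_at_within)
   qed
   obtain k where k: "!!y. y : ball t r ==> ZZ d (w, y) = k"
   proof (rule has_vector_derivative_zero_constant[where f = "%t. ZZ d (w, t)"])
    show "convex (ball t r)" by (rule convex_ball)
    show "((%t. ZZ d (w, t)) has_vector_derivative 0) (at y within ball t r)" if "y : ball t r" for y by (rule hz[OF that])
    fix k assume k: "!!y. y : ball t r ==> ZZ d (w, y) = k"
    show thesis by (rule that[of k]) (rule k)
   qed
   have "\<gamma> s t = \<gamma> s y" if y: "y : ball t r" for y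
   proof -
    have "(w, y) : TT d" using y r(2) by blast
    from TT_snd(3)[OF d(1) this] TT_snd(3)[OF d] show ?thesis using k[OF y] k[of t] r(1) by (simp add: s_def)
   qed
   then show "\<forall>\<^sub>F y in at t within UNIV. \<gamma> s t = \<gamma> s y"
    unfolding eventually_at using r(1) by (intro exI[of _ r]) (auto simp: dist_commute)
  qed
  moreover have "EX t. \<gamma> s t ~= \<gamma> s 0" using cg[OF s] unfolding closed_geodesic_def by (elim conjE)
  ultimately show False by blast
 qed
 then show "len w > 0" using l v0[of 0] by simp
qed

sublocale geodesic_charts DD OM OV TR phi aa WW TT ZZ len
proof
 show "open (TT d)" if "d : DD" for d by (rule open_TT[OF ad(1)[OF that]])
 show "smooth_on (TT d) (ZZ d)" if "d : DD" for d by (rule sm_ZZ[OF ad(1)[OF that]])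
 show "(ZZ d x, fst x) : OM d" if "d : DD" "x : TT d" for d x using TT_snd(2)[OF that(1), of "fst x" "snd x"] that(2) by simp
 show "(ZZ d x, fst x) : OV d e & ZZ e x = TR d e (ZZ d x, fst x)" if d: "d : DD" and e: "e : DD" and x: "x : TT d" "x : TT e" for d e x
 proof -
  obtain w t where wt: "x = (w, t)" by (cases x)
  note T = TT_snd[OF d x(1)[unfolded wt]]
  have "\<gamma> (sI w) t : fst d Int fst e" using x by (simp add: wt TT_def)
  then have "(ZZ d (w, t), w) : OV d e" unfolding OV_def using T(1) by (metis imageI)
  then show ?thesis using T(3) by (simp add: wt TR_def ZZ_def)
 qed
 show "x + (0, 1) : TT d & ZZ d (x + (0, 1)) = ZZ d x" if d: "d : DD" and x: "x : TT d" for d x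
 proof -
  obtain w t where wt: "x = (w, t)" by (cases x)
  have w: "w : WW" using x by (simp add: wt TT_def)
  have "\<gamma> (sI w) (t + 1) = \<gamma> (sI w) t" using cg[OF sIW(1)[OF w]] by (simp add: closed_geodesic_def)
  then show ?thesis using x by (simp add: wt TT_def ZZ_def)
 qed
 show "EX d:DD. (w, t) : TT d" if "w : WW" for w t by (rule TT_cover[OF that])
 show "Dt (Dt (ZZ d)) x = - (Pz d (fst x) (ZZ d x) * (Dt (ZZ d) x * Dt (ZZ d) x))" if "d : DD" "x : TT d" for d x
  using geod_ZZ[OF that(1), of "fst x" "snd x"] that(2) by simp
 show "len w > 0" if "w : WW" for w by (rule len_props(1)[OF that])
 show "exp (phi d w (ZZ d (w, t))) * (cmod (Dt (ZZ d) (w, t)))\<^sup>2 = (len w)\<^sup>2" if "d : DD" "(w, t) : TT d" for d w t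
  by (rule len_props(2)[OF TT_snd(4)[OF that] that])
qed

end

theorem corollary6p8:
  fixes X :: "'x topology" and \<X> :: "('x, complex \<times> complex) chart set"
    and S :: "'s topology" and \<S> :: "('s, complex) chart set"
    and f :: "'x \<Rightarrow> 's"
    and g :: "'s \<Rightarrow> ('x, complex) chart \<Rightarrow> 'x \<Rightarrow> real"
    and \<gamma> :: "'s \<Rightarrow> real \<Rightarrow> 'x"
    and c :: "('s, complex) chart"
    and A :: "'s \<Rightarrow> ('x, complex) chart \<Rightarrow> 'x \<Rightarrow> complex"
    and len :: "'s \<Rightarrow> real"
  assumes "hyperbolic_family X \<X> S \<S> f"
    and "\<And>s. s \<in> topspace S \<Longrightarrow> hyperbolic_metric (fibre_atlas \<X> \<S> f s) (g s)"
    and "geodesic_family X \<X> S \<S> f g \<gamma>"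
    and "\<And>s. len s = curve_length (fibre_atlas \<X> \<S> f s) (g s) (\<gamma> s)"
    and "c \<in> \<S>"
    and "\<And>s. s \<in> fst c \<Longrightarrow> A s \<in> kodaira_spencer \<X> \<S> f c s"
    and "\<And>s. s \<in> fst c \<Longrightarrow> harmonic_beltrami (fibre_atlas \<X> \<S> f s) (g s) (A s)"
  shows "Ck_on 2 (snd c ` fst c) (\<lambda>w. len (chart_inv c w)) \<and>
    (\<forall>s\<in>fst c. len s > 0 \<and>
       Re (dz (dzbar (\<lambda>w. complex_of_real (len (chart_inv c w)))) (snd c s))
         \<le> len s * (beltrami_norm (fibre_atlas \<X> \<S> f s) (A s))\<^sup>2 \<and>
       Re (dz (dzbar (\<lambda>w. complex_of_real (ln (len (chart_inv c w))))) (snd c s))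
         \<le> 3 / 4 * (beltrami_norm (fibre_atlas \<X> \<S> f s) (A s))\<^sup>2)"
proof -
 interpret F: hyperbolic_family_chart X \<X> S \<S> f g \<gamma> c A
  by unfold_locales (fact assms)+
 have len: "F.len = (%w. len (chart_inv c w))" by (simp add: fun_eq_iff F.len_def assms(4))
 show ?thesis
 proof (intro conjI ballI)
  show "Ck_on 2 (snd c ` fst c) (%w. len (chart_inv c w))"
   using F.length_bounds(1) unfolding len F.WW_def .
  fix s assume s: "s : fst c"
  have b: "cmod (F.A d (snd c s) z) <= beltrami_norm (fibre_atlas \<X> \<S> f s) (A s)" if "d : adapted \<X> f c" "z : F.sl d (snd c s)" for d z
   using F.A_bound[OF that] by (simp add: F.sI[OF s])
  show "len s > 0" using F.len_props(1)[OF F.sWW[OF s]] by (simp add: len F.sI[OF s])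
  show "Re (dz (dzbar (%w. complex_of_real (len (chart_inv c w)))) (snd c s)) <= len s * (beltrami_norm (fibre_atlas \<X> \<S> f s) (A s))\<^sup>2"
   "Re (dz (dzbar (%w. complex_of_real (ln (len (chart_inv c w))))) (snd c s)) <= 3 / 4 * (beltrami_norm (fibre_atlas \<X> \<S> f s) (A s))\<^sup>2"
   using F.length_bounds(2)[OF F.sWW[OF s] b] unfolding len by (simp_all add: F.sI[OF s])
 qed
qed

end
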